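(* Let $s>-1$ and $r_0,r_1\ge 0$. There is a constant $c>0$, independent of $n$ and $f$, such that for all integers $n\ge1$ and all $f\in H^{r_1}_{2r_1}(\mathbb{R})$ the following hold. (a) If $-\tfrac12<s\le\tfrac{r_0}{2}\le\tfrac{s+r_1}{2}$, then $$\|(\mathcal{I}-\mathcal{P}_n)[f]\|_{H^s_{r_0}(\mathbb{R})}\le c\bigl(\tfrac{\ell n}{2}\bigr)^{r_0-r_1-s}\|f\|_{H^{r_1}_{2r_1}(\mathbb{R})}.$$ (b) If $0\le\tfrac{r_0}{2}\le s\le r_1$, then $$\|(\mathcal{I}-\mathcal{P}_n)[f]\|_{H^s_{r_0}(\mathbb{R})}\le c\bigl(\tfrac{\ell n}{2}\bigr)^{s-r_1}\|f\|_{H^{r_1}_{2r_1}(\mathbb{R})}.$$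
   Context: Fourier transform: $\mathcal{F}[f](\xi)=\hat f(\xi)=\frac{1}{\sqrt{2\pi}}\int_{\mathbb{R}}e^{-i\xi x}f(x)\,dx$. A scaling parameter $\ell>0$ is fixed. Variable weight Sobolev spaces. For $r\ge 0$ let $\kappa^-_{r,\ell}(x)=\frac{1}{\sqrt{2\pi}}(i\ell-x)^r$ (principal branch). For $s>-\tfrac12$, $r\ge0$, $H^s_r(\mathbb{R})$ consists of all real valued tempered distributions $f$ with $\|f\|_{H^s_r(\mathbb{R})}<\infty$, where $$\|f\|_{H^s_r(\mathbb{R})}^2=\tfrac12\|f\|_{L^2(\mathbb{R})}^2+\int_0^\infty \xi^{2s}\,\bigl|\mathcal{F}[\kappa^-_{r,\ell}f](\xi)\bigr|^2d\xi ,$$ finiteness meaning that $f\in L^2(\mathbb{R})$ and that the restriction of the distribution $\mathcal{F}[\kappa^-_{r,\ell}f]$ to $(0,\infty)$ is a function for which the integral is finite. Malmquist-Takenaka-Christov (MTC) functions: for $k\ge0$, $$\phi_{2k}(x)=2\sqrt{\tfrac{\ell}{\pi}}\,\operatorname{Im}\tfrac{(2x+i\ell)^k}{(2x-i\ell)^{k+1}},\qquad \phi_{2k+1}(x)=2\sqrt{\tfrac{\ell}{\pi}}\,\operatorname{Re}\tfrac{(2x+i\ell)^k}{(2x-i\ell)^{k+1}};$$ they form a complete orthonormal system in $L^2(\mathbb{R})$. $\mathbb{P}_n=\operatorname{span}\{\phi_0,\dots,\phi_n\}$, and $\mathcal{P}_n[f]=\sum_{k=0}^n\langle f,\phi_k\rangle_{L^2(\mathbb{R})}\phi_k$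 is the $L^2(\mathbb{R})$-orthogonal projector onto $\mathbb{P}_n$. $\mathcal{I}$ is the identity. *)

theory Defs
  imports "HOL-Analysis.Analysis"
begin

definition fourier :: "(real \<Rightarrow> complex) \<Rightarrow> real \<Rightarrow> complex" where
  "fourier f \<xi> =
     1 / of_real (sqrt (2 * pi)) * (LINT x|lebesgue. exp (- \<i> * of_real \<xi> * of_real x) * f x)"

definition smooth :: "(real \<Rightarrow> complex) \<Rightarrow> bool" where
  "smooth \<phi> \<longleftrightarrow>
     (\<forall>k x. ((\<lambda>h y. vector_derivative h (at y)) ^^ k) \<phi> differentiable (at x))"

definition test_functions :: "real set \<Rightarrow> (real \<Rightarrow> complex) set" where
  "test_functions U =
     {\<phi>. smooth \<phi> \<and> compact (closure {x. \<phi> x \<noteq> 0}) \<and> closure {x. \<phi> x \<noteq> 0} \<subseteq> U}"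

text \<open>Distributions are represented by their action on test functions. The functional below is
  a tempered distribution whenever \<open>u\<close> is the product of a square integrable function and a
  function of polynomial growth, which is the only case used here. The pairing is bilinear (no
  complex conjugation), so that the Fourier transform is transposed onto the test function.\<close>

definition regular_dist :: "(real \<Rightarrow> complex) \<Rightarrow> (real \<Rightarrow> complex) \<Rightarrow> complex" where
  "regular_dist u \<phi> = (LINT x|lebesgue. u x * \<phi> x)"

definition fourier_dist ::
  "((real \<Rightarrow> complex) \<Rightarrow> complex) \<Rightarrow> (real \<Rightarrow> complex) \<Rightarrow> complex" where
  "fourier_dist T \<phi> = T (fourier \<phi>)"

text \<open>The restriction of \<open>T\<close> to the open set \<open>U\<close> is the locally integrable function \<open>g\<close>.\<close>

definition is_function_on ::
  "real set \<Rightarrow> ((real \<Rightarrow> complex) \<Rightarrow> complex) \<Rightarrow> (real \<Rightarrow> complex) \<Rightarrow> bool" where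
  "is_function_on U T g \<longleftrightarrow>
     (\<forall>K. compact K \<and> K \<subseteq> U \<longrightarrow> set_integrable lebesgue K g) \<and>
     (\<forall>\<phi>\<in>test_functions U. T \<phi> = (LINT \<xi>:U|lebesgue. g \<xi> * \<phi> \<xi>))"

definition kappa_minus :: "real \<Rightarrow> real \<Rightarrow> real \<Rightarrow> complex" where
  "kappa_minus l r x =
     1 / of_real (sqrt (2 * pi)) * (\<i> * of_real l - of_real x) powr of_real r"

definition weighted_spectrum :: "real \<Rightarrow> real \<Rightarrow> (real \<Rightarrow> real) \<Rightarrow> (real \<Rightarrow> complex) \<Rightarrow> complex" where
  "weighted_spectrum l r f = fourier_dist (regular_dist (\<lambda>x. kappa_minus l r x * of_real (f x)))"

text \<open>A function on the half-line \<open>(0, \<infinity>)\<close> representing the weighted spectrum there; it is unique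
  up to null sets if it exists, so integrals do not depend on the choice.\<close>

definition spectrum_fun :: "real \<Rightarrow> real \<Rightarrow> (real \<Rightarrow> real) \<Rightarrow> real \<Rightarrow> complex" where
  "spectrum_fun l r f = (SOME g. is_function_on {0<..} (weighted_spectrum l r f) g)"

text \<open>Elements of the spaces are square integrable, so they are given by functions (representatives
  modulo null sets) rather than by distributions. The real-valued norm is meaningful only on the
  space; statements of finiteness are expressed by membership.\<close>

definition Hspace :: "real \<Rightarrow> real \<Rightarrow> real \<Rightarrow> (real \<Rightarrow> real) set" where
  "Hspace l s r =
     {f. f \<in> borel_measurable lebesgue \<and> integrable lebesgue (\<lambda>x. (f x)\<^sup>2) \<and>
         (\<exists>g. is_function_on {0<..} (weighted_spectrum l r f) g) \<and>
         set_integrable lebesgue {0<..}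
           (\<lambda>\<xi>. \<xi> powr (2 * s) * (cmod (spectrum_fun l r f \<xi>))\<^sup>2)}"

definition Hnorm :: "real \<Rightarrow> real \<Rightarrow> real \<Rightarrow> (real \<Rightarrow> real) \<Rightarrow> real" where
  "Hnorm l s r f =
     sqrt (1 / 2 * (LINT x|lebesgue. (f x)\<^sup>2) +
           (LINT \<xi>:{0<..}|lebesgue. \<xi> powr (2 * s) * (cmod (spectrum_fun l r f \<xi>))\<^sup>2))"

definition mtc :: "real \<Rightarrow> nat \<Rightarrow> real \<Rightarrow> real" where
  "mtc l j x =
     2 * sqrt (l / pi) *
     (let k = j div 2;
          q = (2 * of_real x + \<i> * of_real l) ^ k / (2 * of_real x - \<i> * of_real l) ^ (k + 1)
      in if even j then Im q else Re q)"

definition mtc_proj :: "real \<Rightarrow> nat \<Rightarrow> (real \<Rightarrow> real) \<Rightarrow> real \<Rightarrow> real" where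
  "mtc_proj l n f x = (\<Sum>k\<le>n. (LINT y|lebesgue. f y * mtc l k y) * mtc l k x)"

end

theory Submission
  imports Defs
begin

text \<open>
  Put \<open>P = l / 2 + \<i> x\<close> and \<open>u = 1 - l / P\<close>, the Cayley transform of the line onto the unit circle.
  The MTC functions are multiples of the real and imaginary parts of \<open>u ^ k / P\<close>, and
  \<open>\<i> l - x = \<i> l (3 - u) / (2 (1 - u))\<close>. Up to the harmless factor \<open>((3 - u) / 2) powr r\<close>, whose Taylor
  coefficients are absolutely summable, the weight is \<open>(1 - u) powr (- r)\<close>, and by the
  generating function of the Laguerre polynomials the spectrum on the positive half-line of the
  weight times \<open>cnj (u ^ k / P)\<close> is a combination of Laguerre functions of order \<open>r\<close> and degree at
  most \<open>k\<close>, while that of the weight times \<open>u ^ k / P\<close> vanishes there.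

  For \<open>r = 2 * r1\<close> these functions are orthogonal with respect to \<open>x powr (2 * r1)\<close>, so Bessel's inequality
  bounds \<open>\<Sum>k. (k + 1) powr (2 * r1) * \<bar>c k\<bar>\<^sup>2\<close> by the squared norm of \<open>f\<close> in the source space, \<open>c k\<close> being
  the MTC coefficients. For the target norm, the Laguerre functions of order \<open>r\<close> are
  re-expanded in those of order \<open>2 * s\<close>. The connection coefficients are the Taylor coefficients of
  \<open>(1 - z) powr (2 * s - r)\<close>: they are summable if \<open>r \<le> 2 * s\<close>, and otherwise they form a fractional sum
  of order \<open>r - 2 * s\<close>, which a discrete Hardy inequality bounds at the cost of \<open>r - 2 * s\<close> powers of
  \<open>k + 1\<close>. The tail \<open>2 * k \<ge> n\<close> then yields the rates.
\<close>

section \<open>Square integrable functions\<close>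

text \<open>The source norm controls the spectrum only against test functions supported away from
  the origin, while Bessel's inequality needs pairings with Laguerre functions times
  \<open>x powr (2 * r1)\<close>, which are not of this kind. Moreover the weight grows like
  \<open>|x| powr (2 * r1)\<close> and \<open>f\<close> is merely square integrable, so the pairing
  is controlled through derivatives in the mean of order above \<open>2 * r1\<close>; cutting off a
  power of \<open>x\<close> at the origin makes such derivatives explode. Hence the detour through
  \<open>(1 - exp (- R * x)) ^ M\<close>: its zero of order \<open>M\<close> absorbs the cutoff, its
  transform is a finite sum of explicit powers of \<open>P + k * R\<close>, and when
  \<open>R\<close> tends to infinity only these powers have to be estimated.

  The factor \<open>((3 - u) / 2) powr r\<close> and its reciprocal act on coefficients as one-sided
  convolutions, so each can be removed without loss for increasing weights.

  On the target side membership has to be proved as well: a spectrum of the error is constructed as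
  a limit and then compared with the one selected by choice.\<close>

definition sq_int :: "'a measure \<Rightarrow> ('a \<Rightarrow> complex) \<Rightarrow> bool" where
  "sq_int M f \<longleftrightarrow> f \<in> borel_measurable M \<and> integrable M (\<lambda>x. (cmod (f x))\<^sup>2)"

definition sq_norm :: "'a measure \<Rightarrow> ('a \<Rightarrow> complex) \<Rightarrow> real" where
  "sq_norm M f = (LINT x|M. (cmod (f x))\<^sup>2)"

lemma sq_int_measurable [measurable_dest]: "sq_int M f \<Longrightarrow> f \<in> borel_measurable M"
  by (simp add: sq_int_def)

lemma sq_int_integrable: "sq_int M f \<Longrightarrow> integrable M (\<lambda>x. (cmod (f x))\<^sup>2)"
  by (simp add: sq_int_def)

lemma sq_norm_nonneg: "0 \<le> sq_norm M f"
  by (simp add: sq_norm_def)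

lemma cmod_add_sq_le: "(cmod (a + b))\<^sup>2 \<le> 2 * (cmod a)\<^sup>2 + 2 * (cmod b)\<^sup>2"
proof -
  have "(cmod (a + b))\<^sup>2 \<le> (cmod a + cmod b)\<^sup>2"
    by (intro power_mono norm_triangle_ineq) auto
  also have "\<dots> \<le> 2 * (cmod a)\<^sup>2 + 2 * (cmod b)\<^sup>2"
    using sum_squares_bound[of "cmod a" "cmod b"] by (simp add: power2_sum)
  finally show ?thesis .
qed

lemma sq_int_bound:
  assumes "sq_int M g" "f \<in> borel_measurable M" "AE x in M. cmod (f x) \<le> C * cmod (g x)"
  shows "sq_int M f"
proof -
  have "integrable M (\<lambda>x. C\<^sup>2 * (cmod (g x))\<^sup>2)"
    using sq_int_integrable[OF assms(1)] by simp
  moreover have "AE x in M. norm ((cmod (f x))\<^sup>2) \<le> norm (C\<^sup>2 * (cmod (g x))\<^sup>2)"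
    using assms(3)
  proof eventually_elim
    case (elim x)
    then have "(cmod (f x))\<^sup>2 \<le> (C * cmod (g x))\<^sup>2" by (intro power_mono) auto
    then show ?case by (simp add: power_mult_distrib)
  qed
  ultimately have "integrable M (\<lambda>x. (cmod (f x))\<^sup>2)"
    using assms(2) by (intro Bochner_Integration.integrable_bound[where f="\<lambda>x. C\<^sup>2 * (cmod (g x))\<^sup>2" and g="\<lambda>x. (cmod (f x))\<^sup>2"]) measurable
  then show ?thesis using assms(2) by (simp add: sq_int_def)
qed

lemma sq_int_scale: "sq_int M f \<Longrightarrow> sq_int M (\<lambda>x. c * f x)"
  by (auto simp: sq_int_def norm_mult power_mult_distrib)

lemma sq_norm_scale: "sq_norm M (\<lambda>x. c * f x) = (cmod c)\<^sup>2 * sq_norm M f"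
  by (auto simp: sq_norm_def norm_mult power_mult_distrib)

lemma sq_int_cnj: "sq_int M f \<Longrightarrow> sq_int M (\<lambda>x. cnj (f x))"
  using borel_measurable_continuous_on[of cnj f M] by (auto simp: sq_int_def intro!: continuous_intros)

lemma sq_int_add:
  assumes f: "sq_int M f" and g: "sq_int M g"
  shows "sq_int M (\<lambda>x. f x + g x)"
    and "sq_norm M (\<lambda>x. f x + g x) \<le> 2 * sq_norm M f + 2 * sq_norm M g"
proof -
  have [measurable]: "f \<in> borel_measurable M" "g \<in> borel_measurable M"
    using f g by (auto simp: sq_int_def)
  have i: "integrable M (\<lambda>x. 2 * (cmod (f x))\<^sup>2 + 2 * (cmod (g x))\<^sup>2)"
    using f g by (auto simp: sq_int_def)
  have i2: "integrable M (\<lambda>x. (cmod (f x + g x))\<^sup>2)"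
    by (rule Bochner_Integration.integrable_bound[OF i]) (use cmod_add_sq_le in auto)
  then show "sq_int M (\<lambda>x. f x + g x)" by (simp add: sq_int_def)
  have "sq_norm M (\<lambda>x. f x + g x) \<le> (LINT x|M. 2 * (cmod (f x))\<^sup>2 + 2 * (cmod (g x))\<^sup>2)"
    unfolding sq_norm_def by (intro integral_mono i i2 cmod_add_sq_le)
  also have "\<dots> = 2 * sq_norm M f + 2 * sq_norm M g"
    using f g by (auto simp: sq_int_def sq_norm_def)
  finally show "sq_norm M (\<lambda>x. f x + g x) \<le> 2 * sq_norm M f + 2 * sq_norm M g" .
qed

lemma sq_int_diff:
  assumes f: "sq_int M f" and g: "sq_int M g"
  shows "sq_int M (\<lambda>x. f x - g x)"
    and "sq_norm M (\<lambda>x. f x - g x) \<le> 2 * sq_norm M f + 2 * sq_norm M g"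
  using sq_int_add[OF f sq_int_scale[OF g, of "-1"]] sq_norm_scale[of M "-1" g] by auto

lemma sq_int_zero: "sq_int M (\<lambda>x. 0)"
  by (simp add: sq_int_def)

lemma sq_int_sum: "(\<And>i. i \<in> I \<Longrightarrow> sq_int M (f i)) \<Longrightarrow> sq_int M (\<lambda>x. \<Sum>i\<in>I. f i x)"
  by (induction I rule: infinite_finite_induct) (auto intro: sq_int_add(1) sq_int_zero)

lemma sq_int_mult:
  assumes f: "sq_int M f" and g: "sq_int M g"
  shows "integrable M (\<lambda>x. f x * g x)"
proof -
  have [measurable]: "f \<in> borel_measurable M" "g \<in> borel_measurable M"
    using f g by (auto simp: sq_int_def)
  have i: "integrable M (\<lambda>x. (cmod (f x))\<^sup>2 + (cmod (g x))\<^sup>2)"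
    using f g by (auto simp: sq_int_def)
  show ?thesis
  proof (rule Bochner_Integration.integrable_bound[OF i])
    show "AE x in M. norm (f x * g x) \<le> norm ((cmod (f x))\<^sup>2 + (cmod (g x))\<^sup>2)"
    proof (intro always_eventually allI)
      fix x
      have "0 \<le> (cmod (f x) - cmod (g x))\<^sup>2" by simp
      moreover have "0 \<le> cmod (f x) * cmod (g x)" by simp
      ultimately have "cmod (f x) * cmod (g x) \<le> (cmod (f x))\<^sup>2 + (cmod (g x))\<^sup>2"
        unfolding power2_diff by linarith
      then show "norm (f x * g x) \<le> norm ((cmod (f x))\<^sup>2 + (cmod (g x))\<^sup>2)"
        by (simp add: norm_mult)
    qed
  qed simp
qed

lemma nn_integral_sq_norm:
  "sq_int M f \<Longrightarrow> (\<integral>\<^sup>+x. ennreal ((cmod (f x))\<^sup>2) \<partial>M) = ennreal (sq_norm M f)"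
  unfolding sq_norm_def by (rule nn_integral_eq_integral) (auto simp: sq_int_def)

text \<open>The pairing is bilinear, without conjugation, in accordance with the pairing of
  distributions and test functions.\<close>

lemma sq_int_Cauchy_Schwarz:
  assumes f: "sq_int M f" and g: "sq_int M g"
  shows "(cmod (LINT x|M. f x * g x))\<^sup>2 \<le> sq_norm M f * sq_norm M g"
proof -
  have m: "f \<in> borel_measurable M" "g \<in> borel_measurable M"
    using f g by (auto simp: sq_int_def)
  let ?I = "LINT x|M. cmod (f x) * cmod (g x)"
  have i: "integrable M (\<lambda>x. cmod (f x) * cmod (g x))"
    using integrable_norm[OF sq_int_mult[OF f g]] by (simp add: norm_mult)
  have e: "(\<integral>\<^sup>+x. ennreal (cmod (f x)) * ennreal (cmod (g x)) \<partial>M) = ennreal ?I"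
    using nn_integral_eq_integral[OF i] by (simp add: ennreal_mult)
  have "(\<integral>\<^sup>+x. ennreal (cmod (f x)) * ennreal (cmod (g x)) \<partial>M)\<^sup>2 \<le>
      (\<integral>\<^sup>+x. (ennreal (cmod (f x)))\<^sup>2 \<partial>M) * (\<integral>\<^sup>+x. (ennreal (cmod (g x)))\<^sup>2 \<partial>M)"
    by (intro Cauchy_Schwarz_nn_integral) (use m in measurable)
  then have "ennreal (?I\<^sup>2) \<le> ennreal (sq_norm M f * sq_norm M g)"
    unfolding e by (simp add: ennreal_power nn_integral_sq_norm f g ennreal_mult' sq_norm_nonneg)
  then have *: "?I\<^sup>2 \<le> sq_norm M f * sq_norm M g"
    by (simp add: ennreal_le_iff sq_norm_nonneg)
  have "cmod (LINT x|M. f x * g x) \<le> ?I"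
    using integral_norm_bound[of M "\<lambda>x. f x * g x"] by (simp add: norm_mult)
  then have "(cmod (LINT x|M. f x * g x))\<^sup>2 \<le> ?I\<^sup>2" by (intro power_mono) auto
  with * show ?thesis by linarith
qed

lemma sq_norm_tendsto_integral:
  assumes f: "\<And>n. sq_int M (f n)" "sq_int M h" and g: "sq_int M g"
    and lim: "(\<lambda>n. sq_norm M (\<lambda>x. f n x - h x)) \<longlonglongrightarrow> 0"
  shows "(\<lambda>n. LINT x|M. f n x * g x) \<longlonglongrightarrow> (LINT x|M. h x * g x)"
proof -
  have "(\<lambda>n. sqrt (sq_norm M (\<lambda>x. f n x - h x) * sq_norm M g)) \<longlonglongrightarrow> sqrt (0 * sq_norm M g)"
    by (intro tendsto_intros lim)
  then have z: "(\<lambda>n. sqrt (sq_norm M (\<lambda>x. f n x - h x) * sq_norm M g)) \<longlonglongrightarrow> 0" by simp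
  have "(\<lambda>n. (LINT x|M. f n x * g x) - (LINT x|M. h x * g x)) \<longlonglongrightarrow> 0"
  proof (rule Lim_null_comparison[OF _ z], intro always_eventually allI)
    fix n
    have "(LINT x|M. f n x * g x) - (LINT x|M. h x * g x) = (LINT x|M. (f n x - h x) * g x)"
      by (simp add: left_diff_distrib sq_int_mult f g)
    moreover have "(cmod (LINT x|M. (f n x - h x) * g x))\<^sup>2 \<le> sq_norm M (\<lambda>x. f n x - h x) * sq_norm M g"
      by (intro sq_int_Cauchy_Schwarz sq_int_diff f g)
    ultimately show "norm ((LINT x|M. f n x * g x) - (LINT x|M. h x * g x))
        \<le> sqrt (sq_norm M (\<lambda>x. f n x - h x) * sq_norm M g)"
      by (simp add: real_le_rsqrt)
  qed
  then show ?thesis by (simp add: LIM_zero_iff)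
qed

text \<open>Only \<open>|a + b|^2 \<le> 2 |a|^2 + 2 |b|^2\<close> is used, which costs the factor 2;
  the constants of the final estimates absorb it.\<close>

lemma sq_norm_limit_bound:
  assumes f: "\<And>n. sq_int M (f n)" "sq_int M h"
    and lim: "(\<lambda>n. sq_norm M (\<lambda>x. f n x - h x)) \<longlonglongrightarrow> 0"
    and B: "\<And>n. sq_norm M (f n) \<le> B"
  shows "sq_norm M h \<le> 2 * B"
proof (rule LIMSEQ_le_const)
  show "(\<lambda>n. 2 * B + 2 * sq_norm M (\<lambda>x. f n x - h x)) \<longlonglongrightarrow> 2 * B"
    using tendsto_add[OF tendsto_const tendsto_mult[OF tendsto_const lim], of "2 * B" 2] by simp
  have "sq_norm M h \<le> 2 * B + 2 * sq_norm M (\<lambda>x. f n x - h x)" for n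
    using sq_int_diff(2)[OF f(1) sq_int_diff(1)[OF f(1) f(2)], of n n] B[of n] by simp
  then show "\<exists>N. \<forall>n\<ge>N. sq_norm M h \<le> 2 * B + 2 * sq_norm M (\<lambda>x. f n x - h x)" by blast
qed

text \<open>Finiteness of the weighted sum bounds each of its terms, so
  \<open>|a i| \<le> sqrt C * (1/2) ^ i\<close>. This is applied pointwise to the increments of a
  subsequence in the proof of completeness.\<close>

lemma ennreal_suminf_finite_geometric_decay:
  fixes a :: "nat \<Rightarrow> complex"
  assumes "(\<Sum>i. ennreal (4 ^ i * (cmod (a i))\<^sup>2)) \<noteq> \<infinity>"
  shows "summable a"
proof -
  obtain C where C: "(\<Sum>i. ennreal (4 ^ i * (cmod (a i))\<^sup>2)) = ennreal C" "C \<ge> 0"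
    using assms by (metis ennreal_cases infinity_ennreal_def)
  have "cmod (a i) \<le> sqrt C * (1/2) ^ i" for i
  proof -
    have "ennreal (4 ^ i * (cmod (a i))\<^sup>2) \<le> ennreal C"
      using sum_le_suminf[of "\<lambda>i. ennreal (4 ^ i * (cmod (a i))\<^sup>2)" "{i}"] C by simp
    then have "4 ^ i * (cmod (a i))\<^sup>2 \<le> C" using C by (simp add: ennreal_le_iff)
    then have "(2 ^ i * cmod (a i))\<^sup>2 \<le> C"
      using power_mult[of "2::real" 2 i] power_mult[of "2::real" i 2]
      by (simp add: power_mult_distrib mult.commute)
    then have "2 ^ i * cmod (a i) \<le> sqrt C" by (simp add: real_le_rsqrt)
    then show ?thesis by (simp add: power_divide field_simps)
  qed
  then show ?thesis
    by (intro summable_comparison_test[OF _ summable_mult[OF summable_geometric[of "1/2::real"]]])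
      (auto intro!: exI[of _ 0])
qed

text \<open>A subsequence with geometrically small increments converges almost everywhere; Fatou's lemma
  identifies its pointwise limit as the limit in the mean.\<close>

lemma riesz_fischer:
  fixes f :: "nat \<Rightarrow> 'a \<Rightarrow> complex"
  assumes sq: "\<And>n. sq_int M (f n)"
    and cauchy: "\<And>e. e > 0 \<Longrightarrow> \<exists>N. \<forall>m\<ge>N. \<forall>n\<ge>N. sq_norm M (\<lambda>x. f m x - f n x) \<le> e"
  obtains g where "sq_int M g" "(\<lambda>n. sq_norm M (\<lambda>x. f n x - g x)) \<longlonglongrightarrow> 0"
proof -
  have m [measurable]: "f n \<in> borel_measurable M" for n using sq by (simp add: sq_int_def)
  \<comment> \<open>The rate 1/8 beats the weight \<open>4 ^ i\<close> used below: the weighted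
    increments have integrals at most \<open>(1/2) ^ i\<close>.\<close>
  have "\<forall>i. \<exists>N. \<forall>m\<ge>N. \<forall>n\<ge>N. sq_norm M (\<lambda>x. f m x - f n x) \<le> (1/8)^i"
    by (intro allI cauchy) auto
  then obtain N where N: "\<And>i m n. m \<ge> N i \<Longrightarrow> n \<ge> N i \<Longrightarrow> sq_norm M (\<lambda>x. f m x - f n x) \<le> (1/8)^i"
    by metis
  \<comment> \<open>Summing all earlier thresholds makes \<open>r i\<close> at least each
    \<open>N k\<close> with \<open>k \<le> i\<close>, so the thresholds need not be
    monotone.\<close>
  define r where "r i = (\<Sum>k\<le>i. N k) + i" for i
  have rN: "r j \<ge> N i" if "i \<le> j" for i j
    unfolding r_def using that by (intro trans_le_add1 member_le_sum) auto
  have rge: "r i \<ge> i" for i by (simp add: r_def)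
  define D where "D i x = f (r (Suc i)) x - f (r i) x" for i x
  have [measurable]: "D i \<in> borel_measurable M" for i unfolding D_def by measurable
  have sqD: "sq_int M (D i)" for i unfolding D_def by (intro sq_int_diff sq)
  have D_le: "sq_norm M (D i) \<le> (1/8)^i" for i
    unfolding D_def by (intro N rN) auto
  have "(\<integral>\<^sup>+x. (\<Sum>i. ennreal (4^i * (cmod (D i x))\<^sup>2)) \<partial>M) = (\<Sum>i. \<integral>\<^sup>+x. ennreal (4^i * (cmod (D i x))\<^sup>2) \<partial>M)"
    by (intro nn_integral_suminf) measurable
  also have "\<dots> = (\<Sum>i. ennreal (4^i * sq_norm M (D i)))"
    by (simp add: ennreal_mult nn_integral_cmult nn_integral_sq_norm[OF sqD] sq_norm_nonneg)
  also have "\<dots> \<le> (\<Sum>i. ennreal ((1/2)^i))"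
  proof (intro suminf_le ennreal_leI)
    fix i
    have "4^i * sq_norm M (D i) \<le> 4^i * (1/8)^i" using D_le by simp
    also have "\<dots> = (1/2)^i" by (simp flip: power_mult_distrib)
    finally show "4^i * sq_norm M (D i) \<le> (1/2)^i" .
  qed auto
  also have "\<dots> = ennreal (\<Sum>i. (1/2)^i)"
    by (intro suminf_ennreal2) (auto simp: summable_geometric)
  also have "\<dots> < \<infinity>" by simp
  finally have fin: "(\<integral>\<^sup>+x. (\<Sum>i. ennreal (4^i * (cmod (D i x))\<^sup>2)) \<partial>M) \<noteq> \<infinity>" by simp
  have "AE x in M. (\<Sum>i. ennreal (4^i * (cmod (D i x))\<^sup>2)) \<noteq> \<infinity>"
    by (rule nn_integral_PInf_AE[OF _ fin]) measurable
  then have conv: "AE x in M. convergent (\<lambda>i. f (r i) x)"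
  proof eventually_elim
    case (elim x)
    then have "summable (\<lambda>i. D i x)" by (rule ennreal_suminf_finite_geometric_decay)
    then have "convergent (\<lambda>n. f (r 0) x + (\<Sum>i<n. D i x))"
      by (intro convergent_add convergent_const) (simp add: summable_iff_convergent)
    moreover have "f (r 0) x + (\<Sum>i<n. D i x) = f (r n) x" for n
      unfolding D_def by (subst sum_lessThan_telescope) simp
    ultimately show ?case by simp
  qed
  define g where "g x = lim (\<lambda>i. f (r i) x)" for x
  have [measurable]: "g \<in> borel_measurable M" unfolding g_def by measurable
  \<comment> \<open>Fatou's lemma in the second index, with the first one fixed. It bounds the
    distance to \<open>g\<close> for the whole sequence and not only along the subsequence.\<close>
  have fatou: "(\<integral>\<^sup>+x. ennreal ((cmod (f n x - g x))\<^sup>2) \<partial>M) \<le> ennreal ((1/8)^i)" if "n \<ge> N i" for n i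
  proof -
    have "(\<integral>\<^sup>+x. ennreal ((cmod (f n x - g x))\<^sup>2) \<partial>M) =
        (\<integral>\<^sup>+x. liminf (\<lambda>k. ennreal ((cmod (f n x - f (r k) x))\<^sup>2)) \<partial>M)"
    proof (rule nn_integral_cong_AE, use conv in eventually_elim)
      case (elim x)
      then have "(\<lambda>k. f (r k) x) \<longlonglongrightarrow> g x" unfolding g_def by (simp add: convergent_LIMSEQ_iff)
      then have "(\<lambda>k. ennreal ((cmod (f n x - f (r k) x))\<^sup>2)) \<longlonglongrightarrow> ennreal ((cmod (f n x - g x))\<^sup>2)"
        by (intro tendsto_intros)
      then show ?case by (intro lim_imp_Liminf[symmetric] trivial_limit_sequentially)
    qed
    also have "\<dots> \<le> liminf (\<lambda>k. \<integral>\<^sup>+x. ennreal ((cmod (f n x - f (r k) x))\<^sup>2) \<partial>M)"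
      by (intro nn_integral_liminf) measurable
    also have "\<dots> \<le> limsup (\<lambda>k. \<integral>\<^sup>+x. ennreal ((cmod (f n x - f (r k) x))\<^sup>2) \<partial>M)"
      by (intro Liminf_le_Limsup) auto
    also have "\<dots> \<le> ennreal ((1/8)^i)"
    proof (rule Limsup_bounded, rule eventually_sequentiallyI[of i])
      fix k assume "i \<le> k"
      have "(\<integral>\<^sup>+x. ennreal ((cmod (f n x - f (r k) x))\<^sup>2) \<partial>M) = ennreal (sq_norm M (\<lambda>x. f n x - f (r k) x))"
        by (intro nn_integral_sq_norm sq_int_diff sq)
      also have "\<dots> \<le> ennreal ((1/8)^i)" by (intro ennreal_leI N rN that \<open>i \<le> k\<close>)
      finally show "(\<integral>\<^sup>+x. ennreal ((cmod (f n x - f (r k) x))\<^sup>2) \<partial>M) \<le> ennreal ((1/8)^i)" .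
    qed
    finally show ?thesis .
  qed
  have sqd: "sq_int M (\<lambda>x. f n x - g x)" if "n \<ge> N 0" for n
    unfolding sq_int_def
    using le_less_trans[OF fatou[OF that] ennreal_less_top]
    by (auto intro!: integrableI_bounded)
  \<comment> \<open>Square integrability of \<open>g\<close> itself comes from writing it as a
    difference of two square integrable functions.\<close>
  have "sq_int M (\<lambda>x. f (N 0) x - (f (N 0) x - g x))"
    by (intro sq_int_diff(1) sq sqd) auto
  then have sqg: "sq_int M g" by simp
  have le: "sq_norm M (\<lambda>x. f n x - g x) \<le> (1/8)^i" if "n \<ge> N i" for n i
    using fatou[OF that] nn_integral_sq_norm[OF sq_int_diff(1)[OF sq sqg], of n]
    by (simp add: ennreal_le_iff)
  have "(\<lambda>n. sq_norm M (\<lambda>x. f n x - g x)) \<longlonglongrightarrow> 0"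
  proof (rule LIMSEQ_I)
    fix e :: real assume "e > 0"
    obtain i where i: "(1/8::real)^i < e" using real_arch_pow_inv[OF \<open>e > 0\<close>, of "1/8"] by auto
    have "norm (sq_norm M (\<lambda>x. f n x - g x) - 0) < e" if "n \<ge> N i" for n
      using le[OF that] i by (simp add: sq_norm_nonneg)
    then show "\<exists>no. \<forall>n\<ge>no. norm (sq_norm M (\<lambda>x. f n x - g x) - 0) < e" by blast
  qed
  with sqg show ?thesis by (rule that)
qed

lemma sq_norm_orthogonal_sum:
  fixes e :: "nat \<Rightarrow> 'a \<Rightarrow> real" and d :: "nat \<Rightarrow> complex"
  assumes e: "\<And>j. sq_int M (\<lambda>x. of_real (e j x))"
    and orth: "\<And>i j. (LINT x|M. e i x * e j x) = (if i = j then w i else 0)"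
  shows "sq_norm M (\<lambda>x. \<Sum>j\<in>J. d j * of_real (e j x)) = (\<Sum>j\<in>J. (cmod (d j))\<^sup>2 * w j)"
proof (cases "finite J")
  case True
  have I: "integrable M (\<lambda>x. e i x * e j x)" for i j
    using integrable_Re[OF sq_int_mult[OF e e, of i j]] by simp
  have "(cmod (\<Sum>j\<in>J. d j * of_real (e j x)))\<^sup>2 =
      (\<Sum>i\<in>J. \<Sum>j\<in>J. Re (d i * cnj (d j)) * (e i x * e j x))" for x
  proof -
    have "(cmod (\<Sum>j\<in>J. d j * of_real (e j x)))\<^sup>2 =
      Re ((\<Sum>j\<in>J. d j * of_real (e j x)) * cnj (\<Sum>j\<in>J. d j * of_real (e j x)))"
      by (simp only: complex_norm_square[symmetric] Re_complex_of_real)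
    also have "\<dots> = Re (\<Sum>i\<in>J. \<Sum>j\<in>J. (d i * cnj (d j)) * of_real (e i x * e j x))"
      by (simp add: cnj_sum sum_product mult_ac)
    finally show ?thesis by (simp add: Re_sum)
  qed
  then have "sq_norm M (\<lambda>x. \<Sum>j\<in>J. d j * of_real (e j x)) =
      (\<Sum>i\<in>J. \<Sum>j\<in>J. Re (d i * cnj (d j)) * (LINT x|M. e i x * e j x))"
    unfolding sq_norm_def by (simp only:) (simp add: I Bochner_Integration.integral_sum del: Re_complex_of_real mult.assoc)
  also have "\<dots> = (\<Sum>i\<in>J. Re (d i * cnj (d i)) * w i)"
    unfolding orth by (simp add: True if_distrib[where f="\<lambda>z. _ * z"] sum.delta cong: if_cong)
  also have "\<dots> = (\<Sum>j\<in>J. (cmod (d j))\<^sup>2 * w j)"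
    by (simp only: complex_norm_square[symmetric] Re_complex_of_real)
  finally show ?thesis .
qed (simp add: sq_norm_def)

text \<open>Nonnegativity of the squared distance from \<open>f\<close> to its projection
  \<open>S\<close>. The system is real and not normalised: \<open>w j\<close> is the squared norm of
  \<open>e j\<close>, which for Laguerre functions carries the growth in \<open>j\<close> that is
  wanted.\<close>

lemma bessel_inequality:
  fixes e :: "nat \<Rightarrow> 'a \<Rightarrow> real" and f :: "'a \<Rightarrow> complex"
  assumes e: "\<And>j. sq_int M (\<lambda>x. of_real (e j x))" and f: "sq_int M f"
    and orth: "\<And>i j. (LINT x|M. e i x * e j x) = (if i = j then w i else 0)"
    and w: "\<And>i. w i > 0" and J: "finite J"
  shows "(\<Sum>j\<in>J. (cmod (LINT x|M. f x * of_real (e j x)))\<^sup>2 / w j) \<le> sq_norm M f"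
proof -
  define a where "a j = (LINT x|M. f x * of_real (e j x)) / of_real (w j)" for j
  define S where "S x = (\<Sum>j\<in>J. a j * of_real (e j x))" for x
  have S: "sq_int M S" unfolding S_def by (intro sq_int_sum sq_int_scale e)
  have nS: "sq_norm M S = (\<Sum>j\<in>J. (cmod (a j))\<^sup>2 * w j)"
    unfolding S_def by (rule sq_norm_orthogonal_sum[OF e orth])
  have fS: "(LINT x|M. f x * cnj (S x)) = of_real (\<Sum>j\<in>J. (cmod (a j))\<^sup>2 * w j)"
  proof -
    have "(LINT x|M. f x * cnj (S x)) = (LINT x|M. (\<Sum>j\<in>J. cnj (a j) * (f x * of_real (e j x))))"
      by (simp add: S_def cnj_sum sum_distrib_left mult_ac)
    also have "\<dots> = (\<Sum>j\<in>J. cnj (a j) * (LINT x|M. f x * of_real (e j x)))"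
      by (subst Bochner_Integration.integral_sum) (intro sq_int_mult sq_int_scale f e integrable_mult_right, simp)
    also have "\<dots> = (\<Sum>j\<in>J. a j * cnj (a j) * of_real (w j))"
      by (intro sum.cong refl) (use w in \<open>simp add: a_def less_imp_neq[THEN not_sym]\<close>)
    finally show ?thesis by (simp add: complex_norm_square del: of_real_power)
  qed
  have "(cmod (f x - S x))\<^sup>2 = (cmod (f x))\<^sup>2 - 2 * Re (f x * cnj (S x)) + (cmod (S x))\<^sup>2" for x
    unfolding cmod_power2 by (simp add: power2_eq_square algebra_simps)
  then have "sq_norm M (\<lambda>x. f x - S x) = sq_norm M f - 2 * Re (LINT x|M. f x * cnj (S x)) + sq_norm M S"
    unfolding sq_norm_def using sq_int_integrable[OF f] sq_int_integrable[OF S] sq_int_mult[OF f sq_int_cnj[OF S]]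
    by (simp add: integral_Re del: complex_cnj_mult times_complex.sel)
  then have "0 \<le> sq_norm M f - (\<Sum>j\<in>J. (cmod (a j))\<^sup>2 * w j)"
    unfolding fS nS using sq_norm_nonneg[of M "\<lambda>x. f x - S x"] by simp
  moreover have "(cmod (a j))\<^sup>2 * w j = (cmod (LINT x|M. f x * of_real (e j x)))\<^sup>2 / w j" for j
    using w[of j] by (simp add: a_def norm_divide power_divide power2_eq_square)
  ultimately show ?thesis by simp
qed

section \<open>Smooth functions and test functions\<close>

text \<open>An explicit sequence of all derivatives. It is relative to a set because powers of
  \<open>x\<close> are smooth on the half-line only, and explicit because bounds are needed order by
  order.\<close>

definition deriv_chain :: "(nat \<Rightarrow> real \<Rightarrow> complex) \<Rightarrow> real set \<Rightarrow> bool" where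
  "deriv_chain d S \<longleftrightarrow> (\<forall>i. \<forall>x\<in>S. (d i has_vector_derivative d (Suc i) x) (at x))"

lemma deriv_chainD: "deriv_chain d S \<Longrightarrow> x \<in> S \<Longrightarrow> (d i has_vector_derivative d (Suc i) x) (at x)"
  by (simp add: deriv_chain_def)

lemma deriv_chain_continuous:
  assumes "deriv_chain d S" shows "continuous_on S (d i)"
  using deriv_chainD[OF assms]
  by (meson continuous_at_imp_continuous_on has_vector_derivative_continuous)

lemma smooth_iff_deriv_chain: "smooth \<phi> \<longleftrightarrow> (\<exists>d. d 0 = \<phi> \<and> deriv_chain d UNIV)"
proof
  assume s: "smooth \<phi>"
  show "\<exists>d. d 0 = \<phi> \<and> deriv_chain d UNIV"
    by (rule exI[of _ "\<lambda>k. ((\<lambda>h y. vector_derivative h (at y)) ^^ k) \<phi>"])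
      (use s in \<open>auto simp: smooth_def deriv_chain_def vector_derivative_works[symmetric]\<close>)
next
  assume "\<exists>d. d 0 = \<phi> \<and> deriv_chain d UNIV"
  then obtain d where d: "d 0 = \<phi>" "deriv_chain d UNIV" by blast
  have "((\<lambda>h y. vector_derivative h (at y)) ^^ k) \<phi> = d k" for k
  proof (induction k)
    case (Suc k)
    then show ?case
      using d(2) by (auto simp: deriv_chain_def intro!: ext vector_derivative_at)
  qed (simp add: d)
  then show "smooth \<phi>"
    using d(2) by (auto simp: smooth_def deriv_chain_def dest: differentiableI_vector)
qed

definition leibniz :: "(nat \<Rightarrow> real \<Rightarrow> complex) \<Rightarrow> (nat \<Rightarrow> real \<Rightarrow> complex) \<Rightarrow> nat \<Rightarrow> real \<Rightarrow> complex" where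
  "leibniz d e n x = (\<Sum>i\<le>n. of_nat (n choose i) * (d i x * e (n - i) x))"

text \<open>Pascal's rule, arranged so that the right-hand side is what the product rule yields from
  the terms of the Leibniz sum.\<close>

lemma sum_choose_Suc:
  fixes a :: "nat \<Rightarrow> nat \<Rightarrow> complex"
  shows "(\<Sum>i\<le>Suc n. of_nat (Suc n choose i) * a i (Suc n - i)) =
    (\<Sum>i\<le>n. of_nat (n choose i) * (a (Suc i) (n - i) + a i (Suc (n - i))))"
proof -
  have "(\<Sum>i\<le>Suc n. of_nat (Suc n choose i) * a i (Suc n - i)) =
      (\<Sum>i\<le>n. of_nat (n choose i) * a (Suc i) (n - i)) +
      (a 0 (Suc n) + (\<Sum>i\<le>n. of_nat (n choose Suc i) * a (Suc i) (n - i)))"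
    by (subst sum.atMost_Suc_shift) (simp add: sum.distrib algebra_simps)
  also have "a 0 (Suc n) + (\<Sum>i\<le>n. of_nat (n choose Suc i) * a (Suc i) (n - i)) =
      (\<Sum>i\<le>Suc n. of_nat (n choose i) * a i (Suc n - i))"
    by (subst sum.atMost_Suc_shift) simp
  also have "\<dots> = (\<Sum>i\<le>n. of_nat (n choose i) * a i (Suc (n - i)))"
    by (simp add: Suc_diff_le)
  finally show ?thesis by (simp add: sum.distrib algebra_simps)
qed

lemma deriv_chain_leibniz:
  assumes "deriv_chain d S" "deriv_chain e S"
  shows "deriv_chain (leibniz d e) S"
  unfolding deriv_chain_def
proof (intro allI ballI)
  fix n x assume x: "x \<in> S"
  have "(leibniz d e n has_vector_derivative
      (\<Sum>i\<le>n. of_nat (n choose i) * (d i x * e (Suc (n - i)) x + d (Suc i) x * e (n - i) x))) (at x)"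
    unfolding leibniz_def[abs_def]
    by (intro has_vector_derivative_sum has_vector_derivative_mult_right has_vector_derivative_mult
        deriv_chainD[OF assms(1) x] deriv_chainD[OF assms(2) x])
  also have "(\<Sum>i\<le>n. of_nat (n choose i) * (d i x * e (Suc (n - i)) x + d (Suc i) x * e (n - i) x)) =
      leibniz d e (Suc n) x"
    unfolding leibniz_def sum_choose_Suc[of n "\<lambda>i j. d i x * e j x"] by (simp add: add.commute)
  finally show "(leibniz d e n has_vector_derivative leibniz d e (Suc n) x) (at x)" .
qed

section \<open>Smooth step functions built from \<open>exp (- 1 / x)\<close>\<close>

definition exp_cut :: "nat \<Rightarrow> real \<Rightarrow> real" where
  "exp_cut n x = (if x > 0 then exp (- 1 / x) / x ^ n else 0)"

text \<open>One term of the exponential series is at most the whole sum. The bound serves again for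
  the derivatives of exponentials in the symbol estimates.\<close>

lemma power_le_fact_exp: "y ^ n \<le> fact n * exp y" if "y \<ge> 0" for y :: real
proof -
  have "sum (\<lambda>n. y ^ n /\<^sub>R fact n) {n} \<le> (\<Sum>n. y ^ n /\<^sub>R fact n)"
    using that by (intro sum_le_suminf summable_exp_generic) auto
  then have "y ^ n / fact n \<le> exp y" by (simp add: exp_def divide_inverse mult.commute)
  then show ?thesis by (simp add: field_simps)
qed

lemma exp_cut_le: assumes "x > 0" shows "exp_cut n x \<le> fact n"
proof -
  have "(1 / x) ^ n * exp (- (1 / x)) \<le> (fact n * exp (1 / x)) * exp (- (1 / x))"
    by (intro mult_right_mono power_le_fact_exp) (use assms in auto)
  also have "\<dots> = fact n" by (simp add: mult.assoc flip: exp_add)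
  finally show ?thesis using assms by (simp add: exp_cut_def power_divide)
qed

lemma DERIV_zero_of_quadratic_bound:
  fixes f :: "real \<Rightarrow> real"
  assumes "\<And>x. \<bar>f x\<bar> \<le> C * x\<^sup>2"
  shows "(f has_real_derivative 0) (at 0)"
proof -
  have f0: "f 0 = 0" using assms[of 0] by simp
  have "((\<lambda>h. f h / h) \<longlongrightarrow> 0) (at 0)"
  proof (rule Lim_null_comparison)
    show "((\<lambda>h. C * \<bar>h\<bar>) \<longlongrightarrow> 0) (at 0)"
      using tendsto_mult[OF tendsto_const tendsto_rabs[OF tendsto_ident_at], of C 0 UNIV] by simp
    show "\<forall>\<^sub>F h in at 0. norm (f h / h) \<le> C * \<bar>h\<bar>"
      using eventually_neq_at_within[of 0]
    proof eventually_elim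
      case (elim h)
      then show ?case using assms[of h] by (simp add: divide_le_eq power2_eq_square mult.assoc flip: abs_mult)
    qed
  qed
  then show ?thesis by (simp add: DERIV_def f0)
qed

text \<open>Dividing by \<open>x ^ n\<close> makes the family closed under differentiation, so
  smoothness needs only this one formula. At the origin the derivative vanishes because
  \<open>exp_cut n h = exp_cut (n + 2) h * h^2\<close> is quadratically small.\<close>

lemma DERIV_exp_cut:
  "(exp_cut n has_real_derivative exp_cut (n + 2) x - real n * exp_cut (n + 1) x) (at x)"
proof -
  consider "x > 0" | "x < 0" | "x = 0" by linarith
  then show ?thesis
  proof cases
    case 1
    have "((\<lambda>x. exp (- 1 / x) / x ^ n) has_real_derivative exp_cut (n + 2) x - real n * exp_cut (n + 1) x) (at x)"
    proof -
      have d1: "((\<lambda>x. exp (- 1 / x)) has_real_derivative exp (- 1 / x) * inverse x ^ 2) (at x)"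
        using 1 by (auto intro!: derivative_eq_intros simp: power2_eq_square divide_inverse)
      have d2: "((\<lambda>x. inverse x ^ n) has_real_derivative real n * (- (inverse x ^ 2) * inverse x ^ (n - 1))) (at x)"
        using DERIV_power[OF DERIV_inverse[of x], of n] 1
        by (simp add: power2_eq_square mult_ac)
      have "real n * (- (inverse x ^ 2) * inverse x ^ (n - 1)) = - real n * inverse x ^ (n + 1)"
        by (cases n) (auto simp: power2_eq_square algebra_simps)
      with DERIV_mult[OF d1 d2]
      have "((\<lambda>x. exp (- 1 / x) * inverse x ^ n) has_real_derivative
          exp (- 1 / x) * inverse x ^ 2 * inverse x ^ n + - real n * inverse x ^ (n + 1) * exp (- 1 / x)) (at x)"
        by (simp only:)
      moreover have "exp (- 1 / x) * inverse x ^ 2 * inverse x ^ n + - real n * inverse x ^ (n + 1) * exp (- 1 / x) =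
          exp_cut (n + 2) x - real n * exp_cut (n + 1) x"
        using 1 by (simp add: exp_cut_def divide_inverse power_inverse power_add power2_eq_square mult_ac)
      ultimately show ?thesis
        by (simp add: divide_inverse power_inverse)
    qed
    then show ?thesis
      by (rule has_field_derivative_transform_within_open[of _ _ _ "{0<..}"])
        (use 1 in \<open>auto simp: exp_cut_def\<close>)
  next
    case 2
    have "((\<lambda>x. 0) has_real_derivative exp_cut (n + 2) x - real n * exp_cut (n + 1) x) (at x)"
      using 2 by (auto simp: exp_cut_def)
    then show ?thesis
      by (rule has_field_derivative_transform_within_open[of _ _ _ "{..<0}"])
        (use 2 in \<open>auto simp: exp_cut_def\<close>)
  next
    case 3
    have "\<bar>exp_cut n h\<bar> \<le> fact (n + 2) * h\<^sup>2" for h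
    proof (cases "h > 0")
      case True
      have "exp_cut n h = exp_cut (n + 2) h * h\<^sup>2"
        using True by (simp add: exp_cut_def power_add power2_eq_square)
      also have "\<dots> \<le> fact (n + 2) * h\<^sup>2"
        by (intro mult_right_mono exp_cut_le True) simp
      finally show ?thesis using True by (simp add: exp_cut_def)
    qed (simp add: exp_cut_def)
    then have "(exp_cut n has_real_derivative 0) (at 0)" by (rule DERIV_zero_of_quadratic_bound)
    with 3 show ?thesis by (simp add: exp_cut_def)
  qed
qed

text \<open>A class in which every member has a derivative that is again a member, so all higher
  derivatives exist without being computed. The affine rule provides reflections and dilations of
  the step function.\<close>

inductive_set smooth_alg :: "(real \<Rightarrow> real) set" where
  exp_cut: "exp_cut n \<in> smooth_alg"
| const: "(\<lambda>x. c) \<in> smooth_alg"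
| add: "f \<in> smooth_alg \<Longrightarrow> g \<in> smooth_alg \<Longrightarrow> (\<lambda>x. f x + g x) \<in> smooth_alg"
| mult: "f \<in> smooth_alg \<Longrightarrow> g \<in> smooth_alg \<Longrightarrow> (\<lambda>x. f x * g x) \<in> smooth_alg"
| inverse: "f \<in> smooth_alg \<Longrightarrow> (\<And>x. f x \<noteq> 0) \<Longrightarrow> (\<lambda>x. inverse (f x)) \<in> smooth_alg"
| affine: "f \<in> smooth_alg \<Longrightarrow> (\<lambda>x. f (a * x + b)) \<in> smooth_alg"

lemma smooth_alg_deriv:
  assumes "f \<in> smooth_alg"
  shows "\<exists>f'\<in>smooth_alg. \<forall>x. (f has_real_derivative f' x) (at x)"
  using assms
proof induction
  case (exp_cut n)
  have "(\<lambda>x. exp_cut (n + 2) x + (- real n) * exp_cut (n + 1) x) \<in> smooth_alg"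
    by (intro smooth_alg.add smooth_alg.mult smooth_alg.const smooth_alg.exp_cut)
  then show ?case using DERIV_exp_cut[of n] by (intro bexI) auto
next
  case (const c)
  show ?case by (intro bexI[of _ "\<lambda>x. 0"]) (auto intro: smooth_alg.const)
next
  case (add f g)
  then obtain f' g' where *: "f' \<in> smooth_alg" "g' \<in> smooth_alg"
    "\<And>x. (f has_real_derivative f' x) (at x)" "\<And>x. (g has_real_derivative g' x) (at x)" by blast
  show ?case by (intro bexI[of _ "\<lambda>x. f' x + g' x"]) (auto intro!: derivative_intros smooth_alg.add *)
next
  case (mult f g)
  then obtain f' g' where *: "f' \<in> smooth_alg" "g' \<in> smooth_alg"
    "\<And>x. (f has_real_derivative f' x) (at x)" "\<And>x. (g has_real_derivative g' x) (at x)" by blast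
  show ?case
    by (intro bexI[of _ "\<lambda>x. f' x * g x + g' x * f x"] allI DERIV_mult smooth_alg.add smooth_alg.mult *
        mult.hyps)
next
  case (inverse f)
  then obtain f' where *: "f' \<in> smooth_alg" "\<And>x. (f has_real_derivative f' x) (at x)" by blast
  have "((\<lambda>x. inverse (f x)) has_real_derivative (- 1) * (inverse (f x) * (f' x * inverse (f x)))) (at x)" for x
    using DERIV_inverse'[OF *(2) inverse.hyps(2), of x] by (simp add: mult.assoc)
  moreover have "(\<lambda>x. (- 1) * (inverse (f x) * (f' x * inverse (f x)))) \<in> smooth_alg"
    by (intro smooth_alg.mult smooth_alg.const smooth_alg.inverse inverse.hyps *)
  ultimately show ?case by (intro bexI[of _ "\<lambda>x. (- 1) * (inverse (f x) * (f' x * inverse (f x)))"] allI)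
next
  case (affine f a b)
  then obtain f' where *: "f' \<in> smooth_alg" "\<And>x. (f has_real_derivative f' x) (at x)" by blast
  have "((\<lambda>x. f (a * x + b)) has_real_derivative a * f' (a * x + b)) (at x)" for x
    by (rule DERIV_cong[OF DERIV_chain2[OF *(2)]]) (auto intro!: derivative_eq_intros)
  moreover have "(\<lambda>x. a * f' (a * x + b)) \<in> smooth_alg"
    by (intro smooth_alg.mult smooth_alg.const smooth_alg.affine *)
  ultimately show ?case by (intro bexI[of _ "\<lambda>x. a * f' (a * x + b)"] allI)
qed

lemma smooth_alg_chain:
  assumes "f \<in> smooth_alg"
  obtains d where "d 0 = f" "\<And>i x. (d i has_real_derivative d (Suc i) x) (at x)"
proof -
  obtain D where D: "\<And>f. f \<in> smooth_alg \<Longrightarrow> D f \<in> smooth_alg"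
      "\<And>f x. f \<in> smooth_alg \<Longrightarrow> (f has_real_derivative D f x) (at x)"
    using smooth_alg_deriv by metis
  have "(D ^^ i) f \<in> smooth_alg" for i by (induction i) (auto intro: D assms)
  then show ?thesis by (intro that[of "\<lambda>i. (D ^^ i) f"]) (auto intro: D)
qed

lemma smooth_alg_smooth:
  assumes "f \<in> smooth_alg" shows "smooth (\<lambda>x. of_real (f x))"
proof -
  obtain d where d: "d 0 = f" "\<And>i x. (d i has_real_derivative d (Suc i) x) (at x)"
    using smooth_alg_chain[OF assms] by blast
  have "((\<lambda>x. complex_of_real (d i x)) has_vector_derivative of_real (d (Suc i) x)) (at x)" for i x
    by (rule has_vector_derivative_of_real[OF d(2)])
  then show ?thesis unfolding smooth_iff_deriv_chain
    by (intro exI[of _ "\<lambda>i x. of_real (d i x)"]) (auto simp: d(1) deriv_chain_def)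
qed

text \<open>The denominator never vanishes because \<open>x\<close> and \<open>1 - x\<close> are not
  both nonpositive. The reflection is written \<open>(- 1) * x + 1\<close> to have the shape of the
  affine rule.\<close>

definition smooth_step :: "real \<Rightarrow> real" where
  "smooth_step x = exp_cut 0 x * inverse (exp_cut 0 x + exp_cut 0 ((- 1) * x + 1))"

lemma smooth_step_denominator: "exp_cut 0 x + exp_cut 0 ((- 1) * x + 1) > 0"
  by (cases "x > 0"; cases "x < 1") (auto simp: exp_cut_def intro: add_pos_pos)

lemma smooth_step_alg: "smooth_step \<in> smooth_alg"
  unfolding smooth_step_def[abs_def]
  by (intro smooth_alg.mult smooth_alg.inverse smooth_alg.add smooth_alg.exp_cut smooth_alg.affine
      smooth_step_denominator[THEN less_imp_neq, THEN not_sym])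

lemma smooth_step_0: "x \<le> 0 \<Longrightarrow> smooth_step x = 0"
  and smooth_step_1: "x \<ge> 1 \<Longrightarrow> smooth_step x = 1"
  by (auto simp: smooth_step_def exp_cut_def)

lemma smooth_step_bounds: "0 \<le> smooth_step x" "smooth_step x \<le> 1"
proof -
  have *: "exp_cut 0 x \<ge> 0" for x by (simp add: exp_cut_def)
  show "0 \<le> smooth_step x" unfolding smooth_step_def using * by (simp del: mult_minus1)
  show "smooth_step x \<le> 1"
    using smooth_step_denominator[of x] *[of x] *[of "(-1) * x + 1"] unfolding smooth_step_def
    by (simp add: divide_inverse[symmetric])
qed

text \<open>Derivatives of positive order vanish off the unit interval, where the step is locally
  constant, and are bounded on it by compactness. Both facts are needed for the dilated cutoffs near
  zero and infinity.\<close>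

lemma smooth_step_chain:
  obtains d K where "d 0 = smooth_step" "\<And>i x. (d i has_real_derivative d (Suc i) x) (at x)"
    "\<And>i x. \<bar>d i x\<bar> \<le> K i" "\<And>i x. i \<ge> 1 \<Longrightarrow> x < 0 \<or> x > 1 \<Longrightarrow> d i x = 0"
proof -
  obtain d where d: "d 0 = smooth_step" "\<And>i x. (d i has_real_derivative d (Suc i) x) (at x)"
    using smooth_alg_chain[OF smooth_step_alg] by blast
  have loc: "d (Suc i) x = 0" if "open S" "x \<in> S" "\<And>y. y \<in> S \<Longrightarrow> d i y = c" for i x c S
  proof -
    have "((\<lambda>y. c) has_real_derivative d (Suc i) x) (at x)"
      by (rule has_field_derivative_transform_within_open[OF d(2) that(1,2)]) (use that(3) in auto)
    from DERIV_unique[OF this, of 0] show ?thesis by simp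
  qed
  have z: "(\<forall>x<0. d (Suc i) x = 0) \<and> (\<forall>x>1. d (Suc i) x = 0)" for i
  proof (induction i)
    case 0
    show ?case using loc[of "{..<0}" _ 0 0] loc[of "{1<..}" _ 0 1]
      by (auto simp: d(1) smooth_step_0 smooth_step_1)
  next
    case (Suc i)
    then show ?case using loc[of "{..<0}" _ "Suc i" 0] loc[of "{1<..}" _ "Suc i" 0] by auto
  qed
  have "\<exists>K. \<forall>x. \<bar>d i x\<bar> \<le> K" for i
  proof (cases i)
    case 0
    then show ?thesis using smooth_step_bounds by (intro exI[of _ 1]) (auto simp: d(1) abs_le_iff intro: order_trans[of _ 0])
  next
    case (Suc j)
    have "continuous_on {0..1} (d i)"
      using d(2) by (intro continuous_at_imp_continuous_on ballI) (auto intro: DERIV_isCont)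
    then have "bounded (d i ` {0..1})" by (intro compact_imp_bounded compact_continuous_image) auto
    then obtain K where K: "\<forall>x\<in>{0..1}. \<bar>d i x\<bar> \<le> K" by (auto simp: bounded_iff)
    have "\<bar>d i x\<bar> \<le> max K 0" for x
      using K[rule_format, of x] z[of j] Suc by (cases "x < 0"; cases "x > 1") auto
    then show ?thesis by blast
  qed
  then obtain K where K: "\<And>i x. \<bar>d i x\<bar> \<le> K i" by metis
  have z': "d i x = 0" if "i \<ge> 1" "x < 0 \<or> x > 1" for i x
    using z[of "i - 1"] that by auto
  show ?thesis by (rule that[of d K, OF d(1) d(2) K z'])
qed

section \<open>Measurability, and uniqueness of the function representing a distribution\<close>

lemma borel_measurable_lebesgueI:
  fixes f :: "real \<Rightarrow> 'b::topological_space"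
  shows "f \<in> borel_measurable borel \<Longrightarrow> f \<in> borel_measurable lebesgue"
  by (rule measurable_completion) (simp only: measurable_lborel2)

lemma continuous_imp_lebesgue:
  fixes f :: "real \<Rightarrow> 'b::topological_space"
  assumes "continuous_on UNIV f" shows "f \<in> borel_measurable lebesgue"
  by (intro borel_measurable_lebesgueI borel_measurable_continuous_onI assms)

lemma test_function_chain:
  assumes "\<phi> \<in> test_functions {0<..}"
  obtains d where "d 0 = \<phi>" "deriv_chain d UNIV"
  using assms unfolding test_functions_def smooth_iff_deriv_chain by blast

lemma test_function_continuous:
  assumes "\<phi> \<in> test_functions {0<..}" shows "continuous_on UNIV \<phi>"
proof -
  obtain d where "d 0 = \<phi>" "deriv_chain d UNIV" using test_function_chain[OF assms] by blast
  then show ?thesis using deriv_chain_continuous[of d UNIV 0] by simp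
qed

lemma test_function_measurable:
  assumes "\<phi> \<in> test_functions {0<..}" shows "\<phi> \<in> borel_measurable lebesgue"
  by (intro continuous_imp_lebesgue test_function_continuous assms)

text \<open>Dynkin's pi-lambda argument: lower half-lines are stable under intersection and generate
  the Borel sets, and the sets over which \<open>w\<close> integrates to zero are closed under
  complements and countable disjoint unions.\<close>

lemma integrals_zero_borel:
  fixes w :: "real \<Rightarrow> complex"
  assumes w: "integrable lebesgue w" and z: "\<And>a. (LINT x:{..a}|lebesgue. w x) = 0"
    and A: "A \<in> sets borel"
  shows "(LINT x:A|lebesgue. w x) = 0"
proof -
  have si: "set_integrable lebesgue B w" if "B \<in> sets lebesgue" for B
    using w that unfolding set_integrable_def by (rule integrable_mult_indicator[rotated])

  \<comment> \<open>The whole line is needed for complements; it is an increasing union of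
    half-lines.\<close>
  have UN: "(LINT x:UNIV|lebesgue. w x) = 0"
  proof -
    have "(\<lambda>n. LINT x:{..real n}|lebesgue. w x) \<longlonglongrightarrow> (LINT x:(\<Union>n. {..real n})|lebesgue. w x)"
      by (intro set_integral_cont_up si) (auto simp: incseq_def)
    moreover have "(\<Union>n. {..real n}) = UNIV" using real_arch_simple by auto
    ultimately have "(\<lambda>n::nat. 0) \<longlonglongrightarrow> (LINT x:UNIV|lebesgue. w x)" using z by simp
    then show ?thesis by (simp only: LIMSEQ_const_iff)
  qed
  have b: "sets borel = sigma_sets UNIV (range (\<lambda>a::real. {..a}))"
    unfolding borel_eq_atMost by simp
  have "Int_stable (range (\<lambda>a::real. {..a}))"
  proof (rule Int_stableI)
    fix A B :: "real set" assume "A \<in> range (\<lambda>a. {..a})" "B \<in> range (\<lambda>a. {..a})"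
    then obtain a b where "A = {..a}" "B = {..b}" by blast
    then have "A \<inter> B = {..min a b}" by auto
    then show "A \<inter> B \<in> range (\<lambda>a. {..a})" by blast
  qed
  moreover have "range (\<lambda>a::real. {..a}) \<subseteq> Pow UNIV" by simp
  ultimately show ?thesis
    using A unfolding b
  proof (induction rule: sigma_sets_induct_disjoint)
    case (basic A) then show ?case using z by auto
  next
    case empty show ?case by (simp add: set_lebesgue_integral_def)
  next
    case (compl A)
    have "A \<in> sets borel" using compl(1) unfolding b .
    then have "A \<in> sets lebesgue" by auto
    then have "(LINT x:A \<union> (UNIV - A)|lebesgue. w x) = (LINT x:A|lebesgue. w x) + (LINT x:UNIV - A|lebesgue. w x)"
      by (intro set_integral_Un si) auto
    then show ?case using compl UN by simp
  next
    case (union A)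
    have "range A \<subseteq> sets borel" using union(2) unfolding b .
    then have m: "A i \<in> sets lebesgue" for i by auto
    have "(LINT x:(\<Union>i. A i)|lebesgue. w x) = (\<Sum>i. (LINT x:(A i)|lebesgue. w x))"
      using union(1) by (intro lebesgue_integral_countable_add si m sets.countable_UN'') (auto simp: disjoint_family_on_def m)
    then show ?case using union(3) by simp
  qed
qed

text \<open>Integration over the set where \<open>w\<close> is positive. The one-sided form is
  applied to both signs of the real and imaginary parts.\<close>

lemma AE_zero_of_integrals_zero_real:
  fixes w :: "real \<Rightarrow> real"
  assumes w: "integrable lebesgue w" and z: "\<And>A. A \<in> sets lebesgue \<Longrightarrow> (LINT x:A|lebesgue. w x) \<le> 0"
  shows "AE x in lebesgue. w x \<le> 0"
proof -
  define A where "A = {x. w x > 0}"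
  have A: "A \<in> sets lebesgue"
    using borel_measurable_less[OF borel_measurable_const[of 0] borel_measurable_integrable[OF w]] by (simp add: A_def)
  have i: "integrable lebesgue (\<lambda>x. indicator A x * w x)"
    using integrable_mult_indicator[OF A w] by simp
  have nn: "AE x in lebesgue. 0 \<le> indicator A x * w x" by (auto simp: A_def indicator_def)
  have "(LINT x|lebesgue. indicator A x * w x) \<le> 0"
    using z[OF A] by (simp add: set_lebesgue_integral_def)
  then have "(LINT x|lebesgue. indicator A x * w x) = 0"
    using integral_nonneg_AE[OF nn] by linarith
  then have "AE x in lebesgue. indicator A x * w x = 0"
    using integral_nonneg_eq_0_iff_AE[OF i nn] by simp
  then show ?thesis by eventually_elim (auto simp: A_def indicator_def split: if_splits)
qed

text \<open>Every Lebesgue set differs from a Borel set by a null set, so the Borel case covers the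
  sets on which a component of \<open>w\<close> has a sign.\<close>

lemma AE_zero_of_halfline_integrals:
  fixes w :: "real \<Rightarrow> complex"
  assumes w: "integrable lebesgue w" and z: "\<And>a. (LINT x:{..a}|lebesgue. w x) = 0"
  shows "AE x in lebesgue. w x = 0"
proof -
  have zL: "(LINT x|lebesgue. indicator A x *\<^sub>R w x) = 0" if A: "A \<in> sets lebesgue" for A
  proof -
    obtain S N N' where S: "A = S \<union> N" "N \<subseteq> N'" "N' \<in> null_sets lborel" "S \<in> sets lborel"
      using A by (elim sets_completionE) auto
    have "AE x in lebesgue. x \<notin> N'" using S(3) by (intro AE_not_in) (simp add: null_sets_completionI)
    then have ae: "AE x in lebesgue. indicator A x *\<^sub>R w x = indicator S x *\<^sub>R w x"
      by eventually_elim (use S(1,2) in \<open>auto simp: indicator_def\<close>)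
    have "(LINT x|lebesgue. indicator A x *\<^sub>R w x) = (LINT x|lebesgue. indicator S x *\<^sub>R w x)"
    proof (rule integral_cong_AE)
      show "AE x in lebesgue. indicator A x *\<^sub>R w x = indicator S x *\<^sub>R w x" by (rule ae)
    next
      show "(\<lambda>x. indicator A x *\<^sub>R w x) \<in> borel_measurable lebesgue"
        using borel_measurable_integrable[OF w] A by measurable
      have "S \<in> sets lebesgue" using S(4) by auto
      then show "(\<lambda>x. indicator S x *\<^sub>R w x) \<in> borel_measurable lebesgue"
        using borel_measurable_integrable[OF w] by measurable
    qed
    then show ?thesis using integrals_zero_borel[OF w z, of S] S(4) by (simp add: set_lebesgue_integral_def)
  qed
  have iA: "integrable lebesgue (\<lambda>x. indicator A x *\<^sub>R w x)" if "A \<in> sets lebesgue" for A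
    using that w by (rule integrable_mult_indicator)
  have R: "(LINT x:A|lebesgue. Re (w x)) = 0" "(LINT x:A|lebesgue. Im (w x)) = 0" if "A \<in> sets lebesgue" for A
    using zL[OF that] integral_Re[OF iA[OF that]] integral_Im[OF iA[OF that]]
    by (auto simp: set_lebesgue_integral_def)
  have RI: "AE x in lebesgue. c * Re (w x) \<le> 0" "AE x in lebesgue. c * Im (w x) \<le> 0" for c
  proof -
    show "AE x in lebesgue. c * Re (w x) \<le> 0"
      by (rule AE_zero_of_integrals_zero_real) (use w R in auto)
    show "AE x in lebesgue. c * Im (w x) \<le> 0"
      by (rule AE_zero_of_integrals_zero_real) (use w R in auto)
  qed
  show ?thesis
    using RI(1)[of 1] RI(1)[of "-1"] RI(2)[of 1] RI(2)[of "-1"]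
    by eventually_elim (simp add: complex_eq_iff)
qed

text \<open>The ramps start inside the interval at its endpoints, so the support stays in
  \<open>{a..b}\<close> for every steepness \<open>m\<close>.\<close>

lemma smooth_window_test:
  assumes "0 < a" "a < b" "m > 0"
  shows "(\<lambda>x. of_real (smooth_step (m * x + (- m * a)) * smooth_step ((- m) * x + m * b))) \<in> test_functions {0<..}"
    (is "?f \<in> _")
proof -
  have "closure {x. ?f x \<noteq> 0} \<subseteq> {a..b}"
  proof (rule closure_minimal)
    show "{x. ?f x \<noteq> 0} \<subseteq> {a..b}"
    proof safe
      fix x assume x: "?f x \<noteq> 0"
      have "0 < m * x + (- m * a)" "0 < (- m) * x + m * b"
        using x smooth_step_0[of "m * x + (- m * a)"] smooth_step_0[of "(- m) * x + m * b"]
        by (auto simp flip: not_le)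
      then have "0 < m * (x - a)" "0 < m * (b - x)" by (auto simp: algebra_simps)
      then show "x \<in> {a..b}" using \<open>m > 0\<close> by (simp add: zero_less_mult_iff)
    qed
  qed auto
  moreover have "smooth ?f"
    by (intro smooth_alg_smooth smooth_alg.mult smooth_alg.affine smooth_step_alg)
  ultimately show ?thesis using assms unfolding test_functions_def
    by (auto simp: compact_eq_bounded_closed intro: bounded_subset[of "{a..b}"])
qed

lemma smooth_step_tendsto_1:
  assumes "y > 0" shows "(\<lambda>n. smooth_step (real (Suc n) * y)) \<longlonglongrightarrow> 1"
proof (rule tendsto_eventually)
  obtain N where "1 / y < real N" using reals_Archimedean2 by blast
  then have "1 \<le> real (Suc n) * y" if "n \<ge> N" for n
    using that assms by (simp add: field_simps) (smt (verit) mult_left_mono of_nat_mono)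
  then show "\<forall>\<^sub>F n in sequentially. smooth_step (real (Suc n) * y) = 1"
    by (intro eventually_sequentiallyI[of N] smooth_step_1)
qed

text \<open>The fundamental lemma of the calculus of variations on the half-line. It makes the
  choice inside \<open>spectrum_fun\<close> harmless: any explicitly constructed representative
  computes the norm.\<close>

lemma is_function_on_unique:
  assumes g: "is_function_on {0<..} T g" and h: "is_function_on {0<..} T h"
  shows "AE x in lebesgue. x > 0 \<longrightarrow> g x = h x"
proof -
  define w where "w x = g x - h x" for x
  have gs: "set_integrable lebesgue {a..b} g" "set_integrable lebesgue {a..b} h" if "0 < a" for a b
  proof -
    have "compact {a..b} \<and> {a..b} \<subseteq> {0<..}" using that by auto
    then show "set_integrable lebesgue {a..b} g" "set_integrable lebesgue {a..b} h"
      using g h unfolding is_function_on_def by blast+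
  qed
  have si: "set_integrable lebesgue {a..b} w" if "0 < a" for a b
    unfolding w_def using gs[OF that] by (intro set_integral_diff)
  have zero: "(LINT x:{a<..<b}|lebesgue. w x) = 0" if ab: "0 < a" "a < b" for a b
  proof -
    \<comment> \<open>Windows of steepness \<open>n + 1\<close> tend pointwise everywhere to the
      indicator of the open interval, because they vanish at the endpoints and outside.\<close>
    define \<phi> where "\<phi> n x = (of_real (smooth_step (real (Suc n) * x + (- real (Suc n) * a)) *
      smooth_step ((- real (Suc n)) * x + real (Suc n) * b)) :: complex)" for n x
    have test: "\<phi> n \<in> test_functions {0<..}" for n
      unfolding \<phi>_def by (rule smooth_window_test) (use ab in auto)
    have supp: "\<phi> n x = 0" if "x \<notin> {a<..<b}" for n x
    proof -
      have "real (Suc n) * (x - a) \<le> 0 \<or> real (Suc n) * (b - x) \<le> 0"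
        using that by (auto simp: mult_le_0_iff)
      then have "real (Suc n) * x + (- real (Suc n) * a) \<le> 0 \<or> (- real (Suc n)) * x + real (Suc n) * b \<le> 0"
        by (auto simp: algebra_simps)
      then show ?thesis unfolding \<phi>_def using smooth_step_0 by auto
    qed
    have bd: "cmod (\<phi> n x) \<le> 1" for n x
      unfolding \<phi>_def norm_of_real abs_mult using smooth_step_bounds by (intro mult_le_one) auto
    have lim: "(\<lambda>n. \<phi> n x) \<longlonglongrightarrow> indicator {a<..<b} x" for x
    proof (cases "x \<in> {a<..<b}")
      case True
      have "(\<lambda>n. complex_of_real (smooth_step (real (Suc n) * (x - a)) * smooth_step (real (Suc n) * (b - x)))) \<longlonglongrightarrow> of_real (1 * 1)"
        using True by (intro tendsto_of_real tendsto_mult smooth_step_tendsto_1) auto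
      moreover have "\<phi> n x = of_real (smooth_step (real (Suc n) * (x - a)) * smooth_step (real (Suc n) * (b - x)))" for n
        unfolding \<phi>_def by (simp add: algebra_simps)
      ultimately show ?thesis using True by simp
    qed (use supp in auto)
    have m\<phi>': "\<phi> n \<in> borel_measurable lebesgue" for n
      using test_function_measurable[OF test] .
    have z: "(LINT x|lebesgue. indicator {a..b} x *\<^sub>R w x * \<phi> n x) = 0" for n
    proof -
      have "(LINT x:{0<..}|lebesgue. g x * \<phi> n x) = (LINT x:{0<..}|lebesgue. h x * \<phi> n x)"
        using g h test unfolding is_function_on_def by metis
      moreover have "(LINT x:{0<..}|lebesgue. u x * \<phi> n x) = (LINT x|lebesgue. (indicator {a..b} x *\<^sub>R u x) * \<phi> n x)" for u
        unfolding set_lebesgue_integral_def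
        using supp[of _ n] ab by (intro Bochner_Integration.integral_cong) (force simp: indicator_def)+
      ultimately have eq: "(LINT x|lebesgue. (indicator {a..b} x *\<^sub>R g x) * \<phi> n x) =
          (LINT x|lebesgue. (indicator {a..b} x *\<^sub>R h x) * \<phi> n x)" by simp
      have i: "integrable lebesgue (\<lambda>x. (indicator {a..b} x *\<^sub>R u x) * \<phi> n x)"
        if "set_integrable lebesgue {a..b} u" for u
      proof (rule Bochner_Integration.integrable_bound[OF that[unfolded set_integrable_def]])
        show "(\<lambda>x. (indicator {a..b} x *\<^sub>R u x) * \<phi> n x) \<in> borel_measurable lebesgue"
          using borel_measurable_integrable[OF that[unfolded set_integrable_def]] m\<phi>'[of n]
          by (rule borel_measurable_times)
        show "AE x in lebesgue. norm ((indicator {a..b} x *\<^sub>R u x) * \<phi> n x) \<le> norm (indicator {a..b} x *\<^sub>R u x)"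
          unfolding norm_mult by (intro always_eventually allI mult_right_le_one_le bd norm_ge_zero)
      qed
      have "(LINT x|lebesgue. indicator {a..b} x *\<^sub>R w x * \<phi> n x) =
          (LINT x|lebesgue. (indicator {a..b} x *\<^sub>R g x) * \<phi> n x - (indicator {a..b} x *\<^sub>R h x) * \<phi> n x)"
        by (intro Bochner_Integration.integral_cong refl) (simp only: w_def scaleR_diff_right left_diff_distrib)
      also have "\<dots> = 0"
        using eq by (subst Bochner_Integration.integral_diff[OF i[OF gs(1)] i[OF gs(2)]]) (use ab in auto)
      finally show ?thesis .
    qed
    have "(\<lambda>n. LINT x|lebesgue. indicator {a..b} x *\<^sub>R w x * \<phi> n x) \<longlonglongrightarrow>
        (LINT x|lebesgue. indicator {a..b} x *\<^sub>R w x * indicator {a<..<b} x)"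
    proof (rule integral_dominated_convergence[where w="\<lambda>x. norm (indicator {a..b} x *\<^sub>R w x)"])
      show "integrable lebesgue (\<lambda>x. norm (indicator {a..b} x *\<^sub>R w x))"
        using si[OF ab(1), of b] unfolding set_integrable_def by (rule integrable_norm)
      have mw: "(\<lambda>x. indicator {a..b} x *\<^sub>R w x) \<in> borel_measurable lebesgue"
        using si[OF ab(1), of b] unfolding set_integrable_def by auto
      show "(\<lambda>x. indicator {a..b} x *\<^sub>R w x * indicator {a<..<b} x) \<in> borel_measurable lebesgue"
        by (intro borel_measurable_times mw borel_measurable_indicator) simp
      show "(\<lambda>x. indicator {a..b} x *\<^sub>R w x * \<phi> n x) \<in> borel_measurable lebesgue" for n
        by (intro borel_measurable_times mw m\<phi>')
      show "AE x in lebesgue. (\<lambda>n. indicator {a..b} x *\<^sub>R w x * \<phi> n x) \<longlonglongrightarrow> indicator {a..b} x *\<^sub>R w x * indicator {a<..<b} x"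
        by (intro always_eventually allI tendsto_mult tendsto_const lim)
      show "AE x in lebesgue. norm (indicator {a..b} x *\<^sub>R w x * \<phi> n x) \<le> norm (indicator {a..b} x *\<^sub>R w x)" for n
        unfolding norm_mult by (intro always_eventually allI mult_right_le_one_le bd norm_ge_zero)
    qed
    then have "(LINT x|lebesgue. indicator {a..b} x *\<^sub>R w x * indicator {a<..<b} x) = 0"
      unfolding z by (simp add: LIMSEQ_const_iff)
    moreover have "indicator {a..b} x *\<^sub>R w x * indicator {a<..<b} x = indicator {a<..<b} x *\<^sub>R w x" for x
      by (auto simp: indicator_def)
    ultimately show ?thesis by (simp add: set_lebesgue_integral_def)
  qed
  \<comment> \<open>Integrability is available only away from zero and infinity, so the half-line is
    exhausted by countably many intervals.\<close>
  have "AE x in lebesgue. indicator {1 / real (Suc m)<..<real (Suc m)} x *\<^sub>R w x = 0" for m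
  proof (rule AE_zero_of_halfline_integrals)
    define p q where "p = 1 / real (Suc m)" and "q = real (Suc m)"
    have pq: "0 < p" by (simp add: p_def)
    have "set_integrable lebesgue {p<..<q} w"
      by (rule set_integrable_subset[OF si[OF pq, of q]]) auto
    then show "integrable lebesgue (\<lambda>x. indicator {1 / real (Suc m)<..<real (Suc m)} x *\<^sub>R w x)"
      by (simp add: set_integrable_def p_def q_def)
    fix a
    have "(LINT x:{..a}|lebesgue. indicator {p<..<q} x *\<^sub>R w x) = (LINT x:{p<..<min a q}|lebesgue. w x)"
      unfolding set_lebesgue_integral_def
    proof (rule integral_cong_AE)
      have "AE x in lebesgue. x \<noteq> a"
        by (rule AE_I'[of "{a}"]) auto
      then show "AE x in lebesgue. indicator {..a} x *\<^sub>R indicator {p<..<q} x *\<^sub>R w x = indicator {p<..<min a q} x *\<^sub>R w x"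
        by eventually_elim (auto simp: indicator_def)
      have "(\<lambda>x. indicator {p<..<q} x *\<^sub>R w x) \<in> borel_measurable lebesgue"
        using \<open>set_integrable lebesgue {p<..<q} w\<close> unfolding set_integrable_def by auto
      then show "(\<lambda>x. indicator {..a} x *\<^sub>R indicator {p<..<q} x *\<^sub>R w x) \<in> borel_measurable lebesgue"
        by (rule borel_measurable_scaleR[rotated]) (auto intro!: borel_measurable_indicator)
      have "set_integrable lebesgue {p<..<min a q} w"
        by (rule set_integrable_subset[OF si[OF pq, of q]]) auto
      then show "(\<lambda>x. indicator {p<..<min a q} x *\<^sub>R w x) \<in> borel_measurable lebesgue"
        unfolding set_integrable_def by auto
    qed
    also have "\<dots> = 0"
      using zero[OF pq, of "min a q"] by (cases "p < min a q") (auto simp: set_lebesgue_integral_def)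
    finally show "(LINT x:{..a}|lebesgue. indicator {1 / real (Suc m)<..<real (Suc m)} x *\<^sub>R w x) = 0"
      by (simp add: p_def q_def)
  qed
  then have "AE x in lebesgue. \<forall>m. indicator {1 / real (Suc m)<..<real (Suc m)} x *\<^sub>R w x = 0"
    unfolding AE_all_countable by blast
  then show ?thesis
  proof eventually_elim
    case (elim x)
    show ?case
    proof
      assume x: "x > 0"
      obtain m where m: "max x (1 / x) < real m" using reals_Archimedean2 by blast
      then have "x < real (Suc m)" "1 / x < real (Suc m)" by auto
      then have "x \<in> {1 / real (Suc m)<..<real (Suc m)}" using x by (simp add: field_simps)
      then show "g x = h x" using elim[rule_format, of m] by (simp add: w_def indicator_def split: if_splits)
    qed
  qed
qed

section \<open>The Cayley transform and the MTC functions\<close>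

definition pole :: "real \<Rightarrow> real \<Rightarrow> complex" where
  "pole l x = of_real (l / 2) + \<i> * of_real x"

definition cay :: "real \<Rightarrow> real \<Rightarrow> complex" where
  "cay l x = 1 - of_real l / pole l x"

lemma Re_pole [simp]: "Re (pole l x) = l / 2" and Im_pole [simp]: "Im (pole l x) = x"
  by (simp_all add: pole_def)

lemma cmod_pole_sq: "(cmod (pole l x))\<^sup>2 = (l / 2)\<^sup>2 + x\<^sup>2"
  by (simp add: cmod_power2)

context
  fixes l :: real
  assumes l: "l > 0"
begin

lemma pole_nonzero: "pole l x \<noteq> 0"
  using l by (auto simp: complex_eq_iff)

lemma cmod_pole_pos: "cmod (pole l x) > 0"
  using pole_nonzero by simp

lemma cmod_pole_ge: "cmod (pole l x) \<ge> l / 2" "cmod (pole l x) \<ge> \<bar>x\<bar>"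
  using abs_Re_le_cmod[of "pole l x"] abs_Im_le_cmod[of "pole l x"] l by auto

lemma cay_eq_cnj: "cay l x = - cnj (pole l x) / pole l x"
proof -
  have *: "pole l x - of_real l = - cnj (pole l x)" by (simp add: complex_eq_iff)
  have "cay l x = (pole l x - of_real l) / pole l x"
    using pole_nonzero[of x] by (simp add: cay_def diff_divide_distrib)
  then show ?thesis by (simp only: *)
qed

lemma cmod_cay [simp]: "cmod (cay l x) = 1"
  using pole_nonzero[of x] by (simp add: cay_eq_cnj norm_divide)

lemma cay_nonzero [simp]: "cay l x \<noteq> 0"
  using cmod_cay[of x] by (metis norm_zero zero_neq_one)

lemma cnj_cay: "cnj (cay l x) = inverse (cay l x)"
  using cmod_cay[of x] by (simp add: inverse_eq_divide divide_conv_cnj)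

lemma cay_neq_1: "cay l x \<noteq> 1"
  using l pole_nonzero[of x] by (simp add: cay_def)

text \<open>Up to orientation and the factor \<open>l\<close>, the density \<open>1 / |P|^2\<close>
  is the pull-back of arc length on the circle. The identity trades the holomorphic
  \<open>1 / P^2\<close> for it at the price of one power of \<open>u\<close>.\<close>

lemma inverse_pole_sq: "1 / (pole l x)\<^sup>2 = - cay l x / of_real ((cmod (pole l x))\<^sup>2)"
proof -
  have "of_real ((cmod (pole l x))\<^sup>2) = pole l x * cnj (pole l x)" by (rule complex_norm_square)
  then show ?thesis using pole_nonzero[of x] by (simp add: cay_eq_cnj power2_eq_square)
qed

lemma inverse_cnj_pole: "1 / cnj (pole l x) = - inverse (cay l x) / pole l x"
  using pole_nonzero[of x] by (simp add: cay_eq_cnj)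

lemma cay_deriv: "(cay l has_vector_derivative \<i> * of_real l / (pole l x)\<^sup>2) (at x)"
proof -
  have "(pole l has_vector_derivative \<i>) (at x)"
    unfolding pole_def[abs_def] by (auto intro!: derivative_eq_intros)
  moreover have "((\<lambda>z. 1 - of_real l / z) has_field_derivative of_real l / (pole l x)\<^sup>2) (at (pole l x))"
    using pole_nonzero[of x] by (auto intro!: derivative_eq_intros simp: power2_eq_square)
  ultimately have "((\<lambda>z. 1 - of_real l / z) \<circ> pole l has_vector_derivative \<i> * (of_real l / (pole l x)\<^sup>2)) (at x)"
    by (rule field_vector_diff_chain_at)
  then show ?thesis by (simp add: o_def cay_def[abs_def])
qed

lemma continuous_pole: "continuous_on S (pole l)"
  unfolding pole_def[abs_def] by (intro continuous_intros)

lemma continuous_cay: "continuous_on S (cay l)"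
  unfolding cay_def[abs_def] using pole_nonzero by (intro continuous_intros continuous_pole) auto

lemma pole_measurable [measurable]: "pole l \<in> borel_measurable borel"
  by (intro borel_measurable_continuous_onI continuous_pole)

lemma cay_measurable [measurable]: "cay l \<in> borel_measurable borel"
  by (intro borel_measurable_continuous_onI continuous_cay)

lemma cay_tendsto: "(\<lambda>n. cay l (real n)) \<longlonglongrightarrow> 1" "(\<lambda>n. cay l (- real n)) \<longlonglongrightarrow> 1"
proof -
  have *: "(\<lambda>n. of_real l / pole l (c * real n)) \<longlonglongrightarrow> 0" if "\<bar>c\<bar> = 1" for c
  proof (rule Lim_null_comparison)
    show "(\<lambda>n. l * (1 / real n)) \<longlonglongrightarrow> 0"
      using tendsto_mult[OF tendsto_const lim_1_over_n, of l] by simp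
    show "\<forall>\<^sub>F n in sequentially. norm (of_real l / pole l (c * real n)) \<le> l * (1 / real n)"
      using eventually_gt_at_top[of 0]
    proof eventually_elim
      case (elim n)
      have "real n \<le> cmod (pole l (c * real n))" using cmod_pole_ge(2)[of "c * real n"] that by (simp add: abs_mult)
      then show ?case using l elim cmod_pole_pos[of "c * real n"] by (simp add: norm_divide frac_le)
    qed
  qed
  show "(\<lambda>n. cay l (real n)) \<longlonglongrightarrow> 1" "(\<lambda>n. cay l (- real n)) \<longlonglongrightarrow> 1"
    using tendsto_diff[OF tendsto_const *[of 1], of 1] tendsto_diff[OF tendsto_const *[of "-1"], of 1]
    by (simp_all add: cay_def)
qed

section \<open>The Poisson weight and the orthogonality of powers of the Cayley transform\<close>

lemma poisson_weight:
  "integrable lebesgue (\<lambda>x. 1 / (cmod (pole l x))\<^sup>2)"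
  "(LINT x|lebesgue. 1 / (cmod (pole l x))\<^sup>2) = 2 * pi / l"
proof -
  let ?f = "\<lambda>x. 1 / (cmod (pole l x))\<^sup>2"
  let ?F = "\<lambda>x. (2 / l) * arctan (2 * x / l)"
  have f_eq: "?f x = 1 / ((l / 2)\<^sup>2 + x\<^sup>2)" for x by (simp add: cmod_pole_sq)
  have pos: "(l / 2)\<^sup>2 + x\<^sup>2 > 0" for x using l by (intro add_pos_nonneg) auto
  have D: "(?F has_real_derivative ?f x) (at x)" for x
  proof -
    have "(?F has_real_derivative (2 / l) * (inverse (1 + (2 * x / l)\<^sup>2) * (2 / l))) (at x)"
      using l by (auto intro!: derivative_eq_intros)
    moreover have "(2 / l) * (inverse (1 + (2 * x / l)\<^sup>2) * (2 / l)) = ?f x"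
      using l pos[of x] unfolding f_eq by (simp add: field_simps power2_eq_square)
    ultimately show ?thesis by simp
  qed
  have cont: "isCont ?f x" for x
    unfolding f_eq[abs_def] using pos[of x] by (intro continuous_intros) auto
  have "LIM x at_top. (2 / l) * x :> at_top"
    using l by (intro filterlim_tendsto_pos_mult_at_top[OF tendsto_const] filterlim_ident) auto
  then have lin: "LIM x at_top. 2 * x / l :> at_top" by simp
  have top: "(?F \<longlongrightarrow> (2 / l) * (pi / 2)) at_top"
    by (intro tendsto_mult tendsto_const filterlim_compose[OF tendsto_arctan_at_top] lin)
  have bot: "(?F \<longlongrightarrow> (2 / l) * (- (pi / 2))) at_bot"
  proof -
    have "((\<lambda>x. - ?F (- x)) \<longlongrightarrow> - ((2 / l) * (pi / 2))) at_bot"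
      using filterlim_compose[OF top filterlim_uminus_at_top_at_bot] by (intro tendsto_minus)
    then show ?thesis by (simp add: arctan_minus)
  qed
  have 1: "set_integrable lborel (einterval (-\<infinity>) \<infinity>) ?f"
    and 2: "(LBINT x=-\<infinity>..\<infinity>. ?f x) = (2 / l) * (pi / 2) - (2 / l) * (- (pi / 2))"
    using D cont top bot
    by (intro interval_integral_FTC_nonneg[where F="?F"]; simp add: ereal_tendsto_simps)+
  have i: "integrable lborel ?f" using 1 by (simp add: set_integrable_def)
  then show "integrable lebesgue ?f" by (rule integrable_completion[THEN iffD2, rotated]) (use i in auto)
  have "(LINT x|lebesgue. ?f x) = (LINT x|lborel. ?f x)"
    by (rule integral_completion) (use i in auto)
  also have "\<dots> = (2 / l) * (pi / 2) - (2 / l) * (- (pi / 2))"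
    using 2 by (simp add: interval_lebesgue_integral_def set_lebesgue_integral_def)
  finally show "(LINT x|lebesgue. ?f x) = 2 * pi / l" using l by simp
qed

lemma cay_powi_integrable:
  "integrable lebesgue (\<lambda>x. cay l x powi m / of_real ((cmod (pole l x))\<^sup>2))"
proof (rule Bochner_Integration.integrable_bound[OF poisson_weight(1)])
  have "continuous_on UNIV (\<lambda>x. cay l x powi m / of_real ((cmod (pole l x))\<^sup>2))"
    using pole_nonzero by (intro continuous_intros continuous_cay continuous_pole) auto
  then show "(\<lambda>x. cay l x powi m / of_real ((cmod (pole l x))\<^sup>2)) \<in> borel_measurable lebesgue"
    by (rule continuous_imp_lebesgue)
qed (auto simp: norm_divide norm_power_int norm_power)

text \<open>For \<open>m \<noteq> 0\<close> the integrand has a primitive proportional to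
  \<open>u powi m\<close>, and \<open>u\<close> tends to 1 at both ends of the line.\<close>

lemma cay_powi_integral:
  "(LINT x|lebesgue. cay l x powi m / of_real ((cmod (pole l x))\<^sup>2)) = (if m = 0 then of_real (2 * pi / l) else 0)"
proof (cases "m = 0")
  case True
  have "(LINT x|lebesgue. complex_of_real (1 / (cmod (pole l x))\<^sup>2)) = of_real (2 * pi / l)"
    by (simp only: integral_complex_of_real poisson_weight(2))
  then show ?thesis using True by simp
next
  case False
  let ?f = "\<lambda>x. cay l x powi m / of_real ((cmod (pole l x))\<^sup>2)"
  let ?F = "\<lambda>x. cay l x powi m * (\<i> / (of_real l * of_int m))"
  have D: "(?F has_vector_derivative ?f x) (at x)" for x
  proof -
    have "((\<lambda>z. z powi m) has_field_derivative of_int m * cay l x powi (m - 1)) (at (cay l x))"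
      using DERIV_power_int[OF DERIV_ident, where n=m and x="cay l x" and s=UNIV] by simp
    from field_vector_diff_chain_at[OF cay_deriv this]
    have "((\<lambda>x. cay l x powi m) has_vector_derivative \<i> * of_real l / (pole l x)\<^sup>2 * (of_int m * cay l x powi (m - 1))) (at x)"
      by (simp add: o_def)
    from has_vector_derivative_mult_left[OF this, of "\<i> / (of_real l * of_int m)"]
    have "(?F has_vector_derivative \<i> * of_real l * (1 / (pole l x)\<^sup>2) * (of_int m * cay l x powi (m - 1)) * (\<i> / (of_real l * of_int m))) (at x)"
      by simp
    also have "\<i> * of_real l * (1 / (pole l x)\<^sup>2) * (of_int m * cay l x powi (m - 1)) * (\<i> / (of_real l * of_int m)) =
        - (1 / (pole l x)\<^sup>2) * cay l x powi (m - 1)"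
      using l False by (simp add: field_simps)
    also have "\<dots> = (cay l x * cay l x powi (m - 1)) / of_real ((cmod (pole l x))\<^sup>2)"
      unfolding inverse_pole_sq by simp
    also have "cay l x * cay l x powi (m - 1) = cay l x powi m"
      using power_int_add[of "cay l x" 1 "m - 1"] by simp
    finally show ?thesis .
  qed
  have cont: "continuous_on S ?f" for S
    using pole_nonzero by (intro continuous_intros continuous_cay continuous_pole) auto
  have "(\<lambda>n. LINT x:{- real n..real n}|lebesgue. ?f x) \<longlonglongrightarrow> (LINT x:(\<Union>n. {- real n..real n})|lebesgue. ?f x)"
  proof (intro set_integral_cont_up)
    show "incseq (\<lambda>n. {- real n..real n})" by (auto simp: incseq_def)
    have "(\<Union>n. {- real n..real n}) \<in> sets lebesgue" by (intro sets.countable_UN) auto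
    then show "set_integrable lebesgue (\<Union>n. {- real n..real n}) ?f"
      unfolding set_integrable_def using cay_powi_integrable by (intro integrable_mult_indicator)
  qed auto
  moreover have "(\<Union>n. {- real n..real n}) = UNIV"
  proof (intro UNIV_eq_I[symmetric] sym[OF UNIV_eq_I])
    fix x :: real obtain n where "\<bar>x\<bar> \<le> real n" using real_arch_simple by blast
    then show "x \<in> (\<Union>n. {- real n..real n})" by (auto simp: abs_le_iff intro!: exI[of _ n])
  qed
  moreover have "(LINT x:{- real n..real n}|lebesgue. ?f x) = ?F (real n) - ?F (- real n)" for n
  proof -
    have "(LINT x:{- real n..real n}|lebesgue. ?f x) = (LINT x|lborel. indicator {- real n..real n} x *\<^sub>R ?f x)"
      unfolding set_lebesgue_integral_def
    proof (rule integral_completion)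
      show "(\<lambda>x. indicator {- real n..real n} x *\<^sub>R ?f x) \<in> borel_measurable lborel"
        unfolding measurable_lborel2
        by (intro borel_measurable_scaleR borel_measurable_indicator borel_measurable_continuous_onI[OF cont]) simp
    qed
    also have "\<dots> = ?F (real n) - ?F (- real n)"
    proof (rule integral_FTC_Icc)
      show "(?F has_vector_derivative ?f x) (at x within {- real n..real n})" for x
        by (rule has_vector_derivative_at_within[OF D])
      show "continuous_on {- real n..real n} ?f" by (rule cont)
    qed simp
    finally show ?thesis .
  qed
  ultimately have "(\<lambda>n. ?F (real n) - ?F (- real n)) \<longlonglongrightarrow> (LINT x|lebesgue. ?f x)"
    by (simp add: set_lebesgue_integral_def)
  moreover have "(\<lambda>n. ?F (real n) - ?F (- real n)) \<longlonglongrightarrow>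
      1 powi m * (\<i> / (of_real l * of_int m)) - 1 powi m * (\<i> / (of_real l * of_int m))"
    by (intro tendsto_intros cay_tendsto) auto
  ultimately have "(LINT x|lebesgue. ?f x) = 0"
    using LIMSEQ_unique by fastforce
  then show ?thesis using False by simp
qed

text \<open>\<open>2 x - \<i> l = - 2 \<i> P\<close> and \<open>2 x + \<i> l = - 2 \<i> P u\<close>.
  The remaining factor \<open>\<i> / 2\<close> exchanges real and imaginary parts, hence the swap
  relative to the definition of \<open>mtc\<close>.\<close>

lemma mtc_even: "mtc l (2 * k) x = sqrt (l / pi) * Re (cay l x ^ k / pole l x)"
  and mtc_odd: "mtc l (Suc (2 * k)) x = - sqrt (l / pi) * Im (cay l x ^ k / pole l x)"
proof -
  have 1: "2 * of_real x - \<i> * of_real l = - 2 * \<i> * pole l x"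
    by (simp add: pole_def algebra_simps complex_eq_iff)
  have 2: "2 * of_real x + \<i> * of_real l = (- 2 * \<i> * pole l x) * cay l x"
    using pole_nonzero[of x] by (simp add: cay_eq_cnj complex_eq_iff)
  have "(2 * of_real x + \<i> * of_real l) ^ k / (2 * of_real x - \<i> * of_real l) ^ (k + 1) =
      cay l x ^ k / (- 2 * \<i> * pole l x)"
    unfolding 1 2 power_mult_distrib[of "- 2 * \<i> * pole l x"] using pole_nonzero[of x] by simp
  also have "\<dots> = (\<i> / 2) * (cay l x ^ k / pole l x)"
    using pole_nonzero[of x] by (simp add: field_simps)
  finally have *: "(2 * of_real x + \<i> * of_real l) ^ k / (2 * of_real x - \<i> * of_real l) ^ (k + 1) =
      (\<i> / 2) * (cay l x ^ k / pole l x)" .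
  have d: "Suc (2 * k) div 2 = k" by simp
  have p: "Re (\<i> / 2 * z) = - (Im z / 2)" "Im (\<i> / 2 * z) = Re z / 2" for z by simp_all
  show "mtc l (2 * k) x = sqrt (l / pi) * Re (cay l x ^ k / pole l x)"
    "mtc l (Suc (2 * k)) x = - sqrt (l / pi) * Im (cay l x ^ k / pole l x)"
    unfolding mtc_def Let_def d nonzero_mult_div_cancel_left[OF zero_neq_numeral[symmetric]] * p
    by simp_all
qed

text \<open>The only pole is at \<open>x = \<i> l / 2\<close>, so these functions belong to the
  Hardy space of the lower half-plane and their conjugates to that of the upper one.\<close>

definition hardy :: "nat \<Rightarrow> real \<Rightarrow> complex" where
  "hardy k x = cay l x ^ k / pole l x"

lemma hardy_continuous: "continuous_on S (hardy k)"
  unfolding hardy_def[abs_def] using pole_nonzero by (intro continuous_intros continuous_cay continuous_pole) auto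

lemma cmod_hardy: "cmod (hardy k x) = 1 / cmod (pole l x)"
  by (simp add: hardy_def norm_divide norm_power)

lemma hardy_sq_int: "sq_int lebesgue (hardy k)"
  unfolding sq_int_def using poisson_weight(1)
  by (auto simp: cmod_hardy power_divide intro: continuous_imp_lebesgue hardy_continuous)

lemma hardy_mult_cnj: "hardy j x * cnj (hardy k x) = cay l x powi (int j - int k) / of_real ((cmod (pole l x))\<^sup>2)"
  unfolding hardy_def complex_norm_square
  by (simp add: cnj_cay power_int_diff power_int_of_nat divide_inverse power_inverse)

text \<open>The exponent \<open>j + k + 1\<close> is never zero, which is why products without
  conjugation integrate to zero.\<close>

lemma hardy_mult: "hardy j x * hardy k x = - (cay l x powi (int (j + k + 1)) / of_real ((cmod (pole l x))\<^sup>2))"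
proof -
  have "hardy j x * hardy k x = cay l x ^ (j + k) * (1 / (pole l x)\<^sup>2)"
    by (simp add: hardy_def power_add power2_eq_square)
  then show ?thesis unfolding inverse_pole_sq power_int_of_nat by (simp add: mult_ac)
qed

text \<open>The conjugates supply exactly the exponents -1, -2, ..., so the two families together
  carry all integer powers of \<open>u\<close>.\<close>

lemma cnj_hardy: "cnj (hardy k x) = - (cay l x powi (- int (Suc k)) / pole l x)"
  using inverse_cnj_pole[of x]
  by (simp add: hardy_def cnj_cay power_int_minus power_inverse divide_inverse mult_ac del: of_nat_Suc)

lemma hardy_orthogonal:
  "(LINT x|lebesgue. hardy j x * cnj (hardy k x)) = (if j = k then of_real (2 * pi / l) else 0)"
  "(LINT x|lebesgue. hardy j x * hardy k x) = 0"
  unfolding hardy_mult_cnj hardy_mult by (auto simp only: cay_powi_integral integral_minus minus_zero split: if_splits)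

lemma mtc_hardy:
  "mtc l (2 * k) x = sqrt (l / pi) * Re (hardy k x)"
  "mtc l (Suc (2 * k)) x = - sqrt (l / pi) * Im (hardy k x)"
  by (simp_all add: hardy_def mtc_even mtc_odd)

lemma hardy_mtc:
  "hardy k x = of_real (sqrt (pi / l)) * (of_real (mtc l (2 * k) x) - \<i> * of_real (mtc l (Suc (2 * k)) x))"
proof -
  have "sqrt (pi / l) * sqrt (l / pi) = 1" using l by (simp flip: real_sqrt_mult)
  then have "sqrt (pi / l) * (sqrt (l / pi) * t) = t" for t by (simp flip: mult.assoc)
  then show ?thesis by (simp add: mtc_hardy complex_eq_iff)
qed

lemma mtc_continuous: "continuous_on S (mtc l j)"
proof -
  have "continuous_on S (mtc l (2 * k))" "continuous_on S (mtc l (Suc (2 * k)))" for k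
    unfolding mtc_hardy[abs_def] by (intro continuous_intros hardy_continuous)+
  then show ?thesis by (cases j rule: parity_cases) (auto elim!: evenE oddE)
qed

lemma mtc_sq_int: "sq_int lebesgue (\<lambda>x. of_real (mtc l j x))"
proof (rule sq_int_bound[OF hardy_sq_int[of 0], where C="sqrt (l / pi)"])
  show "(\<lambda>x. complex_of_real (mtc l j x)) \<in> borel_measurable lebesgue"
    by (intro continuous_imp_lebesgue continuous_intros mtc_continuous)
  have "\<bar>mtc l (2 * k) x\<bar> \<le> sqrt (l / pi) * cmod (hardy 0 x)"
    "\<bar>mtc l (Suc (2 * k)) x\<bar> \<le> sqrt (l / pi) * cmod (hardy 0 x)" for k x
    using abs_Re_le_cmod[of "hardy k x"] abs_Im_le_cmod[of "hardy k x"] l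
    by (simp_all only: mtc_hardy abs_mult abs_minus_cancel cmod_hardy) (auto intro!: mult_left_mono simp del: times_divide_eq_right)
  then show "AE x in lebesgue. cmod (complex_of_real (mtc l j x)) \<le> sqrt (l / pi) * cmod (hardy 0 x)"
    by (cases j rule: parity_cases) (auto elim!: evenE oddE)
qed

text \<open>Products of real and imaginary parts are combinations of the parts of
  \<open>z * cnj w\<close> and \<open>z * w\<close>, whose integrals are known; the parities of the
  two indices are treated separately.\<close>

lemma mtc_orthonormal: "(LINT x|lebesgue. mtc l i x * mtc l j x) = (if i = j then 1 else 0)"
proof -
  let ?c = "l / pi"
  have c: "sqrt ?c * sqrt ?c = ?c" using l by simp
  have I1: "integrable lebesgue (\<lambda>x. hardy a x * hardy b x)" for a b
    by (intro sq_int_mult hardy_sq_int)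
  have I2: "integrable lebesgue (\<lambda>x. hardy a x * cnj (hardy b x))" for a b
    by (intro sq_int_mult hardy_sq_int sq_int_cnj)
  have RR: "mtc l (2*a) x * mtc l (2*b) x = ?c / 2 * (Re (hardy a x * cnj (hardy b x)) + Re (hardy a x * hardy b x))"
    "mtc l (Suc (2*a)) x * mtc l (Suc (2*b)) x = ?c / 2 * (Re (hardy a x * cnj (hardy b x)) - Re (hardy a x * hardy b x))"
    "mtc l (2*a) x * mtc l (Suc (2*b)) x = ?c / 2 * (Im (hardy a x * cnj (hardy b x)) - Im (hardy a x * hardy b x))" for a b x
  proof -
    have *: "sqrt ?c * u * (sqrt ?c * v) = ?c * (u * v)" "sqrt ?c * u * (- sqrt ?c * v) = - (?c * (u * v))"
      "(- sqrt ?c * u) * (- sqrt ?c * v) = ?c * (u * v)" for u v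
      using c by (metis (no_types, lifting) mult.assoc mult.left_commute mult_minus_left mult_minus_right minus_minus)+
    show "mtc l (2*a) x * mtc l (2*b) x = ?c / 2 * (Re (hardy a x * cnj (hardy b x)) + Re (hardy a x * hardy b x))"
      "mtc l (Suc (2*a)) x * mtc l (Suc (2*b)) x = ?c / 2 * (Re (hardy a x * cnj (hardy b x)) - Re (hardy a x * hardy b x))"
      "mtc l (2*a) x * mtc l (Suc (2*b)) x = ?c / 2 * (Im (hardy a x * cnj (hardy b x)) - Im (hardy a x * hardy b x))"
      unfolding mtc_hardy * by (simp_all add: algebra_simps)
  qed
  have R: "(LINT x|lebesgue. Re (hardy a x * hardy b x)) = 0" "(LINT x|lebesgue. Im (hardy a x * hardy b x)) = 0"
    "(LINT x|lebesgue. Re (hardy a x * cnj (hardy b x))) = (if a = b then 2 * pi / l else 0)"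
    "(LINT x|lebesgue. Im (hardy a x * cnj (hardy b x))) = 0" for a b
    unfolding integral_Re[OF I1] integral_Im[OF I1] integral_Re[OF I2] integral_Im[OF I2] hardy_orthogonal
    by auto
  have J: "integrable lebesgue (\<lambda>x. Re (hardy a x * hardy b x))" "integrable lebesgue (\<lambda>x. Im (hardy a x * hardy b x))"
    "integrable lebesgue (\<lambda>x. Re (hardy a x * cnj (hardy b x)))" "integrable lebesgue (\<lambda>x. Im (hardy a x * cnj (hardy b x)))" for a b
    by (intro integrable_Re integrable_Im I1 I2)+
  have E: "(LINT x|lebesgue. mtc l (2*a) x * mtc l (2*b) x) = (if a = b then 1 else 0)"
    "(LINT x|lebesgue. mtc l (Suc (2*a)) x * mtc l (Suc (2*b)) x) = (if a = b then 1 else 0)"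
    "(LINT x|lebesgue. mtc l (2*a) x * mtc l (Suc (2*b)) x) = 0" for a b
    unfolding RR using l
    by (simp_all only: integral_mult_right_zero Bochner_Integration.integral_add[OF J(3) J(1)]
        Bochner_Integration.integral_diff[OF J(3) J(1)] Bochner_Integration.integral_diff[OF J(4) J(2)] R) auto
  have E': "(LINT x|lebesgue. mtc l (Suc (2*a)) x * mtc l (2*b) x) = 0" for a b
    using E(3)[of b a] by (simp add: mult.commute)
  obtain a where a: "i = 2 * a \<or> i = Suc (2 * a)" by (metis evenE oddE add.commute plus_1_eq_Suc)
  obtain b where b: "j = 2 * b \<or> j = Suc (2 * b)" by (metis evenE oddE add.commute plus_1_eq_Suc)
  have "2 * a \<noteq> Suc (2 * b)" "Suc (2 * a) \<noteq> 2 * b" by presburger+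
  with a b show ?thesis using E[of a b] E'[of a b] by (elim disjE) (auto simp only: split: if_splits)
qed

section \<open>Completeness of the MTC functions among square integrable functions\<close>

lemma cay_powi_times_integrable:
  assumes "integrable lebesgue \<nu>"
  shows "integrable lebesgue (\<lambda>x. \<nu> x * cay l x powi k)"
proof (rule Bochner_Integration.integrable_bound[OF assms])
  have "continuous_on UNIV (\<lambda>x. cay l x powi k)"
    by (intro continuous_intros continuous_cay) auto
  then show "(\<lambda>x. \<nu> x * cay l x powi k) \<in> borel_measurable lebesgue"
    by (intro borel_measurable_times[OF borel_measurable_integrable[OF assms]] continuous_imp_lebesgue)
qed (simp add: norm_mult norm_power_int)

text \<open>The induction runs over all densities \<open>\<nu>\<close>: multiplying
  \<open>\<nu>\<close> by a polynomial in \<open>u\<close> preserves orthogonality to every power,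
  which is what the product case needs. On the circle \<open>cnj u = 1 / u\<close>, so a linear
  factor merely shifts exponents.\<close>

lemma real_polynomial_cay_orthogonal:
  assumes "real_polynomial_function q" "integrable lebesgue \<nu>"
    "\<And>k. (LINT x|lebesgue. \<nu> x * cay l x powi k) = 0"
  shows "integrable lebesgue (\<lambda>x. \<nu> x * of_real (q (cay l x)))
    \<and> (\<forall>k. (LINT x|lebesgue. \<nu> x * of_real (q (cay l x)) * cay l x powi k) = 0)"
  using assms
proof (induction arbitrary: \<nu> rule: real_polynomial_function.induct)
  case (linear f)
  interpret f: bounded_linear f by fact
  define A B where "A = (of_real (f 1) - \<i> * of_real (f \<i>)) / 2" and "B = (of_real (f 1) + \<i> * of_real (f \<i>)) / 2"
  have f_eq: "of_real (f z) = A * z + B * cnj z" for z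
  proof -
    have "z = Re z *\<^sub>R 1 + Im z *\<^sub>R \<i>" by (simp add: complex_eq_iff)
    then have "f z = f (Re z *\<^sub>R 1 + Im z *\<^sub>R \<i>)" by (rule arg_cong)
    also have "\<dots> = Re z * f 1 + Im z * f \<i>" by (simp only: f.add f.scaleR real_scaleR_def)
    finally show ?thesis unfolding A_def B_def by (simp add: complex_eq_iff field_simps)
  qed
  have e: "\<nu> x * of_real (f (cay l x)) * cay l x powi k =
      A * (\<nu> x * cay l x powi (k + 1)) + B * (\<nu> x * cay l x powi (k - 1))" for x k
    unfolding f_eq by (simp add: cnj_cay power_int_add power_int_diff field_simps)
  have I: "integrable lebesgue (\<lambda>x. \<nu> x * of_real (f (cay l x)) * cay l x powi k)" for k
    unfolding e by (intro Bochner_Integration.integrable_add integrable_mult_right cay_powi_times_integrable linear)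
  have "(LINT x|lebesgue. \<nu> x * of_real (f (cay l x)) * cay l x powi k) = 0" for k
    unfolding e using linear
    by (subst Bochner_Integration.integral_add) (auto intro!: cay_powi_times_integrable)
  then show ?case using I[of 0] by simp
next
  case (const c)
  have "(LINT x|lebesgue. \<nu> x * of_real c * cay l x powi k) = of_real c * (LINT x|lebesgue. \<nu> x * cay l x powi k)" for k
    by (subst integral_mult_right_zero[symmetric]) (simp add: mult_ac)
  then show ?case using const by simp
next
  case (add f g)
  have 1: "integrable lebesgue (\<lambda>x. \<nu> x * of_real (f (cay l x)))" "\<And>k. (LINT x|lebesgue. \<nu> x * of_real (f (cay l x)) * cay l x powi k) = 0"
    using add.IH(1)[OF add.prems] by auto
  have 2: "integrable lebesgue (\<lambda>x. \<nu> x * of_real (g (cay l x)))" "\<And>k. (LINT x|lebesgue. \<nu> x * of_real (g (cay l x)) * cay l x powi k) = 0"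
    using add.IH(2)[OF add.prems] by auto
  have "(LINT x|lebesgue. \<nu> x * of_real (f (cay l x)) * cay l x powi k + \<nu> x * of_real (g (cay l x)) * cay l x powi k) = 0" for k
    by (subst Bochner_Integration.integral_add) (simp_all add: 1 2 cay_powi_times_integrable)
  moreover have "integrable lebesgue (\<lambda>x. \<nu> x * of_real (f (cay l x)) + \<nu> x * of_real (g (cay l x)))"
    by (intro Bochner_Integration.integrable_add 1 2)
  ultimately show ?case by (simp add: algebra_simps)
next
  case (mult f g)
  have 1: "integrable lebesgue (\<lambda>x. \<nu> x * of_real (f (cay l x)))" "\<And>k. (LINT x|lebesgue. \<nu> x * of_real (f (cay l x)) * cay l x powi k) = 0"
    using mult.IH(1)[OF mult.prems] by auto
  show ?case using mult.IH(2)[OF 1] by (simp add: mult.assoc)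
qed

text \<open>Weierstrass approximation on the compact circle; the error is controlled by the integral
  of \<open>|\<nu>|\<close>.\<close>

lemma continuous_cay_orthogonal:
  fixes h :: "complex \<Rightarrow> real"
  assumes "continuous_on (sphere 0 1) h" "integrable lebesgue \<nu>"
    and z: "\<And>k. (LINT x|lebesgue. \<nu> x * cay l x powi k) = 0"
  shows "(LINT x|lebesgue. \<nu> x * of_real (h (cay l x))) = 0"
proof -
  have conth: "continuous_on UNIV (\<lambda>x. h (cay l x))"
    by (rule continuous_on_compose2[OF assms(1) continuous_cay]) auto
  have mh: "(\<lambda>x. \<nu> x * of_real (h (cay l x))) \<in> borel_measurable lebesgue"
    by (intro borel_measurable_times[OF borel_measurable_integrable[OF assms(2)]] continuous_imp_lebesgue
        continuous_on_of_real conth)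
  define I where "I = (LINT x|lebesgue. cmod (\<nu> x))"
  have "cmod (LINT x|lebesgue. \<nu> x * of_real (h (cay l x))) \<le> e * I" if e: "e > 0" for e
  proof -
    obtain q where q: "real_polynomial_function q" "\<And>z. z \<in> sphere 0 1 \<Longrightarrow> \<bar>h z - q z\<bar> < e"
      using Stone_Weierstrass_real_polynomial_function[OF compact_sphere assms(1) e] by blast
    have Q: "integrable lebesgue (\<lambda>x. \<nu> x * of_real (q (cay l x)))" "(LINT x|lebesgue. \<nu> x * of_real (q (cay l x))) = 0"
      using real_polynomial_cay_orthogonal[OF q(1) assms(2) z] by (auto dest: spec[of _ 0])
    have le: "cmod (\<nu> x * of_real (h (cay l x)) - \<nu> x * of_real (q (cay l x))) \<le> e * cmod (\<nu> x)" for x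
    proof -
      have "\<bar>h (cay l x) - q (cay l x)\<bar> \<le> e" using q(2)[of "cay l x"] by simp
      then have "cmod (\<nu> x) * \<bar>h (cay l x) - q (cay l x)\<bar> \<le> cmod (\<nu> x) * e" by (intro mult_left_mono) auto
      then show ?thesis by (simp add: norm_mult mult.commute flip: right_diff_distrib of_real_diff)
    qed
    have int: "integrable lebesgue (\<lambda>x. \<nu> x * of_real (h (cay l x)) - \<nu> x * of_real (q (cay l x)))"
    proof (rule Bochner_Integration.integrable_bound[where f="\<lambda>x. e * cmod (\<nu> x)"])
      show "(\<lambda>x. \<nu> x * of_real (h (cay l x)) - \<nu> x * of_real (q (cay l x))) \<in> borel_measurable lebesgue"
        by (intro borel_measurable_diff mh borel_measurable_integrable[OF Q(1)])
    qed (use le assms(2) e in \<open>auto simp: abs_mult\<close>)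
    have "cmod (LINT x|lebesgue. \<nu> x * of_real (h (cay l x)) - \<nu> x * of_real (q (cay l x))) \<le> (LINT x|lebesgue. e * cmod (\<nu> x))"
    proof (rule order_trans[OF integral_norm_bound])
      show "(LINT x|lebesgue. norm (\<nu> x * of_real (h (cay l x)) - \<nu> x * of_real (q (cay l x)))) \<le> (LINT x|lebesgue. e * cmod (\<nu> x))"
        using assms(2) by (intro integral_mono integrable_norm[OF int] le) auto
    qed
    moreover have "(LINT x|lebesgue. \<nu> x * of_real (h (cay l x)) - \<nu> x * of_real (q (cay l x))) = (LINT x|lebesgue. \<nu> x * of_real (h (cay l x)))"
      using Bochner_Integration.integral_diff[OF Bochner_Integration.integrable_add[OF int Q(1)] Q(1)] Q(2) by simp
    ultimately show ?thesis by (simp add: I_def)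
  qed
  moreover have "I \<ge> 0" by (simp add: I_def)
  ultimately have "cmod (LINT x|lebesgue. \<nu> x * of_real (h (cay l x))) \<le> e" if "e > 0" for e
  proof -
    have "cmod (LINT x|lebesgue. \<nu> x * of_real (h (cay l x))) \<le> e / (I + 1) * I"
      using \<open>\<And>e. e > 0 \<Longrightarrow> _ \<le> e * I\<close>[of "e / (I + 1)"] that \<open>I \<ge> 0\<close> by simp
    also have "\<dots> \<le> e" using that \<open>I \<ge> 0\<close> by (simp add: field_simps)
    finally show ?thesis .
  qed
  then show ?thesis using field_le_epsilon[of "cmod (LINT x|lebesgue. \<nu> x * of_real (h (cay l x)))" 0] by simp
qed

text \<open>The left side is continuous on the whole circle, the point 1 included, and its sign
  decides whether \<open>x\<close> exceeds \<open>a\<close>. This lets half-lines be approximated by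
  continuous functions of \<open>u\<close>.\<close>

lemma cay_halfline: "l / 2 * Im (cay l x) - a * (1 - Re (cay l x)) = (l\<^sup>2 / 2) * (x - a) / (cmod (pole l x))\<^sup>2"
proof -
  have "1 - cay l x = of_real l * cnj (pole l x) / of_real ((cmod (pole l x))\<^sup>2)"
    unfolding complex_norm_square using pole_nonzero[of x] by (simp add: cay_def)
  then have *: "1 - cay l x = of_real (l / (cmod (pole l x))\<^sup>2) * cnj (pole l x)" by simp
  from arg_cong[OF *, of Re] arg_cong[OF *, of Im]
  have "1 - Re (cay l x) = l / (cmod (pole l x))\<^sup>2 * (l / 2)" "Im (cay l x) = l / (cmod (pole l x))\<^sup>2 * x"
    by simp_all
  then have "l / 2 * Im (cay l x) - a * (1 - Re (cay l x)) =
      l / 2 * (l / (cmod (pole l x))\<^sup>2 * x) - a * (l / (cmod (pole l x))\<^sup>2 * (l / 2))"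
    by (simp only:)
  also have "\<dots> = (l\<^sup>2 / 2) * (x - a) / (cmod (pole l x))\<^sup>2"
    using cmod_pole_pos[of x] by (simp add: power2_eq_square field_simps)
  finally show ?thesis .
qed

text \<open>The density \<open>d / P\<close> is integrable as a product of square integrable
  functions, and all its Fourier coefficients on the circle vanish; hence it integrates to zero over
  every half-line.\<close>

lemma hardy_complete:
  assumes d: "sq_int lebesgue d"
    and z: "\<And>k. (LINT x|lebesgue. d x * hardy k x) = 0" "\<And>k. (LINT x|lebesgue. d x * cnj (hardy k x)) = 0"
  shows "AE x in lebesgue. d x = 0"
proof -
  define \<mu> where "\<mu> x = d x / pole l x" for x
  have \<mu>_eq: "\<mu> x = d x * hardy 0 x" for x by (simp add: \<mu>_def hardy_def)
  have \<mu>: "integrable lebesgue \<mu>" unfolding \<mu>_eq[abs_def] by (intro sq_int_mult d hardy_sq_int)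
  have zk: "(LINT x|lebesgue. \<mu> x * cay l x powi k) = 0" for k
  proof (cases k rule: int_cases)
    case (nonneg n)
    have "\<mu> x * cay l x powi k = d x * hardy n x" for x by (simp add: nonneg \<mu>_def hardy_def power_int_of_nat)
    then show ?thesis using z(1) by simp
  next
    case (neg n)
    have "\<mu> x * cay l x powi k = - (d x * cnj (hardy n x))" for x unfolding cnj_hardy neg \<mu>_def by simp
    then show ?thesis using z(2) by simp
  qed
  have "AE x in lebesgue. \<mu> x = 0"
  proof (rule AE_zero_of_halfline_integrals[OF \<mu>])
    fix a
    define G where "G z = l / 2 * Im z - a * (1 - Re z)" for z
    \<comment> \<open>Equal to 1 where \<open>G \<le> 0\<close> and eventually 0 where
      \<open>G > 0\<close>: continuous functions decreasing to the indicator of the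
      half-line.\<close>
    define h where "h n z = max 0 (1 - real n * max 0 (G z))" for n z
    have hc: "continuous_on S (h n)" for S n unfolding h_def[abs_def] G_def by (intro continuous_intros)
    have h1: "0 \<le> h n z" "h n z \<le> 1" for n z unfolding h_def by auto
    have "(\<lambda>n. LINT x|lebesgue. \<mu> x * of_real (h n (cay l x))) \<longlonglongrightarrow> (LINT x|lebesgue. \<mu> x * indicator {..a} x)"
    proof (rule integral_dominated_convergence[where w="\<lambda>x. cmod (\<mu> x)"])
      show "(\<lambda>x. \<mu> x * indicator {..a} x) \<in> borel_measurable lebesgue"
        using \<mu> by (intro borel_measurable_times borel_measurable_indicator) auto
      show "(\<lambda>x. \<mu> x * of_real (h n (cay l x))) \<in> borel_measurable lebesgue" for n
        by (intro borel_measurable_times[OF borel_measurable_integrable[OF \<mu>]] continuous_imp_lebesgue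
            continuous_on_of_real continuous_on_compose2[OF hc continuous_cay]) auto
      show "AE x in lebesgue. norm (\<mu> x * of_real (h n (cay l x))) \<le> cmod (\<mu> x)" for n
        using h1[of n] by (auto simp: norm_mult intro!: mult_right_le_one_le)
      have "(\<lambda>n. h n (cay l x)) \<longlonglongrightarrow> indicator {..a} x" for x
      proof (cases "x \<le> a")
        case True
        have "G (cay l x) \<le> 0" unfolding G_def cay_halfline using True
          by (intro divide_nonpos_nonneg mult_nonneg_nonpos) auto
        then show ?thesis using True by (simp add: h_def)
      next
        case False
        have G: "G (cay l x) > 0" unfolding G_def cay_halfline using False l pole_nonzero[of x] by simp
        obtain N where N: "1 / G (cay l x) < real N" using reals_Archimedean2 by blast
        have "h n (cay l x) = 0" if "n \<ge> N" for n
        proof -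
          have "1 / G (cay l x) \<le> real n" using N that by linarith
          then have "1 \<le> real n * G (cay l x)" using G by (simp add: field_simps)
          then show ?thesis using G by (simp add: h_def)
        qed
        then have "\<forall>\<^sub>F n in sequentially. h n (cay l x) = 0" by (intro eventually_sequentiallyI)
        then show ?thesis using False by (simp add: tendsto_eventually)
      qed
      then have "(\<lambda>n. \<mu> x * of_real (h n (cay l x))) \<longlonglongrightarrow> \<mu> x * of_real (indicator {..a} x)" for x
        by (intro tendsto_intros)
      then show "AE x in lebesgue. (\<lambda>n. \<mu> x * of_real (h n (cay l x))) \<longlonglongrightarrow> \<mu> x * indicator {..a} x"
        by (simp add: of_real_indicator)
    qed (use \<mu> in auto)
    moreover have "(LINT x|lebesgue. \<mu> x * of_real (h n (cay l x))) = 0" for n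
      by (rule continuous_cay_orthogonal[OF hc \<mu> zk])
    ultimately have "(LINT x|lebesgue. \<mu> x * indicator {..a} x) = 0" by (simp add: LIMSEQ_const_iff)
    then show "(LINT x:{..a}|lebesgue. \<mu> x) = 0"
      unfolding set_lebesgue_integral_def by (simp add: scaleR_conv_of_real of_real_indicator mult.commute)
  qed
  then show ?thesis by eventually_elim (use pole_nonzero in \<open>simp add: \<mu>_def\<close>)
qed

definition mtc_coeff :: "(real \<Rightarrow> real) \<Rightarrow> nat \<Rightarrow> real" where
  "mtc_coeff f j = (LINT y|lebesgue. f y * mtc l j y)"

lemma mtc_proj_eq: "mtc_proj l n f x = (\<Sum>k\<le>n. mtc_coeff f k * mtc l k x)"
  by (simp add: mtc_proj_def mtc_coeff_def)

lemma mtc_coeff_complex: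
  assumes f: "sq_int lebesgue (\<lambda>x. of_real (f x))"
  shows "(LINT x|lebesgue. of_real (f x) * of_real (mtc l j x)) = complex_of_real (mtc_coeff f j)"
  unfolding mtc_coeff_def by (simp only: of_real_mult[symmetric] integral_complex_of_real)

lemma mtc_sum_sq_norm: "sq_norm lebesgue (\<lambda>x. \<Sum>j\<in>J. d j * of_real (mtc l j x)) = (\<Sum>j\<in>J. (cmod (d j))\<^sup>2)"
  using sq_norm_orthogonal_sum[of lebesgue "mtc l" "\<lambda>_. 1" d J] mtc_sq_int mtc_orthonormal by simp

lemma mtc_proj_sq_int: "sq_int lebesgue (\<lambda>x. of_real (mtc_proj l n f x))"
  unfolding mtc_proj_eq of_real_sum of_real_mult by (intro sq_int_sum sq_int_scale mtc_sq_int)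

lemma mtc_coeff_bessel:
  assumes f: "sq_int lebesgue (\<lambda>x. of_real (f x))"
  shows "(\<Sum>j<n. (mtc_coeff f j)\<^sup>2) \<le> sq_norm lebesgue (\<lambda>x. of_real (f x))"
  using bessel_inequality[of lebesgue "mtc l" "\<lambda>x. of_real (f x)" "\<lambda>_. 1" "{..<n}"] f mtc_sq_int mtc_orthonormal
  by (simp add: mtc_coeff_complex)

lemma mtc_coeff_summable:
  assumes f: "sq_int lebesgue (\<lambda>x. of_real (f x))"
  shows "summable (\<lambda>j. (mtc_coeff f j)\<^sup>2)"
  by (rule summableI_nonneg_bounded) (auto intro: mtc_coeff_bessel[OF f])

text \<open>Bessel's inequality makes the partial sums Cauchy. Their limit has the same coefficients
  as \<open>f\<close>, so completeness identifies it with \<open>f\<close>.\<close>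

lemma mtc_proj_tendsto:
  assumes f: "sq_int lebesgue (\<lambda>x. of_real (f x))"
  shows "(\<lambda>n. sq_norm lebesgue (\<lambda>x. of_real (mtc_proj l n f x) - of_real (f x))) \<longlonglongrightarrow> 0"
proof -
  define S where "S n x = complex_of_real (mtc_proj l n f x)" for n x
  have S: "sq_int lebesgue (S n)" for n unfolding S_def by (rule mtc_proj_sq_int)
  have S_eq: "S n x = (\<Sum>j\<le>n. of_real (mtc_coeff f j) * of_real (mtc l j x))" for n x
    by (simp add: S_def mtc_proj_eq)
  let ?a = "\<lambda>j. (mtc_coeff f j)\<^sup>2"
  have diff: "sq_norm lebesgue (\<lambda>x. S m x - S n x) = (\<Sum>j\<in>{n<..m}. ?a j)" if "n \<le> m" for m n
  proof -
    have "S m x - S n x = (\<Sum>j\<in>{n<..m}. of_real (mtc_coeff f j) * of_real (mtc l j x))" for x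
    proof -
      have "{..m} = {..n} \<union> {n<..m}" using that by auto
      moreover have "{..n} \<inter> {n<..m} = {}" by auto
      ultimately show ?thesis unfolding S_eq by (simp only: sum.union_disjoint finite_atMost finite_greaterThanAtMost) simp
    qed
    then show ?thesis using mtc_sum_sq_norm[of "\<lambda>j. of_real (mtc_coeff f j)" "{n<..m}"] by simp
  qed
  have comm: "sq_norm lebesgue (\<lambda>x. S m x - S n x) = sq_norm lebesgue (\<lambda>x. S n x - S m x)" for m n
    by (simp add: sq_norm_def norm_minus_commute)
  have "\<exists>N. \<forall>m\<ge>N. \<forall>n\<ge>N. sq_norm lebesgue (\<lambda>x. S m x - S n x) \<le> e" if e: "e > 0" for e
  proof -
    obtain N where N: "\<And>m n. m \<ge> N \<Longrightarrow> norm (sum ?a {m..<n}) < e"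
      using mtc_coeff_summable[OF f] e unfolding summable_Cauchy by blast
    have *: "sq_norm lebesgue (\<lambda>x. S m x - S n x) \<le> e" if "N \<le> n" "n \<le> m" for m n
    proof -
      have "{n<..m} = {Suc n..<Suc m}" by auto
      then show ?thesis using N[of "Suc n" "Suc m"] diff[OF that(2)] that(1) by simp
    qed
    have "sq_norm lebesgue (\<lambda>x. S m x - S n x) \<le> e" if "N \<le> n" "N \<le> m" for m n
      using *[of n m] *[of m n] comm[of m n] that by (cases "n \<le> m") auto
    then show ?thesis by blast
  qed
  from riesz_fischer[OF S this] obtain F where F: "sq_int lebesgue F" "(\<lambda>n. sq_norm lebesgue (\<lambda>x. S n x - F x)) \<longlonglongrightarrow> 0"
    by blast
  define d where "d x = of_real (f x) - F x" for x
  have d: "sq_int lebesgue d" unfolding d_def by (intro sq_int_diff f F)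
  have Sj: "(LINT x|lebesgue. S n x * of_real (mtc l j x)) = of_real (mtc_coeff f j)" if "n \<ge> j" for n j
  proof -
    have "(LINT x|lebesgue. S n x * of_real (mtc l j x)) =
        (LINT x|lebesgue. complex_of_real (\<Sum>i\<le>n. mtc_coeff f i * (mtc l i x * mtc l j x)))"
      by (simp add: S_eq sum_distrib_right mult.assoc)
    also have "\<dots> = of_real (LINT x|lebesgue. (\<Sum>i\<le>n. mtc_coeff f i * (mtc l i x * mtc l j x)))"
      by (rule integral_complex_of_real)
    also have "(LINT x|lebesgue. (\<Sum>i\<le>n. mtc_coeff f i * (mtc l i x * mtc l j x))) =
        (\<Sum>i\<le>n. mtc_coeff f i * (LINT x|lebesgue. mtc l i x * mtc l j x))"
    proof -
      have "integrable lebesgue (\<lambda>x. mtc l i x * mtc l j x)" for i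
        using integrable_Re[OF sq_int_mult[OF mtc_sq_int mtc_sq_int, of i j]] by simp
      then show ?thesis by (simp add: Bochner_Integration.integral_sum)
    qed
    also have "\<dots> = mtc_coeff f j" using that
      by (simp add: mtc_orthonormal if_distrib[where f="\<lambda>z. _ * z"] sum.delta cong: if_cong)
    finally show ?thesis .
  qed
  have dj: "(LINT x|lebesgue. d x * of_real (mtc l j x)) = 0" for j
  proof -
    have "(\<lambda>n. LINT x|lebesgue. S n x * of_real (mtc l j x)) \<longlonglongrightarrow> (LINT x|lebesgue. F x * of_real (mtc l j x))"
      by (rule sq_norm_tendsto_integral[OF S F(1) mtc_sq_int F(2)])
    moreover have "\<forall>\<^sub>F n in sequentially. (LINT x|lebesgue. S n x * of_real (mtc l j x)) = of_real (mtc_coeff f j)"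
      using Sj by (intro eventually_sequentiallyI[of j])
    ultimately have "(LINT x|lebesgue. F x * of_real (mtc l j x)) = of_real (mtc_coeff f j)"
      by (rule LIMSEQ_unique[OF _ tendsto_eventually])
    then show ?thesis
      unfolding d_def left_diff_distrib
        Bochner_Integration.integral_diff[OF sq_int_mult[OF f mtc_sq_int] sq_int_mult[OF F(1) mtc_sq_int]]
      by (simp only: mtc_coeff_complex[OF f] diff_self)
  qed
  have "AE x in lebesgue. d x = 0"
  proof (rule hardy_complete[OF d])
    fix k
    have i: "integrable lebesgue (\<lambda>x. d x * of_real (mtc l j x))" for j by (intro sq_int_mult d mtc_sq_int)
    have "d x * hardy k x = of_real (sqrt (pi / l)) * (d x * of_real (mtc l (2 * k) x) - \<i> * (d x * of_real (mtc l (Suc (2 * k)) x)))" for x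
      unfolding hardy_mtc by (simp add: algebra_simps)
    then have "(LINT x|lebesgue. d x * hardy k x) = of_real (sqrt (pi / l)) *
        ((LINT x|lebesgue. d x * of_real (mtc l (2 * k) x)) - \<i> * (LINT x|lebesgue. d x * of_real (mtc l (Suc (2 * k)) x)))"
      by (simp only: integral_mult_right_zero Bochner_Integration.integral_diff[OF i integrable_mult_right[OF i]])
    then show "(LINT x|lebesgue. d x * hardy k x) = 0" by (simp only: dj) simp
    have "d x * cnj (hardy k x) = of_real (sqrt (pi / l)) * (d x * of_real (mtc l (2 * k) x) + \<i> * (d x * of_real (mtc l (Suc (2 * k)) x)))" for x
      unfolding hardy_mtc by (simp add: algebra_simps)
    then have "(LINT x|lebesgue. d x * cnj (hardy k x)) = of_real (sqrt (pi / l)) *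
        ((LINT x|lebesgue. d x * of_real (mtc l (2 * k) x)) + \<i> * (LINT x|lebesgue. d x * of_real (mtc l (Suc (2 * k)) x)))"
      by (simp only: integral_mult_right_zero Bochner_Integration.integral_add[OF i integrable_mult_right[OF i]])
    then show "(LINT x|lebesgue. d x * cnj (hardy k x)) = 0" by (simp only: dj) simp
  qed
  then have "sq_norm lebesgue (\<lambda>x. S n x - of_real (f x)) = sq_norm lebesgue (\<lambda>x. S n x - F x)" for n
    unfolding sq_norm_def
  proof (intro integral_cong_AE)
    show "(\<lambda>x. (cmod (S n x - of_real (f x)))\<^sup>2) \<in> borel_measurable lebesgue"
      using sq_int_diff(1)[OF S f, of n] by (auto simp: sq_int_def)
    show "(\<lambda>x. (cmod (S n x - F x))\<^sup>2) \<in> borel_measurable lebesgue"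
      using sq_int_diff(1)[OF S F(1), of n] by (auto simp: sq_int_def)
  qed (auto simp: d_def elim!: eventually_mono)
  with F(2) show ?thesis by (simp add: S_def)
qed

end

section \<open>Binomial coefficients and Laguerre polynomials\<close>

text \<open>Fubini for absolutely summable double series, with rows on one side and diagonals on the
  other. The Laguerre generating function arises in this way.\<close>

lemma sums_diagonal:
  fixes f :: "nat \<Rightarrow> nat \<Rightarrow> 'a::banach"
  assumes row: "\<And>i. (\<lambda>m. f i m) sums r i" "\<And>i. summable (\<lambda>m. norm (f i m))"
    and tot: "summable (\<lambda>i. \<Sum>m. norm (f i m))" and S: "r sums S"
  shows "(\<lambda>n. \<Sum>i\<le>n. f i (n - i)) sums S"
proof -
  have norm_row: "((\<lambda>m. norm (f i m)) has_sum (\<Sum>m. norm (f i m))) UNIV" for i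
    using row(2)[of i] by (intro norm_summable_imp_has_sum) (auto intro: summable_sums)
  have "(\<lambda>p. norm (case p of (i, m) \<Rightarrow> f i m)) summable_on (UNIV \<times> UNIV)"
  proof (rule Infinite_Sum.abs_summable_on_Sigma_iff[THEN iffD2], intro conjI ballI)
    show "(\<lambda>m. norm (case (i, m) of (i, m) \<Rightarrow> f i m)) summable_on UNIV" for i
      using norm_row[of i] by (auto simp: summable_on_def)
    have "infsum (\<lambda>m. norm (f i m)) UNIV = (\<Sum>m. norm (f i m))" for i
      by (rule infsumI[OF norm_row])
    moreover have "(\<lambda>i. norm (\<Sum>m. norm (f i m))) summable_on UNIV"
      using tot row(2) by (intro norm_summable_imp_summable_on) (simp add: suminf_nonneg)
    ultimately show "(\<lambda>i. norm (\<Sum>\<^sub>\<infinity>m. norm (case (i, m) of (i, m) \<Rightarrow> f i m))) summable_on UNIV"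
      by simp
  qed
  then obtain T where T: "((\<lambda>(i, m). f i m) has_sum T) (UNIV \<times> UNIV)"
    using Infinite_Sum.abs_summable_summable unfolding summable_on_def by blast
  have "(f i has_sum r i) UNIV" for i
    by (intro norm_summable_imp_has_sum row)
  then have "(r has_sum T) UNIV" by (intro has_sum_SigmaD[OF T]) auto
  then have TS: "T = S" using S has_sum_imp_sums sums_unique2 by blast
  have "((\<lambda>(n, i). f i (n - i)) has_sum S) (Sigma UNIV (\<lambda>n. {..n})) = ((\<lambda>(i, m). f i m) has_sum T) (UNIV \<times> UNIV)"
    by (rule has_sum_reindex_bij_witness[where i="\<lambda>(i, m). (i + m, i)" and j="\<lambda>(n, i). (i, n - i)"]) (auto simp: TS)
  then have "((\<lambda>(n, i). f i (n - i)) has_sum S) (Sigma UNIV (\<lambda>n. {..n}))" using T by simp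
  then have "((\<lambda>n. \<Sum>i\<le>n. f i (n - i)) has_sum S) UNIV"
    by (rule has_sum_SigmaD) (auto intro!: has_sum_finite)
  then show ?thesis by (rule has_sum_imp_sums)
qed

text \<open>The coefficient of \<open>z ^ m\<close> in \<open>(1 - z) powr (- x)\<close>. With this
  sign convention it is positive for \<open>x > 0\<close>, and orders add under convolution.\<close>

definition bin :: "real \<Rightarrow> nat \<Rightarrow> real" where
  "bin x m = pochhammer x m / fact m"

lemma bin_0 [simp]: "bin x 0 = 1"
  by (simp add: bin_def)

lemma bin_pos: "x > 0 \<Longrightarrow> bin x m > 0"
  by (simp add: bin_def pochhammer_pos)

lemma bin_add: "bin (x + y) n = (\<Sum>k\<le>n. bin x k * bin y (n - k))"
proof -
  have "bin (x + y) n = (\<Sum>k\<le>n. real (n choose k) * pochhammer x k * pochhammer y (n - k)) / fact n"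
    unfolding bin_def pochhammer_binomial_sum ..
  also have "\<dots> = (\<Sum>k\<le>n. bin x k * bin y (n - k))"
    unfolding sum_divide_distrib by (intro sum.cong refl) (simp add: bin_def binomial_fact)
  finally show ?thesis .
qed

lemma bin_gbinomial: "of_real (bin x m) = (- 1) ^ m * ((- of_real x :: 'a::{real_field}) gchoose m)"
  by (simp add: bin_def gbinomial_pochhammer pochhammer_of_real mult.assoc[symmetric] flip: power_mult_distrib)

lemma bin_sums:
  fixes z :: complex assumes "cmod z < 1"
  shows "(\<lambda>m. of_real (bin x m) * z ^ m) sums (1 - z) powr (- of_real x)"
proof -
  have "(\<lambda>m. ((- of_real x :: complex) gchoose m) * (- z) ^ m) sums (1 + (- z)) powr (- of_real x)"
    using assms by (intro gen_binomial_complex) simp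
  moreover have "(- z) ^ m = (- 1) ^ m * z ^ m" for m by (rule power_minus)
  ultimately show ?thesis by (simp add: bin_gbinomial mult_ac)
qed

lemma bin_sums_real:
  assumes "\<bar>z\<bar> < 1"
  shows "(\<lambda>m. bin x m * z ^ m) sums (1 - z) powr (- x)"
proof -
  have "(\<lambda>m. ((- x) gchoose m) * (- z) ^ m) sums (1 + (- z)) powr (- x)"
    using assms by (intro gen_binomial_real) simp
  moreover have "(- z) ^ m = (- 1) ^ m * z ^ m" for m by (rule power_minus)
  ultimately show ?thesis using bin_gbinomial[of x, where 'a=real] by (simp add: mult_ac)
qed

lemma bin_summable_norm: "cmod z < 1 \<Longrightarrow> summable (\<lambda>m. \<bar>bin x m\<bar> * cmod z ^ m)"
proof -
  assume z: "cmod z < 1"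
  obtain r where r: "cmod z < r" "r < 1" using dense[OF z] by blast
  have "0 \<le> r" using r(1) norm_ge_zero[of z] by linarith
  then have "cmod (of_real r) < 1" using r by simp
  from sums_summable[OF bin_sums[OF this, of x]]
  have "summable (\<lambda>m. norm (of_real (bin x m) * (z :: complex) ^ m))"
  proof (intro powser_insidea[of _ "of_real r"])
    have "0 \<le> r" using r(1) norm_ge_zero[of z] by linarith
    then show "cmod z < norm (complex_of_real r)" using r(1) by simp
  qed
  then show ?thesis by (simp add: norm_mult norm_power)
qed

text \<open>The associated Laguerre polynomial of degree \<open>n\<close> and order
  \<open>a\<close>; the customary binomial coefficient, \<open>n + a\<close> over
  \<open>n - i\<close>, equals \<open>bin (a + i + 1) (n - i)\<close>.\<close>

definition laguerre :: "real \<Rightarrow> nat \<Rightarrow> real \<Rightarrow> real" where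
  "laguerre a n t = (\<Sum>i\<le>n. (- t) ^ i / fact i * bin (a + real i + 1) (n - i))"

lemma laguerre_continuous: "continuous_on S (\<lambda>x. laguerre a n (c * x))"
  unfolding laguerre_def by (intro continuous_intros) auto

lemma powr_minus_add_nat:
  fixes w :: complex
  assumes "w \<noteq> 0"
  shows "w powr (- of_real (a + real i + 1)) = w powr (- of_real (a + 1)) * (1 / w) ^ i"
proof -
  have "- complex_of_real (a + real i + 1) = - of_real (a + 1) - of_nat i" by simp
  then show ?thesis using assms by (simp only: powr_diff powr_nat) (simp add: power_one_over)
qed

text \<open>The generating function at \<open>t = - s\<close>, where all terms are nonnegative. It
  is a majorant for complex \<open>z\<close> with \<open>|z| = r\<close>, uniformly in
  \<open>|t| \<le> s\<close>.\<close>

lemma laguerre_sums_majorant: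
  fixes s r :: real
  assumes "a > -1" "0 \<le> r" "r < 1" "s \<ge> 0"
  shows "(\<lambda>n. \<Sum>i\<le>n. s ^ i / fact i * bin (a + real i + 1) (n - i) * r ^ n) sums
      ((1 - r) powr (- (a + 1)) * exp (s * r / (1 - r)))"
    and "\<And>i. summable (\<lambda>m. norm ((s * r) ^ i / fact i * (bin (a + real i + 1) m * r ^ m)))"
    and "summable (\<lambda>i. \<Sum>m. norm ((s * r) ^ i / fact i * (bin (a + real i + 1) m * r ^ m)))"
proof -
  let ?f = "\<lambda>i m. (s * r) ^ i / fact i * (bin (a + real i + 1) m * r ^ m)"
  let ?C = "(1 - r) powr (- (a + 1))"
  let ?r = "\<lambda>i. ?C * ((s * r / (1 - r)) ^ i /\<^sub>R fact i)"
  have nn: "?f i m \<ge> 0" for i m using assms bin_pos[of "a + real i + 1" m] by (simp add: less_imp_le)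
  have row: "?f i sums ?r i" for i
  proof -
    have "?f i sums ((s * r) ^ i / fact i * (1 - r) powr (- (a + real i + 1)))"
      using assms by (intro sums_mult bin_sums_real) auto
    moreover have "(1 - r) powr (- (a + real i + 1)) = ?C * (1 / (1 - r)) ^ i"
    proof -
      have "- (a + real i + 1) = - (a + 1) - real i" by simp
      then show ?thesis using assms by (simp only: powr_diff) (simp add: powr_realpow power_one_over divide_inverse power_inverse)
    qed
    ultimately show ?thesis by (simp add: power_divide power_mult_distrib divide_inverse mult_ac power_inverse)
  qed
  have nrow: "(\<lambda>m. norm (?f i m)) sums ?r i" for i
    using row[of i] by (simp only: real_norm_def abs_of_nonneg[OF nn])
  show s1: "summable (\<lambda>m. norm (?f i m))" for i using nrow by (rule sums_summable)
  have e: "?r sums (?C * exp (s * r / (1 - r)))"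
    by (intro sums_mult exp_converges)
  then show s2: "summable (\<lambda>i. \<Sum>m. norm (?f i m))"
    unfolding sums_unique[OF nrow, symmetric] by (rule sums_summable)
  have "(\<lambda>n. \<Sum>i\<le>n. ?f i (n - i)) sums (?C * exp (s * r / (1 - r)))"
    by (rule sums_diagonal[OF row s1 s2 e])
  moreover have "?f i (n - i) = s ^ i / fact i * bin (a + real i + 1) (n - i) * r ^ n" if "i \<le> n" for i n
  proof -
    have "r ^ n = r ^ i * r ^ (n - i)" using that by (simp flip: power_add)
    then show ?thesis by (simp add: power_mult_distrib)
  qed
  then have "(\<Sum>i\<le>n. ?f i (n - i)) = (\<Sum>i\<le>n. s ^ i / fact i * bin (a + real i + 1) (n - i) * r ^ n)" for n
    by (intro sum.cong) auto
  ultimately show "(\<lambda>n. \<Sum>i\<le>n. s ^ i / fact i * bin (a + real i + 1) (n - i) * r ^ n) sums (?C * exp (s * r / (1 - r)))"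
    by (simp only:)
qed

text \<open>Powers of \<open>t\<close> are collected: row \<open>i\<close> is
  \<open>(- t z) ^ i / i!\<close> times the binomial series of order \<open>a + i + 1\<close>, and
  the sum over \<open>i\<close> is an exponential series in \<open>- t z / (1 - z)\<close>.\<close>

lemma laguerre_sums:
  fixes z :: complex
  assumes "a > -1" "cmod z < 1"
  shows "(\<lambda>n. of_real (laguerre a n t) * z ^ n) sums ((1 - z) powr (- of_real (a + 1)) * exp (- (of_real t * z / (1 - z))))"
proof -
  let ?f = "\<lambda>i m. (- of_real t * z) ^ i / fact i * (of_real (bin (a + real i + 1) m) * z ^ m)"
  let ?C = "(1 - z) powr (- of_real (a + 1))"
  let ?r = "\<lambda>i. ?C * ((- (of_real t * z / (1 - z))) ^ i /\<^sub>R fact i)"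
  have z1: "1 - z \<noteq> 0" using assms(2) by auto
  have row: "?f i sums ?r i" for i
  proof -
    have "?f i sums ((- of_real t * z) ^ i / fact i * (1 - z) powr (- of_real (a + real i + 1)))"
      by (intro sums_mult bin_sums assms)
    moreover have "(- of_real t * z) ^ i / fact i * (1 - z) powr (- of_real (a + real i + 1)) = ?r i"
      unfolding powr_minus_add_nat[OF z1] scaleR_conv_of_real
      by (simp add: divide_inverse mult_ac flip: power_mult_distrib)
    ultimately show ?thesis by simp
  qed
  have nf: "norm (?f i m) = norm ((\<bar>t\<bar> * cmod z) ^ i / fact i * (bin (a + real i + 1) m * cmod z ^ m))" for i m
    by (simp add: norm_mult norm_divide norm_power abs_mult)
  have "(\<lambda>n. \<Sum>i\<le>n. ?f i (n - i)) sums (?C * exp (- (of_real t * z / (1 - z))))"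
  proof (rule sums_diagonal[OF row])
    show "summable (\<lambda>m. norm (?f i m))" for i
      unfolding nf by (rule laguerre_sums_majorant(2)) (use assms in auto)
    show "summable (\<lambda>i. \<Sum>m. norm (?f i m))"
      unfolding nf by (rule laguerre_sums_majorant(3)) (use assms in auto)
    show "?r sums (?C * exp (- (of_real t * z / (1 - z))))"
      by (intro sums_mult exp_converges)
  qed
  moreover have "(\<Sum>i\<le>n. ?f i (n - i)) = of_real (laguerre a n t) * z ^ n" for n
    unfolding laguerre_def of_real_sum sum_distrib_right
  proof (intro sum.cong refl)
    fix i assume "i \<in> {..n}"
    then have "z ^ n = z ^ i * z ^ (n - i)" by (simp flip: power_add)
    then show "?f i (n - i) = of_real ((- t) ^ i / fact i * bin (a + real i + 1) (n - i)) * z ^ n"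
      by (simp only: power_mult_distrib[of "- complex_of_real t"]) simp
  qed
  ultimately show ?thesis by simp
qed

lemma laguerre_norm_sum_le:
  assumes "a > -1" "0 \<le> r" "r < 1" "\<bar>t\<bar> \<le> s"
  shows "\<bar>laguerre a n t\<bar> * r ^ n \<le> (\<Sum>i\<le>n. s ^ i / fact i * bin (a + real i + 1) (n - i) * r ^ n)"
proof -
  have "\<bar>laguerre a n t\<bar> \<le> (\<Sum>i\<le>n. s ^ i / fact i * bin (a + real i + 1) (n - i))"
    unfolding laguerre_def
  proof (intro order_trans[OF sum_abs] sum_mono)
    fix i
    have b: "bin (a + real i + 1) (n - i) \<ge> 0" using assms(1) by (intro less_imp_le bin_pos) auto
    have "\<bar>(- t) ^ i / fact i * bin (a + real i + 1) (n - i)\<bar> = \<bar>t\<bar> ^ i / fact i * bin (a + real i + 1) (n - i)"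
      using b by (simp add: abs_mult power_abs)
    also have "\<dots> \<le> s ^ i / fact i * bin (a + real i + 1) (n - i)"
      using b assms(4) by (intro mult_right_mono divide_right_mono power_mono) auto
    finally show "\<bar>(- t) ^ i / fact i * bin (a + real i + 1) (n - i)\<bar> \<le> s ^ i / fact i * bin (a + real i + 1) (n - i)" .
  qed
  then have "\<bar>laguerre a n t\<bar> * r ^ n \<le> (\<Sum>i\<le>n. s ^ i / fact i * bin (a + real i + 1) (n - i)) * r ^ n"
    using assms(2) by (intro mult_right_mono) auto
  then show ?thesis by (simp add: sum_distrib_right)
qed

lemma sum_triangle_swap:
  fixes F :: "nat \<Rightarrow> nat \<Rightarrow> 'a::comm_monoid_add"
  shows "(\<Sum>i\<le>n. \<Sum>k\<le>n - i. F i k) = (\<Sum>j\<le>n. \<Sum>i\<le>j. F i (n - j))"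
proof -
  have "(\<Sum>i\<le>n. \<Sum>k\<le>n - i. F i k) = (\<Sum>(i, k)\<in>(SIGMA i:{..n}. {..n - i}). F i k)"
    by (simp add: sum.Sigma)
  also have "\<dots> = (\<Sum>(j, i)\<in>(SIGMA j:{..n}. {..j}). F i (n - j))"
    by (rule sum.reindex_bij_witness[where i="\<lambda>(j, i). (i, n - j)" and j="\<lambda>(i, k). (n - k, i)"]) auto
  also have "\<dots> = (\<Sum>j\<le>n. \<Sum>i\<le>j. F i (n - j))"
    by (simp add: sum.Sigma)
  finally show ?thesis .
qed

text \<open>The generating functions of orders \<open>a\<close> and \<open>b\<close> differ by the
  factor \<open>(1 - z) powr (- (a - b))\<close>, whose coefficients are \<open>bin (a - b)\<close>.
  On coefficients this is Vandermonde's identity \<open>bin_add\<close>.\<close>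

lemma laguerre_connection: "laguerre a n t = (\<Sum>j\<le>n. bin (a - b) (n - j) * laguerre b j t)"
proof -
  have "laguerre a n t = (\<Sum>i\<le>n. \<Sum>k\<le>n - i. (- t) ^ i / fact i * (bin (a - b) k * bin (b + real i + 1) (n - i - k)))"
    unfolding laguerre_def
  proof (intro sum.cong refl)
    fix i
    have "a + real i + 1 = (a - b) + (b + real i + 1)" by simp
    then show "(- t) ^ i / fact i * bin (a + real i + 1) (n - i) =
        (\<Sum>k\<le>n - i. (- t) ^ i / fact i * (bin (a - b) k * bin (b + real i + 1) (n - i - k)))"
      by (simp only: bin_add sum_distrib_left)
  qed
  also have "\<dots> = (\<Sum>j\<le>n. \<Sum>i\<le>j. (- t) ^ i / fact i * (bin (a - b) (n - j) * bin (b + real i + 1) (n - i - (n - j))))"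
    by (rule sum_triangle_swap)
  also have "\<dots> = (\<Sum>j\<le>n. bin (a - b) (n - j) * laguerre b j t)"
    unfolding laguerre_def sum_distrib_left by (intro sum.cong refl) (simp add: mult_ac)
  finally show ?thesis .
qed

section \<open>Gamma integrals and the orthogonality of Laguerre polynomials\<close>

lemma powr_exp_integral_scaled:
  fixes a q :: real
  assumes "a > -1" "q > 0"
  shows "set_integrable lebesgue {0<..} (\<lambda>x. x powr a * exp (- q * x))"
    and "(LINT x:{0<..}|lebesgue. x powr a * exp (- q * x)) = Gamma (a + 1) * q powr (- (a + 1))"
proof -
  let ?h = "\<lambda>q (x::real). indicator {0<..} x *\<^sub>R (x powr a * exp (- q * x)) :: real"
  have m: "?h q \<in> borel_measurable borel" for q :: real by measurable
  have "((\<lambda>t. t powr a / exp t) has_integral Gamma (a + 1)) {0..}"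
    using Gamma_integral_real[of "a + 1"] assms(1) by simp
  then have "((\<lambda>t. if t \<in> {0..} then t powr a / exp t else 0) has_integral Gamma (a + 1)) UNIV"
    unfolding has_integral_restrict_UNIV .
  then have 1: "(?h 1 has_integral Gamma (a + 1)) UNIV"
    by (rule has_integral_spike[of "{0}", rotated 2]) (auto simp: indicator_def exp_minus divide_inverse)
  have nn: "?h q x \<ge> 0" for q x :: real by simp
  have "(\<integral>\<^sup>+x. ennreal (?h 1 x) \<partial>lborel) = ennreal (Gamma (a + 1))"
    by (rule nn_integral_has_integral_lborel[OF m nn 1])
  then have hb: "has_bochner_integral lborel (?h 1) (Gamma (a + 1))"
    by (intro has_bochner_integral_nn_integral) (use assms m nn Gamma_real_pos[of "a + 1"] in \<open>auto simp: less_imp_le\<close>)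
  have q: "?h q x = q powr (- a) * ?h 1 (0 + q * x)" for x :: real
    using assms(2) by (auto simp: indicator_def powr_mult powr_minus zero_less_mult_iff)
  have i1: "integrable lborel (?h 1)" and v1: "(LINT x|lborel. ?h 1 x) = Gamma (a + 1)"
    using hb by (auto simp: has_bochner_integral_iff)
  have iq: "integrable lborel (?h q)"
    unfolding q using assms(2) by (intro integrable_mult_right lborel_integrable_real_affine i1) auto
  then have "integrable lebesgue (?h q)"
    by (subst integrable_completion) (auto simp: borel_measurable_integrable)
  then show "set_integrable lebesgue {0<..} (\<lambda>x. x powr a * exp (- q * x))"
    by (simp only: set_integrable_def)
  have "Gamma (a + 1) = \<bar>q\<bar> *\<^sub>R (LINT x|lborel. ?h 1 (0 + q * x))"
    using lborel_integral_real_affine[of q "?h 1" 0] assms(2) v1 by (simp only:)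
  moreover have "(LINT x|lborel. ?h q x) = q powr (- a) * (LINT x|lborel. ?h 1 (0 + q * x))"
    unfolding q by (rule integral_mult_right_zero)
  ultimately have "(LINT x|lborel. ?h q x) = Gamma (a + 1) * q powr (- (a + 1))"
    using assms(2) by (simp add: powr_diff powr_minus field_simps powr_add)
  moreover have "(LINT x|lebesgue. ?h q x) = (LINT x|lborel. ?h q x)"
    by (rule integral_completion) (use iq in \<open>auto simp: borel_measurable_integrable\<close>)
  ultimately show "(LINT x:{0<..}|lebesgue. x powr a * exp (- q * x)) = Gamma (a + 1) * q powr (- (a + 1))"
    by (simp only: set_lebesgue_integral_def)
qed

text \<open>The exponential is expanded about a real point \<open>q\<close> so large that \<open>P\<close> lies in the disc of
  convergence of the binomial series.\<close>

lemma powr_exp_integral: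
  assumes a: "a > -1" and P: "Re P > 0"
  shows "set_integrable lebesgue {0<..} (\<lambda>x. of_real (x powr a) * exp (- P * of_real x))"
    and "(LINT x:{0<..}|lebesgue. of_real (x powr a) * exp (- P * of_real x)) = of_real (Gamma (a + 1)) * P powr (- of_real (a + 1))"
proof -
  \<comment> \<open>With this value \<open>|q - P|^2 = q^2 - |P|^2\<close>, so the ratio
    \<open>z\<close> below lies strictly inside the unit disc.\<close>
  define q where "q = (cmod P)\<^sup>2 / Re P"
  have P0: "P \<noteq> 0" using P by auto
  have q: "q > 0" using P P0 by (simp add: q_def)
  have "(cmod (of_real q - P))\<^sup>2 = q\<^sup>2 - 2 * q * Re P + (cmod P)\<^sup>2"
    unfolding cmod_power2 by (simp add: power2_eq_square algebra_simps)
  also have "\<dots> < q\<^sup>2" using P P0 by (simp add: q_def)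
  finally have "cmod (of_real q - P) < q" by (rule power2_less_imp_less) (use q in simp)
  define z where "z = (of_real q - P) / of_real q"
  have z: "cmod z < 1" using \<open>cmod (of_real q - P) < q\<close> q by (simp add: z_def norm_divide)
  have qz: "of_real q - P = of_real q * z" using q by (simp add: z_def)
  define f where "f n x = indicator {0<..} x *\<^sub>R ((of_real q * z) ^ n / fact n * of_real (x powr (a + real n) * exp (- q * x)))" for n x
  have fi: "integrable lebesgue (f n)" for n
  proof -
    have "set_integrable lebesgue {0<..} (\<lambda>x. x powr (a + real n) * exp (- q * x))"
      using a q by (intro powr_exp_integral_scaled) auto
    then have "integrable lebesgue (\<lambda>x. (of_real q * z) ^ n / fact n * complex_of_real (indicator {0<..} x *\<^sub>R (x powr (a + real n) * exp (- q * x))))"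
      unfolding set_integrable_def by (intro integrable_mult_right) (simp only: complex_of_real_integrable_eq)
    then show ?thesis unfolding f_def[abs_def] by (simp add: scaleR_conv_of_real mult_ac)
  qed
  \<comment> \<open>Each term integrates to a Gamma value, and after division by \<open>n!\<close>
    these are binomial coefficients of order \<open>a + 1\<close>; hence the sum over
    \<open>n\<close> is a binomial series in \<open>z\<close>.\<close>
  have G: "Gamma (a + real n + 1) * q powr (- (a + real n + 1)) * q ^ n / fact n = Gamma (a + 1) * q powr (- (a + 1)) * bin (a + 1) n" for n
  proof -
    have "a + 1 \<notin> \<int>\<^sub>\<le>\<^sub>0" using a by (auto elim!: nonpos_Ints_cases)
    moreover have "Gamma (a + 1) > 0" using a by (intro Gamma_real_pos) auto
    ultimately have "Gamma (a + 1 + real n) = pochhammer (a + 1) n * Gamma (a + 1)"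
      by (simp add: pochhammer_Gamma)
    moreover have "q powr (- (a + real n + 1)) * q ^ n = q powr (- (a + 1))"
      using q by (simp add: powr_realpow[symmetric] flip: powr_add)
    ultimately show ?thesis by (simp add: bin_def add_ac)
  qed
  have val: "(LINT x|lebesgue. f n x) = of_real (Gamma (a + 1) * q powr (- (a + 1))) * (of_real (bin (a + 1) n) * z ^ n)" for n
  proof -
    have "(LINT x|lebesgue. f n x) = (of_real q * z) ^ n / fact n * complex_of_real (LINT x:{0<..}|lebesgue. x powr (a + real n) * exp (- q * x))"
      unfolding set_lebesgue_integral_def integral_complex_of_real[symmetric] integral_mult_right_zero[symmetric] f_def
      by (intro Bochner_Integration.integral_cong refl) (simp add: scaleR_conv_of_real mult_ac)
    also have "\<dots> = (of_real q * z) ^ n / fact n * of_real (Gamma (a + real n + 1) * q powr (- (a + real n + 1)))"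
      using a q by (subst powr_exp_integral_scaled(2)) auto
    also have "\<dots> = z ^ n * of_real (Gamma (a + real n + 1) * q powr (- (a + real n + 1)) * q ^ n / fact n)"
      by (simp add: power_mult_distrib)
    also have "\<dots> = of_real (Gamma (a + 1) * q powr (- (a + 1))) * (of_real (bin (a + 1) n) * z ^ n)"
      unfolding G by simp
    finally show ?thesis .
  qed
  have nval: "(LINT x|lebesgue. norm (f n x)) = Gamma (a + 1) * q powr (- (a + 1)) * (\<bar>bin (a + 1) n\<bar> * cmod z ^ n)" for n
  proof -
    have "(LINT x|lebesgue. norm (f n x)) = (q * cmod z) ^ n / fact n * (LINT x:{0<..}|lebesgue. x powr (a + real n) * exp (- q * x))"
      unfolding set_lebesgue_integral_def integral_mult_right_zero[symmetric] f_def using q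
      by (intro Bochner_Integration.integral_cong refl) (simp add: norm_mult norm_divide norm_power)
    also have "\<dots> = (q * cmod z) ^ n / fact n * (Gamma (a + real n + 1) * q powr (- (a + real n + 1)))"
      using a q by (subst powr_exp_integral_scaled(2)) auto
    also have "\<dots> = cmod z ^ n * (Gamma (a + real n + 1) * q powr (- (a + real n + 1)) * q ^ n / fact n)"
      by (simp add: power_mult_distrib)
    also have "\<dots> = Gamma (a + 1) * q powr (- (a + 1)) * (\<bar>bin (a + 1) n\<bar> * cmod z ^ n)"
      unfolding G using bin_pos[of "a + 1" n] a by simp
    finally show ?thesis .
  qed
  let ?g = "\<lambda>x. indicator {0<..} x *\<^sub>R (of_real (x powr a) * exp (- P * of_real x))"
  have fs: "(\<lambda>n. f n x) sums ?g x" for x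
  proof (cases "x > 0")
    case True
    have fe: "f n x = of_real (x powr a * exp (- q * x)) * ((of_real q * z * of_real x) ^ n /\<^sub>R fact n)" for n
      using True unfolding f_def
      by (simp add: powr_add powr_realpow power_mult_distrib scaleR_conv_of_real divide_inverse mult_ac)
    have "(\<lambda>n. f n x) sums (of_real (x powr a * exp (- q * x)) * exp (of_real q * z * of_real x))"
      unfolding fe by (intro sums_mult exp_converges)
    moreover have "of_real (exp (- q * x)) * exp (of_real q * z * of_real x) = exp (- P * of_real x)"
      unfolding qz[symmetric] by (simp add: exp_of_real[symmetric] algebra_simps flip: exp_add)
    ultimately show ?thesis using True by (simp add: mult.assoc)
  qed (simp add: f_def)
  have nfs: "summable (\<lambda>n. norm (f n x))" for x
  proof (cases "x > 0")
    case True
    have "norm (f n x) = x powr a * exp (- q * x) * ((q * cmod z * x) ^ n /\<^sub>R fact n)" for n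
      using True q unfolding f_def
      by (simp add: powr_add powr_realpow power_mult_distrib divide_inverse mult_ac norm_mult norm_power norm_inverse)
    then show ?thesis using summable_exp_generic[of "q * cmod z * x"] by (simp only: summable_mult)
  qed (simp add: f_def)
  have sn: "summable (\<lambda>n. LINT x|lebesgue. norm (f n x))"
    unfolding nval by (intro summable_mult bin_summable_norm z)
  have eq: "(\<lambda>x. \<Sum>n. f n x) = ?g" using sums_unique[OF fs] by auto
  have "integrable lebesgue (\<lambda>x. \<Sum>n. f n x)"
    by (rule integrable_suminf[OF fi _ sn]) (use nfs in auto)
  then show "set_integrable lebesgue {0<..} (\<lambda>x. of_real (x powr a) * exp (- P * of_real x))"
    unfolding eq set_integrable_def .
  have "(\<lambda>n. LINT x|lebesgue. f n x) sums (LINT x|lebesgue. (\<Sum>n. f n x))"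
    by (rule sums_integral[OF fi _ sn]) (use nfs in auto)
  moreover have "(\<lambda>n. LINT x|lebesgue. f n x) sums (of_real (Gamma (a + 1) * q powr (- (a + 1))) * (1 - z) powr (- of_real (a + 1)))"
    unfolding val by (intro sums_mult bin_sums z)
  ultimately have "(LINT x|lebesgue. ?g x) = of_real (Gamma (a + 1) * q powr (- (a + 1))) * (1 - z) powr (- of_real (a + 1))"
    unfolding eq by (rule sums_unique2)
  also have "\<dots> = of_real (Gamma (a + 1)) * P powr (- of_real (a + 1))"
  proof -
    have z1: "1 - z = P / of_real q" using q by (simp add: z_def field_simps)
    have "1 - z \<noteq> 0" unfolding z1 using q P0 by simp
    then have "Ln (of_real q * (1 - z)) = of_real (ln q) + Ln (1 - z)"
      using Ln_times_of_real[of q "1 - z"] Ln_of_real[of q] q by simp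
    moreover have "of_real q * (1 - z) = P" unfolding z1 using q by simp
    ultimately have "Ln P = of_real (ln q) + Ln (1 - z)" by (simp only:)
    then have "P powr (- of_real (a + 1)) = exp (- of_real (a + 1) * of_real (ln q) + - of_real (a + 1) * Ln (1 - z))"
      using P0 by (simp only: powr_def if_False distrib_left)
    also have "\<dots> = exp (- of_real (a + 1) * of_real (ln q)) * (1 - z) powr (- of_real (a + 1))"
      using \<open>1 - z \<noteq> 0\<close> by (simp only: exp_add powr_def if_False)
    also have "exp (- of_real (a + 1) * of_real (ln q)) = complex_of_real (exp (- (a + 1) * ln q))"
      by (simp only: exp_of_real[symmetric] of_real_mult of_real_minus)
    also have "exp (- (a + 1) * ln q) = q powr (- (a + 1))" using q by (simp add: powr_def)
    finally show ?thesis by simp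
  qed
  finally show "(LINT x:{0<..}|lebesgue. of_real (x powr a) * exp (- P * of_real x)) = of_real (Gamma (a + 1)) * P powr (- of_real (a + 1))"
    by (simp only: set_lebesgue_integral_def)
qed

text \<open>The \<open>k\<close>-th finite difference of the polynomial
  \<open>pochhammer y i\<close> of degree \<open>i\<close>. A single difference lowers the degree by
  one and shifts the argument, hence an induction over all \<open>x\<close>.\<close>

lemma finite_difference_pochhammer:
  fixes x :: real
  shows "(i < k \<longrightarrow> (\<Sum>m\<le>k. (- 1) ^ m * real (k choose m) * pochhammer (x + real m) i) = 0) \<and>
    (i = k \<longrightarrow> (\<Sum>m\<le>k. (- 1) ^ m * real (k choose m) * pochhammer (x + real m) i) = (- 1) ^ k * fact k)"
proof (induction k arbitrary: i x)
  case 0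
  show ?case by simp
next
  case (Suc k)
  define S where "S k i x = (\<Sum>m\<le>k. (- 1) ^ m * real (k choose m) * pochhammer (x + real m) i)" for k i x
  have step: "S (Suc k) i x = S k i x - S k i (x + 1)" for i x
  proof -
    have "S (Suc k) i x = pochhammer x i + (\<Sum>m\<le>k. (- 1) ^ Suc m * real (k choose Suc m) * pochhammer (x + real (Suc m)) i)
        + (\<Sum>m\<le>k. (- 1) ^ Suc m * real (k choose m) * pochhammer (x + real (Suc m)) i)"
      unfolding S_def by (subst sum.atMost_Suc_shift) (simp add: algebra_simps sum.distrib sum_negf sum_subtractf)
    also have "pochhammer x i + (\<Sum>m\<le>k. (- 1) ^ Suc m * real (k choose Suc m) * pochhammer (x + real (Suc m)) i) =
        (\<Sum>m\<le>Suc k. (- 1) ^ m * real (k choose m) * pochhammer (x + real m) i)"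
      by (subst sum.atMost_Suc_shift) simp
    also have "\<dots> = S k i x" unfolding S_def by simp
    also have "(\<Sum>m\<le>k. (- 1) ^ Suc m * real (k choose m) * pochhammer (x + real (Suc m)) i) = - S k i (x + 1)"
      unfolding S_def by (simp add: sum_negf[symmetric] add_ac)
    finally show ?thesis by simp
  qed
  have step2: "S (Suc k) (Suc j) x = - (real j + 1) * S k j (x + 1)" for j x
  proof -
    have "pochhammer (x + real m) (Suc j) - pochhammer (x + 1 + real m) (Suc j) = - (real j + 1) * pochhammer (x + 1 + real m) j" for m
    proof -
      have "pochhammer (x + real m) (Suc j) = (x + real m) * pochhammer (x + 1 + real m) j"
        by (simp add: pochhammer_rec add_ac)
      moreover have "pochhammer (x + 1 + real m) (Suc j) = pochhammer (x + 1 + real m) j * (x + 1 + real m + real j)"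
        by (rule pochhammer_Suc)
      ultimately show ?thesis by (simp add: algebra_simps)
    qed
    then have "(- 1) ^ m * real (k choose m) * pochhammer (x + real m) (Suc j) - (- 1) ^ m * real (k choose m) * pochhammer (x + 1 + real m) (Suc j)
        = - (real j + 1) * ((- 1) ^ m * real (k choose m) * pochhammer (x + 1 + real m) j)" for m
      by (simp only: right_diff_distrib[symmetric] mult.left_commute)
    then show ?thesis unfolding step unfolding S_def sum_subtractf[symmetric] sum_distrib_left by simp
  qed
  have z: "S (Suc k) 0 x = 0" unfolding step by (simp add: S_def)
  have "(i < Suc k \<longrightarrow> S (Suc k) i x = 0) \<and> (i = Suc k \<longrightarrow> S (Suc k) i x = (- 1) ^ Suc k * fact (Suc k))"
  proof (cases i)
    case 0
    then show ?thesis using z by simp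
  next
    case (Suc j)
    have "(j < k \<longrightarrow> S k j (x + 1) = 0) \<and> (j = k \<longrightarrow> S k j (x + 1) = (- 1) ^ k * fact k)"
      unfolding S_def by (rule Suc.IH)
    then show ?thesis using step2[of j x] Suc by (auto simp: algebra_simps)
  qed
  then show ?case unfolding S_def .
qed

text \<open>Integrating the Laguerre sum term by term turns the moment of order \<open>i\<close>
  into a \<open>k\<close>-th finite difference of a polynomial of degree \<open>i\<close>.\<close>

lemma power_exp_laguerre_integral:
  assumes a: "a > -1" and p: "p > 0"
  shows "set_integrable lebesgue {0<..} (\<lambda>x. x powr a * exp (- p * x) * ((p * x) ^ i * laguerre a k (p * x)))"
    and "(LINT x:{0<..}|lebesgue. x powr a * exp (- p * x) * ((p * x) ^ i * laguerre a k (p * x))) =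
      p powr (- (a + 1)) * Gamma (a + 1 + real k) / fact k * (\<Sum>m\<le>k. (- 1) ^ m * real (k choose m) * pochhammer (a + 1 + real m) i)"
proof -
  define c where "c m = (- 1) ^ m * p ^ (i + m) / fact m * bin (a + real m + 1) (k - m)" for m
  let ?g = "\<lambda>m x. indicator {0<..} x *\<^sub>R (x powr (a + real (i + m)) * exp (- p * x)) :: real"
  have e: "indicator {0<..} x *\<^sub>R (x powr a * exp (- p * x) * ((p * x) ^ i * laguerre a k (p * x))) = (\<Sum>m\<le>k. c m * ?g m x)" for x
  proof (cases "x > 0")
    case True
    have "x powr (a + real (i + m)) = x powr a * x ^ i * x ^ m" for m
      using True by (simp add: powr_add powr_realpow power_add flip: of_nat_add)
    moreover have "(- (p * x)) ^ m = (- 1) ^ m * p ^ m * x ^ m" for m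
      by (metis mult.assoc mult_minus1 power_mult_distrib)
    ultimately show ?thesis using True
      by (simp add: laguerre_def c_def sum_distrib_left power_mult_distrib power_add mult_ac)
  qed simp
  have gi: "integrable lebesgue (?g m)" for m
    using powr_exp_integral_scaled(1)[of "a + real (i + m)" p] a p by (simp only: set_integrable_def)
  have gv: "(LINT x|lebesgue. ?g m x) = Gamma (a + real (i + m) + 1) * p powr (- (a + real (i + m) + 1))" for m
    using powr_exp_integral_scaled(2)[of "a + real (i + m)" p] a p by (simp only: set_lebesgue_integral_def)
  show "set_integrable lebesgue {0<..} (\<lambda>x. x powr a * exp (- p * x) * ((p * x) ^ i * laguerre a k (p * x)))"
    unfolding set_integrable_def e by (intro Bochner_Integration.integrable_sum integrable_mult_right gi)
  have "(LINT x:{0<..}|lebesgue. x powr a * exp (- p * x) * ((p * x) ^ i * laguerre a k (p * x))) =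
      (\<Sum>m\<le>k. c m * (LINT x|lebesgue. ?g m x))"
    unfolding set_lebesgue_integral_def e
    by (subst Bochner_Integration.integral_sum[OF integrable_mult_right[OF gi]]) (simp only: integral_mult_right_zero)
  also have "\<dots> = (\<Sum>m\<le>k. p powr (- (a + 1)) * Gamma (a + 1 + real k) / fact k * ((- 1) ^ m * real (k choose m) * pochhammer (a + 1 + real m) i))"
  proof (intro sum.cong refl)
    fix m assume m: "m \<in> {..k}"
    have ni: "a + 1 + real m \<notin> \<int>\<^sub>\<le>\<^sub>0" using a by (auto elim!: nonpos_Ints_cases)
    have gp: "Gamma (a + 1 + real m) > 0" using a by (intro Gamma_real_pos) auto
    have G1: "Gamma (a + real (i + m) + 1) = pochhammer (a + 1 + real m) i * Gamma (a + 1 + real m)"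
      using ni gp by (simp add: pochhammer_Gamma add_ac)
    have G2: "pochhammer (a + 1 + real m) (k - m) * Gamma (a + 1 + real m) = Gamma (a + 1 + real k)"
    proof -
      have "pochhammer (a + 1 + real m) (k - m) * Gamma (a + 1 + real m) = Gamma (a + 1 + real m + real (k - m))"
        using ni gp by (simp add: pochhammer_Gamma)
      also have "a + 1 + real m + real (k - m) = a + 1 + real k" using m by (simp add: of_nat_diff)
      finally show ?thesis .
    qed
    have pp: "p ^ (i + m) * p powr (- (a + real (i + m) + 1)) = p powr (- (a + 1))"
      using p by (simp add: powr_realpow[symmetric] flip: powr_add)
    have fk: "real (k choose m) / fact k = 1 / (fact m * fact (k - m))"
      using m by (simp add: binomial_fact)
    have "c m * (LINT x|lebesgue. ?g m x) = (- 1) ^ m * (p ^ (i + m) * p powr (- (a + real (i + m) + 1)))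
        * (pochhammer (a + 1 + real m) (k - m) * Gamma (a + 1 + real m)) * pochhammer (a + 1 + real m) i * (1 / (fact m * fact (k - m)))"
      unfolding c_def gv bin_def G1 by (simp add: add_ac)
    also have "\<dots> = p powr (- (a + 1)) * Gamma (a + 1 + real k) / fact k * ((- 1) ^ m * real (k choose m) * pochhammer (a + 1 + real m) i)"
      unfolding pp G2 fk[symmetric] by simp
    finally show "c m * (LINT x|lebesgue. ?g m x) = p powr (- (a + 1)) * Gamma (a + 1 + real k) / fact k * ((- 1) ^ m * real (k choose m) * pochhammer (a + 1 + real m) i)" .
  qed
  finally show "(LINT x:{0<..}|lebesgue. x powr a * exp (- p * x) * ((p * x) ^ i * laguerre a k (p * x))) =
      p powr (- (a + 1)) * Gamma (a + 1 + real k) / fact k * (\<Sum>m\<le>k. (- 1) ^ m * real (k choose m) * pochhammer (a + 1 + real m) i)"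
    by (simp add: sum_distrib_left)
qed

text \<open>The factor of lower degree is expanded in powers. Moments of order below
  \<open>k\<close> vanish, so on the diagonal only the leading coefficient
  \<open>(- 1) ^ k / k!\<close> contributes.\<close>

lemma laguerre_orthogonal:
  assumes a: "a > -1" and p: "p > 0"
  shows "set_integrable lebesgue {0<..} (\<lambda>x. x powr a * exp (- p * x) * (laguerre a j (p * x) * laguerre a k (p * x)))"
    and "(LINT x:{0<..}|lebesgue. x powr a * exp (- p * x) * (laguerre a j (p * x) * laguerre a k (p * x))) =
      (if j = k then p powr (- (a + 1)) * Gamma (a + 1 + real k) / fact k else 0)"
proof -
  let ?g = "\<lambda>k i x. indicator {0<..} x *\<^sub>R (x powr a * exp (- p * x) * ((p * x) ^ i * laguerre a k (p * x))) :: real"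
  define c where "c j i = (- 1) ^ i / fact i * bin (a + real i + 1) (j - i)" for j i
  have e: "indicator {0<..} x *\<^sub>R (x powr a * exp (- p * x) * (laguerre a j (p * x) * laguerre a k (p * x))) = (\<Sum>i\<le>j. c j i * ?g k i x)" for x j k
  proof -
    have "(- (p * x)) ^ i = (- 1) ^ i * (p * x) ^ i" for i by (rule power_minus)
    then have "laguerre a j (p * x) = (\<Sum>i\<le>j. c j i * (p * x) ^ i)" by (simp add: laguerre_def c_def mult_ac)
    then show ?thesis by (simp add: sum_distrib_left sum_distrib_right mult_ac)
  qed
  have gi: "integrable lebesgue (?g k i)" for i k
    using power_exp_laguerre_integral(1)[OF a p] by (simp only: set_integrable_def)
  show "set_integrable lebesgue {0<..} (\<lambda>x. x powr a * exp (- p * x) * (laguerre a j (p * x) * laguerre a k (p * x)))"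
    unfolding set_integrable_def e by (intro Bochner_Integration.integrable_sum integrable_mult_right gi)
  have v: "(LINT x:{0<..}|lebesgue. x powr a * exp (- p * x) * (laguerre a j (p * x) * laguerre a k (p * x))) =
      (if j = k then p powr (- (a + 1)) * Gamma (a + 1 + real k) / fact k else 0)" if "j \<le> k" for j k
  proof -
    have gv: "(LINT x|lebesgue. ?g k i x) = (if i = k then p powr (- (a + 1)) * Gamma (a + 1 + real k) / fact k * ((- 1) ^ k * fact k) else 0)" if "i \<le> k" for i
      using power_exp_laguerre_integral(2)[OF a p, of i k] finite_difference_pochhammer[of i k "a + 1"] that
      unfolding set_lebesgue_integral_def by (cases "i = k") auto
    have "(LINT x:{0<..}|lebesgue. x powr a * exp (- p * x) * (laguerre a j (p * x) * laguerre a k (p * x))) =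
        (\<Sum>i\<le>j. c j i * (LINT x|lebesgue. ?g k i x))"
      unfolding set_lebesgue_integral_def e
      by (subst Bochner_Integration.integral_sum[OF integrable_mult_right[OF gi]]) (simp only: integral_mult_right_zero)
    also have "\<dots> = (\<Sum>i\<le>j. if i = k then c j k * (p powr (- (a + 1)) * Gamma (a + 1 + real k) / fact k * ((- 1) ^ k * fact k)) else 0)"
    proof (intro sum.cong refl)
      fix i assume "i \<in> {..j}"
      then have "i \<le> k" using \<open>j \<le> k\<close> by simp
      show "c j i * (LINT x|lebesgue. ?g k i x) =
          (if i = k then c j k * (p powr (- (a + 1)) * Gamma (a + 1 + real k) / fact k * ((- 1) ^ k * fact k)) else 0)"
        unfolding gv[OF \<open>i \<le> k\<close>] by simp
    qed
    also have "\<dots> = (if j = k then c k k * (p powr (- (a + 1)) * Gamma (a + 1 + real k) / fact k * ((- 1) ^ k * fact k)) else 0)"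
      using \<open>j \<le> k\<close> by (auto simp: sum.delta)
    also have "c k k = (- 1) ^ k / fact k" by (simp add: c_def)
    finally show ?thesis by (simp add: mult_ac flip: power_mult_distrib)
  qed
  show "(LINT x:{0<..}|lebesgue. x powr a * exp (- p * x) * (laguerre a j (p * x) * laguerre a k (p * x))) =
      (if j = k then p powr (- (a + 1)) * Gamma (a + 1 + real k) / fact k else 0)"
    using v[of j k] v[of k j] by (cases "j \<le> k") (auto simp: mult.commute)
qed

section \<open>Discrete Hardy inequalities\<close>

text \<open>By Euler's limit formula for the Gamma function the ratio \<open>\<rho>\<close> tends to
  \<open>1 / Gamma x\<close>. A positive sequence with positive limit is bounded above and away from
  zero.\<close>

lemma bin_asymptotic:
  assumes x: "x > 0"
  obtains c C where "c > 0" "C > 0"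
    "\<And>m. c * (real m + 1) powr (x - 1) \<le> bin x m" "\<And>m. bin x m \<le> C * (real m + 1) powr (x - 1)"
proof -
  define \<rho> where "\<rho> m = bin x m / (real m + 1) powr (x - 1)" for m
  have pos: "\<rho> m > 0" for m using bin_pos[OF x, of m] by (simp add: \<rho>_def)
  have xn: "x \<notin> \<int>\<^sub>\<le>\<^sub>0" using x by (auto elim!: nonpos_Ints_cases)
  have Gx: "Gamma x > 0" using x by (rule Gamma_real_pos)
  have "(\<lambda>m. (real m / real (Suc m)) powr x * (1 / (real m / real (Suc m) + x * (1 / real (Suc m)))) / Gamma_series x m)
      \<longlonglongrightarrow> 1 powr x * (1 / (1 + x * 0)) / Gamma x"
    using Gx by (intro tendsto_intros LIMSEQ_n_over_Suc_n LIMSEQ_Suc[OF lim_1_over_n] Gamma_series_LIMSEQ) auto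
  moreover have "\<forall>\<^sub>F m in sequentially. (real m / real (Suc m)) powr x * (1 / (real m / real (Suc m) + x * (1 / real (Suc m)))) / Gamma_series x m = \<rho> m"
    using eventually_gt_at_top[of 0]
  proof eventually_elim
    case (elim m)
    have m: "real m > 0" using elim by simp
    have pp: "pochhammer x m > 0" using x by (rule pochhammer_pos)
    have g: "Gamma_series x m = fact m * real m powr x / (pochhammer x m * (real m + x))"
      using m by (simp add: Gamma_series_def powr_def pochhammer_Suc add.commute)
    have d: "real m / real (Suc m) + x * (1 / real (Suc m)) = (real m + x) / (real m + 1)"
      by (simp add: add_divide_distrib add.commute)
    have "(real m / real (Suc m)) powr x = real m powr x / ((real m + 1) powr (x - 1) * (real m + 1))"
      using m by (simp add: powr_divide powr_diff add.commute)
    moreover have "(A / (B * M)) * (1 / (y / M)) / (F * A / (p * y)) = p / F / B"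
      if "A > 0" "B > 0" "M > 0" "y > 0" "p > 0" "F > 0" for A B M y p F :: real
      using that by (simp add: field_simps)
    ultimately show ?case unfolding g d \<rho>_def bin_def using m pp x by (simp add: add.commute[of x])
  qed
  ultimately have lim: "\<rho> \<longlonglongrightarrow> 1 / Gamma x"
    by (simp add: tendsto_cong)
  have lim2: "(\<lambda>m. inverse (\<rho> m)) \<longlonglongrightarrow> inverse (1 / Gamma x)"
    using Gx by (intro tendsto_inverse lim) auto
  obtain C where C: "C > 0" "\<And>m. norm (\<rho> m) \<le> C"
    using convergent_imp_Bseq[OF convergentI[OF lim]] unfolding Bseq_def by blast
  obtain D where D: "D > 0" "\<And>m. norm (inverse (\<rho> m)) \<le> D"
    using convergent_imp_Bseq[OF convergentI[OF lim2]] unfolding Bseq_def by blast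
  show ?thesis
  proof (rule that[of "1 / D" C])
    fix m
    have p: "(real m + 1) powr (x - 1) > 0" by simp
    have e: "bin x m = \<rho> m * (real m + 1) powr (x - 1)" using p by (simp add: \<rho>_def)
    have "inverse (\<rho> m) \<le> D" "\<rho> m \<le> C" using C(2)[of m] D(2)[of m] pos[of m] by auto
    then have "1 / D \<le> \<rho> m" using pos[of m] D(1) by (simp add: field_simps)
    then show "1 / D * (real m + 1) powr (x - 1) \<le> bin x m" unfolding e using p by (intro mult_right_mono) auto
    show "bin x m \<le> C * (real m + 1) powr (x - 1)" unfolding e using p \<open>\<rho> m \<le> C\<close> by (intro mult_right_mono) auto
  qed (use C D in auto)
qed

lemma fact_add_ge: "fact k * (real k + 1) ^ q \<le> fact (q + k)"
proof (induction q)
  case (Suc q)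
  have "fact k * (real k + 1) ^ Suc q = (real k + 1) * (fact k * (real k + 1) ^ q)" by simp
  also have "\<dots> \<le> (real (Suc (q + k))) * fact (q + k)"
    using Suc by (intro mult_mono) auto
  finally show ?case by simp
qed simp

text \<open>The terms decay like \<open>m powr (- 1 - a)\<close>. As the asymptotics are available
  for positive parameters only, the first \<open>q > a\<close> factors of the Pochhammer product are
  split off, which leaves the parameter \<open>q - a\<close>.\<close>

lemma bin_minus_summable:
  assumes "a \<ge> 0" shows "summable (\<lambda>m. \<bar>bin (- a) m\<bar>)"
proof (cases "a = 0")
  case True
  have "bin (- a) m = 0" if "m \<notin> {0}" for m using that True by (simp add: bin_def pochhammer_0_left)
  then show ?thesis by (intro summable_finite[of "{0}"]) auto
next
  case False
  then have a: "a > 0" using assms by simp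
  obtain q :: nat where q: "real q > a" using reals_Archimedean2 by blast
  obtain C where C: "C > 0" "\<And>m. bin (real q - a) m \<le> C * (real m + 1) powr (real q - a - 1)"
    using bin_asymptotic[of "real q - a"] q by (metis diff_gt_0_iff_gt)
  define D where "D = \<bar>pochhammer (- a) q\<bar>"
  have le: "\<bar>bin (- a) (q + k)\<bar> \<le> D * C * (real k + 1) powr (- 1 - a)" for k
  proof -
    have bp: "pochhammer (real q - a) k > 0" using q by (intro pochhammer_pos) auto
    have "\<bar>bin (- a) (q + k)\<bar> = D * (pochhammer (real q - a) k / fact (q + k))"
      using bp by (simp add: bin_def pochhammer_product' D_def abs_mult)
    also have "\<dots> \<le> D * (pochhammer (real q - a) k / (fact k * (real k + 1) ^ q))"
      using bp fact_add_ge[of k q] by (intro mult_left_mono divide_left_mono) (auto simp: D_def)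
    also have "\<dots> = D * (bin (real q - a) k / (real k + 1) ^ q)" by (simp add: bin_def)
    also have "\<dots> \<le> D * (C * (real k + 1) powr (real q - a - 1) / (real k + 1) ^ q)"
      using C(2) by (intro mult_left_mono divide_right_mono) (auto simp: D_def)
    also have "(real k + 1) powr (real q - a - 1) / (real k + 1) ^ q = (real k + 1) powr (- 1 - a)"
    proof -
      have "real q - a - 1 - real q = - 1 - a" by simp
      then show ?thesis by (simp only: powr_realpow[symmetric] powr_diff[symmetric])
    qed
    then have "D * (C * (real k + 1) powr (real q - a - 1) / (real k + 1) ^ q) = D * C * (real k + 1) powr (- 1 - a)"
      by (metis mult.assoc times_divide_eq_right)
    finally show ?thesis .
  qed
  have "summable (\<lambda>n. real n powr (- 1 - a))" using a by (simp add: summable_real_powr_iff)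
  then have "summable (\<lambda>k. real (Suc k) powr (- 1 - a))" by (subst summable_Suc_iff)
  then have "summable (\<lambda>k. D * C * (real k + 1) powr (- 1 - a))" by (intro summable_mult) (simp add: add.commute)
  then have "summable (\<lambda>k. \<bar>bin (- a) (q + k)\<bar>)"
    by (rule summable_comparison_test[rotated]) (use le in auto)
  then show ?thesis using summable_iff_shift[of "\<lambda>m. \<bar>bin (- a) m\<bar>" q] by (simp add: add.commute)
qed

lemma powr_square: "((x::real) powr e)\<^sup>2 = x powr (2 * e)"
  by (simp add: power2_eq_square flip: powr_add)

text \<open>Cauchy-Schwarz with the kernel split as \<open>sqrt (K * v)\<close> times
  \<open>sqrt (K / v)\<close>. The matrix is finite and upper triangular, and the bound does not
  involve its size \<open>N\<close>.\<close>

lemma schur_test: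
  fixes K :: "nat \<Rightarrow> nat \<Rightarrow> real"
  assumes K: "\<And>j k. K j k \<ge> 0" and v: "\<And>k. v k > 0"
    and 1: "\<And>j. j < N \<Longrightarrow> (\<Sum>k\<in>{j..<N}. K j k * v k) \<le> C1 * v j"
    and 2: "\<And>k. k < N \<Longrightarrow> (\<Sum>j\<le>k. K j k * v j) \<le> C2 * v k"
    and C: "C1 \<ge> 0"
  shows "(\<Sum>j<N. (\<Sum>k\<in>{j..<N}. K j k * x k)\<^sup>2) \<le> C1 * C2 * (\<Sum>k<N. (x k)\<^sup>2)"
proof -
  have "(\<Sum>k\<in>{j..<N}. K j k * x k)\<^sup>2 \<le> C1 * (\<Sum>k\<in>{j..<N}. K j k * v j * ((x k)\<^sup>2 / v k))" if "j < N" for j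
  proof -
    have "(\<Sum>k\<in>{j..<N}. K j k * x k) = (\<Sum>k\<in>{j..<N}. sqrt (K j k * v k) * (sqrt (K j k / v k) * x k))"
    proof (intro sum.cong refl)
      fix k
      have "sqrt (K j k * v k) * sqrt (K j k / v k) = K j k"
        using K[of j k] v[of k] by (simp flip: real_sqrt_mult)
      then show "K j k * x k = sqrt (K j k * v k) * (sqrt (K j k / v k) * x k)" by (simp flip: mult.assoc)
    qed
    then have "(\<Sum>k\<in>{j..<N}. K j k * x k)\<^sup>2 \<le>
        (\<Sum>k\<in>{j..<N}. (sqrt (K j k * v k))\<^sup>2) * (\<Sum>k\<in>{j..<N}. (sqrt (K j k / v k) * x k)\<^sup>2)"
      using Cauchy_Schwarz_ineq_sum[of "\<lambda>k. sqrt (K j k * v k)" "\<lambda>k. sqrt (K j k / v k) * x k" "{j..<N}"] by simp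
    also have "\<dots> = (\<Sum>k\<in>{j..<N}. K j k * v k) * (\<Sum>k\<in>{j..<N}. K j k / v k * (x k)\<^sup>2)"
      using K v by (simp add: power_mult_distrib less_imp_le)
    also have "\<dots> \<le> C1 * v j * (\<Sum>k\<in>{j..<N}. K j k / v k * (x k)\<^sup>2)"
      using K v that by (intro mult_right_mono 1 sum_nonneg mult_nonneg_nonneg divide_nonneg_nonneg) (auto simp: less_imp_le)
    finally show ?thesis by (simp add: sum_distrib_left mult_ac)
  qed
  then have "(\<Sum>j<N. (\<Sum>k\<in>{j..<N}. K j k * x k)\<^sup>2) \<le> (\<Sum>j<N. C1 * (\<Sum>k\<in>{j..<N}. K j k * v j * ((x k)\<^sup>2 / v k)))"
    by (intro sum_mono) auto
  also have "\<dots> = C1 * (\<Sum>j<N. \<Sum>k\<in>{j..<N}. K j k * v j * ((x k)\<^sup>2 / v k))"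
    by (simp add: sum_distrib_left)
  also have "(\<Sum>j<N. \<Sum>k\<in>{j..<N}. K j k * v j * ((x k)\<^sup>2 / v k)) = (\<Sum>k<N. \<Sum>j\<le>k. K j k * v j * ((x k)\<^sup>2 / v k))"
    unfolding sum.Sigma[OF finite_lessThan ballI[OF finite_atLeastLessThan]]
      sum.Sigma[OF finite_lessThan ballI[OF finite_atMost]]
    by (rule sum.reindex_bij_witness[where i="\<lambda>(k, j). (j, k)" and j="\<lambda>(j, k). (k, j)"]) auto
  also have "\<dots> = (\<Sum>k<N. (\<Sum>j\<le>k. K j k * v j) * ((x k)\<^sup>2 / v k))"
    by (simp only: sum_distrib_right)
  also have "\<dots> \<le> (\<Sum>k<N. C2 * v k * ((x k)\<^sup>2 / v k))"
    using v by (intro sum_mono mult_right_mono 2) (auto simp: less_imp_le)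
  also have "\<dots> = C2 * (\<Sum>k<N. (x k)\<^sup>2)"
    using v by (simp add: sum_distrib_left less_imp_neq[THEN not_sym])
  finally show ?thesis using C by (simp add: mult_left_mono mult.assoc)
qed

text \<open>Young's inequality for a summable kernel. The weight passes through because only indices
  \<open>k \<ge> j\<close> enter and it is nondecreasing for \<open>e \<ge> 0\<close>.\<close>

lemma convolution_bound:
  fixes b :: "nat \<Rightarrow> real" and x :: "nat \<Rightarrow> real"
  assumes b: "summable (\<lambda>m. \<bar>b m\<bar>)" and e: "e \<ge> 0" and x: "\<And>k. x k \<ge> 0"
  shows "(\<Sum>j<N. (real j + 1) powr (2 * e) * (\<Sum>k\<in>{j..<N}. \<bar>b (k - j)\<bar> * x k)\<^sup>2)
    \<le> (\<Sum>m. \<bar>b m\<bar>)\<^sup>2 * (\<Sum>k<N. (real k + 1) powr (2 * e) * (x k)\<^sup>2)"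
proof -
  define B where "B = (\<Sum>m. \<bar>b m\<bar>)"
  have B: "B \<ge> 0" unfolding B_def by (intro suminf_nonneg b) auto
  have part: "sum (\<lambda>m. \<bar>b m\<bar>) I \<le> B" if "finite I" for I
    unfolding B_def using that by (intro sum_le_suminf b) auto
  have "(\<Sum>j<N. (real j + 1) powr (2 * e) * (\<Sum>k\<in>{j..<N}. \<bar>b (k - j)\<bar> * x k)\<^sup>2) \<le>
      (\<Sum>j<N. (\<Sum>k\<in>{j..<N}. \<bar>b (k - j)\<bar> * ((real k + 1) powr e * x k))\<^sup>2)"
  proof (intro sum_mono)
    fix j
    have "(\<Sum>k\<in>{j..<N}. \<bar>b (k - j)\<bar> * ((real j + 1) powr e * x k)) = (real j + 1) powr e * (\<Sum>k\<in>{j..<N}. \<bar>b (k - j)\<bar> * x k)"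
      by (simp add: sum_distrib_left mult_ac)
    then have "(real j + 1) powr (2 * e) * (\<Sum>k\<in>{j..<N}. \<bar>b (k - j)\<bar> * x k)\<^sup>2 =
        (\<Sum>k\<in>{j..<N}. \<bar>b (k - j)\<bar> * ((real j + 1) powr e * x k))\<^sup>2"
      by (simp only: power_mult_distrib powr_square)
    also have "\<dots> \<le> (\<Sum>k\<in>{j..<N}. \<bar>b (k - j)\<bar> * ((real k + 1) powr e * x k))\<^sup>2"
      using e x by (intro power_mono sum_mono mult_left_mono mult_right_mono powr_mono2 sum_nonneg) auto
    finally show "(real j + 1) powr (2 * e) * (\<Sum>k\<in>{j..<N}. \<bar>b (k - j)\<bar> * x k)\<^sup>2 \<le>
      (\<Sum>k\<in>{j..<N}. \<bar>b (k - j)\<bar> * ((real k + 1) powr e * x k))\<^sup>2" .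
  qed
  also have "\<dots> \<le> B * B * (\<Sum>k<N. ((real k + 1) powr e * x k)\<^sup>2)"
  proof (rule schur_test[where v="\<lambda>_. 1"])
    fix j assume "j < N"
    have "(\<Sum>k\<in>{j..<N}. \<bar>b (k - j)\<bar>) = sum (\<lambda>m. \<bar>b m\<bar>) {..<N - j}"
      by (rule sum.reindex_bij_witness[where i="\<lambda>m. m + j" and j="\<lambda>k. k - j"]) auto
    then show "(\<Sum>k\<in>{j..<N}. \<bar>b (k - j)\<bar> * 1) \<le> B * 1" using part[of "{..<N - j}"] by simp
  next
    fix k
    have "(\<Sum>j\<le>k. \<bar>b (k - j)\<bar>) = sum (\<lambda>m. \<bar>b m\<bar>) {..k}"
      by (rule sum.reindex_bij_witness[where i="\<lambda>m. k - m" and j="\<lambda>j. k - j"]) auto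
    then show "(\<Sum>j\<le>k. \<bar>b (k - j)\<bar> * 1) \<le> B * 1" using part[of "{..k}"] by simp
  qed (use B in auto)
  also have "(\<Sum>k<N. ((real k + 1) powr e * x k)\<^sup>2) = (\<Sum>k<N. (real k + 1) powr (2 * e) * (x k)\<^sup>2)"
    by (simp only: power_mult_distrib powr_square)
  finally show ?thesis by (simp add: B_def power2_eq_square)
qed

text \<open>Comparison with an integral: by the mean value theorem \<open>s\<close> times a term is
  at most \<open>m powr (- s) - (m + 1) powr (- s)\<close>, and these differences telescope.\<close>

lemma powr_tail_sum_le:
  assumes s: "s > 0"
  shows "(\<Sum>m\<in>{Suc j..<Suc (j + n)}. (real m + 1) powr (- 1 - s)) \<le> (real j + 1) powr (- s) / s"
proof -
  have step: "s * (real m + 1) powr (- 1 - s) \<le> real m powr (- s) - (real m + 1) powr (- s)" if m: "m > 0" for m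
  proof -
    have "\<exists>z::real. real m < z \<and> z < real m + 1 \<and>
      (real m + 1) powr (- s) - real m powr (- s) = (real m + 1 - real m) * (- s * z powr (- s - 1))"
      using m by (intro MVT2) (auto intro!: derivative_eq_intros)
    then obtain z where z: "real m < z" "z < real m + 1"
      "(real m + 1) powr (- s) - real m powr (- s) = - s * z powr (- s - 1)" by auto
    have "(real m + 1) powr (- 1 - s) \<le> z powr (- 1 - s)"
      using z m s by (intro powr_mono2') auto
    then have "s * (real m + 1) powr (- 1 - s) \<le> s * z powr (- 1 - s)" using s by simp
    also have "\<dots> = real m powr (- s) - (real m + 1) powr (- s)"    proof -
      have "- 1 - s = - s - 1" by simp
      moreover have "s * z powr (- s - 1) = real m powr (- s) - (real m + 1) powr (- s)"
        using z(3) by linarith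
      ultimately show ?thesis by (simp only:)
    qed
    finally show ?thesis .
  qed
  have "s * (\<Sum>m\<in>{Suc j..<Suc (j + n)}. (real m + 1) powr (- 1 - s)) \<le> (real j + 1) powr (- s) - (real (j + n) + 1) powr (- s)"
  proof (induction n)
    case (Suc n)
    have "{Suc j..<Suc (j + Suc n)} = insert (Suc (j + n)) {Suc j..<Suc (j + n)}" by auto
    then have "s * (\<Sum>m\<in>{Suc j..<Suc (j + Suc n)}. (real m + 1) powr (- 1 - s)) =
        s * (real (Suc (j + n)) + 1) powr (- 1 - s) + s * (\<Sum>m\<in>{Suc j..<Suc (j + n)}. (real m + 1) powr (- 1 - s))"
      by (simp add: distrib_left)
    also have "\<dots> \<le> (real (Suc (j + n)) powr (- s) - (real (Suc (j + n)) + 1) powr (- s)) +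
        ((real j + 1) powr (- s) - (real (j + n) + 1) powr (- s))"
      by (intro add_mono Suc step) auto
    also have "\<dots> = (real j + 1) powr (- s) - (real (j + Suc n) + 1) powr (- s)"
      by (simp add: add_ac)
    finally show ?case .
  qed simp
  also have "\<dots> \<le> (real j + 1) powr (- s)" by simp
  finally show ?thesis using s by (simp add: field_simps)
qed

lemma bin_one: "bin 1 m = 1"
  by (simp add: bin_def pochhammer_fact[symmetric])

text \<open>The sum is split where \<open>k - j\<close> passes \<open>j\<close>. Before that, the
  power is at most its value at \<open>j\<close> and the binomials add up to
  \<open>bin (a + 1) j\<close>; beyond it the terms are dominated by
  \<open>(m + 1) powr (- 1 - s)\<close> with \<open>m = k - j\<close>.\<close>

lemma bin_weyl_sum_le:
  assumes a: "a > 0" and s: "s > 0"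
  obtains C where "C \<ge> 0" "\<And>j N. (\<Sum>k\<in>{j..<N}. bin a (k - j) * (real k + 1) powr (- a - s)) \<le> C * (real j + 1) powr (- s)"
proof -
  obtain C where C: "C > 0" "\<And>m. bin a m \<le> C * (real m + 1) powr (a - 1)"
    using bin_asymptotic[OF a] by metis
  obtain C' where C': "C' > 0" "\<And>m. bin (a + 1) m \<le> C' * (real m + 1) powr (a + 1 - 1)"
    using bin_asymptotic[of "a + 1"] a by (metis add_pos_pos zero_less_one)
  show ?thesis
  proof (rule that[of "C' + C / s"])
    show "0 \<le> C' + C / s" using C C' s by simp
    fix j N
    let ?g = "\<lambda>m. bin a m * (real (j + m) + 1) powr (- a - s)"
    have g0: "?g m \<ge> 0" for m using bin_pos[OF a, of m] by simp
    have "(\<Sum>k\<in>{j..<N}. bin a (k - j) * (real k + 1) powr (- a - s)) = sum ?g {..<N - j}"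
      by (rule sum.reindex_bij_witness[where i="\<lambda>m. m + j" and j="\<lambda>k. k - j"]) (auto simp: add_ac)
    also have "\<dots> \<le> sum ?g ({..j} \<union> {Suc j..<Suc (j + N)})"
      using g0 by (intro sum_mono2) auto
    also have "\<dots> = sum ?g {..j} + sum ?g {Suc j..<Suc (j + N)}"
      by (intro sum.union_disjoint) auto
    also have "sum ?g {..j} \<le> C' * (real j + 1) powr (- s)"
    proof -
      have "sum ?g {..j} \<le> (\<Sum>m\<le>j. bin a m * (real j + 1) powr (- a - s))"
        using bin_pos[OF a] a s by (intro sum_mono mult_left_mono powr_mono2') (auto simp: less_imp_le)
      also have "\<dots> = bin (a + 1) j * (real j + 1) powr (- a - s)"
        by (simp add: bin_add bin_one sum_distrib_right)
      also have "\<dots> \<le> C' * (real j + 1) powr a * (real j + 1) powr (- a - s)"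
        using C'(2)[of j] by (intro mult_right_mono) auto
      also have "\<dots> = C' * (real j + 1) powr (- s)" by (simp add: mult.assoc flip: powr_add)
      finally show ?thesis .
    qed
    also have "sum ?g {Suc j..<Suc (j + N)} \<le> C / s * (real j + 1) powr (- s)"
    proof -
      have "sum ?g {Suc j..<Suc (j + N)} \<le> (\<Sum>m\<in>{Suc j..<Suc (j + N)}. C * (real m + 1) powr (- 1 - s))"
      proof (intro sum_mono)
        fix m
        have "?g m \<le> (C * (real m + 1) powr (a - 1)) * (real m + 1) powr (- a - s)"
          using C(1) a s bin_pos[OF a, of m] by (intro mult_mono C(2) powr_mono2') auto
        also have "\<dots> = C * (real m + 1) powr (- 1 - s)" by (simp add: mult.assoc flip: powr_add)
        finally show "?g m \<le> C * (real m + 1) powr (- 1 - s)" .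
      qed
      also have "\<dots> \<le> C * ((real j + 1) powr (- s) / s)"
        unfolding sum_distrib_left[symmetric] using C(1) by (intro mult_left_mono powr_tail_sum_le s) auto
      finally show ?thesis by simp
    qed
    finally show "(\<Sum>k\<in>{j..<N}. bin a (k - j) * (real k + 1) powr (- a - s)) \<le> (C' + C / s) * (real j + 1) powr (- s)"
      by (simp add: distrib_right)
  qed
qed

text \<open>A discrete Hardy inequality for the Weyl fractional sum of order \<open>a\<close>: Schur's test with
  the weight \<open>(k + 1) powr (- 1 / 2)\<close>, which is admissible precisely because \<open>s > - 1 / 2\<close>.\<close>

lemma fractional_hardy:
  assumes a: "a > 0" and s: "s > - (1 / 2)"
  obtains C where "C \<ge> 0" "\<And>N x. (\<Sum>j<N. (real j + 1) powr (2 * s) * (\<Sum>k\<in>{j..<N}. bin a (k - j) * x k)\<^sup>2)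
    \<le> C * (\<Sum>k<N. (real k + 1) powr (2 * (a + s)) * (x k)\<^sup>2)"
proof -
  define v where "v k = (real k + 1) powr (- (1 / 2))" for k :: nat
  \<comment> \<open>The weights of both sides are moved into the kernel, so that an unweighted bound
    remains to be shown.\<close>
  define K where "K j k = (real j + 1) powr s * (bin a (k - j) * (real k + 1) powr (- a - s))" for j k :: nat
  have Kpos: "K j k \<ge> 0" for j k using bin_pos[OF a] by (simp add: K_def less_imp_le)
  obtain C1 where C1: "C1 \<ge> 0" "\<And>j N. (\<Sum>k\<in>{j..<N}. bin a (k - j) * (real k + 1) powr (- a - (s + 1 / 2))) \<le> C1 * (real j + 1) powr (- (s + 1 / 2))"
    using bin_weyl_sum_le[OF a, of "s + 1 / 2"] s by auto
  obtain c where c: "c > 0" "\<And>m. c * (real m + 1) powr (s + 1 / 2 - 1) \<le> bin (s + 1 / 2) m"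
  proof -
    have "s + 1 / 2 > 0" using s by simp
    from bin_asymptotic[OF this] show ?thesis using that by metis
  qed
  obtain C' where C': "C' > 0" "\<And>m. bin (s + 1 / 2 + a) m \<le> C' * (real m + 1) powr (s + 1 / 2 + a - 1)"
  proof -
    have "s + 1 / 2 + a > 0" using s a by simp
    from bin_asymptotic[OF this] show ?thesis using that by metis
  qed
  have 1: "(\<Sum>k\<in>{j..<N}. K j k * v k) \<le> C1 * v j" for j N
  proof -
    have "K j k * v k = (real j + 1) powr s * (bin a (k - j) * (real k + 1) powr (- a - (s + 1 / 2)))" for k
    proof -
      have "(real k + 1) powr (- a - s) * v k = (real k + 1) powr (- a - (s + 1 / 2))"
        unfolding v_def powr_add[symmetric] by (simp add: algebra_simps)
      then show ?thesis by (simp add: K_def mult.assoc)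
    qed
    then have "(\<Sum>k\<in>{j..<N}. K j k * v k) = (real j + 1) powr s * (\<Sum>k\<in>{j..<N}. bin a (k - j) * (real k + 1) powr (- a - (s + 1 / 2)))"
      by (simp add: sum_distrib_left)
    also have "\<dots> \<le> (real j + 1) powr s * (C1 * (real j + 1) powr (- (s + 1 / 2)))"
      by (intro mult_left_mono C1) auto
    also have "\<dots> = C1 * ((real j + 1) powr s * (real j + 1) powr (- (s + 1 / 2)))" by simp
    also have "(real j + 1) powr s * (real j + 1) powr (- (s + 1 / 2)) = v j"
      unfolding v_def powr_add[symmetric] by simp
    finally show ?thesis .
  qed
  \<comment> \<open>For the column sums the lower bound of the asymptotics replaces
    \<open>(j + 1) powr (s - 1 / 2)\<close> by a multiple of \<open>bin (s + 1 / 2) j\<close>, after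
    which the sum is an exact convolution.\<close>
  have 2: "(\<Sum>j\<le>k. K j k * v j) \<le> C' / c * v k" for k
  proof -
    have "(\<Sum>j\<le>k. K j k * v j) \<le> (\<Sum>j\<le>k. (real k + 1) powr (- a - s) * (1 / c) * (bin (s + 1 / 2) j * bin a (k - j)))"
    proof (intro sum_mono)
      fix j
      have "(real j + 1) powr s * v j = (real j + 1) powr (s + 1 / 2 - 1)"
        unfolding v_def powr_add[symmetric] by simp
      also have "\<dots> \<le> (1 / c) * bin (s + 1 / 2) j" using c(2)[of j] c(1) by (simp add: field_simps)
      finally have "(real j + 1) powr s * v j * (bin a (k - j) * (real k + 1) powr (- a - s)) \<le>
          (1 / c) * bin (s + 1 / 2) j * (bin a (k - j) * (real k + 1) powr (- a - s))"
        using bin_pos[OF a, of "k - j"] by (intro mult_right_mono) auto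
      then show "K j k * v j \<le> (real k + 1) powr (- a - s) * (1 / c) * (bin (s + 1 / 2) j * bin a (k - j))"
        by (simp add: K_def mult_ac)
    qed
    also have "\<dots> = (real k + 1) powr (- a - s) * (1 / c) * bin (s + 1 / 2 + a) k"
      by (simp add: bin_add sum_distrib_left)
    also have "\<dots> \<le> (real k + 1) powr (- a - s) * (1 / c) * (C' * (real k + 1) powr (s + 1 / 2 + a - 1))"
      using c(1) by (intro mult_left_mono C') auto
    also have "\<dots> = C' / c * ((real k + 1) powr (- a - s) * (real k + 1) powr (s + 1 / 2 + a - 1))" by simp
    also have "(real k + 1) powr (- a - s) * (real k + 1) powr (s + 1 / 2 + a - 1) = v k"
      unfolding v_def powr_add[symmetric] by simp
    finally show ?thesis .
  qed
  show ?thesis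
  proof (rule that[of "C1 * (C' / c)"])
    show "0 \<le> C1 * (C' / c)" using C1 C' c by simp
    fix N and x :: "nat \<Rightarrow> real"
    define y where "y k = (real k + 1) powr (a + s) * x k" for k
    have "(\<Sum>j<N. (\<Sum>k\<in>{j..<N}. K j k * y k)\<^sup>2) \<le> C1 * (C' / c) * (\<Sum>k<N. (y k)\<^sup>2)"
      by (rule schur_test[where v=v]) (use Kpos C1(1) 1 2 in \<open>auto simp: v_def\<close>)
    moreover have "(\<Sum>k\<in>{j..<N}. K j k * y k)\<^sup>2 = (real j + 1) powr (2 * s) * (\<Sum>k\<in>{j..<N}. bin a (k - j) * x k)\<^sup>2" for j
    proof -
      have "K j k * y k = (real j + 1) powr s * (bin a (k - j) * x k)" for k
      proof -
        have "(real k + 1) powr (- a - s) * ((real k + 1) powr (a + s)) = 1" by (simp flip: powr_add)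
        then have "(real k + 1) powr (- a - s) * ((real k + 1) powr (a + s) * x k) = x k" by (simp flip: mult.assoc)
        then show ?thesis by (simp add: K_def y_def mult.assoc)
      qed
      then have "(\<Sum>k\<in>{j..<N}. K j k * y k) = (real j + 1) powr s * (\<Sum>k\<in>{j..<N}. bin a (k - j) * x k)"
        by (simp add: sum_distrib_left)
      then show ?thesis by (simp only: power_mult_distrib powr_square)
    qed
    moreover have "(y k)\<^sup>2 = (real k + 1) powr (2 * (a + s)) * (x k)\<^sup>2" for k
      by (simp only: y_def power_mult_distrib powr_square)
    ultimately show "(\<Sum>j<N. (real j + 1) powr (2 * s) * (\<Sum>k\<in>{j..<N}. bin a (k - j) * x k)\<^sup>2)
      \<le> C1 * (C' / c) * (\<Sum>k<N. (real k + 1) powr (2 * (a + s)) * (x k)\<^sup>2)" by simp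
  qed
qed

section \<open>Taylor coefficients of the regular factor of the weight\<close>

lemma Ln_mult_right_half_plane:
  assumes "Re a > 0" "Re b > 0"
  shows "Ln (a * b) = Ln a + Ln b"
proof -
  have "\<bar>Im (Ln a)\<bar> < pi / 2" "\<bar>Im (Ln b)\<bar> < pi / 2"
    using assms by (auto intro: Re_Ln_pos_lt_imp simp del: less_divide_eq_numeral1)
  then show ?thesis using assms by (intro Ln_times_simple) auto
qed

text \<open>Taylor coefficients of \<open>((3 - u) / 2) powr r\<close> at the origin. The branch
  point \<open>u = 3\<close> lies outside the closed disc, hence the geometric factor.\<close>

definition ratio_coeff :: "real \<Rightarrow> nat \<Rightarrow> real" where
  "ratio_coeff r m = (3 / 2) powr r * (bin (- r) m * (1 / 3) ^ m)"

lemma ratio_coeff_summable: "summable (\<lambda>m. \<bar>ratio_coeff r m\<bar>)"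
  using summable_mult[OF bin_summable_norm[of "1 / 3" "- r"], of "(3 / 2) powr r"]
  by (simp add: ratio_coeff_def abs_mult)

lemma ratio_sums:
  assumes "cmod u \<le> 1"
  shows "(\<lambda>m. of_real (ratio_coeff r m) * u ^ m) sums (((3 - u) / 2) powr of_real r)"
proof -
  have u3: "cmod (u / 3) < 1" using assms by (simp add: norm_divide)
  have R: "Re (1 - u / 3) > 0" using complex_Re_le_cmod[of u] assms by simp
  have "(\<lambda>m. of_real ((3 / 2) powr r) * (of_real (bin (- r) m) * (u / 3) ^ m)) sums
      (of_real ((3 / 2) powr r) * (1 - u / 3) powr (- of_real (- r)))"
    by (intro sums_mult bin_sums u3)
  moreover have "of_real ((3 / 2) powr r) * (1 - u / 3) powr (- of_real (- r)) = ((3 - u) / 2) powr of_real r"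
  proof -
    have L: "Ln (of_real (3 / 2) * (1 - u / 3)) = Ln (of_real (3 / 2)) + Ln (1 - u / 3)"
      using R by (intro Ln_mult_right_half_plane) auto
    have l32: "Ln (of_real (3 / 2)) = of_real (ln (3 / 2))" by (rule Ln_of_real) auto
    have e: "(3 - u) / 2 = of_real (3 / 2) * (1 - u / 3)" by (simp add: field_simps)
    have nz: "of_real (3 / 2) * (1 - u / 3) \<noteq> 0" "1 - u / 3 \<noteq> 0" using R by auto
    have "((3 - u) / 2) powr of_real r = exp (of_real r * of_real (ln (3 / 2)) + of_real r * Ln (1 - u / 3))"
      unfolding e using nz by (simp only: powr_def if_False L l32 distrib_left)
    also have "\<dots> = of_real (exp (r * ln (3 / 2))) * exp (of_real r * Ln (1 - u / 3))"
      by (simp only: exp_add exp_of_real[symmetric] of_real_mult)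
    also have "exp (r * ln (3 / 2)) = (3 / 2) powr r" by (simp add: powr_def)
    finally show ?thesis using nz(2) by (simp add: powr_def)
  qed
  moreover have "of_real (ratio_coeff r m) * u ^ m = of_real ((3 / 2) powr r) * (of_real (bin (- r) m) * (u / 3) ^ m)" for m
    by (simp add: ratio_coeff_def power_divide)
  ultimately show ?thesis by simp
qed

section \<open>Fourier transforms of test functions against the weight\<close>

lemma compact_support_integrable:
  fixes f :: "real \<Rightarrow> complex"
  assumes c: "continuous_on UNIV f" and z: "\<And>x. x \<notin> {a..b} \<Longrightarrow> f x = 0"
  shows "integrable lborel f" "integrable lebesgue f"
proof -
  have "set_integrable lborel {a..b} f"
    by (intro borel_integrable_atLeastAtMost' continuous_on_subset[OF c]) auto
  moreover have "(\<lambda>x. indicator {a..b} x *\<^sub>R f x) = f" using z by (auto simp: indicator_def)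
  ultimately show i: "integrable lborel f" by (simp add: set_integrable_def)
  show "integrable lebesgue f"
    by (subst integrable_completion) (use i in \<open>auto simp: borel_measurable_integrable\<close>)
qed

lemma compact_support_integral_deriv:
  fixes F f :: "real \<Rightarrow> complex"
  assumes D: "\<And>x. (F has_vector_derivative f x) (at x)" and c: "continuous_on UNIV f"
    and z: "\<And>x. x \<notin> {a..b} \<Longrightarrow> F x = 0" "\<And>x. x \<notin> {a..b} \<Longrightarrow> f x = 0"
  shows "(LINT x|lebesgue. f x) = 0"
proof (cases "a \<le> b")
  case True
  have "(LINT x|lebesgue. f x) = (LINT x|lborel. f x)"
    by (rule integral_completion) (use borel_measurable_continuous_onI[OF c] in simp)
  also have "\<dots> = (LINT x|lborel. indicator {a - 1..b + 1} x *\<^sub>R f x)"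
    using z(2) by (intro Bochner_Integration.integral_cong) (auto simp: indicator_def)
  also have "\<dots> = F (b + 1) - F (a - 1)"
    by (rule integral_FTC_Icc) (use True in \<open>auto intro!: has_vector_derivative_at_within[OF D] continuous_on_subset[OF c]\<close>)
  also have "\<dots> = 0" by (simp add: z)
  finally show ?thesis .
next
  case False
  then have "f x = 0" for x using z(2)[of x] by auto
  then show ?thesis by simp
qed

definition test_chain :: "(nat \<Rightarrow> real \<Rightarrow> complex) \<Rightarrow> real \<Rightarrow> real \<Rightarrow> bool" where
  "test_chain d a b \<longleftrightarrow> 0 < a \<and> deriv_chain d UNIV \<and> (\<forall>i x. x \<notin> {a..b} \<longrightarrow> d i x = 0)"

lemma test_chainD:
  assumes "test_chain d a b"
  shows "0 < a" "deriv_chain d UNIV" "x \<notin> {a..b} \<Longrightarrow> d i x = 0" "continuous_on S (d i)" "integrable lebesgue (d i)"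
    "d i \<in> borel_measurable lebesgue"
proof -
  show "0 < a" and d: "deriv_chain d UNIV" and z: "\<And>x i. x \<notin> {a..b} \<Longrightarrow> d i x = 0"
    using assms by (auto simp: test_chain_def)
  have c: "continuous_on UNIV (d i)" by (rule deriv_chain_continuous[OF d])
  then show "continuous_on S (d i)" by (rule continuous_on_subset) simp
  show "integrable lebesgue (d i)" by (rule compact_support_integrable(2)[OF c z])
  show "d i \<in> borel_measurable lebesgue" by (rule continuous_imp_lebesgue[OF c])
qed

lemma deriv_chain_zero:
  assumes d: "deriv_chain d UNIV" and S: "open S" "\<And>x. x \<in> S \<Longrightarrow> d 0 x = 0"
  shows "x \<in> S \<Longrightarrow> d i x = 0"
proof (induction i arbitrary: x)
  case (Suc i)
  have "((\<lambda>x. 0) has_vector_derivative d (Suc i) x) (at x)"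
    by (rule has_vector_derivative_transform_within_open[OF deriv_chainD[OF d] S(1)]) (use Suc in auto)
  then show ?case using vector_derivative_unique_at[OF _ has_vector_derivative_const] by blast
qed (use S in auto)

lemma test_function_test_chain:
  assumes "\<phi> \<in> test_functions {0<..}"
  obtains d a b where "d 0 = \<phi>" "test_chain d a b"
proof -
  let ?K = "closure {x. \<phi> x \<noteq> 0}"
  have K: "compact ?K" "?K \<subseteq> {0<..}" using assms by (auto simp: test_functions_def)
  obtain a b where ab: "0 < a" "?K \<subseteq> {a..b}"
  proof (cases "?K = {}")
    case True
    then show ?thesis using that[of 1 1] by simp
  next
    case False
    obtain a where a: "a \<in> ?K" "\<forall>y\<in>?K. a \<le> y" using compact_attains_inf[OF K(1) False] by blast
    obtain b where b: "b \<in> ?K" "\<forall>y\<in>?K. y \<le> b" using compact_attains_sup[OF K(1) False] by blast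
    show ?thesis by (rule that[of a b]) (use a b K(2) in auto)
  qed
  obtain d where d: "d 0 = \<phi>" "deriv_chain d UNIV" using test_function_chain[OF assms] by blast
  have "d i x = 0" if "x \<notin> {a..b}" for i x
  proof (rule deriv_chain_zero[OF d(2), of "- {a..b}"])
    fix y assume "y \<in> - {a..b}"
    then have "y \<notin> ?K" using ab(2) by auto
    then show "d 0 y = 0" using closure_subset[of "{x. \<phi> x \<noteq> 0}"] d(1) by auto
  qed (use that in auto)
  then show ?thesis using that[of d a b] d ab by (auto simp: test_chain_def)
qed

lemma test_chain_test_function:
  assumes "test_chain d a b" shows "d 0 \<in> test_functions {0<..}"
proof -
  have "closure {x. d 0 x \<noteq> 0} \<subseteq> {a..b}"
    using test_chainD(3)[OF assms, of _ 0] by (intro closure_minimal subsetI) (blast, simp)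
  then show ?thesis using test_chainD(1,2)[OF assms] unfolding test_functions_def smooth_iff_deriv_chain
    by (auto simp: compact_eq_bounded_closed intro: bounded_subset[of "{a..b}"])
qed

text \<open>The continuation of the Fourier transform to \<open>Re p \<ge> 0\<close>, the image of
  the disc; imaginary \<open>p\<close> corresponds to the circle.\<close>

definition laplace :: "(real \<Rightarrow> complex) \<Rightarrow> complex \<Rightarrow> complex" where
  "laplace \<phi> p = (LINT x|lebesgue. exp (- p * of_real x) * \<phi> x)"

lemma fourier_laplace: "fourier \<phi> x = of_real (1 / sqrt (2 * pi)) * laplace \<phi> (\<i> * of_real x)"
  by (simp add: fourier_def laplace_def)

lemma laplace_deriv:
  assumes "test_chain d a b" shows "laplace (d (Suc i)) p = p * laplace (d i) p"
proof -
  note D = test_chainD[OF assms]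
  let ?e = "\<lambda>x. exp (- p * complex_of_real x)"
  have e: "(?e has_vector_derivative - p * ?e x) (at x)" for x
    by (rule has_vector_derivative_real_field) (auto intro!: derivative_eq_intros)
  have ec: "continuous_on UNIV ?e" by (intro continuous_intros)
  have c: "continuous_on UNIV (\<lambda>x. ?e x * d i x)" for i by (intro continuous_intros ec D(4))
  have i: "integrable lebesgue (\<lambda>x. ?e x * d i x)" for i
    by (rule compact_support_integrable(2)[OF c]) (use D(3) in simp)
  have "(LINT x|lebesgue. ?e x * d (Suc i) x + (- p) * (?e x * d i x)) = 0"
  proof (rule compact_support_integral_deriv)
    show "((\<lambda>x. ?e x * d i x) has_vector_derivative ?e x * d (Suc i) x + (- p) * (?e x * d i x)) (at x)" for x
      using has_vector_derivative_mult[OF e deriv_chainD[OF D(2), of x i]] by (simp add: mult.assoc)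
    show "continuous_on UNIV (\<lambda>x. ?e x * d (Suc i) x + (- p) * (?e x * d i x))"
      by (intro continuous_on_add continuous_on_mult_left c)
    show "x \<notin> {a..b} \<Longrightarrow> ?e x * d i x = 0" "x \<notin> {a..b} \<Longrightarrow> ?e x * d (Suc i) x + (- p) * (?e x * d i x) = 0" for x
      using D(3) by simp_all
  qed
  then have "(LINT x|lebesgue. ?e x * d (Suc i) x) + (- p) * (LINT x|lebesgue. ?e x * d i x) = 0"
    using Bochner_Integration.integral_add[OF i integrable_mult_right[OF i, of "- p"], of "Suc i" i]
    by (simp only: integral_mult_right_zero)
  then show ?thesis by (simp add: laplace_def)
qed

lemma laplace_norm_le:
  assumes "test_chain d a b" "Re p \<ge> 0"
  shows "cmod (laplace (d i) p) \<le> (LINT x|lebesgue. cmod (d i x))"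
  unfolding laplace_def
proof (rule order_trans[OF integral_norm_bound], rule integral_mono)
  note D = test_chainD[OF assms(1)]
  have le: "cmod (exp (- p * of_real x) * d i x) \<le> cmod (d i x)" for x
  proof (cases "x > 0")
    case True
    then have "cmod (exp (- p * of_real x)) \<le> 1" using assms(2) by (simp add: norm_exp_eq_Re)
    then show ?thesis by (simp add: norm_mult mult_left_le_one_le)
  next
    case False
    then have "d i x = 0" using D(1) by (intro D(3)) auto
    then show ?thesis by simp
  qed
  then show "\<And>x. cmod (exp (- p * of_real x) * d i x) \<le> cmod (d i x)" .
  show n: "integrable lebesgue (\<lambda>x. cmod (d i x))" by (intro integrable_norm D)
  have "continuous_on UNIV (\<lambda>x. exp (- p * complex_of_real x) * d i x)" by (intro continuous_intros D(4))
  from compact_support_integrable(2)[OF this, of a b] D(3)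
  show "integrable lebesgue (\<lambda>x. cmod (exp (- p * of_real x) * d i x))" by (intro integrable_norm) simp
qed

text \<open>\<open>p ^ n\<close> times the transform is the transform of the \<open>n\<close>-th
  derivative. Only two integrals enter the bound, so that it can be kept uniform along a sequence of
  test functions.\<close>

lemma laplace_decay:
  assumes "test_chain d a b" "Re p \<ge> 0"
  shows "(1 + cmod p) ^ n * cmod (laplace (d 0) p) \<le> 2 ^ n * ((LINT x|lebesgue. cmod (d 0 x)) + (LINT x|lebesgue. cmod (d n x)))"
proof -
  have pn: "laplace (d n) p = p ^ n * laplace (d 0) p"
    by (induction n) (auto simp: laplace_deriv[OF assms(1)])
  have "(1 + cmod p) ^ n \<le> (2 * max 1 (cmod p)) ^ n" by (intro power_mono) auto
  also have "\<dots> \<le> 2 ^ n * (1 + cmod p ^ n)"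
    by (cases "cmod p \<le> 1") (auto simp: power_mult_distrib max_def)
  finally have "(1 + cmod p) ^ n * cmod (laplace (d 0) p) \<le> 2 ^ n * (1 + cmod p ^ n) * cmod (laplace (d 0) p)"
    by (intro mult_right_mono) auto
  also have "\<dots> = 2 ^ n * (cmod (laplace (d 0) p) + cmod (laplace (d n) p))"
    unfolding pn by (simp add: norm_mult norm_power algebra_simps)
  also have "\<dots> \<le> 2 ^ n * ((LINT x|lebesgue. cmod (d 0 x)) + (LINT x|lebesgue. cmod (d n x)))"
    by (intro mult_left_mono add_mono laplace_norm_le[OF assms]) auto
  finally show ?thesis .
qed

lemma laplace_tendsto:
  assumes "test_chain d a b" and p: "p \<longlonglongrightarrow> q" "\<And>n. Re (p n) \<ge> 0"
  shows "(\<lambda>n. laplace (d 0) (p n)) \<longlonglongrightarrow> laplace (d 0) q"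
  unfolding laplace_def
proof (rule integral_dominated_convergence[where w="\<lambda>x. cmod (d 0 x)"])
  note D = test_chainD[OF assms(1)]
  have "continuous_on UNIV (\<lambda>x. exp (- p * complex_of_real x) * d 0 x)" for p by (intro continuous_intros D(4))
  then show "(\<lambda>x. exp (- q * of_real x) * d 0 x) \<in> borel_measurable lebesgue"
    "\<And>n. (\<lambda>x. exp (- p n * of_real x) * d 0 x) \<in> borel_measurable lebesgue"
    by (auto intro: continuous_imp_lebesgue)
  show "integrable lebesgue (\<lambda>x. cmod (d 0 x))" by (intro integrable_norm D)
  show "AE x in lebesgue. (\<lambda>n. exp (- p n * of_real x) * d 0 x) \<longlonglongrightarrow> exp (- q * of_real x) * d 0 x"
    by (intro always_eventually allI tendsto_intros p)
  show "AE x in lebesgue. norm (exp (- p n * of_real x) * d 0 x) \<le> cmod (d 0 x)" for n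
  proof (intro always_eventually allI)
    fix x
    show "norm (exp (- p n * of_real x) * d 0 x) \<le> cmod (d 0 x)"
    proof (cases "x > 0")
      case True
      then have "cmod (exp (- p n * of_real x)) \<le> 1" using p(2) by (simp add: norm_exp_eq_Re)
      then show ?thesis by (simp add: norm_mult mult_left_le_one_le)
    next
      case False
      then have "d 0 x = 0" using D(1) by (intro D(3)) auto
      then show ?thesis by simp
    qed
  qed
qed

lemma fourier_continuous:
  assumes "test_chain d a b" shows "continuous_on S (fourier (d 0))"
  unfolding continuous_on_sequentially fourier_laplace[abs_def] o_def
proof (intro ballI allI impI, elim conjE)
  fix x and s :: "nat \<Rightarrow> real" assume "s \<longlonglongrightarrow> x"
  then have "(\<lambda>n. \<i> * complex_of_real (s n)) \<longlonglongrightarrow> \<i> * complex_of_real x"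
    by (intro tendsto_intros)
  then have "(\<lambda>n. laplace (d 0) (\<i> * complex_of_real (s n))) \<longlonglongrightarrow> laplace (d 0) (\<i> * complex_of_real x)"
    by (rule laplace_tendsto[OF assms]) simp
  then show "(\<lambda>n. complex_of_real (1 / sqrt (2 * pi)) * laplace (d 0) (\<i> * complex_of_real (s n))) \<longlonglongrightarrow>
      complex_of_real (1 / sqrt (2 * pi)) * laplace (d 0) (\<i> * complex_of_real x)"
    by (intro tendsto_intros)
qed

lemma cmod_powr_real: "z \<noteq> 0 \<Longrightarrow> cmod (z powr of_real r) = cmod z powr r"
  by (simp add: powr_def norm_exp_eq_Re)

text \<open>The power of \<open>x\<close> is left out: the spectrum of \<open>cnj (hardy k)\<close>
  involves these functions bare, and the weight is attached in \<open>lag_basis\<close>.\<close>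

definition lag_fun :: "real \<Rightarrow> real \<Rightarrow> nat \<Rightarrow> real \<Rightarrow> real" where
  "lag_fun l r j x = exp (- (l * x) / 2) * laguerre r j (l * x)"

lemma lag_fun_continuous: "continuous_on S (lag_fun l r j)"
  unfolding lag_fun_def[abs_def] by (intro continuous_intros laguerre_continuous) auto

context
  fixes l :: real
  assumes l: "l > 0"
begin

text \<open>Only branches are at stake: \<open>P\<close>, \<open>(3 - u) / 2\<close> and their
  product lie in the right half-plane, so their principal logarithms add, and adding that of
  \<open>\<i>\<close> does not leave the principal strip.\<close>

lemma kappa_eq:
  "kappa_minus l r x = of_real (1 / sqrt (2 * pi)) * \<i> powr of_real r *
    (pole l x powr of_real r * ((3 - cay l x) / 2) powr of_real r)"
proof -
  let ?m = "(3 - cay l x) / 2"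
  have R: "Re (pole l x) > 0" using l by simp
  have M: "Re ?m > 0" using complex_Re_le_cmod[of "cay l x"] cmod_cay[OF l, of x] by simp
  have pm: "pole l x * ?m = of_real l + \<i> * of_real x"
    using pole_nonzero[OF l, of x] by (simp add: cay_def field_simps) (simp add: pole_def algebra_simps)
  have PM: "Re (pole l x * ?m) > 0" unfolding pm using l by simp
  have e: "\<i> * of_real l - of_real x = \<i> * (pole l x * ?m)"
    unfolding pm by (simp add: algebra_simps)
  have L1: "Ln (pole l x * ?m) = Ln (pole l x) + Ln ?m" by (rule Ln_mult_right_half_plane[OF R M])
  have b: "\<bar>Im (Ln (pole l x * ?m))\<bar> < pi / 2" by (rule Re_Ln_pos_lt_imp[OF PM])
  have nz: "pole l x \<noteq> 0" "?m \<noteq> 0" "pole l x * ?m \<noteq> 0" "\<i> * (pole l x * ?m) \<noteq> 0"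
  proof -
    show 1: "pole l x \<noteq> 0" by (rule pole_nonzero[OF l])
    show 2: "?m \<noteq> 0" using M by fastforce
    show "pole l x * ?m \<noteq> 0" "\<i> * (pole l x * ?m) \<noteq> 0" using 1 2 by simp_all
  qed
  have L2: "Ln (\<i> * (pole l x * ?m)) = Ln \<i> + Ln (pole l x * ?m)"
    by (rule Ln_times_simple) (use b nz pi_gt_zero in auto)
  have "(\<i> * (pole l x * ?m)) powr of_real r = \<i> powr of_real r * (pole l x powr of_real r * ?m powr of_real r)"
    using nz by (simp only: powr_def if_False L2 L1 distrib_left exp_add complex_i_not_zero)
  then show ?thesis unfolding kappa_minus_def e by (simp add: mult.assoc)
qed

lemma kappa_continuous: "continuous_on S (kappa_minus l r)"
  unfolding kappa_minus_def[abs_def]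
  by (intro continuous_intros) (use l in \<open>auto simp: complex_nonpos_Reals_iff\<close>)

lemma cmod_kappa_le:
  assumes r: "r \<ge> 0" "r \<le> real n"
  obtains C where "C > 0" "\<And>x. cmod (kappa_minus l r x) \<le> C * (1 + \<bar>x\<bar>) ^ n"
proof
  show "(max 1 l) powr r > 0" using l by simp
  fix x
  have nz: "\<i> * of_real l - of_real x \<noteq> 0" using l by (auto simp: complex_eq_iff)
  have "cmod (\<i> * of_real l - of_real x) \<le> l + \<bar>x\<bar>"
    using norm_triangle_ineq4[of "\<i> * of_real l" "of_real x"] l by (simp add: norm_mult)
  also have "\<dots> \<le> max 1 l * (1 + \<bar>x\<bar>)"
    using mult_right_mono[of 1 "max 1 l" "\<bar>x\<bar>"] by (simp add: distrib_left)
  finally have "cmod (\<i> * of_real l - of_real x) powr r \<le> (max 1 l * (1 + \<bar>x\<bar>)) powr r"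
    using r by (intro powr_mono2) auto
  also have "\<dots> = (max 1 l) powr r * (1 + \<bar>x\<bar>) powr r" using l by (subst powr_mult) auto
  also have "(1 + \<bar>x\<bar>) powr r \<le> (1 + \<bar>x\<bar>) powr real n" using r by (intro powr_mono) auto
  also have "(1 + \<bar>x\<bar>) powr real n = (1 + \<bar>x\<bar>) ^ n" by (simp add: powr_realpow)
  finally have *: "cmod ((\<i> * of_real l - of_real x) powr of_real r) \<le> (max 1 l) powr r * (1 + \<bar>x\<bar>) ^ n"
    using l by (simp add: cmod_powr_real[OF nz] mult_left_mono)
  have "1 \<le> sqrt (2 * pi)" using pi_ge_two by (intro real_le_rsqrt) simp
  then have "1 / sqrt (2 * pi) * cmod ((\<i> * of_real l - of_real x) powr of_real r) \<le> cmod ((\<i> * of_real l - of_real x) powr of_real r)"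
    by (intro mult_left_le_one_le) auto
  with * show "cmod (kappa_minus l r x) \<le> (max 1 l) powr r * (1 + \<bar>x\<bar>) ^ n"
    by (simp add: kappa_minus_def norm_mult norm_divide)
qed

lemma cmod_pole_le: "cmod (pole l x) \<le> max 1 l * (1 + \<bar>x\<bar>)"
proof -
  have "cmod (pole l x) \<le> l / 2 + \<bar>x\<bar>"
    using norm_triangle_ineq[of "of_real (l / 2)" "\<i> * of_real x"] l by (simp add: pole_def norm_mult)
  also have "\<dots> \<le> max 1 l * (1 + \<bar>x\<bar>)"
    using mult_right_mono[of 1 "max 1 l" "\<bar>x\<bar>"] l by (simp add: distrib_left)
  finally show ?thesis .
qed

text \<open>Integrating \<open>F \<circ> cay l\<close> against the Poisson weight extracts the Taylor coefficients of
  \<open>F\<close>: this is Cauchy's formula on the unit circle, obtained here by Abel summation.\<close>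

lemma taylor_coefficient_integral:
  fixes c :: "nat \<Rightarrow> complex"
  assumes F: "\<And>u. cmod u < 1 \<Longrightarrow> (\<lambda>m. c m * u ^ m) sums F u"
    and B: "\<And>u. cmod u < 1 \<Longrightarrow> cmod (F u) \<le> B"
    and lim: "\<And>x \<rho>. \<rho> \<longlonglongrightarrow> 1 \<Longrightarrow> (\<And>n. 0 < \<rho> n \<and> \<rho> n < 1) \<Longrightarrow> (\<lambda>n. F (of_real (\<rho> n) * cay l x)) \<longlonglongrightarrow> F (cay l x)"
    and meas: "(\<lambda>x. F (cay l x)) \<in> borel_measurable lebesgue"
  shows "(LINT x|lebesgue. F (cay l x) * (cay l x powi (- k) / of_real ((cmod (pole l x))\<^sup>2))) =
      (if k \<ge> 0 then of_real (2 * pi / l) * c (nat k) else 0)"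
proof -
  \<comment> \<open>Radii below 1 and tending to 1, at which the power series may be integrated term
    by term.\<close>
  define \<rho> where "\<rho> n = real (Suc n) / real (Suc (Suc n))" for n
  have \<rho>: "0 < \<rho> n" "\<rho> n < 1" for n by (auto simp: \<rho>_def)
  have \<rho>lim: "\<rho> \<longlonglongrightarrow> 1" unfolding \<rho>_def using LIMSEQ_n_over_Suc_n[THEN LIMSEQ_Suc] .
  let ?w = "\<lambda>j x. cay l x powi j / of_real ((cmod (pole l x))\<^sup>2)"
  have wi: "integrable lebesgue (?w j)" for j by (rule cay_powi_integrable[OF l])
  have nw: "cmod (?w j x) = 1 / (cmod (pole l x))\<^sup>2" for j x
    using l by (simp add: norm_divide norm_power_int norm_power)
  have cs: "summable (\<lambda>m. cmod (c m) * r ^ m)" if "0 \<le> r" "r < 1" for r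
  proof -
    from dense[OF \<open>r < 1\<close>] obtain q where q: "r < q" "q < 1" by blast
    have "summable (\<lambda>m. c m * of_real q ^ m)" using F[of "of_real q"] q that by (auto intro: sums_summable)
    then have "summable (\<lambda>m. norm (c m * complex_of_real r ^ m))"
      by (rule powser_insidea) (use q that in auto)
    then show ?thesis using that by (simp add: norm_mult norm_power)
  qed
  \<comment> \<open>By orthogonality of the powers of \<open>u\<close> only the term
    \<open>m = k\<close> survives; for negative \<open>k\<close> there is none.\<close>
  have val: "(LINT x|lebesgue. F (of_real (\<rho> n) * cay l x) * ?w (- k) x) =
      (if k \<ge> 0 then of_real (2 * pi / l) * (c (nat k) * of_real (\<rho> n) ^ nat k) else 0)" for n
  proof -
    let ?f = "\<lambda>m x. (c m * of_real (\<rho> n) ^ m) * ?w (int m - k) x"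
    have fi: "integrable lebesgue (?f m)" for m by (intro integrable_mult_right wi)
    have fs: "(\<lambda>m. ?f m x) sums (F (of_real (\<rho> n) * cay l x) * ?w (- k) x)" for x
    proof -
      have "(\<lambda>m. c m * (of_real (\<rho> n) * cay l x) ^ m * ?w (- k) x) sums (F (of_real (\<rho> n) * cay l x) * ?w (- k) x)"
        using \<rho>[of n] l by (intro sums_mult2 F) (simp add: norm_mult)
      moreover have "c m * (of_real (\<rho> n) * cay l x) ^ m * ?w (- k) x = ?f m x" for m
      proof -
        have "cay l x powi (int m - k) = cay l x ^ m * cay l x powi (- k)"
          using power_int_add[of "cay l x" "int m" "- k"] l by (simp add: power_int_of_nat)
        then show ?thesis by (simp add: power_mult_distrib)
      qed
      ultimately show ?thesis by (simp only:)
    qed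
    have nf: "norm (?f m x) = (cmod (c m) * \<rho> n ^ m) * (1 / (cmod (pole l x))\<^sup>2)" for m x
      using \<rho>[of n] by (simp only: norm_mult nw) (simp add: norm_power)
    have s1: "summable (\<lambda>m. norm (?f m x))" for x
      unfolding nf using \<rho>[of n] by (intro summable_mult2 cs) auto
    have s2: "summable (\<lambda>m. LINT x|lebesgue. norm (?f m x))"
      unfolding nf integral_mult_right_zero using \<rho>[of n] by (intro summable_mult2 cs) auto
    have "(\<lambda>m. LINT x|lebesgue. ?f m x) sums (LINT x|lebesgue. (\<Sum>m. ?f m x))"
      by (rule sums_integral[OF fi _ s2]) (use s1 in simp)
    then have S: "(\<lambda>m. LINT x|lebesgue. ?f m x) sums (LINT x|lebesgue. F (of_real (\<rho> n) * cay l x) * ?w (- k) x)"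
      unfolding sums_unique[OF fs, symmetric] .
    have I: "(LINT x|lebesgue. ?f m x) = (if int m = k then of_real (2 * pi / l) * (c m * of_real (\<rho> n) ^ m) else 0)" for m
      unfolding integral_mult_right_zero cay_powi_integral[OF l] by simp
    show ?thesis
    proof (cases "k \<ge> 0")
      case True
      then have I': "(LINT x|lebesgue. ?f m x) = (if m = nat k then of_real (2 * pi / l) * (c m * of_real (\<rho> n) ^ m) else 0)" for m
        unfolding I by auto
      have "(\<lambda>m. LINT x|lebesgue. ?f m x) sums (of_real (2 * pi / l) * (c (nat k) * of_real (\<rho> n) ^ nat k))"
        unfolding I' by (rule sums_single)
      then show ?thesis using sums_unique2[OF S] True by simp
    next
      case False
      then have I': "(LINT x|lebesgue. ?f m x) = 0" for m unfolding I by auto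
      have "(\<lambda>m. LINT x|lebesgue. ?f m x) sums 0" unfolding I' by simp
      then show ?thesis using sums_unique2[OF S] False by simp
    qed
  qed
  have "(\<lambda>n. LINT x|lebesgue. F (of_real (\<rho> n) * cay l x) * ?w (- k) x) \<longlonglongrightarrow> (LINT x|lebesgue. F (cay l x) * ?w (- k) x)"
  proof (rule integral_dominated_convergence[where w="\<lambda>x. B * (1 / (cmod (pole l x))\<^sup>2)"])
    show "(\<lambda>x. F (cay l x) * ?w (- k) x) \<in> borel_measurable lebesgue"
      by (intro borel_measurable_times meas borel_measurable_integrable[OF wi])
    show "integrable lebesgue (\<lambda>x. B * (1 / (cmod (pole l x))\<^sup>2))"
      by (intro integrable_mult_right poisson_weight[OF l])
    show "AE x in lebesgue. (\<lambda>n. F (of_real (\<rho> n) * cay l x) * ?w (- k) x) \<longlonglongrightarrow> F (cay l x) * ?w (- k) x"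
      by (intro always_eventually allI tendsto_mult tendsto_const lim[OF \<rho>lim]) (use \<rho> in auto)
    fix n
    have Fr: "F (of_real (\<rho> n) * cay l x) = (\<Sum>m. c m * (of_real (\<rho> n) * cay l x) ^ m)" for x
      using \<rho>[of n] l by (intro sums_unique F) (simp add: norm_mult)
    have "(\<lambda>x. c m * (of_real (\<rho> n) * cay l x) ^ m) \<in> borel_measurable lebesgue" for m
      by (intro continuous_imp_lebesgue continuous_intros continuous_cay[OF l])
    then have "(\<lambda>x. F (of_real (\<rho> n) * cay l x)) \<in> borel_measurable lebesgue"
      unfolding Fr by (rule borel_measurable_suminf)
    then show "(\<lambda>x. F (of_real (\<rho> n) * cay l x) * ?w (- k) x) \<in> borel_measurable lebesgue"
      by (intro borel_measurable_times borel_measurable_integrable[OF wi])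
    show "AE x in lebesgue. norm (F (of_real (\<rho> n) * cay l x) * ?w (- k) x) \<le> B * (1 / (cmod (pole l x))\<^sup>2)"
      unfolding norm_mult nw using \<rho>[of n] l
      by (intro always_eventually allI mult_right_mono B) (auto simp: norm_mult)
  qed
  moreover have "(\<lambda>n. LINT x|lebesgue. F (of_real (\<rho> n) * cay l x) * ?w (- k) x) \<longlonglongrightarrow>
      (if k \<ge> 0 then of_real (2 * pi / l) * (c (nat k) * of_real 1 ^ nat k) else 0)"
  proof (cases "k \<ge> 0")
    case True
    then show ?thesis unfolding val if_P[OF True] by (intro tendsto_intros \<rho>lim)
  next
    case False
    show ?thesis unfolding val if_not_P[OF False] by (rule tendsto_const)
  qed
  ultimately have "(LINT x|lebesgue. F (cay l x) * ?w (- k) x) =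
      (if k \<ge> 0 then of_real (2 * pi / l) * (c (nat k) * of_real 1 ^ nat k) else 0)"
    by (rule LIMSEQ_unique)
  then show ?thesis by (simp only: of_real_1 power_one mult_1_right)
qed

text \<open>The inverse Cayley transform: \<open>p = half_plane u\<close> solves
  \<open>u = (p - l / 2) / (p + l / 2)\<close>. The circle without 1 goes to the imaginary
  axis.\<close>

definition half_plane :: "complex \<Rightarrow> complex" where
  "half_plane u = of_real (l / 2) * ((1 + u) / (1 - u))"

lemma half_plane_cay: "half_plane (cay l x) = \<i> * of_real x"
  using pole_nonzero[OF l, of x] l
  by (simp add: half_plane_def cay_def field_simps) (simp add: pole_def algebra_simps)

lemma Re_half_plane: "cmod u \<le> 1 \<Longrightarrow> Re (half_plane u) \<ge> 0"
proof -
  assume u: "cmod u \<le> 1"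
  have "Re ((1 + u) / (1 - u)) = (1 - (cmod u)\<^sup>2) / (cmod (1 - u))\<^sup>2"
    unfolding Re_divide cmod_power2 by (simp add: power2_eq_square algebra_simps)
  moreover have "(cmod u)\<^sup>2 \<le> 1" using u by (simp add: power_le_one)
  ultimately have "Re ((1 + u) / (1 - u)) \<ge> 0" by simp
  moreover have "Re (of_real (l / 2) * w) = l / 2 * Re w" for w by simp
  ultimately show ?thesis using l unfolding half_plane_def by (simp only: mult_nonneg_nonneg)
qed

text \<open>With \<open>t = l * x\<close> the generating function times
  \<open>exp (- l * x / 2)\<close> collapses to the kernel \<open>exp (- p * x)\<close> with
  \<open>p = half_plane u\<close>. The support of the test function is bounded, so one majorant
  serves all \<open>x\<close> and integration term by term is legitimate.\<close>

lemma laplace_half_plane_sums: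
  assumes d: "test_chain d a b" and r: "r \<ge> 0" and u: "cmod u < 1"
  shows "(\<lambda>j. (LINT x|lebesgue. of_real (lag_fun l r j x) * d 0 x) * u ^ j) sums
    ((1 - u) powr (- of_real (r + 1)) * laplace (d 0) (half_plane u))"
    and "summable (\<lambda>j. cmod ((LINT x|lebesgue. of_real (lag_fun l r j x) * d 0 x) * u ^ j))"
proof -
  note D = test_chainD[OF d]
  let ?f = "\<lambda>j x. (of_real (lag_fun l r j x) * d 0 x) * u ^ j"
  have fi: "integrable lebesgue (?f j)" for j
  proof (rule compact_support_integrable(2))
    show "continuous_on UNIV (?f j)" by (intro continuous_intros lag_fun_continuous D(4))
    show "x \<notin> {a..b} \<Longrightarrow> ?f j x = 0" for x using D(3) by simp
  qed
  define m where "m j = (\<Sum>i\<le>j. (l * \<bar>b\<bar>) ^ i / fact i * bin (r + real i + 1) (j - i) * cmod u ^ j)" for j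
  have ms: "summable m" unfolding m_def
    using laguerre_sums_majorant(1)[of r "cmod u" "l * \<bar>b\<bar>"] r u l by (auto intro: sums_summable)
  have le: "norm (?f j x) \<le> m j * cmod (d 0 x)" for j x
  proof (cases "x \<in> {a..b}")
    case True
    then have x: "0 < x" "x \<le> \<bar>b\<bar>" using D(1) by auto
    have "\<bar>lag_fun l r j x\<bar> * cmod u ^ j \<le> \<bar>laguerre r j (l * x)\<bar> * cmod u ^ j"
      using x l by (intro mult_right_mono) (auto simp: lag_fun_def abs_mult intro!: mult_left_le_one_le)
    also have "\<dots> \<le> m j"
      unfolding m_def by (rule laguerre_norm_sum_le) (use r u x l in \<open>auto simp: abs_mult\<close>)
    finally have "\<bar>lag_fun l r j x\<bar> * cmod u ^ j * cmod (d 0 x) \<le> m j * cmod (d 0 x)" by (intro mult_right_mono) auto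
    then show ?thesis by (simp add: norm_mult norm_power mult_ac)
  qed (use D(3) in simp)
  have s1: "summable (\<lambda>j. norm (?f j x))" for x
    by (rule summable_comparison_test[OF _ summable_mult2[OF ms, of "cmod (d 0 x)"]]) (use le in auto)
  have I: "(LINT x|lebesgue. norm (?f j x)) \<le> m j * (LINT x|lebesgue. cmod (d 0 x))" for j
    unfolding integral_mult_right_zero[symmetric]
    by (intro integral_mono le integrable_norm fi integrable_mult_right D)
  have s2: "summable (\<lambda>j. LINT x|lebesgue. norm (?f j x))"
    by (rule summable_comparison_test[OF _ summable_mult2[OF ms, of "LINT x|lebesgue. cmod (d 0 x)"]]) (use I in auto)
  have u1: "1 - u \<noteq> 0" using u by auto
  have fs: "(\<lambda>j. ?f j x) sums ((1 - u) powr (- of_real (r + 1)) * (exp (- half_plane u * of_real x) * d 0 x))" for x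
  proof -
    have "(\<lambda>j. (of_real (laguerre r j (l * x)) * u ^ j) * (of_real (exp (- (l * x) / 2)) * d 0 x)) sums
        ((1 - u) powr (- of_real (r + 1)) * exp (- (of_real (l * x) * u / (1 - u))) * (of_real (exp (- (l * x) / 2)) * d 0 x))"
      using r u by (intro sums_mult2 laguerre_sums) auto
    moreover have "exp (- half_plane u * of_real x) = exp (- (of_real (l * x) * u / (1 - u))) * of_real (exp (- (l * x) / 2))"
    proof -
      have "- half_plane u * of_real x = - (of_real (l * x) * u / (1 - u)) + of_real (- (l * x) / 2)"
        using u1 by (simp add: half_plane_def field_simps)
      then show ?thesis by (simp only: exp_add exp_of_real)
    qed
    ultimately show ?thesis by (simp add: lag_fun_def mult_ac)
  qed
  have "(\<lambda>j. LINT x|lebesgue. ?f j x) sums (LINT x|lebesgue. (\<Sum>j. ?f j x))"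
    by (rule sums_integral[OF fi _ s2]) (use s1 in simp)
  then show "(\<lambda>j. (LINT x|lebesgue. of_real (lag_fun l r j x) * d 0 x) * u ^ j) sums
    ((1 - u) powr (- of_real (r + 1)) * laplace (d 0) (half_plane u))"
    unfolding sums_unique[OF fs, symmetric] by (simp only: integral_mult_right_zero integral_mult_left_zero laplace_def)
  show "summable (\<lambda>j. cmod ((LINT x|lebesgue. of_real (lag_fun l r j x) * d 0 x) * u ^ j))"
  proof (rule summable_comparison_test[OF _ s2], intro exI allI impI)
    fix j
    show "norm (cmod ((LINT x|lebesgue. of_real (lag_fun l r j x) * d 0 x) * u ^ j)) \<le> (LINT x|lebesgue. norm (?f j x))"
      using integral_norm_bound[of lebesgue "?f j"] by (simp only: integral_mult_left_zero real_norm_def abs_norm_cancel)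
  qed
qed

text \<open>On the circle this is, up to a constant, the weight times the Fourier transform of
  \<open>\<phi>\<close> times \<open>P\<close>, continued into the disc; \<open>gen_coeff\<close>
  collects its Taylor coefficients.\<close>

definition gen_fun :: "real \<Rightarrow> (real \<Rightarrow> complex) \<Rightarrow> complex \<Rightarrow> complex" where
  "gen_fun r \<phi> u = ((3 - u) / 2) powr of_real r * ((1 - u) powr (- of_real (r + 1)) * laplace \<phi> (half_plane u))"

definition gen_coeff :: "real \<Rightarrow> (real \<Rightarrow> complex) \<Rightarrow> nat \<Rightarrow> complex" where
  "gen_coeff r \<phi> k = (\<Sum>j\<le>k. of_real (ratio_coeff r (k - j)) * (LINT x|lebesgue. of_real (lag_fun l r j x) * \<phi> x))"

lemma gen_fun_sums:
  assumes d: "test_chain d a b" and r: "r \<ge> 0" and u: "cmod u < 1"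
  shows "(\<lambda>k. gen_coeff r (d 0) k * u ^ k) sums gen_fun r (d 0) u"
proof -
  let ?a = "\<lambda>m. of_real (ratio_coeff r m) * u ^ m"
  let ?b = "\<lambda>j. (LINT x|lebesgue. of_real (lag_fun l r j x) * d 0 x) * u ^ j"
  have b: "?b sums ((1 - u) powr (- of_real (r + 1)) * laplace (d 0) (half_plane u))" "summable (\<lambda>j. norm (?b j))"
    using laplace_half_plane_sums[OF d r u] by auto
  have a: "?a sums (((3 - u) / 2) powr of_real r)" using u by (intro ratio_sums) simp
  have an: "summable (\<lambda>m. norm (?a m))"
  proof (rule summable_comparison_test[OF _ ratio_coeff_summable[of r]], intro exI allI impI)
    show "norm (norm (?a m)) \<le> \<bar>ratio_coeff r m\<bar>" for m
      using u by (simp add: norm_mult norm_power mult_left_le power_le_one)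
  qed
  have "(\<lambda>k. \<Sum>i\<le>k. ?b i * ?a (k - i)) sums ((\<Sum>j. ?b j) * (\<Sum>m. ?a m))"
    by (rule Cauchy_product_sums[OF b(2) an])
  moreover have "(\<Sum>i\<le>k. ?b i * ?a (k - i)) = gen_coeff r (d 0) k * u ^ k" for k
    unfolding gen_coeff_def sum_distrib_right
  proof (intro sum.cong refl)
    fix i assume "i \<in> {..k}"
    then have "u ^ k = u ^ i * u ^ (k - i)" by (simp flip: power_add)
    then show "?b i * ?a (k - i) = of_real (ratio_coeff r (k - i)) * (LINT x|lebesgue. of_real (lag_fun l r i x) * d 0 x) * u ^ k"
      by (simp add: mult_ac)
  qed
  ultimately show ?thesis
    unfolding sums_unique[OF a, symmetric] sums_unique[OF b(1), symmetric] gen_fun_def by (simp add: mult_ac)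
qed

lemma cmod_ratio_le: 
  assumes "r \<ge> 0" "cmod u \<le> 1"
  shows "cmod (((3 - u) / 2) powr of_real r) \<le> 2 powr r"
proof -
  have "Re ((3 - u) / 2) > 0" using complex_Re_le_cmod[of u] assms(2) by simp
  then have "(3 - u) / 2 \<noteq> 0" by auto
  moreover have "cmod ((3 - u) / 2) \<le> 2" using norm_triangle_ineq4[of 3 u] assms(2) by (simp add: norm_divide)
  ultimately show ?thesis unfolding cmod_powr_real[OF \<open>(3 - u) / 2 \<noteq> 0\<close>] using assms(1)
    by (intro powr_mono2) auto
qed

text \<open>The singularity at \<open>u = 1\<close> is offset by decay: \<open>1 / |1 - u|\<close>
  is at most a multiple of \<open>1 + |p|\<close>, and the transform of a test function decays
  faster than any power of \<open>p\<close>.\<close>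

lemma gen_fun_bounded:
  assumes d: "test_chain d a b" and r: "r \<ge> 0"
  obtains B where "\<And>u. cmod u < 1 \<Longrightarrow> cmod (gen_fun r (d 0) u) \<le> B"
proof -
  obtain n :: nat where n: "r + 1 \<le> real n" using real_arch_simple by blast
  define C where "C = max 1 (1 / l)"
  define K where "K = 2 ^ n * ((LINT x|lebesgue. cmod (d 0 x)) + (LINT x|lebesgue. cmod (d n x)))"
  have C: "C \<ge> 1" "C \<ge> 1 / l" by (auto simp: C_def)
  have "cmod (gen_fun r (d 0) u) \<le> 2 powr r * (C powr (r + 1) * K)" if u: "cmod u < 1" for u
  proof -
    have u1: "1 - u \<noteq> 0" using u by auto
    let ?p = "half_plane u"
    have p: "?p + of_real (l / 2) = of_real l / (1 - u)" using u1 by (simp add: half_plane_def field_simps)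
    have "1 / cmod (1 - u) = cmod (?p + of_real (l / 2)) / l" unfolding p using l by (simp add: norm_divide)
    also have "\<dots> \<le> (cmod ?p + l / 2) / l"
      using norm_triangle_ineq[of ?p "of_real (l / 2)"] l by (intro divide_right_mono) auto
    also have "\<dots> = 1 / l * cmod ?p + 1 / 2" using l by (simp add: field_simps)
    also have "\<dots> \<le> C * cmod ?p + C" using C by (intro add_mono mult_right_mono) auto
    finally have "1 / cmod (1 - u) \<le> C * (1 + cmod ?p)" by (simp add: algebra_simps)
    then have "(1 / cmod (1 - u)) powr (r + 1) \<le> (C * (1 + cmod ?p)) powr (r + 1)"
      using r by (intro powr_mono2) auto
    also have "\<dots> = C powr (r + 1) * (1 + cmod ?p) powr (r + 1)" using C by (subst powr_mult) auto
    also have "\<dots> \<le> C powr (r + 1) * (1 + cmod ?p) ^ n"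
      using n by (intro mult_left_mono) (auto simp: powr_realpow[symmetric] add_pos_nonneg intro!: powr_mono)
    finally have *: "cmod ((1 - u) powr (- of_real (r + 1))) \<le> C powr (r + 1) * (1 + cmod ?p) ^ n"
      using cmod_powr_real[OF u1, of "- (r + 1)"] u1 by (simp only: of_real_minus powr_minus) (simp add: inverse_powr divide_inverse)
    have "cmod ((1 - u) powr (- of_real (r + 1)) * laplace (d 0) ?p) \<le> C powr (r + 1) * (1 + cmod ?p) ^ n * cmod (laplace (d 0) ?p)"
      unfolding norm_mult by (intro mult_right_mono *) auto
    also have "\<dots> \<le> C powr (r + 1) * K"
      unfolding K_def mult.assoc[of "C powr (r + 1)"] using Re_half_plane[of u] u by (intro mult_left_mono laplace_decay[OF d]) auto
    finally have 1: "cmod ((1 - u) powr (- of_real (r + 1)) * laplace (d 0) ?p) \<le> C powr (r + 1) * K" .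
    have 2: "cmod (((3 - u) / 2) powr of_real r) \<le> 2 powr r" using r u by (intro cmod_ratio_le) auto
    have "cmod (((3 - u) / 2) powr of_real r) * cmod ((1 - u) powr (- of_real (r + 1)) * laplace (d 0) ?p) \<le> 2 powr r * (C powr (r + 1) * K)"
      by (rule mult_mono[OF 2 1]) auto
    then show ?thesis unfolding gen_fun_def by (simp only: norm_mult)
  qed
  then show ?thesis by (rule that)
qed

lemma gen_fun_tendsto:
  assumes d: "test_chain d a b" and v: "v \<longlonglongrightarrow> u" "\<And>n. cmod (v n) \<le> 1" and u: "cmod u \<le> 1" "u \<noteq> 1"
  shows "(\<lambda>n. gen_fun r (d 0) (v n)) \<longlonglongrightarrow> gen_fun r (d 0) u"
proof -
  have nr: "Re u \<noteq> 1"
  proof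
    assume R: "Re u = 1"
    have "(Re u)\<^sup>2 + (Im u)\<^sup>2 \<le> 1" using u(1) by (simp add: cmod_power2[symmetric] power_le_one)
    then have "Im u = 0" using R by simp
    then show False using R u(2) by (simp add: complex_eq_iff)
  qed
  then have "Re (1 - u) > 0" using complex_Re_le_cmod[of u] u(1) by simp
  then have 1: "1 - u \<notin> \<real>\<^sub>\<le>\<^sub>0" by (auto simp: complex_nonpos_Reals_iff)
  have "Re ((3 - u) / 2) > 0" using complex_Re_le_cmod[of u] u(1) by simp
  then have 2: "(3 - u) / 2 \<notin> \<real>\<^sub>\<le>\<^sub>0" by (auto simp: complex_nonpos_Reals_iff)
  have h: "(\<lambda>n. half_plane (v n)) \<longlonglongrightarrow> half_plane u"
    unfolding half_plane_def using u(2) by (intro tendsto_intros v) auto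
  have L: "(\<lambda>n. laplace (d 0) (half_plane (v n))) \<longlonglongrightarrow> laplace (d 0) (half_plane u)"
    by (rule laplace_tendsto[OF d h]) (use v(2) Re_half_plane in auto)
  show ?thesis unfolding gen_fun_def
    by (intro tendsto_intros L v tendsto_powr_complex 1 2) auto
qed

lemma gen_fun_integral:
  assumes d: "test_chain d a b" and r: "r \<ge> 0"
  shows "(LINT x|lebesgue. gen_fun r (d 0) (cay l x) * (cay l x powi (- k) / of_real ((cmod (pole l x))\<^sup>2))) =
      (if k \<ge> 0 then of_real (2 * pi / l) * gen_coeff r (d 0) (nat k) else 0)"
proof -
  obtain B where B: "\<And>u. cmod u < 1 \<Longrightarrow> cmod (gen_fun r (d 0) u) \<le> B" using gen_fun_bounded[OF d r] by blast
  have c: "continuous_on UNIV (\<lambda>x. gen_fun r (d 0) (cay l x))"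
    unfolding continuous_on_sequentially o_def
  proof (intro ballI allI impI, elim conjE)
    fix x and s :: "nat \<Rightarrow> real" assume "s \<longlonglongrightarrow> x"
    then have "(\<lambda>n. cay l (s n)) \<longlonglongrightarrow> cay l x"
      using continuous_cay[OF l, of UNIV] by (auto simp: continuous_on_sequentially o_def)
    then show "(\<lambda>n. gen_fun r (d 0) (cay l (s n))) \<longlonglongrightarrow> gen_fun r (d 0) (cay l x)"
      by (rule gen_fun_tendsto[OF d]) (use l cay_neq_1[OF l] in auto)
  qed
  show ?thesis
  proof (rule taylor_coefficient_integral[OF gen_fun_sums[OF d r] B])
    show "(\<lambda>x. gen_fun r (d 0) (cay l x)) \<in> borel_measurable lebesgue" by (rule continuous_imp_lebesgue[OF c])
    fix x and \<rho> :: "nat \<Rightarrow> real" assume \<rho>: "\<rho> \<longlonglongrightarrow> 1" "\<And>n. 0 < \<rho> n \<and> \<rho> n < 1"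
    have "(\<lambda>n. of_real (\<rho> n) * cay l x) \<longlonglongrightarrow> of_real 1 * cay l x" by (intro tendsto_intros \<rho>)
    then have "(\<lambda>n. of_real (\<rho> n) * cay l x) \<longlonglongrightarrow> cay l x" by simp
    then show "(\<lambda>n. gen_fun r (d 0) (of_real (\<rho> n) * cay l x)) \<longlonglongrightarrow> gen_fun r (d 0) (cay l x)"
      by (rule gen_fun_tendsto[OF d])
        (use l cay_neq_1[OF l] \<rho>(2) in \<open>auto simp: norm_mult less_imp_le\<close>)
  qed
qed

text \<open>\<open>1 - u = l / P\<close>. The additional factor \<open>P\<close> accounts for the
  exponent \<open>r + 1\<close> of the Laguerre generating function of order
  \<open>r\<close>.\<close>

lemma pole_powr_cay: "of_real (l powr (r + 1)) * (1 - cay l x) powr (- of_real (r + 1)) = pole l x powr of_real r * pole l x"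
proof -
  have P: "Re (pole l x) > 0" using l by simp
  have P0: "pole l x \<noteq> 0" by (rule pole_nonzero[OF l])
  have e: "1 - cay l x = of_real l / pole l x" by (simp add: cay_def)
  have "Re (of_real l / pole l x) > 0" using l by (simp add: Re_divide add_pos_nonneg)
  then have "Ln (pole l x * (of_real l / pole l x)) = Ln (pole l x) + Ln (of_real l / pole l x)"
    by (rule Ln_mult_right_half_plane[OF P])
  then have L: "Ln (of_real l / pole l x) = of_real (ln l) - Ln (pole l x)"
    using P0 l Ln_of_real[of l] by simp
  have "of_real (l powr (r + 1)) * (1 - cay l x) powr (- of_real (r + 1)) =
      exp (of_real ((r + 1) * ln l)) * exp (- of_real (r + 1) * (of_real (ln l) - Ln (pole l x)))"
    using l P0 by (simp only: e powr_def L exp_of_real) (simp add: powr_def)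
  also have "\<dots> = exp (of_real r * Ln (pole l x) + Ln (pole l x))"
    by (simp add: exp_add[symmetric] algebra_simps)
  also have "\<dots> = pole l x powr of_real r * pole l x"
    using P0 by (simp add: exp_add powr_def)
  finally show ?thesis .
qed

lemma kappa_fourier_gen_fun:
  "kappa_minus l r x * fourier \<phi> x * pole l x =
    of_real (1 / (2 * pi)) * \<i> powr of_real r * of_real (l powr (r + 1)) * gen_fun r \<phi> (cay l x)"
proof -
  have "gen_fun r \<phi> (cay l x) * of_real (l powr (r + 1)) =
      ((3 - cay l x) / 2) powr of_real r * (pole l x powr of_real r * pole l x * laplace \<phi> (\<i> * of_real x))"
    unfolding gen_fun_def half_plane_cay pole_powr_cay[symmetric] by (simp add: mult_ac)
  moreover have "complex_of_real (1 / sqrt (2 * pi)) * of_real (1 / sqrt (2 * pi)) = of_real (1 / (2 * pi))"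
    unfolding of_real_mult[symmetric] by (simp add: real_sqrt_mult[symmetric])
  moreover have "kappa_minus l r x * fourier \<phi> x * pole l x =
      (complex_of_real (1 / sqrt (2 * pi)) * of_real (1 / sqrt (2 * pi))) * \<i> powr of_real r *
      (((3 - cay l x) / 2) powr of_real r * (pole l x powr of_real r * pole l x * laplace \<phi> (\<i> * of_real x)))"
    unfolding kappa_eq fourier_laplace by (simp only: mult_ac)
  ultimately have "kappa_minus l r x * fourier \<phi> x * pole l x =
      complex_of_real (1 / (2 * pi)) * \<i> powr of_real r * (gen_fun r \<phi> (cay l x) * of_real (l powr (r + 1)))"
    by (simp only:)
  then show ?thesis by (simp only: mult.assoc mult.commute[of "gen_fun r \<phi> (cay l x)"])
qed

text \<open>In both cases the integrand is \<open>gen_fun\<close> on the circle times a power of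
  \<open>u\<close> against the Poisson weight. For \<open>hardy\<close> the power is positive and
  asks for a Taylor coefficient of negative index; for the conjugate it is \<open>- k\<close> and
  picks the coefficient of index \<open>k\<close>.\<close>

lemma kappa_hardy_fourier_integral:
  assumes d: "test_chain d a b" and r: "r \<ge> 0"
  shows "(LINT x|lebesgue. kappa_minus l r x * hardy l k x * fourier (d 0) x) = 0"
    and "(LINT x|lebesgue. kappa_minus l r x * cnj (hardy l k x) * fourier (d 0) x) =
      \<i> powr of_real r * of_real (l powr r) * gen_coeff r (d 0) k"
proof -
  let ?c = "complex_of_real (1 / (2 * pi)) * \<i> powr of_real r * of_real (l powr (r + 1))"
  let ?W = "\<lambda>x. complex_of_real ((cmod (pole l x))\<^sup>2)"
  have P0: "pole l x \<noteq> 0" for x by (rule pole_nonzero[OF l])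
  have 1: "kappa_minus l r x * hardy l k x * fourier (d 0) x = - (?c * (gen_fun r (d 0) (cay l x) * (cay l x powi (- (- int (k + 1))) / ?W x)))" for x
  proof -
    have "kappa_minus l r x * hardy l k x * fourier (d 0) x = (kappa_minus l r x * fourier (d 0) x * pole l x) * (cay l x ^ k * (1 / (pole l x)\<^sup>2))"
      using P0[of x] by (simp add: hardy_def[OF l] power2_eq_square)
    then show ?thesis unfolding kappa_fourier_gen_fun inverse_pole_sq[OF l] minus_minus power_int_of_nat by (simp add: mult_ac)
  qed
  have 2: "kappa_minus l r x * cnj (hardy l k x) * fourier (d 0) x = ?c * (gen_fun r (d 0) (cay l x) * (cay l x powi (- int k) / ?W x))" for x
  proof -
    have s: "cay l x powi (- int (Suc k)) * cay l x = cay l x powi (- int k)"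
      using power_int_add[of "cay l x" "- int (Suc k)" 1] l by simp
    have "kappa_minus l r x * cnj (hardy l k x) * fourier (d 0) x =
        (kappa_minus l r x * fourier (d 0) x * pole l x) * (- (cay l x powi (- int (Suc k))) * (1 / (pole l x)\<^sup>2))"
      unfolding cnj_hardy[OF l] using P0[of x] by (simp add: power2_eq_square del: of_nat_Suc)
    also have "- (cay l x powi (- int (Suc k))) * (1 / (pole l x)\<^sup>2) = cay l x powi (- int k) / ?W x"
      unfolding inverse_pole_sq[OF l] s[symmetric] by simp
    finally show ?thesis unfolding kappa_fourier_gen_fun by (simp add: mult.assoc)
  qed
  show "(LINT x|lebesgue. kappa_minus l r x * hardy l k x * fourier (d 0) x) = 0"
    unfolding 1 integral_minus integral_mult_right_zero gen_fun_integral[OF d r] by simp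
  have c: "?c * of_real (2 * pi / l) = \<i> powr of_real r * of_real (l powr r)"
    using l by (simp add: powr_add)
  show "(LINT x|lebesgue. kappa_minus l r x * cnj (hardy l k x) * fourier (d 0) x) = \<i> powr of_real r * of_real (l powr r) * gen_coeff r (d 0) k"
    unfolding 2 integral_mult_right_zero gen_fun_integral[OF d r] c[symmetric] by simp
qed

text \<open>Of the \<open>n + 1\<close> derivatives, \<open>n\<close> outweigh the growth of the
  weight and one more yields a square integrable majorant. \<open>K\<close> does not depend on the
  test function, as the dominated limits over truncations require.\<close>

lemma kappa_fourier_bound:
  assumes r: "r \<ge> 0" and n: "r \<le> real n"
  obtains K where "K \<ge> 0" "\<forall>d a b x. test_chain d a b \<longrightarrow> cmod (kappa_minus l r x * fourier (d 0) x) \<le>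
    K * ((LINT x|lebesgue. cmod (d 0 x)) + (LINT x|lebesgue. cmod (d (Suc n) x))) * cmod (hardy l 0 x)"
proof -
  obtain C where C: "C > 0" "\<And>x. cmod (kappa_minus l r x) \<le> C * (1 + \<bar>x\<bar>) ^ n"
    using cmod_kappa_le[OF r n] by blast
  show ?thesis
  proof (rule that[of "C * 2 ^ Suc n * max 1 l"], goal_cases)
    case 1
    show ?case using C(1) by simp
  next
    case 2
    show ?case
    proof (intro allI impI)
    fix d a b and x :: real assume d: "test_chain d a b"
    define B where "B = (LINT x|lebesgue. cmod (d 0 x)) + (LINT x|lebesgue. cmod (d (Suc n) x))"
    define K where "K = 2 ^ Suc n * B"
    have K0: "K \<ge> 0" by (simp add: K_def B_def)
    have x1: "1 + \<bar>x\<bar> > 0" by simp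
    have "(1 + \<bar>x\<bar>) ^ Suc n * cmod (laplace (d 0) (\<i> * of_real x)) \<le> K"
      using laplace_decay[OF d, of "\<i> * of_real x" "Suc n"] by (simp add: K_def B_def norm_mult)
    moreover have "cmod (fourier (d 0) x) \<le> cmod (laplace (d 0) (\<i> * of_real x))"
    proof -
      have "1 \<le> sqrt (2 * pi)" using pi_ge_two by (intro real_le_rsqrt) simp
      then show ?thesis unfolding fourier_laplace norm_mult norm_of_real by (intro mult_left_le_one_le) auto
    qed
    ultimately have "(1 + \<bar>x\<bar>) ^ Suc n * cmod (fourier (d 0) x) \<le> K"
      by (meson mult_left_mono order_trans x1 less_imp_le zero_le_power)
    then have "C * ((1 + \<bar>x\<bar>) ^ Suc n * cmod (fourier (d 0) x)) \<le> C * K" using C(1) by simp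
    moreover have "(1 + \<bar>x\<bar>) * cmod (kappa_minus l r x * fourier (d 0) x) \<le> (1 + \<bar>x\<bar>) * (C * (1 + \<bar>x\<bar>) ^ n * cmod (fourier (d 0) x))"
      unfolding norm_mult using C(2) by (intro mult_left_mono mult_right_mono) auto
    ultimately have "(1 + \<bar>x\<bar>) * cmod (kappa_minus l r x * fourier (d 0) x) \<le> C * K"
      by (simp add: mult_ac)
    then have "cmod (kappa_minus l r x * fourier (d 0) x) \<le> C * K / (1 + \<bar>x\<bar>)"
      using x1 by (simp add: field_simps)
    also have "\<dots> \<le> C * K * (max 1 l / cmod (pole l x))"
    proof -
      have "1 / (1 + \<bar>x\<bar>) \<le> max 1 l / cmod (pole l x)"
        using cmod_pole_le[of x] x1 cmod_pole_pos[OF l, of x] by (simp add: field_simps)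
      then have "C * K * (1 / (1 + \<bar>x\<bar>)) \<le> C * K * (max 1 l / cmod (pole l x))"
        using C(1) K0 by (intro mult_left_mono mult_nonneg_nonneg) auto
      then show ?thesis by simp
    qed
    finally show "cmod (kappa_minus l r x * fourier (d 0) x) \<le> C * 2 ^ Suc n * max 1 l *
        ((LINT x|lebesgue. cmod (d 0 x)) + (LINT x|lebesgue. cmod (d (Suc n) x))) * cmod (hardy l 0 x)"
      unfolding B_def[symmetric] by (simp add: cmod_hardy[OF l] K_def mult_ac)
    qed
  qed
qed

lemma kappa_fourier_sq_int:
  assumes d: "test_chain d a b" and r: "r \<ge> 0"
  shows "sq_int lebesgue (\<lambda>x. kappa_minus l r x * fourier (d 0) x)"
proof -
  obtain n :: nat where n: "r \<le> real n" using real_arch_simple by blast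
  obtain K where K: "\<forall>d a b x. test_chain d a b \<longrightarrow> cmod (kappa_minus l r x * fourier (d 0) x) \<le>
    K * ((LINT x|lebesgue. cmod (d 0 x)) + (LINT x|lebesgue. cmod (d (Suc n) x))) * cmod (hardy l 0 x)"
    by (rule kappa_fourier_bound[OF r n], rule that, assumption)
  from K[rule_format, OF d] show ?thesis
    by (intro sq_int_bound[OF hardy_sq_int[OF l, of 0]] continuous_imp_lebesgue continuous_intros kappa_continuous
        fourier_continuous[OF d] always_eventually allI)
qed

end

section \<open>Test functions approximating Laguerre functions\<close>

text \<open>Each derivative costs at most a factor \<open>1 / x\<close>. Such bounds survive
  products and, for constant \<open>U\<close>, dilations, so they hold for the cutoffs uniformly in
  the scale.\<close>

definition symbol :: "(real \<Rightarrow> real) \<Rightarrow> (nat \<Rightarrow> real \<Rightarrow> complex) \<Rightarrow> (nat \<Rightarrow> real) \<Rightarrow> bool" where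
  "symbol U d C \<longleftrightarrow> deriv_chain d {0<..} \<and> (\<forall>i. \<forall>x>0. cmod (d i x) * x ^ i \<le> C i * U x)"

lemma symbol_bound: "symbol U d C \<Longrightarrow> x > 0 \<Longrightarrow> cmod (d i x) * x ^ i \<le> C i * U x"
  by (simp add: symbol_def)

lemma symbol_leibniz:
  assumes d: "symbol U d C" and e: "symbol V e K"
  shows "symbol (\<lambda>x. U x * V x) (leibniz d e) (\<lambda>n. \<Sum>i\<le>n. real (n choose i) * (C i * K (n - i)))"
  unfolding symbol_def
proof (intro conjI allI impI)
  show "deriv_chain (leibniz d e) {0<..}"
    using d e by (intro deriv_chain_leibniz) (auto simp: symbol_def)
  fix n and x :: real assume x: "x > 0"
  have "cmod (leibniz d e n x) * x ^ n \<le> (\<Sum>i\<le>n. cmod (of_nat (n choose i) * (d i x * e (n - i) x))) * x ^ n"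
    unfolding leibniz_def using x by (intro mult_right_mono norm_sum) auto
  also have "\<dots> = (\<Sum>i\<le>n. real (n choose i) * ((cmod (d i x) * x ^ i) * (cmod (e (n - i) x) * x ^ (n - i))))"
    unfolding sum_distrib_right
  proof (intro sum.cong refl)
    fix i assume "i \<in> {..n}"
    then have "x ^ n = x ^ i * x ^ (n - i)" by (simp flip: power_add)
    then show "cmod (of_nat (n choose i) * (d i x * e (n - i) x)) * x ^ n =
        real (n choose i) * ((cmod (d i x) * x ^ i) * (cmod (e (n - i) x) * x ^ (n - i)))"
      by (simp add: norm_mult)
  qed
  also have "\<dots> \<le> (\<Sum>i\<le>n. real (n choose i) * ((C i * U x) * (K (n - i) * V x)))"
  proof (intro sum_mono mult_left_mono)
    fix i
    have "0 \<le> C i * U x" by (rule order_trans[OF _ symbol_bound[OF d x]]) (use x in simp)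
    then show "(cmod (d i x) * x ^ i) * (cmod (e (n - i) x) * x ^ (n - i)) \<le> (C i * U x) * (K (n - i) * V x)"
      by (intro mult_mono[OF symbol_bound[OF d x] symbol_bound[OF e x]]) (use x in auto)
  qed auto
  also have "\<dots> = (\<Sum>i\<le>n. real (n choose i) * (C i * K (n - i))) * (U x * V x)"
    unfolding sum_distrib_right by (intro sum.cong refl) (simp add: mult_ac)
  finally show "cmod (leibniz d e n x) * x ^ n \<le> (\<Sum>i\<le>n. real (n choose i) * (C i * K (n - i))) * (U x * V x)" .
qed

lemma leibniz_0 [simp]: "leibniz d e 0 x = d 0 x * e 0 x"
  by (simp add: leibniz_def)

lemma symbol_powr: "\<exists>d C. symbol (\<lambda>x. x powr a) d C \<and> (\<forall>x. d 0 x = of_real (x powr a))"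
proof -
  define c where "c i = (\<Prod>j<i. a - real j)" for i
  define d where "d i x = complex_of_real (c i * x powr (a - real i))" for i x
  have "deriv_chain d {0<..}"
    unfolding deriv_chain_def
  proof (intro allI ballI)
    fix i and x :: real assume x: "x \<in> {0<..}"
    have "((\<lambda>x. c i * x powr (a - real i)) has_real_derivative c (Suc i) * x powr (a - real (Suc i))) (at x)"
      using x by (auto intro!: derivative_eq_intros simp: c_def algebra_simps)
    then have "((\<lambda>x. complex_of_real (c i * x powr (a - real i))) has_vector_derivative of_real (c (Suc i) * x powr (a - real (Suc i)))) (at x)"
      by (rule has_vector_derivative_of_real)
    then show "(d i has_vector_derivative d (Suc i) x) (at x)" by (simp only: d_def[abs_def])
  qed
  moreover have "cmod (d i x) * x ^ i \<le> \<bar>c i\<bar> * x powr a" if "x > 0" for i x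
  proof -
    have "cmod (d i x) * x ^ i = \<bar>c i\<bar> * (x powr (a - real i) * x ^ i)"
      unfolding d_def norm_of_real abs_mult by simp
    also have "x powr (a - real i) * x ^ i = x powr a"
      using that by (simp add: powr_realpow[symmetric] flip: powr_add)
    finally show ?thesis by simp
  qed
  ultimately have "symbol (\<lambda>x. x powr a) d (\<lambda>i. \<bar>c i\<bar>)" by (simp add: symbol_def)
  moreover have "d 0 x = of_real (x powr a)" for x by (simp add: d_def c_def)
  ultimately show ?thesis by blast
qed

lemma has_vector_derivative_exp_real:
  "((\<lambda>x. complex_of_real (c * exp (- p * x))) has_vector_derivative complex_of_real (c * (- p) * exp (- p * x))) (at x)"
  by (rule has_vector_derivative_of_real) (auto intro!: derivative_eq_intros)

text \<open>Half of the exponent pays for the factor \<open>x ^ i\<close>, hence the bound by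
  \<open>exp (- p * x / 2)\<close>.\<close>

lemma symbol_exp:
  assumes p: "p > 0"
  shows "\<exists>d C. symbol (\<lambda>x. exp (- p * x / 2)) d C \<and> (\<forall>x. d 0 x = of_real (exp (- p * x)))"
proof -
  define d where "d i x = complex_of_real ((- p) ^ i * exp (- p * x))" for i x
  have "deriv_chain d {0<..}"
    unfolding deriv_chain_def
    using has_vector_derivative_exp_real[of "(- p) ^ i" p for i] unfolding d_def[abs_def] power_Suc2 by blast
  moreover have "cmod (d i x) * x ^ i \<le> (2 ^ i * fact i) * exp (- p * x / 2)" if x: "x > 0" for i x
  proof -
    have "(p * x / 2) ^ i \<le> fact i * exp (p * x / 2)" using p x by (intro power_le_fact_exp) auto
    then have "2 ^ i * (p * x / 2) ^ i * exp (- p * x) \<le> 2 ^ i * (fact i * exp (p * x / 2)) * exp (- p * x)"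
      by (intro mult_left_mono mult_right_mono) auto
    also have "\<dots> = 2 ^ i * fact i * (exp (p * x / 2) * exp (- p * x))" by simp
    also have "exp (p * x / 2) * exp (- p * x) = exp (- p * x / 2)" unfolding exp_add[symmetric] by simp
    also have "2 ^ i * (p * x / 2) ^ i = (p * x) ^ i" by (simp flip: power_mult_distrib)
    finally show ?thesis using p by (simp add: d_def norm_mult norm_power power_mult_distrib mult_ac)
  qed
  ultimately have "symbol (\<lambda>x. exp (- p * x / 2)) d (\<lambda>i. 2 ^ i * fact i)" by (simp add: symbol_def)
  moreover have "d 0 x = of_real (exp (- p * x))" for x by (simp add: d_def)
  ultimately show ?thesis by blast
qed

text \<open>The majorant \<open>x\<close> records the simple zero at the origin, which becomes a
  zero of order \<open>M\<close> in the next lemma.\<close>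

lemma symbol_one_minus_exp:
  assumes R: "R > 0"
  shows "\<exists>d C. symbol (\<lambda>x. x) d C \<and> (\<forall>x. d 0 x = of_real (1 - exp (- R * x)))"
proof -
  define d where "d i x = (if i = 0 then 1 else 0) - complex_of_real ((- R) ^ i * exp (- R * x))" for i x
  define C where "C i = (if i = 0 then R else R * fact (i - 1))" for i
  have "deriv_chain d {0<..}"
    unfolding deriv_chain_def
  proof (intro allI ballI)
    fix i and x :: real
    have "((\<lambda>x. (if i = 0 then 1 else 0) - complex_of_real ((- R) ^ i * exp (- R * x))) has_vector_derivative
        0 - complex_of_real ((- R) ^ i * (- R) * exp (- R * x))) (at x)"
      by (intro has_vector_derivative_diff has_vector_derivative_const has_vector_derivative_exp_real)
    moreover have "0 - complex_of_real ((- R) ^ i * (- R) * exp (- R * x)) = d (Suc i) x"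
      unfolding d_def power_Suc2 by simp
    moreover have "d i = (\<lambda>x. (if i = 0 then 1 else 0) - complex_of_real ((- R) ^ i * exp (- R * x)))"
      by (simp add: d_def fun_eq_iff)
    ultimately show "(d i has_vector_derivative d (Suc i) x) (at x)"
      by (simp only:)
  qed
  moreover have "cmod (d i x) * x ^ i \<le> C i * x" if x: "x > 0" for i x
  proof (cases i)
    case 0
    have "d 0 x = of_real (1 - exp (- R * x))" by (simp add: d_def)
    moreover have "exp (- R * x) \<le> 1" using R x by simp
    moreover have "1 - exp (- R * x) \<le> R * x" using exp_ge_add_one_self[of "- R * x"] by simp
    ultimately show ?thesis using 0 by (simp only: norm_of_real) (simp add: C_def)
  next
    case (Suc j)
    have "(R * x) ^ j \<le> fact j * exp (R * x)" using R x by (intro power_le_fact_exp) auto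
    then have "(R * x) ^ j * exp (- R * x) \<le> fact j * exp (R * x) * exp (- R * x)"
      by (intro mult_right_mono) auto
    also have "\<dots> = fact j" by (simp add: mult.assoc flip: exp_add)
    finally have "R * x * ((R * x) ^ j * exp (- R * x)) \<le> R * x * fact j" using R x by (intro mult_left_mono) auto
    then show ?thesis using Suc R by (simp add: d_def C_def norm_mult norm_power power_mult_distrib mult_ac)
  qed
  ultimately have "symbol (\<lambda>x. x) d C" by (simp add: symbol_def)
  moreover have "d 0 x = of_real (1 - exp (- R * x))" for x by (simp add: d_def)
  ultimately show ?thesis by blast
qed

lemma symbol_one_minus_exp_power:
  assumes R: "R > 0"
  shows "\<exists>d C. symbol (\<lambda>x. x ^ M) d C \<and> (\<forall>x. d 0 x = of_real ((1 - exp (- R * x)) ^ M))"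
proof (induction M)
  case 0
  have "symbol (\<lambda>x. x ^ 0) (\<lambda>i x. if i = 0 then 1 else 0) (\<lambda>i. 1)"
    by (auto simp: symbol_def deriv_chain_def)
  then show ?case by (intro exI[of _ "\<lambda>i x. if i = 0 then 1 else 0"] exI[of _ "\<lambda>i. 1"]) auto
next
  case (Suc M)
  obtain d C where d: "symbol (\<lambda>x. x) d C" "\<And>x. d 0 x = of_real (1 - exp (- R * x))"
    using symbol_one_minus_exp[OF R] by blast
  obtain e K where e: "symbol (\<lambda>x. x ^ M) e K" "\<And>x. e 0 x = of_real ((1 - exp (- R * x)) ^ M)"
    using Suc by blast
  have "symbol (\<lambda>x. x ^ Suc M) (leibniz d e) (\<lambda>n. \<Sum>i\<le>n. real (n choose i) * (C i * K (n - i)))"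
    using symbol_leibniz[OF d(1) e(1)] by simp
  moreover have "leibniz d e 0 x = of_real ((1 - exp (- R * x)) ^ Suc M)" for x
    unfolding leibniz_0 d(2) e(2) by simp
  ultimately show ?case by blast
qed

text \<open>With the factor \<open>x ^ i\<close>, differentiating the dilated steps produces powers
  of \<open>m * x\<close> and \<open>x / m\<close>, which are at most 2 wherever the derivatives do
  not vanish; hence \<open>C\<close> is independent of \<open>m\<close>.\<close>

lemma cutoff_chain:
  obtains \<theta> C where "\<And>m. m \<ge> 1 \<Longrightarrow> symbol (\<lambda>x. 1) (\<theta> m) C"
    "\<And>m x. \<theta> m 0 x = of_real (smooth_step (m * x - 1) * smooth_step (2 - x / m))"
    "\<And>m i x. m \<ge> 1 \<Longrightarrow> x > 0 \<Longrightarrow> x < 1 / m \<or> x > 2 * m \<Longrightarrow> \<theta> m i x = 0"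
proof -
  obtain d K where d: "d 0 = smooth_step" "\<And>i x. (d i has_real_derivative d (Suc i) x) (at x)"
      "\<And>i x. \<bar>d i x\<bar> \<le> K i" "\<And>i x. i \<ge> 1 \<Longrightarrow> x < 0 \<or> x > 1 \<Longrightarrow> d i x = 0"
    using smooth_step_chain by blast
  define e where "e m i x = complex_of_real (m ^ i * d i (m * x - 1))" for m :: real and i x
  define f where "f m i x = complex_of_real ((- 1 / m) ^ i * d i (2 - x / m))" for m :: real and i x
  have dz: "d i x = 0" if "x < 0" for i x
    using d(4)[of i x] smooth_step_0[of x] that d(1) by (cases i) auto
  have aff: "((\<lambda>x. complex_of_real (s ^ i * d i (s * x + t))) has_vector_derivative complex_of_real (s ^ Suc i * d (Suc i) (s * x + t))) (at x)" for s t i x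
  proof (rule has_vector_derivative_of_real)
    show "((\<lambda>x. s ^ i * d i (s * x + t)) has_real_derivative s ^ Suc i * d (Suc i) (s * x + t)) (at x)"
      by (rule DERIV_cong[OF DERIV_cmult[OF DERIV_chain2[OF d(2)]]]) (auto intro!: derivative_eq_intros)
  qed
  have e: "symbol (\<lambda>x. 1) (e m) (\<lambda>i. 2 ^ i * K i)" if m: "m \<ge> 1" for m
    unfolding symbol_def
  proof (intro conjI allI impI)
    show "deriv_chain (e m) {0<..}"
      unfolding deriv_chain_def using aff[of m _ "- 1"] by (simp add: e_def[abs_def])
    fix i and x :: real assume x: "x > 0"
    show "cmod (e m i x) * x ^ i \<le> 2 ^ i * K i * 1"
    proof (cases "i \<ge> 1 \<and> (m * x - 1 < 0 \<or> m * x - 1 > 1)")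
      case True
      then show ?thesis using d(4)[of i "m * x - 1"] order_trans[OF abs_ge_zero d(3)[of i 0]] by (simp add: e_def)
    next
      case False
      have "(m * x) ^ i \<le> 2 ^ i"
      proof (cases i)
        case (Suc j)
        then have "m * x \<le> 2" using False by auto
        then show ?thesis using m x by (intro power_mono) auto
      qed simp
      then have "(m * x) ^ i * \<bar>d i (m * x - 1)\<bar> \<le> 2 ^ i * K i" using m x by (intro mult_mono d(3)) auto
      then show ?thesis using m by (simp add: e_def norm_mult norm_power power_mult_distrib mult_ac)
    qed
  qed
  have f: "symbol (\<lambda>x. 1) (f m) (\<lambda>i. 2 ^ i * K i)" if m: "m \<ge> 1" for m
    unfolding symbol_def
  proof (intro conjI allI impI)
    have "2 - x / m = (- 1 / m) * x + 2" for x by simp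
    then show "deriv_chain (f m) {0<..}"
      unfolding deriv_chain_def using aff[of "- 1 / m" _ 2] by (simp only: f_def[abs_def]) blast
    fix i and x :: real assume x: "x > 0"
    show "cmod (f m i x) * x ^ i \<le> 2 ^ i * K i * 1"
    proof (cases "i \<ge> 1 \<and> (2 - x / m < 0 \<or> 2 - x / m > 1)")
      case True
      then show ?thesis using d(4)[of i "2 - x / m"] order_trans[OF abs_ge_zero d(3)[of i 0]] by (simp add: f_def)
    next
      case False
      have "(x / m) ^ i \<le> 2 ^ i"
      proof (cases i)
        case (Suc j)
        then have "x / m \<le> 2" using False by auto
        then show ?thesis using m x by (intro power_mono) auto
      qed simp
      then have "(x / m) ^ i * \<bar>d i (2 - x / m)\<bar> \<le> 2 ^ i * K i" using m x by (intro mult_mono d(3)) auto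
      then show ?thesis using m by (simp add: f_def norm_mult norm_power norm_divide power_divide mult_ac)
    qed
  qed
  show ?thesis
  proof (rule that[of "\<lambda>m. leibniz (e m) (f m)" "\<lambda>n. \<Sum>i\<le>n. real (n choose i) * (2 ^ i * K i * (2 ^ (n - i) * K (n - i)))"])
    show "symbol (\<lambda>x. 1) (leibniz (e m) (f m)) (\<lambda>n. \<Sum>i\<le>n. real (n choose i) * (2 ^ i * K i * (2 ^ (n - i) * K (n - i))))"
      if "m \<ge> 1" for m using symbol_leibniz[OF e[OF that] f[OF that]] by simp
    show "leibniz (e m) (f m) 0 x = of_real (smooth_step (m * x - 1) * smooth_step (2 - x / m))" for m x
      by (simp add: e_def f_def d(1))
    show "leibniz (e m) (f m) i x = 0" if m: "m \<ge> 1" and x: "x > 0" "x < 1 / m \<or> x > 2 * m" for m i x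
    proof -
      have "m * x - 1 < 0 \<or> 2 - x / m < 0" using m x by (auto simp: field_simps)
      then have "e m j x = 0 \<or> f m k x = 0" for j k using dz by (auto simp: e_def f_def)
      then show ?thesis unfolding leibniz_def by (intro sum.neutral) auto
    qed
  qed
qed

text \<open>Extension by zero stays smooth because the functions already vanish on an interval to
  the right of the origin.\<close>

lemma cutoff_test_chain:
  assumes d: "deriv_chain d {0<..}" and m: "m \<ge> 1"
    and z: "\<And>i x. x > 0 \<Longrightarrow> x < 1 / m \<or> x > 2 * m \<Longrightarrow> d i x = 0"
  shows "test_chain (\<lambda>i x. if x > 0 then d i x else 0) (1 / m) (2 * m)"
  unfolding test_chain_def
proof (intro conjI allI impI)
  show "0 < 1 / m" using m by simp
  show "(if x > 0 then d i x else 0) = 0" if "x \<notin> {1 / m..2 * m}" for i x using z that by auto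
  show "deriv_chain (\<lambda>i x. if x > 0 then d i x else 0) UNIV"
    unfolding deriv_chain_def
  proof (intro allI ballI)
    fix i and x :: real
    show "((\<lambda>x. if x > 0 then d i x else 0) has_vector_derivative (if x > 0 then d (Suc i) x else 0)) (at x)"
    proof (cases "x > 0")
      case True
      have "(d i has_vector_derivative d (Suc i) x) (at x)" using True by (intro deriv_chainD[OF d]) auto
      then have "((\<lambda>x. if x > 0 then d i x else 0) has_vector_derivative d (Suc i) x) (at x)"
        by (rule has_vector_derivative_transform_within_open[of _ _ _ "{0<..}"]) (use True in auto)
      then show ?thesis using True by simp
    next
      case False
      have "((\<lambda>x. 0) has_vector_derivative 0) (at x)" by (rule has_vector_derivative_const)
      then have "((\<lambda>x. if x > 0 then d i x else 0) has_vector_derivative 0) (at x)"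
      proof (rule has_vector_derivative_transform_within_open[of _ _ _ "{..<1 / m}"])
        have "0 < 1 / m" using m by simp
        then show "x \<in> {..<1 / m}" using False unfolding lessThan_iff by linarith
        show "0 = (if y > 0 then d i y else 0)" if "y \<in> {..<1 / m}" for y using z[of y i] that by auto
      qed auto
      then show ?thesis using False by simp
    qed
  qed
qed

text \<open>The wanted function \<open>x powr a * exp (- p * x)\<close> with a zero of order
  \<open>M\<close> added at the origin; the limit of large \<open>R\<close> removes that zero
  again.\<close>

definition damped :: "real \<Rightarrow> real \<Rightarrow> real \<Rightarrow> nat \<Rightarrow> real \<Rightarrow> real" where
  "damped a p R M x = x powr a * exp (- p * x) * (1 - exp (- R * x)) ^ M"

text \<open>Truncations of \<open>damped a p R M\<close> that are test functions, with the derivatives of order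
  \<open>M\<close> bounded in the mean uniformly in the truncation; the factor \<open>(1 - exp (- R * x)) ^ M\<close>
  compensates the growth of the derivatives of the cutoff near the origin.\<close>

lemma damped_truncation:
  assumes a: "a \<ge> 0" and p: "p > 0" and R: "R > 0"
  obtains \<phi> B where "\<And>m. test_chain (\<phi> m) (1 / real (Suc m)) (2 * real (Suc m))"
    "\<And>m x. cmod (\<phi> m 0 x) \<le> indicator {0<..} x * damped a p R M x"
    "\<And>x. (\<lambda>m. \<phi> m 0 x) \<longlonglongrightarrow> of_real (indicator {0<..} x * damped a p R M x)"
    "\<And>m. (LINT x|lebesgue. cmod (\<phi> m 0 x)) + (LINT x|lebesgue. cmod (\<phi> m M x)) \<le> B"
proof -
  obtain \<theta> C where \<theta>: "\<And>m. m \<ge> 1 \<Longrightarrow> symbol (\<lambda>x. 1) (\<theta> m) C"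
    "\<And>m x. \<theta> m 0 x = of_real (smooth_step (m * x - 1) * smooth_step (2 - x / m))"
    "\<And>m i x. m \<ge> 1 \<Longrightarrow> x > 0 \<Longrightarrow> x < 1 / m \<or> x > 2 * m \<Longrightarrow> \<theta> m i x = 0"
    using cutoff_chain by metis
  obtain d1 C1 where 1: "symbol (\<lambda>x. x powr a) d1 C1" "\<And>x. d1 0 x = of_real (x powr a)" using symbol_powr by blast
  obtain d2 C2 where 2: "symbol (\<lambda>x. exp (- p * x / 2)) d2 C2" "\<And>x. d2 0 x = of_real (exp (- p * x))" using symbol_exp[OF p] by blast
  obtain d3 C3 where 3: "symbol (\<lambda>x. x ^ M) d3 C3" "\<And>x. d3 0 x = of_real ((1 - exp (- R * x)) ^ M)" using symbol_one_minus_exp_power[OF R] by blast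
  define e where "e = leibniz (leibniz d1 d2) d3"
  obtain K where e: "symbol (\<lambda>x. x powr a * exp (- p * x / 2) * x ^ M) e K"
    unfolding e_def using symbol_leibniz[OF symbol_leibniz[OF 1(1) 2(1)] 3(1)] by blast
  have e0: "e 0 x = of_real (damped a p R M x)" for x
    by (simp add: e_def 1 2 3 damped_def)
  define h where "h m = leibniz (\<theta> (real (Suc m))) e" for m
  obtain L where h: "\<And>m. symbol (\<lambda>x. x powr a * exp (- p * x / 2) * x ^ M) (h m) L"
  proof
    show "symbol (\<lambda>x. x powr a * exp (- p * x / 2) * x ^ M) (h m) (\<lambda>n. \<Sum>i\<le>n. real (n choose i) * (C i * K (n - i)))" for m
      unfolding h_def using symbol_leibniz[OF \<theta>(1) e, of "real (Suc m)"] by simp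
  qed
  define \<phi> where "\<phi> m i x = (if x > 0 then h m i x else 0)" for m i x
  have tc: "test_chain (\<phi> m) (1 / real (Suc m)) (2 * real (Suc m))" for m
    unfolding \<phi>_def[abs_def]
  proof (rule cutoff_test_chain)
    show "deriv_chain (h m) {0<..}" using h by (simp add: symbol_def)
    show "h m i x = 0" if "x > 0" "x < 1 / real (Suc m) \<or> x > 2 * real (Suc m)" for i x
      unfolding h_def leibniz_def using \<theta>(3)[OF _ that] by (intro sum.neutral) auto
  qed simp
  have dn: "damped a p R M x \<ge> 0" if "x > 0" for x using that R by (simp add: damped_def)
  have h0: "h m 0 x = of_real (smooth_step (real (Suc m) * x - 1) * smooth_step (2 - x / real (Suc m)) * damped a p R M x)" for m x
    unfolding h_def leibniz_0 e0 \<theta>(2) by simp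
  have b1: "cmod (\<phi> m 0 x) \<le> indicator {0<..} x * damped a p R M x" for m x
  proof (cases "x > 0")
    case True
    have s: "0 \<le> smooth_step (real (Suc m) * x - 1) * smooth_step (2 - x / real (Suc m))"
      "smooth_step (real (Suc m) * x - 1) * smooth_step (2 - x / real (Suc m)) \<le> 1"
      using smooth_step_bounds by (auto intro!: mult_nonneg_nonneg mult_le_one)
    have "cmod (\<phi> m 0 x) = smooth_step (real (Suc m) * x - 1) * smooth_step (2 - x / real (Suc m)) * damped a p R M x"
      using True mult_nonneg_nonneg[OF s(1) dn[OF True]] unfolding \<phi>_def h0 by (simp only: if_True norm_of_real abs_of_nonneg)
    also have "\<dots> \<le> damped a p R M x" using s dn[OF True] by (intro mult_left_le_one_le)
    finally show ?thesis using True by simp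
  qed (simp add: \<phi>_def)
  have lim: "(\<lambda>m. \<phi> m 0 x) \<longlonglongrightarrow> of_real (indicator {0<..} x * damped a p R M x)" for x
  proof (cases "x > 0")
    case True
    obtain N where N: "max (2 / x) x < real N" using reals_Archimedean2 by blast
    have "\<phi> m 0 x = of_real (damped a p R M x)" if "m \<ge> N" for m
    proof -
      have m: "2 / x < real (Suc m)" "x < real (Suc m)" using N that by auto
      have "1 \<le> real (Suc m) * x - 1" using m(1) True by (simp add: field_simps)
      moreover have "1 \<le> 2 - x / real (Suc m)" using m(2) by (simp add: field_simps)
      ultimately show ?thesis unfolding \<phi>_def h0 using True smooth_step_1 by simp
    qed
    then have "\<forall>\<^sub>F m in sequentially. \<phi> m 0 x = of_real (indicator {0<..} x * damped a p R M x)"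
      using True by (intro eventually_sequentiallyI[of N]) simp
    then show ?thesis by (rule tendsto_eventually)
  qed (simp add: \<phi>_def)
  \<comment> \<open>Integrable majorants: the \<open>M\<close>-th derivative loses
    \<open>x ^ M\<close>, which the zero of order \<open>M\<close> restores, leaving
    \<open>W0\<close>; the function itself keeps the zero and is bounded by
    \<open>W1\<close>.\<close>
  define W0 where "W0 x = indicator {0<..} x *\<^sub>R (x powr a * exp (- (p / 2) * x))" for x :: real
  define W1 where "W1 x = indicator {0<..} x *\<^sub>R (x powr (a + real M) * exp (- (p / 2) * x))" for x :: real
  have i0: "integrable lebesgue W0" unfolding W0_def[abs_def] set_integrable_def[symmetric]
    by (rule powr_exp_integral_scaled(1)) (use a p in auto)
  have i1: "integrable lebesgue W1" unfolding W1_def[abs_def] set_integrable_def[symmetric]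
    by (rule powr_exp_integral_scaled(1)) (use a p in auto)
  have bM: "cmod (\<phi> m M x) \<le> L M * W0 x" for m x
  proof (cases "x > 0")
    case True
    have "cmod (h m M x) * x ^ M \<le> (L M * (x powr a * exp (- p * x / 2))) * x ^ M"
      using symbol_bound[OF h True, of m M] by (simp add: mult_ac)
    then have "cmod (h m M x) \<le> L M * (x powr a * exp (- p * x / 2))" using True by simp
    then show ?thesis using True by (simp add: \<phi>_def W0_def)
  qed (simp add: \<phi>_def W0_def)
  have b0: "cmod (\<phi> m 0 x) \<le> L 0 * W1 x" for m x
  proof (cases "x > 0")
    case True
    have "cmod (h m 0 x) \<le> L 0 * (x powr a * exp (- p * x / 2) * x ^ M)"
      using symbol_bound[OF h True, of m 0] by simp
    then show ?thesis using True by (simp add: \<phi>_def W1_def powr_add powr_realpow mult_ac)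
  qed (simp add: \<phi>_def W1_def)
  have "(LINT x|lebesgue. cmod (\<phi> m 0 x)) + (LINT x|lebesgue. cmod (\<phi> m M x)) \<le>
      (LINT x|lebesgue. L 0 * W1 x) + (LINT x|lebesgue. L M * W0 x)" for m
    by (intro add_mono integral_mono b0 bM integrable_norm test_chainD(5)[OF tc] integrable_mult_right i0 i1)
  then show ?thesis by (rule that[OF tc b1 lim])
qed

lemma damped_le: "x > 0 \<Longrightarrow> R > 0 \<Longrightarrow> damped a p R M x \<le> x powr a * exp (- p * x)"
  "x > 0 \<Longrightarrow> R > 0 \<Longrightarrow> 0 \<le> damped a p R M x"
  by (auto simp: damped_def intro!: mult_left_le power_le_one)

text \<open>The binomial theorem turns the damping factor into shifts of the exponent by
  \<open>k * R\<close>. The argument is \<open>P - p\<close> because \<open>damped\<close> already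
  contains \<open>exp (- p * x)\<close>.\<close>

lemma damped_integral:
  assumes a: "a > -1" and P: "Re P > 0" and R: "R > 0"
  shows "laplace (\<lambda>x. of_real (indicator {0<..} x * damped a p R M x)) (P - of_real p) =
    of_real (Gamma (a + 1)) * (\<Sum>k\<le>M. (-1) ^ k * of_nat (M choose k) * (P + of_real (real k * R)) powr (- of_real (a + 1)))"
proof -
  let ?Q = "\<lambda>k. P + of_real (real k * R)"
  have Q: "Re (?Q k) > 0" for k using P R by (simp add: add_pos_nonneg)
  let ?g = "\<lambda>k x. indicator {0<..} x *\<^sub>R (of_real (x powr a) * exp (- ?Q k * of_real x)) :: complex"
  have gi: "integrable lebesgue (?g k)" for k
    using powr_exp_integral(1)[OF a Q] by (simp only: set_integrable_def)
  have gv: "(LINT x|lebesgue. ?g k x) = of_real (Gamma (a + 1)) * ?Q k powr (- of_real (a + 1))" for k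
    using powr_exp_integral(2)[OF a Q] by (simp only: set_lebesgue_integral_def)
  have e: "exp (- (P - of_real p) * of_real x) * of_real (indicator {0<..} x * damped a p R M x) = (\<Sum>k\<le>M. ((-1) ^ k * of_nat (M choose k)) * ?g k x)" for x
  proof (cases "x > 0")
    case True
    have "(1 - exp (- R * x)) ^ M = (\<Sum>k\<le>M. of_nat (M choose k) * (- exp (- R * x)) ^ k * 1 ^ (M - k))"
      using binomial_ring[of "- exp (- R * x)" 1 M] by (simp add: add.commute)
    also have "\<dots> = (\<Sum>k\<le>M. (-1) ^ k * real (M choose k) * exp (- (real k * R * x)))"
      by (intro sum.cong refl) (simp add: power_minus[of "exp _"] exp_of_nat_mult[symmetric] mult_ac)
    finally have b: "complex_of_real ((1 - exp (- R * x)) ^ M) = (\<Sum>k\<le>M. (-1) ^ k * of_nat (M choose k) * of_real (exp (- (real k * R * x))))"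
      by simp
    have "exp (- (P - of_real p) * of_real x) * of_real (exp (- p * x)) * of_real (exp (- (real k * R * x))) = exp (- ?Q k * of_real x)" for k
      by (simp add: exp_of_real[symmetric] algebra_simps flip: exp_add)
    then have c: "exp (- (P - of_real p) * of_real x) * (of_real (exp (- p * x)) * (u * of_real (exp (- (real k * R * x))))) = u * exp (- ?Q k * of_real x)" for k u
      by (simp add: mult_ac)
    have "exp (- (P - of_real p) * of_real x) * of_real (indicator {0<..} x * damped a p R M x) =
        of_real (x powr a) * (exp (- (P - of_real p) * of_real x) * (of_real (exp (- p * x)) * of_real ((1 - exp (- R * x)) ^ M)))"
      using True unfolding damped_def by (simp only: of_real_mult) (simp add: mult_ac)
    also have "\<dots> = of_real (x powr a) * (\<Sum>k\<le>M. ((-1) ^ k * of_nat (M choose k)) * exp (- ?Q k * of_real x))"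
      unfolding b sum_distrib_left c ..
    finally show ?thesis using True by (simp add: sum_distrib_left mult_ac)
  qed simp
  show ?thesis unfolding laplace_def e
    by (subst Bochner_Integration.integral_sum[OF integrable_mult_right[OF gi]])
      (simp only: integral_mult_right_zero gv sum_distrib_left mult.left_commute[of "of_real (Gamma (a + 1))"])
qed

section \<open>Weighted coefficient sums\<close>

lemma cmod_kappa_powr_le:
  assumes l: "l > 0" and al: "al \<ge> 0"
  shows "cmod (kappa_minus l al x) \<le> 2 powr al * cmod (pole l x) powr al"
proof -
  have nz: "\<i> * of_real l - of_real x \<noteq> 0" using l by (auto simp: complex_eq_iff)
  have "(cmod (\<i> * of_real l - of_real x))\<^sup>2 \<le> (2 * cmod (pole l x))\<^sup>2"
    unfolding power_mult_distrib cmod_pole_sq unfolding cmod_power2 using l by (simp add: power2_eq_square)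
  then have "cmod (\<i> * of_real l - of_real x) \<le> 2 * cmod (pole l x)"
    by (rule power2_le_imp_le) simp
  then have "cmod (\<i> * of_real l - of_real x) powr al \<le> (2 * cmod (pole l x)) powr al"
    using al by (intro powr_mono2) auto
  also have "\<dots> = 2 powr al * cmod (pole l x) powr al" by (subst powr_mult) auto
  finally have *: "cmod ((\<i> * of_real l - of_real x) powr of_real al) \<le> 2 powr al * cmod (pole l x) powr al"
    by (simp add: cmod_powr_real[OF nz])
  have "1 \<le> sqrt (2 * pi)" using pi_ge_two by (intro real_le_rsqrt) simp
  then have "1 / sqrt (2 * pi) * cmod ((\<i> * of_real l - of_real x) powr of_real al) \<le> cmod ((\<i> * of_real l - of_real x) powr of_real al)"
    by (intro mult_left_le_one_le) auto
  with * show ?thesis by (simp add: kappa_minus_def norm_mult norm_divide)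
qed

text \<open>Half of the weight \<open>x powr b\<close> is built in, which makes these functions
  orthogonal with respect to Lebesgue measure.\<close>

definition lag_basis :: "real \<Rightarrow> real \<Rightarrow> nat \<Rightarrow> real \<Rightarrow> real" where
  "lag_basis l b j x = indicator {0<..} x * (x powr (b / 2) * lag_fun l b j x)"

lemma lag_basis_mult:
  "lag_basis l b i x * lag_basis l b j x =
    indicator {0<..} x *\<^sub>R (x powr b * exp (- l * x) * (laguerre b i (l * x) * laguerre b j (l * x)))"
proof (cases "x > 0")
  case True
  have "x powr (b / 2) * x powr (b / 2) = x powr b" by (simp flip: powr_add)
  moreover have "exp (- (l * x) / 2) * exp (- (l * x) / 2) = exp (- l * x)" by (simp flip: exp_add)
  ultimately have "x powr b * exp (- l * x) = (x powr (b / 2) * x powr (b / 2)) * (exp (- (l * x) / 2) * exp (- (l * x) / 2))"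
    by (simp only:)
  then show ?thesis using True by (simp add: lag_basis_def lag_fun_def)
qed (simp add: lag_basis_def)

lemma lag_basis_sq_int:
  assumes "b > -1" "l > 0" shows "sq_int lebesgue (\<lambda>x. of_real (lag_basis l b j x))"
proof -
  have "lag_fun l b j \<in> borel_measurable borel" by (intro borel_measurable_continuous_onI lag_fun_continuous)
  then have "(\<lambda>x. complex_of_real (lag_basis l b j x)) \<in> borel_measurable borel" unfolding lag_basis_def by measurable
  then have "(\<lambda>x. complex_of_real (lag_basis l b j x)) \<in> borel_measurable lebesgue" by (rule borel_measurable_lebesgueI)
  moreover have "integrable lebesgue (\<lambda>x. lag_basis l b j x * lag_basis l b j x)"
    unfolding lag_basis_mult set_integrable_def[symmetric] using assms by (intro laguerre_orthogonal(1)) auto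
  ultimately show ?thesis by (simp add: sq_int_def power2_eq_square)
qed

lemma lag_basis_orthogonal:
  assumes "b > -1" "l > 0"
  shows "(LINT x|lebesgue. lag_basis l b i x * lag_basis l b j x) =
    (if i = j then l powr (- (b + 1)) * (Gamma (b + 1) * bin (b + 1) i) else 0)"
proof -
  have "Gamma (b + 1 + real i) / fact i = Gamma (b + 1) * bin (b + 1) i"
  proof -
    have "b + 1 \<notin> \<int>\<^sub>\<le>\<^sub>0" using assms(1) by (auto elim!: nonpos_Ints_cases)
    moreover have "Gamma (b + 1) > 0" using assms(1) by (intro Gamma_real_pos) auto
    ultimately show ?thesis by (simp add: bin_def pochhammer_Gamma)
  qed
  then show ?thesis unfolding lag_basis_mult set_lebesgue_integral_def[symmetric] laguerre_orthogonal(2)[OF assms]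
    by (metis times_divide_eq_right)
qed

section \<open>A function of the source space together with its weighted spectrum
  \<open>g\<close>\<close>

context
  fixes l r1 :: real and f :: "real \<Rightarrow> real" and g :: "real \<Rightarrow> complex"
  assumes l: "l > 0" and r1: "r1 \<ge> 0"
    and f: "sq_int lebesgue (\<lambda>x. of_real (f x))"
    and star: "\<forall>\<phi>\<in>test_functions {0<..}.
      (LINT x|lebesgue. kappa_minus l (2 * r1) x * of_real (f x) * fourier \<phi> x) = (LINT x:{0<..}|lebesgue. g x * \<phi> x)"
    and g: "sq_int lebesgue (\<lambda>x. indicator {0<..} x *\<^sub>R (of_real (x powr r1) * g x))"
begin

definition wg :: "real \<Rightarrow> complex" where
  "wg x = indicator {0<..} x *\<^sub>R (of_real (x powr r1) * g x)"

lemma wg_sq_int: "sq_int lebesgue wg"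
  using g by (simp only: wg_def[abs_def])

lemma f_measurable: "(\<lambda>x. complex_of_real (f x)) \<in> borel_measurable lebesgue"
  using f by (simp only: sq_int_def)

lemma power_exp_sq_int:
  assumes a: "a \<ge> 2 * r1" and p: "p > 0"
  shows "sq_int lebesgue (\<lambda>x. of_real (indicator {0<..} x * (x powr (a - r1) * exp (- p * x))))"
  unfolding sq_int_def
proof
  have "(\<lambda>x. complex_of_real (indicator {0<..} x * (x powr (a - r1) * exp (- p * x)))) \<in> borel_measurable borel"
    by measurable
  then show "(\<lambda>x. complex_of_real (indicator {0<..} x * (x powr (a - r1) * exp (- p * x)))) \<in> borel_measurable lebesgue"
    by (rule borel_measurable_lebesgueI)
  have sq: "(cmod (of_real (indicator {0<..} x * (x powr (a - r1) * exp (- p * x)))))\<^sup>2 =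
      indicator {0<..} x *\<^sub>R (x powr (2 * (a - r1)) * exp (- (2 * p) * x))" for x
  proof (cases "x > 0")
    case True
    have "(exp (- p * x))\<^sup>2 = exp (- (2 * p) * x)" by (simp add: power2_eq_square flip: exp_add)
    then show ?thesis using True by (simp only: norm_of_real power2_abs power_mult_distrib powr_square) simp
  qed simp
  show "integrable lebesgue (\<lambda>x. (cmod (of_real (indicator {0<..} x * (x powr (a - r1) * exp (- p * x)))))\<^sup>2)"
  proof -
    have "2 * (a - r1) > -1" "2 * p > 0" using a p r1 by auto
    from powr_exp_integral_scaled(1)[OF this] show ?thesis
      unfolding sq set_integrable_def .
  qed
qed

lemma pairing_integrable:
  assumes a: "a \<ge> 2 * r1" and p: "p > 0"
  shows "integrable lebesgue (\<lambda>x. indicator {0<..} x *\<^sub>R (g x * of_real (x powr a * exp (- p * x))))"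
proof -
  have "integrable lebesgue (\<lambda>x. wg x * of_real (indicator {0<..} x * (x powr (a - r1) * exp (- p * x))))"
    by (intro sq_int_mult wg_sq_int power_exp_sq_int a p)
  moreover have "wg x * of_real (indicator {0<..} x * (x powr (a - r1) * exp (- p * x))) =
      indicator {0<..} x *\<^sub>R (g x * of_real (x powr a * exp (- p * x)))" for x
  proof (cases "x > 0")
    case True
    have "x powr r1 * x powr (a - r1) = x powr a" by (simp flip: powr_add)
    then have "complex_of_real (x powr r1) * of_real (x powr (a - r1)) = of_real (x powr a)" by (simp flip: of_real_mult)
    moreover have "wg x * of_real (indicator {0<..} x * (x powr (a - r1) * exp (- p * x))) =
        (of_real (x powr r1) * of_real (x powr (a - r1))) * (g x * of_real (exp (- p * x)))"
      using True by (simp add: wg_def)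
    ultimately show ?thesis using True by simp
  qed (simp add: wg_def)
  ultimately show ?thesis by (simp only:)
qed

lemma indicator_g_measurable: "(\<lambda>x. indicator {0<..} x *\<^sub>R g x) \<in> borel_measurable lebesgue"
proof -
  have "(\<lambda>x. complex_of_real (x powr (- r1))) \<in> borel_measurable borel" by measurable
  then have "(\<lambda>x. of_real (x powr (- r1)) * wg x) \<in> borel_measurable lebesgue"
    using wg_sq_int by (intro borel_measurable_times[OF borel_measurable_lebesgueI]) (simp_all only: sq_int_def)
  moreover have "of_real (x powr (- r1)) * wg x = indicator {0<..} x *\<^sub>R g x" for x
  proof (cases "x > 0")
    case True
    have "complex_of_real (x powr (- r1)) * of_real (x powr r1) = 1"
      using True by (simp flip: of_real_mult powr_add)
    moreover have "of_real (x powr (- r1)) * wg x = (complex_of_real (x powr (- r1)) * of_real (x powr r1)) * g x"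
      using True by (simp add: wg_def)
    ultimately show ?thesis using True by simp
  qed (simp add: wg_def)
  ultimately show ?thesis by (simp only:)
qed

text \<open>Passage from test functions to \<open>damped\<close> by truncation. On the left the
  uniform bound on derivatives of order \<open>n + 1\<close> gives domination by a multiple of
  \<open>|hardy 0| * |f|\<close>; on the right the truncations stay below
  \<open>x powr a * exp (- p * x)\<close>, which pairs integrably with \<open>g\<close>.\<close>

lemma damped_identity:
  assumes a: "a \<ge> 2 * r1" and p: "p > 0" and R: "R > 0" and n: "2 * r1 \<le> real n"
  shows "(LINT x|lebesgue. kappa_minus l (2 * r1) x * of_real (f x) *
      (of_real (1 / sqrt (2 * pi)) * laplace (\<lambda>x. of_real (indicator {0<..} x * damped a p R (Suc n) x)) (\<i> * of_real x))) =
    (LINT x:{0<..}|lebesgue. g x * of_real (damped a p R (Suc n) x))"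
proof -
  let ?\<psi> = "\<lambda>x. indicator {0<..} x * damped a p R (Suc n) x"
  have a0: "a \<ge> 0" using a r1 by simp
  obtain \<phi> B where \<phi>: "\<And>m. test_chain (\<phi> m) (1 / real (Suc m)) (2 * real (Suc m))"
    "\<And>m x. cmod (\<phi> m 0 x) \<le> ?\<psi> x"
    "\<And>x. (\<lambda>m. \<phi> m 0 x) \<longlonglongrightarrow> of_real (?\<psi> x)"
    "\<And>m. (LINT x|lebesgue. cmod (\<phi> m 0 x)) + (LINT x|lebesgue. cmod (\<phi> m (Suc n) x)) \<le> B"
    by (rule damped_truncation[OF a0 p R], rule that, fast+)
  have kap: "2 * r1 \<ge> 0" using r1 by simp
  obtain K where K: "K \<ge> 0" "\<forall>d a b x. test_chain d a b \<longrightarrow> cmod (kappa_minus l (2 * r1) x * fourier (d 0) x) \<le>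
    K * ((LINT x|lebesgue. cmod (d 0 x)) + (LINT x|lebesgue. cmod (d (Suc n) x))) * cmod (hardy l 0 x)"
    by (rule kappa_fourier_bound[OF l kap n], rule that, assumption+)
  have lap: "(\<lambda>m. laplace (\<phi> m 0) (\<i> * of_real x)) \<longlonglongrightarrow> laplace (\<lambda>x. of_real (?\<psi> x)) (\<i> * of_real x)" for x
    unfolding laplace_def
  proof (rule integral_dominated_convergence[where w="\<lambda>y. indicator {0<..} y *\<^sub>R (y powr a * exp (- p * y))"])
    show w: "integrable lebesgue (\<lambda>y. indicator {0<..} y *\<^sub>R (y powr a * exp (- p * y)))"
      using powr_exp_integral_scaled(1)[of a p] a0 p by (simp only: set_integrable_def)
    show m: "(\<lambda>y. exp (- (\<i> * of_real x) * of_real y) * \<phi> m 0 y) \<in> borel_measurable lebesgue" for m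
      by (intro continuous_imp_lebesgue continuous_intros test_chainD(4)[OF \<phi>(1)])
    have lim: "(\<lambda>m. exp (- (\<i> * of_real x) * of_real y) * \<phi> m 0 y) \<longlonglongrightarrow> exp (- (\<i> * of_real x) * of_real y) * of_real (?\<psi> y)" for y
      by (intro tendsto_mult tendsto_const \<phi>(3))
    show "AE y in lebesgue. (\<lambda>m. exp (- (\<i> * of_real x) * of_real y) * \<phi> m 0 y) \<longlonglongrightarrow> exp (- (\<i> * of_real x) * of_real y) * of_real (?\<psi> y)"
      by (intro always_eventually allI lim)
    show "(\<lambda>y. exp (- (\<i> * of_real x) * of_real y) * of_real (?\<psi> y)) \<in> borel_measurable lebesgue"
      by (rule borel_measurable_LIMSEQ_metric[OF m lim])
    show "AE y in lebesgue. norm (exp (- (\<i> * of_real x) * of_real y) * \<phi> m 0 y) \<le> indicator {0<..} y *\<^sub>R (y powr a * exp (- p * y))" for m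
    proof (intro always_eventually allI)
      fix y
      have "norm (exp (- (\<i> * of_real x) * of_real y) * \<phi> m 0 y) = cmod (\<phi> m 0 y)" by (simp add: norm_mult norm_exp_eq_Re)
      also have "\<dots> \<le> ?\<psi> y" by (rule \<phi>)
      also have "\<dots> \<le> indicator {0<..} y *\<^sub>R (y powr a * exp (- p * y))"
        using damped_le(1)[of y R a p "Suc n"] R by (cases "y > 0") auto
      finally show "norm (exp (- (\<i> * of_real x) * of_real y) * \<phi> m 0 y) \<le> indicator {0<..} y *\<^sub>R (y powr a * exp (- p * y))" .
    qed
  qed
  have L: "(\<lambda>m. LINT x|lebesgue. kappa_minus l (2 * r1) x * of_real (f x) * fourier (\<phi> m 0) x) \<longlonglongrightarrow>
      (LINT x|lebesgue. kappa_minus l (2 * r1) x * of_real (f x) * (of_real (1 / sqrt (2 * pi)) * laplace (\<lambda>x. of_real (?\<psi> x)) (\<i> * of_real x)))"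
  proof (rule integral_dominated_convergence[where w="\<lambda>x. K * B * cmod (hardy l 0 x * of_real (f x))"])
    show "integrable lebesgue (\<lambda>x. K * B * cmod (hardy l 0 x * of_real (f x)))"
      by (intro integrable_mult_right integrable_norm sq_int_mult hardy_sq_int[OF l] f)
    show m: "(\<lambda>x. kappa_minus l (2 * r1) x * of_real (f x) * fourier (\<phi> m 0) x) \<in> borel_measurable lebesgue" for m
      by (intro borel_measurable_times f_measurable continuous_imp_lebesgue kappa_continuous[OF l] fourier_continuous[OF \<phi>(1)])
    have lim: "(\<lambda>m. kappa_minus l (2 * r1) x * of_real (f x) * fourier (\<phi> m 0) x) \<longlonglongrightarrow>
        kappa_minus l (2 * r1) x * of_real (f x) * (of_real (1 / sqrt (2 * pi)) * laplace (\<lambda>x. of_real (?\<psi> x)) (\<i> * of_real x))" for x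
      unfolding fourier_laplace by (intro tendsto_intros lap)
    then show "AE x in lebesgue. (\<lambda>m. kappa_minus l (2 * r1) x * of_real (f x) * fourier (\<phi> m 0) x) \<longlonglongrightarrow>
        kappa_minus l (2 * r1) x * of_real (f x) * (of_real (1 / sqrt (2 * pi)) * laplace (\<lambda>x. of_real (?\<psi> x)) (\<i> * of_real x))"
      by (intro always_eventually allI)
    show "(\<lambda>x. kappa_minus l (2 * r1) x * of_real (f x) * (of_real (1 / sqrt (2 * pi)) * laplace (\<lambda>x. of_real (?\<psi> x)) (\<i> * of_real x))) \<in> borel_measurable lebesgue"
      by (rule borel_measurable_LIMSEQ_metric[OF m lim])
    show "AE x in lebesgue. norm (kappa_minus l (2 * r1) x * of_real (f x) * fourier (\<phi> m 0) x) \<le> K * B * cmod (hardy l 0 x * of_real (f x))" for m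
    proof (intro always_eventually allI)
      fix x
      have "cmod (kappa_minus l (2 * r1) x * fourier (\<phi> m 0) x) \<le> K * B * cmod (hardy l 0 x)"
        by (rule order_trans[OF K(2)[rule_format, OF \<phi>(1)]]) (intro mult_right_mono mult_left_mono \<phi>(4) K(1) norm_ge_zero)
      then have "cmod (kappa_minus l (2 * r1) x * fourier (\<phi> m 0) x) * cmod (of_real (f x)) \<le> K * B * cmod (hardy l 0 x) * cmod (of_real (f x))"
        by (intro mult_right_mono norm_ge_zero)
      then show "norm (kappa_minus l (2 * r1) x * of_real (f x) * fourier (\<phi> m 0) x) \<le> K * B * cmod (hardy l 0 x * of_real (f x))"
        by (simp only: norm_mult mult_ac)
    qed
  qed
  have Rt: "(\<lambda>m. LINT x|lebesgue. indicator {0<..} x *\<^sub>R (g x * \<phi> m 0 x)) \<longlonglongrightarrow>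
      (LINT x|lebesgue. indicator {0<..} x *\<^sub>R (g x * of_real (damped a p R (Suc n) x)))"
  proof (rule integral_dominated_convergence[where w="\<lambda>x. norm (indicator {0<..} x *\<^sub>R (g x * of_real (x powr a * exp (- p * x))))"])
    show "integrable lebesgue (\<lambda>x. norm (indicator {0<..} x *\<^sub>R (g x * of_real (x powr a * exp (- p * x)))))"
      by (intro integrable_norm pairing_integrable a p)
    have e: "indicator {0<..} x *\<^sub>R (g x * u) = (indicator {0<..} x *\<^sub>R g x) * u" for x u by simp
    show m: "(\<lambda>x. indicator {0<..} x *\<^sub>R (g x * \<phi> m 0 x)) \<in> borel_measurable lebesgue" for m
      unfolding e by (intro borel_measurable_times indicator_g_measurable test_chainD(6)[OF \<phi>(1)])
    have lim: "(\<lambda>m. indicator {0<..} x *\<^sub>R (g x * \<phi> m 0 x)) \<longlonglongrightarrow> indicator {0<..} x *\<^sub>R (g x * of_real (damped a p R (Suc n) x))" for x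
    proof -
      have "(\<lambda>m. indicator {0<..} x *\<^sub>R (g x * \<phi> m 0 x)) \<longlonglongrightarrow> indicator {0<..} x *\<^sub>R (g x * of_real (?\<psi> x))"
        by (intro tendsto_scaleR tendsto_mult tendsto_const \<phi>(3))
      then show ?thesis by (cases "x > 0") auto
    qed
    then show "AE x in lebesgue. (\<lambda>m. indicator {0<..} x *\<^sub>R (g x * \<phi> m 0 x)) \<longlonglongrightarrow> indicator {0<..} x *\<^sub>R (g x * of_real (damped a p R (Suc n) x))"
      by (intro always_eventually allI)
    show "(\<lambda>x. indicator {0<..} x *\<^sub>R (g x * of_real (damped a p R (Suc n) x))) \<in> borel_measurable lebesgue"
      by (rule borel_measurable_LIMSEQ_metric[OF m lim])
    show "AE x in lebesgue. norm (indicator {0<..} x *\<^sub>R (g x * \<phi> m 0 x)) \<le> norm (indicator {0<..} x *\<^sub>R (g x * of_real (x powr a * exp (- p * x))))" for m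
    proof (intro always_eventually allI)
      fix x
      show "norm (indicator {0<..} x *\<^sub>R (g x * \<phi> m 0 x)) \<le> norm (indicator {0<..} x *\<^sub>R (g x * of_real (x powr a * exp (- p * x))))"
      proof (cases "x > 0")
        case True
        have "cmod (\<phi> m 0 x) \<le> x powr a * exp (- p * x)"
          using order_trans[OF \<phi>(2)[of m x], of "x powr a * exp (- p * x)"] damped_le(1)[OF True R, of a p "Suc n"] True by simp
        then have "cmod (g x) * cmod (\<phi> m 0 x) \<le> cmod (g x) * (x powr a * exp (- p * x))" by (intro mult_left_mono) auto
        then show ?thesis using True by (simp add: norm_mult abs_mult)
      qed simp
    qed
  qed
  have "(LINT x|lebesgue. kappa_minus l (2 * r1) x * of_real (f x) * fourier (\<phi> m 0) x) =
      (LINT x|lebesgue. indicator {0<..} x *\<^sub>R (g x * \<phi> m 0 x))" for m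
    using star[rule_format, OF test_chain_test_function[OF \<phi>(1)]] by (simp only: set_lebesgue_integral_def)
  then show ?thesis using LIMSEQ_unique[OF L] Rt by (simp only: set_lebesgue_integral_def)
qed

text \<open>The limit of large \<open>R\<close> removes the damping. In \<open>W\<close> all terms
  but the first tend to zero, and all are dominated by multiples of
  \<open>|P| powr (- a - 1)\<close>, whose product with the weight is square integrable because
  \<open>a \<ge> 2 * r1\<close>.\<close>

lemma power_exp_identity:
  assumes a: "a \<ge> 2 * r1"
  shows "(LINT x:{0<..}|lebesgue. g x * of_real (x powr a * exp (- (l / 2) * x))) =
    of_real (Gamma (a + 1) / sqrt (2 * pi)) * (LINT x|lebesgue. kappa_minus l (2 * r1) x * of_real (f x) * pole l x powr (- of_real (a + 1)))"
    and "integrable lebesgue (\<lambda>x. kappa_minus l (2 * r1) x * of_real (f x) * pole l x powr (- of_real (a + 1)))"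
proof -
  obtain n :: nat where n: "2 * r1 \<le> real n" using real_arch_simple by blast
  have a0: "a \<ge> 0" using a r1 by simp
  define R where "R k = real (Suc k)" for k
  have R: "R k > 0" for k by (simp add: R_def)
  have Rlim: "filterlim R at_top sequentially"
    unfolding R_def by (rule filterlim_compose[OF filterlim_real_sequentially filterlim_Suc])
  let ?M = "Suc n"
  define W where "W k x = (\<Sum>j\<le>?M. (-1) ^ j * of_nat (?M choose j) * (pole l x + of_real (real j * R k)) powr (- of_real (a + 1)))" for k x
  have P0: "pole l x \<noteq> 0" for x by (rule pole_nonzero[OF l])
  have Pj0: "pole l x + of_real (real j * R k) \<noteq> 0" for x j k
  proof -
    have "Re (pole l x + of_real (real j * R k)) > 0" using l R[of k] by (simp add: add_pos_nonneg less_imp_le)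
    then show ?thesis by (metis less_irrefl zero_complex.sel(1))
  qed
  \<comment> \<open>The decay rate \<open>l / 2\<close> is chosen so that the shifted argument is
    exactly \<open>pole l x\<close>.\<close>
  have lapW: "laplace (\<lambda>x. of_real (indicator {0<..} x * damped a (l / 2) (R k) ?M x)) (\<i> * of_real x) = of_real (Gamma (a + 1)) * W k x" for k x
  proof -
    have "\<i> * of_real x = pole l x - of_real (l / 2)" by (simp add: pole_def)
    then show ?thesis unfolding W_def using damped_integral[of a "pole l x" "R k" "l / 2" ?M] a0 l R[of k] by (simp only: Re_pole)
  qed
  have id: "(LINT x|lebesgue. kappa_minus l (2 * r1) x * of_real (f x) * W k x) * of_real (Gamma (a + 1) / sqrt (2 * pi)) =
      (LINT x|lebesgue. indicator {0<..} x *\<^sub>R (g x * of_real (damped a (l / 2) (R k) ?M x)))" for k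
  proof -
    have "(LINT x|lebesgue. kappa_minus l (2 * r1) x * of_real (f x) * W k x) * of_real (Gamma (a + 1) / sqrt (2 * pi)) =
      (LINT x|lebesgue. kappa_minus l (2 * r1) x * of_real (f x) * (of_real (1 / sqrt (2 * pi)) * (of_real (Gamma (a + 1)) * W k x)))"
      unfolding integral_mult_left_zero[symmetric] by (intro Bochner_Integration.integral_cong refl) simp
    also have "\<dots> = (LINT x:{0<..}|lebesgue. g x * of_real (damped a (l / 2) (R k) ?M x))"
      unfolding lapW[symmetric] by (rule damped_identity[OF a _ R n]) (use l in simp)
    finally show ?thesis by (simp only: set_lebesgue_integral_def)
  qed
  define C where "C = 2 powr (2 * r1) * (l / 2) powr (2 * r1 - a)"
  have kP: "cmod (kappa_minus l (2 * r1) x) * cmod (pole l x) powr (- (a + 1)) \<le> C * cmod (hardy l 0 x)" for x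
  proof -
    have "cmod (kappa_minus l (2 * r1) x) * cmod (pole l x) powr (- (a + 1)) \<le> (2 powr (2 * r1) * cmod (pole l x) powr (2 * r1)) * cmod (pole l x) powr (- (a + 1))"
      using r1 by (intro mult_right_mono cmod_kappa_powr_le[OF l]) auto
    also have "\<dots> = 2 powr (2 * r1) * (cmod (pole l x) powr (2 * r1 - a) * cmod (pole l x) powr (- 1))"
      unfolding mult.assoc powr_add[symmetric] by (simp add: algebra_simps)
    also have "\<dots> \<le> 2 powr (2 * r1) * ((l / 2) powr (2 * r1 - a) * cmod (pole l x) powr (- 1))"
      using a l cmod_pole_ge(1)[OF l, of x] by (intro mult_left_mono mult_right_mono powr_mono2') auto
    also have "\<dots> = C * cmod (hardy l 0 x)" using cmod_pole_pos[OF l, of x] by (simp add: C_def cmod_hardy[OF l] powr_minus_divide)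
    finally show ?thesis .
  qed
  have Wb: "cmod (W k x) \<le> 2 ^ ?M * cmod (pole l x) powr (- (a + 1))" for k x
  proof -
    have "cmod (W k x) \<le> (\<Sum>j\<le>?M. real (?M choose j) * cmod (pole l x) powr (- (a + 1)))"
      unfolding W_def
    proof (intro order_trans[OF norm_sum] sum_mono)
      fix j
      have "cmod (pole l x) \<le> cmod (pole l x + of_real (real j * R k))"
      proof (rule power2_le_imp_le)
        have "l / 2 \<le> l / 2 + real j * R k" using R[of k] by simp
        then show "(cmod (pole l x))\<^sup>2 \<le> (cmod (pole l x + of_real (real j * R k)))\<^sup>2"
          unfolding cmod_power2 using l by (auto intro!: power_mono)
      qed simp
      then have "cmod (pole l x + of_real (real j * R k)) powr (- (a + 1)) \<le> cmod (pole l x) powr (- (a + 1))"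
        using a0 cmod_pole_pos[OF l, of x] by (intro powr_mono2') auto
      then have "cmod ((pole l x + of_real (real j * R k)) powr (- of_real (a + 1))) \<le> cmod (pole l x) powr (- (a + 1))"
        using cmod_powr_real[OF Pj0, of x j k "- (a + 1)"] by (simp only: of_real_minus)
      then have "real (?M choose j) * cmod ((pole l x + of_real (real j * R k)) powr (- of_real (a + 1))) \<le> real (?M choose j) * cmod (pole l x) powr (- (a + 1))"
        by (intro mult_left_mono) auto
      then show "cmod ((-1) ^ j * of_nat (?M choose j) * (pole l x + of_real (real j * R k)) powr (- of_real (a + 1))) \<le>
          real (?M choose j) * cmod (pole l x) powr (- (a + 1))"
        by (simp only: norm_mult norm_power norm_minus_cancel norm_one power_one mult_1_left norm_of_nat)
    qed
    also have "\<dots> = real (\<Sum>j\<le>?M. ?M choose j) * cmod (pole l x) powr (- (a + 1))"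
      by (simp only: of_nat_sum sum_distrib_right)
    also have "(\<Sum>j\<le>?M. ?M choose j) = 2 ^ ?M" by (rule choose_row_sum)
    finally show ?thesis by simp
  qed
  have Wlim: "(\<lambda>k. W k x) \<longlonglongrightarrow> pole l x powr (- of_real (a + 1))" for x
  proof -
    have z: "(\<lambda>k. (pole l x + of_real (real j * R k)) powr (- of_real (a + 1))) \<longlonglongrightarrow> (if j = 0 then pole l x powr (- of_real (a + 1)) else 0)" for j
    proof (cases "j = 0")
      case False
      have "(\<lambda>k. (pole l x + of_real (real j * R k)) powr (- of_real (a + 1))) \<longlonglongrightarrow> 0"
      proof (rule Lim_null_comparison)
        show "(\<lambda>k. R k powr (- (a + 1))) \<longlonglongrightarrow> 0" using a0 by (intro tendsto_neg_powr Rlim) auto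
        show "\<forall>\<^sub>F k in sequentially. norm ((pole l x + of_real (real j * R k)) powr (- of_real (a + 1))) \<le> R k powr (- (a + 1))"
        proof (intro always_eventually allI)
          fix k
          have "1 * R k \<le> real j * R k" using False R[of k] by (intro mult_right_mono) auto
          then have "R k \<le> Re (pole l x + of_real (real j * R k))" using l by simp
          also have "\<dots> \<le> cmod (pole l x + of_real (real j * R k))" by (rule complex_Re_le_cmod)
          finally have "cmod (pole l x + of_real (real j * R k)) powr (- (a + 1)) \<le> R k powr (- (a + 1))"
            using a0 R[of k] by (intro powr_mono2') auto
          then show "norm ((pole l x + of_real (real j * R k)) powr (- of_real (a + 1))) \<le> R k powr (- (a + 1))"
            using cmod_powr_real[OF Pj0, of x j k "- (a + 1)"] by (simp only: of_real_minus)
        qed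
      qed
      then show ?thesis using False by simp
    qed simp
    have "(\<lambda>k. W k x) \<longlonglongrightarrow> (\<Sum>j\<le>?M. (-1) ^ j * of_nat (?M choose j) * (if j = 0 then pole l x powr (- of_real (a + 1)) else 0))"
      unfolding W_def by (intro tendsto_sum tendsto_mult tendsto_const z)
    also have "(\<Sum>j\<le>?M. (-1) ^ j * of_nat (?M choose j) * (if j = 0 then pole l x powr (- of_real (a + 1)) else 0)) =
        (\<Sum>j\<le>?M. if j = 0 then pole l x powr (- of_real (a + 1)) else 0)"
      by (intro sum.cong refl) auto
    also have "\<dots> = pole l x powr (- of_real (a + 1))" by simp
    finally show ?thesis .
  qed
  have Pcont: "continuous_on UNIV (\<lambda>x. (pole l x + of_real t) powr (- of_real (a + 1)))" if "t \<ge> 0" for t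
  proof -
    have "Re (pole l x + of_real t) > 0" for x using l that by simp
    then have "pole l x + of_real t \<notin> \<real>\<^sub>\<le>\<^sub>0" "pole l x + of_real t \<noteq> 0" for x
      by (metis complex_nonpos_Reals_iff not_less) (metis less_irrefl zero_complex.sel(1) \<open>\<And>x. Re (pole l x + of_real t) > 0\<close>)
    then show ?thesis by (intro continuous_intros continuous_pole[OF l]) (use l that in auto)
  qed
  have Wm: "W k \<in> borel_measurable lebesgue" for k
    unfolding W_def[abs_def] using R[of k]
    by (intro continuous_imp_lebesgue continuous_on_sum continuous_on_mult continuous_on_const Pcont) auto
  let ?w = "\<lambda>x. 2 ^ ?M * C * cmod (hardy l 0 x * of_real (f x))"
  have wi: "integrable lebesgue ?w"
    by (intro integrable_mult_right integrable_norm sq_int_mult hardy_sq_int[OF l] f)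
  have mk: "(\<lambda>x. kappa_minus l (2 * r1) x * of_real (f x) * W k x) \<in> borel_measurable lebesgue" for k
    by (intro borel_measurable_times f_measurable continuous_imp_lebesgue kappa_continuous[OF l] Wm)
  have lk: "(\<lambda>k. kappa_minus l (2 * r1) x * of_real (f x) * W k x) \<longlonglongrightarrow> kappa_minus l (2 * r1) x * of_real (f x) * pole l x powr (- of_real (a + 1))" for x
    by (intro tendsto_intros Wlim)
  have bk: "norm (kappa_minus l (2 * r1) x * of_real (f x) * W k x) \<le> ?w x" for k x
  proof -
    have "cmod (kappa_minus l (2 * r1) x) * cmod (W k x) \<le> cmod (kappa_minus l (2 * r1) x) * (2 ^ ?M * cmod (pole l x) powr (- (a + 1)))"
      by (intro mult_left_mono Wb) auto
    also have "\<dots> = 2 ^ ?M * (cmod (kappa_minus l (2 * r1) x) * cmod (pole l x) powr (- (a + 1)))" by simp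
    also have "\<dots> \<le> 2 ^ ?M * (C * cmod (hardy l 0 x))" by (intro mult_left_mono kP) auto
    finally have "cmod (kappa_minus l (2 * r1) x) * cmod (W k x) * cmod (of_real (f x)) \<le> 2 ^ ?M * (C * cmod (hardy l 0 x)) * cmod (of_real (f x))"
      by (intro mult_right_mono norm_ge_zero)
    then show ?thesis by (simp only: norm_mult mult_ac)
  qed
  have mlim: "(\<lambda>x. kappa_minus l (2 * r1) x * of_real (f x) * pole l x powr (- of_real (a + 1))) \<in> borel_measurable lebesgue"
    by (rule borel_measurable_LIMSEQ_metric[OF mk lk])
  have L: "(\<lambda>k. LINT x|lebesgue. kappa_minus l (2 * r1) x * of_real (f x) * W k x) \<longlonglongrightarrow>
      (LINT x|lebesgue. kappa_minus l (2 * r1) x * of_real (f x) * pole l x powr (- of_real (a + 1)))"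
    by (rule integral_dominated_convergence[OF mlim mk wi]) (use lk bk in \<open>auto intro!: always_eventually\<close>)
  show "integrable lebesgue (\<lambda>x. kappa_minus l (2 * r1) x * of_real (f x) * pole l x powr (- of_real (a + 1)))"
    by (rule integrable_dominated_convergence[OF mlim mk wi]) (use lk bk in \<open>auto intro!: always_eventually\<close>)
  let ?v = "\<lambda>x. indicator {0<..} x *\<^sub>R (g x * of_real (x powr a * exp (- (l / 2) * x)))"
  have vi: "integrable lebesgue ?v" by (rule pairing_integrable[OF a]) (use l in simp)
  have e: "indicator {0<..} x *\<^sub>R (g x * u) = (indicator {0<..} x *\<^sub>R g x) * u" for x u by simp
  have dm: "(\<lambda>x. indicator {0<..} x *\<^sub>R (g x * of_real (damped a (l / 2) (R k) ?M x))) \<in> borel_measurable lebesgue" for k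
  proof -
    have "(\<lambda>x. complex_of_real (damped a (l / 2) (R k) ?M x)) \<in> borel_measurable borel" unfolding damped_def by measurable
    then show ?thesis unfolding e by (intro borel_measurable_times indicator_g_measurable borel_measurable_lebesgueI)
  qed
  have dl: "(\<lambda>k. indicator {0<..} x *\<^sub>R (g x * of_real (damped a (l / 2) (R k) ?M x))) \<longlonglongrightarrow> ?v x" for x
  proof (cases "x > 0")
    case True
    have "filterlim (\<lambda>k. x * R k) at_top sequentially"
      by (rule filterlim_tendsto_pos_mult_at_top[OF tendsto_const True Rlim])
    then have "filterlim (\<lambda>k. - (x * R k)) at_bot sequentially" by (simp add: filterlim_uminus_at_top)
    then have "(\<lambda>k. exp (- (x * R k))) \<longlonglongrightarrow> 0" by (rule filterlim_compose[OF exp_at_bot])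
    then have "(\<lambda>k. exp (- R k * x)) \<longlonglongrightarrow> 0" by (simp add: mult.commute)
    then have "(\<lambda>k. damped a (l / 2) (R k) ?M x) \<longlonglongrightarrow> x powr a * exp (- (l / 2) * x) * (1 - 0) ^ ?M"
      unfolding damped_def by (intro tendsto_intros)
    then have "(\<lambda>k. damped a (l / 2) (R k) ?M x) \<longlonglongrightarrow> x powr a * exp (- (l / 2) * x)" by (simp only: diff_zero power_one mult_1_right)
    then show ?thesis by (intro tendsto_intros)
  qed simp
  have db: "norm (indicator {0<..} x *\<^sub>R (g x * of_real (damped a (l / 2) (R k) ?M x))) \<le> norm (?v x)" for k x
  proof (cases "x > 0")
    case True
    have "cmod (g x) * \<bar>damped a (l / 2) (R k) ?M x\<bar> \<le> cmod (g x) * \<bar>x powr a * exp (- (l / 2) * x)\<bar>"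
      using damped_le[OF True R[of k], of a "l / 2" ?M] by (intro mult_left_mono) auto
    then show ?thesis using True by (simp only: norm_scaleR norm_mult norm_of_real indicator_def) simp
  qed simp
  have Rt: "(\<lambda>k. LINT x|lebesgue. indicator {0<..} x *\<^sub>R (g x * of_real (damped a (l / 2) (R k) ?M x))) \<longlonglongrightarrow> (LINT x|lebesgue. ?v x)"
    by (rule integral_dominated_convergence[OF borel_measurable_integrable[OF vi] dm integrable_norm[OF vi]])
      (use dl db in \<open>auto intro!: always_eventually\<close>)
  from tendsto_mult[OF L tendsto_const, of "of_real (Gamma (a + 1) / sqrt (2 * pi))"]
  have "(\<lambda>k. LINT x|lebesgue. indicator {0<..} x *\<^sub>R (g x * of_real (damped a (l / 2) (R k) ?M x))) \<longlonglongrightarrow>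
      (LINT x|lebesgue. kappa_minus l (2 * r1) x * of_real (f x) * pole l x powr (- of_real (a + 1))) * of_real (Gamma (a + 1) / sqrt (2 * pi))"
    unfolding id .
  from LIMSEQ_unique[OF Rt this]
  show "(LINT x:{0<..}|lebesgue. g x * of_real (x powr a * exp (- (l / 2) * x))) =
    of_real (Gamma (a + 1) / sqrt (2 * pi)) * (LINT x|lebesgue. kappa_minus l (2 * r1) x * of_real (f x) * pole l x powr (- of_real (a + 1)))"
    by (simp only: set_lebesgue_integral_def mult.commute)
qed

text \<open>The part of the weight that is not a power of \<open>P\<close> remains attached to
  \<open>hardy\<close>; it is these coefficients, not those of \<open>f\<close> itself, that are
  directly visible in \<open>g\<close>.\<close>

definition weighted_coeff :: "nat \<Rightarrow> complex" where
  "weighted_coeff j = (LINT x|lebesgue. of_real (f x) * (((3 - cay l x) / 2) powr of_real (2 * r1) * hardy l j x))"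

lemma ratio_hardy_sq_int: "sq_int lebesgue (\<lambda>x. ((3 - cay l x) / 2) powr of_real (2 * r1) * hardy l j x)"
proof (rule sq_int_bound[OF hardy_sq_int[OF l, of 0], where C="2 powr (2 * r1)"])
  have R: "Re ((3 - cay l x) / 2) > 0" for x using complex_Re_le_cmod[of "cay l x"] cmod_cay[OF l, of x] by simp
  have 1: "(3 - cay l x) / 2 \<in> - \<real>\<^sub>\<le>\<^sub>0" for x using R[of x] unfolding Compl_iff complex_nonpos_Reals_iff by linarith
  have 2: "continuous_on UNIV (\<lambda>x. (3 - cay l x) / 2)" by (intro continuous_intros continuous_cay[OF l]) auto
  have 3: "continuous_on (- \<real>\<^sub>\<le>\<^sub>0) (\<lambda>z. z powr complex_of_real (2 * r1))"
    by (intro continuous_on_powr_complex continuous_intros) (auto simp: complex_nonpos_Reals_iff)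
  have "continuous_on UNIV (\<lambda>x. ((3 - cay l x) / 2) powr of_real (2 * r1))"
    by (rule continuous_on_compose2[OF 3 2]) (use 1 in blast)
  then show "(\<lambda>x. ((3 - cay l x) / 2) powr of_real (2 * r1) * hardy l j x) \<in> borel_measurable lebesgue"
    by (intro continuous_imp_lebesgue continuous_on_mult hardy_continuous[OF l])
  have "cmod (((3 - cay l x) / 2) powr of_real (2 * r1)) * cmod (hardy l j x) \<le> 2 powr (2 * r1) * cmod (hardy l 0 x)" for x
    using cmod_ratio_le[OF l, of "2 * r1" "cay l x"] r1 l by (intro mult_mono) (auto simp: cmod_hardy[OF l])
  then show "AE x in lebesgue. cmod (((3 - cay l x) / 2) powr of_real (2 * r1) * hardy l j x) \<le> 2 powr (2 * r1) * cmod (hardy l 0 x)"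
    by (intro always_eventually allI) (simp only: norm_mult)
qed

text \<open>Summing the power identities over the monomials of the Laguerre polynomial produces
  \<open>(1 - l / P) ^ j\<close> by the binomial theorem, and this is \<open>u ^ j\<close>.\<close>

lemma laguerre_pairing:
  "(LINT x:{0<..}|lebesgue. g x * of_real (x powr (2 * r1) * lag_fun l (2 * r1) j x)) =
    \<i> powr of_real (2 * r1) * of_real (Gamma (2 * r1 + 1 + real j) / fact j / (2 * pi)) * weighted_coeff j"
proof -
  let ?al = "2 * r1"
  define c where "c i = (- l) ^ i / fact i * bin (?al + real i + 1) (j - i)" for i
  let ?v = "\<lambda>i x. indicator {0<..} x *\<^sub>R (g x * of_real (x powr (?al + real i) * exp (- (l / 2) * x)))"
  let ?w = "\<lambda>i x. kappa_minus l ?al x * of_real (f x) * pole l x powr (- of_real (?al + real i + 1))"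
  have vi: "integrable lebesgue (?v i)" for i by (rule pairing_integrable) (use l in auto)
  have wi: "integrable lebesgue (?w i)" for i by (rule power_exp_identity(2)) auto
  have vw: "(LINT x|lebesgue. ?v i x) = of_real (Gamma (?al + real i + 1) / sqrt (2 * pi)) * (LINT x|lebesgue. ?w i x)" for i
    using power_exp_identity(1)[of "?al + real i"] by (simp only: set_lebesgue_integral_def le_add_same_cancel1 of_nat_0_le_iff)
  have e: "indicator {0<..} x *\<^sub>R (g x * of_real (x powr ?al * lag_fun l ?al j x)) = (\<Sum>i\<le>j. of_real (c i) * ?v i x)" for x
  proof (cases "x > 0")
    case True
    have "x powr ?al * lag_fun l ?al j x = (\<Sum>i\<le>j. c i * (x powr (?al + real i) * exp (- (l / 2) * x)))"
      unfolding lag_fun_def laguerre_def sum_distrib_left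
    proof (intro sum.cong refl)
      fix i
      have "(- (l * x)) ^ i = (- l) ^ i * x ^ i" by (simp flip: power_mult_distrib)
      then show "x powr ?al * (exp (- (l * x) / 2) * ((- (l * x)) ^ i / fact i * bin (?al + real i + 1) (j - i))) =
          c i * (x powr (?al + real i) * exp (- (l / 2) * x))"
        using True by (simp add: c_def powr_add powr_realpow)
    qed
    then show ?thesis using True by (simp add: sum_distrib_left mult_ac)
  qed simp
  \<comment> \<open>The Gamma value of each monomial completes the Pochhammer factor to one
    independent of \<open>i\<close>; what remains are the plain binomial coefficients.\<close>
  have cG: "c i * Gamma (?al + real i + 1) = Gamma (?al + 1 + real j) / fact j * (real (j choose i) * (- l) ^ i)" if "i \<le> j" for i
  proof -
    have ni: "?al + 1 + real i \<notin> \<int>\<^sub>\<le>\<^sub>0" using r1 by (auto elim!: nonpos_Ints_cases)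
    have gp: "Gamma (?al + 1 + real i) > 0" using r1 by (intro Gamma_real_pos) auto
    have "pochhammer (?al + 1 + real i) (j - i) * Gamma (?al + 1 + real i) = Gamma (?al + 1 + real i + real (j - i))"
      using ni gp by (simp add: pochhammer_Gamma)
    also have "?al + 1 + real i + real (j - i) = ?al + 1 + real j" using that by (simp add: of_nat_diff)
    finally have G: "pochhammer (?al + 1 + real i) (j - i) * Gamma (?al + 1 + real i) = Gamma (?al + 1 + real j)" .
    have eq: "?al + real i + 1 = ?al + 1 + real i" by simp
    have "c i * Gamma (?al + real i + 1) = (- l) ^ i / (fact i * fact (j - i)) * (pochhammer (?al + 1 + real i) (j - i) * Gamma (?al + 1 + real i))"
      unfolding c_def bin_def eq by simp
    then show ?thesis unfolding G using that by (simp add: binomial_fact)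
  qed
  have sum_eq: "(\<Sum>i\<le>j. of_real (c i * Gamma (?al + real i + 1)) * ?w i x) =
      of_real (Gamma (?al + 1 + real j) / fact j) * (of_real (1 / sqrt (2 * pi)) * \<i> powr of_real ?al) *
        (of_real (f x) * (((3 - cay l x) / 2) powr of_real ?al * hardy l j x))" for x
  proof -
    have P0: "pole l x \<noteq> 0" by (rule pole_nonzero[OF l])
    let ?G = "complex_of_real (Gamma (?al + 1 + real j) / fact j)"
    have "(\<Sum>i\<le>j. of_real (c i * Gamma (?al + real i + 1)) * ?w i x) =
        (\<Sum>i\<le>j. ?G * (kappa_minus l ?al x * of_real (f x) * pole l x powr (- of_real (?al + 1))) * (of_nat (j choose i) * (- of_real l / pole l x) ^ i))"
    proof (intro sum.cong refl)
      fix i assume "i \<in> {..j}"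
      then have "i \<le> j" by simp
      show "of_real (c i * Gamma (?al + real i + 1)) * ?w i x =
        ?G * (kappa_minus l ?al x * of_real (f x) * pole l x powr (- of_real (?al + 1))) * (of_nat (j choose i) * (- of_real l / pole l x) ^ i)"
      proof -
        have "(- of_real l / pole l x) ^ i = (- complex_of_real l) ^ i * (1 / pole l x) ^ i"
          by (simp flip: power_mult_distrib)
        then show ?thesis unfolding cG[OF \<open>i \<le> j\<close>] powr_minus_add_nat[OF P0] by simp
      qed
    qed
    also have "\<dots> = ?G * (kappa_minus l ?al x * of_real (f x) * pole l x powr (- of_real (?al + 1))) * (\<Sum>i\<le>j. of_nat (j choose i) * (- of_real l / pole l x) ^ i * 1 ^ (j - i))"
      by (simp add: sum_distrib_left)
    also have "(\<Sum>i\<le>j. of_nat (j choose i) * (- of_real l / pole l x) ^ i * 1 ^ (j - i)) = (- of_real l / pole l x + 1) ^ j"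
      by (rule binomial_ring[symmetric])
    also have "- of_real l / pole l x + 1 = cay l x" by (simp add: cay_def)
    also have "kappa_minus l ?al x * of_real (f x) * pole l x powr (- of_real (?al + 1)) =
        (of_real (1 / sqrt (2 * pi)) * \<i> powr of_real ?al) * (of_real (f x) * (((3 - cay l x) / 2) powr of_real ?al * (1 / pole l x)))"
    proof -
      have "pole l x powr of_real ?al * pole l x powr (- of_real (?al + 1)) = pole l x powr (- 1)"
        by (simp flip: powr_add)
      also have "\<dots> = 1 / pole l x" using P0 by (simp add: powr_minus divide_inverse)
      finally have PP: "pole l x powr of_real ?al * pole l x powr (- of_real (?al + 1)) = 1 / pole l x" .
      show ?thesis unfolding kappa_eq[OF l] PP[symmetric] by (simp only: mult_ac)
    qed
    finally have "(\<Sum>i\<le>j. of_real (c i * Gamma (?al + real i + 1)) * ?w i x) =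
        ?G * ((of_real (1 / sqrt (2 * pi)) * \<i> powr of_real ?al) * (of_real (f x) * (((3 - cay l x) / 2) powr of_real ?al * (1 / pole l x)))) * cay l x ^ j" .
    moreover have "hardy l j x = (1 / pole l x) * cay l x ^ j" by (simp add: hardy_def[OF l])
    ultimately show ?thesis by (simp only: mult_ac)
  qed
  have "(LINT x:{0<..}|lebesgue. g x * of_real (x powr ?al * lag_fun l ?al j x)) = (\<Sum>i\<le>j. of_real (c i) * (LINT x|lebesgue. ?v i x))"
    unfolding set_lebesgue_integral_def e
    by (subst Bochner_Integration.integral_sum[OF integrable_mult_right[OF vi]]) (simp only: integral_mult_right_zero)
  also have "\<dots> = (\<Sum>i\<le>j. of_real (1 / sqrt (2 * pi)) * (of_real (c i * Gamma (?al + real i + 1)) * (LINT x|lebesgue. ?w i x)))"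
    unfolding vw by (intro sum.cong refl) simp
  also have "\<dots> = of_real (1 / sqrt (2 * pi)) * (LINT x|lebesgue. (\<Sum>i\<le>j. of_real (c i * Gamma (?al + real i + 1)) * ?w i x))"
    by (subst Bochner_Integration.integral_sum[OF integrable_mult_right[OF wi]]) (simp only: integral_mult_right_zero sum_distrib_left)
  also have "\<dots> = of_real (1 / sqrt (2 * pi)) * (of_real (Gamma (?al + 1 + real j) / fact j) * (of_real (1 / sqrt (2 * pi)) * \<i> powr of_real ?al) * weighted_coeff j)"
    unfolding sum_eq weighted_coeff_def by (simp only: integral_mult_right_zero)
  also have "\<dots> = \<i> powr of_real ?al * of_real (Gamma (?al + 1 + real j) / fact j / (2 * pi)) * weighted_coeff j"
  proof -
    have s: "complex_of_real (1 / sqrt (2 * pi)) * of_real (1 / sqrt (2 * pi)) = of_real (1 / (2 * pi))"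
      unfolding of_real_mult[symmetric] by (simp add: real_sqrt_mult[symmetric])
    have "of_real (1 / sqrt (2 * pi)) * (G * (of_real (1 / sqrt (2 * pi)) * I) * W) = I * (G * of_real (1 / (2 * pi))) * W" for G I W :: complex
      unfolding s[symmetric] by (simp only: mult_ac)
    then show ?thesis by (simp only:) simp
  qed
  finally show ?thesis .
qed

text \<open>Bessel's inequality for \<open>lag_basis\<close> of order \<open>2 * r1\<close>. Pairing
  and squared norm are both proportional to \<open>\<gamma> j\<close>, so one factor
  \<open>\<gamma> j\<close> survives; it is at least a multiple of
  \<open>(j + 1) powr (2 * r1)\<close>.\<close>

lemma weighted_coeff_bessel:
  assumes c: "c > 0" "\<And>m. c * (real m + 1) powr (2 * r1) \<le> bin (2 * r1 + 1) m"
  shows "(\<Sum>j<n. (real j + 1) powr (2 * r1) * (cmod (weighted_coeff j))\<^sup>2) \<le>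
    (2 * pi)\<^sup>2 * l powr (- (2 * r1 + 1)) / (Gamma (2 * r1 + 1) * c) * sq_norm lebesgue wg"
proof -
  let ?al = "2 * r1"
  define \<gamma> where "\<gamma> j = Gamma (?al + 1 + real j) / fact j" for j
  have G1: "Gamma (?al + 1) > 0" using r1 by (intro Gamma_real_pos) auto
  have \<gamma>_bin: "\<gamma> j = Gamma (?al + 1) * bin (?al + 1) j" for j
  proof -
    have "?al + 1 \<notin> \<int>\<^sub>\<le>\<^sub>0" using r1 by (auto elim!: nonpos_Ints_cases)
    then show ?thesis using G1 by (simp add: \<gamma>_def bin_def pochhammer_Gamma)
  qed
  have \<gamma>: "\<gamma> j > 0" for j unfolding \<gamma>_bin using G1 r1 by (intro mult_pos_pos bin_pos) auto
  let ?e = "lag_basis l ?al"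
  have al: "?al > -1" using r1 by simp
  have pair: "(LINT x|lebesgue. wg x * of_real (?e j x)) = \<i> powr of_real ?al * of_real (\<gamma> j / (2 * pi)) * weighted_coeff j" for j
  proof -
    have "wg x * of_real (?e j x) = indicator {0<..} x *\<^sub>R (g x * of_real (x powr ?al * lag_fun l ?al j x))" for x
    proof (cases "x > 0")
      case True
      have "x powr ?al = x powr r1 * x powr r1" by (simp flip: powr_add)
      then show ?thesis using True by (simp add: wg_def lag_basis_def)
    qed (simp add: wg_def)
    then show ?thesis using laguerre_pairing[of j] by (simp only: set_lebesgue_integral_def \<gamma>_def)
  qed
  have lp: "l powr (- (?al + 1)) > 0" using l by simp
  have "(\<Sum>j<n. (cmod (LINT x|lebesgue. wg x * of_real (?e j x)))\<^sup>2 / (l powr (- (?al + 1)) * \<gamma> j)) \<le> sq_norm lebesgue wg"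
    by (rule bessel_inequality[OF lag_basis_sq_int[OF al l] wg_sq_int])
      (use lag_basis_orthogonal[OF al l] lp \<gamma> in \<open>auto simp: \<gamma>_bin\<close>)
  moreover have "(cmod (LINT x|lebesgue. wg x * of_real (?e j x)))\<^sup>2 / (l powr (- (?al + 1)) * \<gamma> j) =
      \<gamma> j * (cmod (weighted_coeff j))\<^sup>2 / ((2 * pi)\<^sup>2 * l powr (- (?al + 1)))" for j
  proof -
    have "cmod (\<i> powr of_real ?al) = 1" using cmod_powr_real[of \<i> ?al] by simp
    then have "cmod (\<i> powr of_real ?al * of_real (\<gamma> j / (2 * pi)) * weighted_coeff j) = \<gamma> j / (2 * pi) * cmod (weighted_coeff j)"
      using \<gamma>[of j] by (simp only: norm_mult norm_of_real) simp
    then show ?thesis unfolding pair using \<gamma>[of j] lp by (simp add: power_mult_distrib power_divide power2_eq_square mult_ac)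
  qed
  ultimately have *: "(\<Sum>j<n. \<gamma> j * (cmod (weighted_coeff j))\<^sup>2) \<le> sq_norm lebesgue wg * ((2 * pi)\<^sup>2 * l powr (- (?al + 1)))"
    using lp by (simp add: sum_divide_distrib[symmetric] pos_divide_le_eq)
  have "(\<Sum>j<n. (real j + 1) powr ?al * (cmod (weighted_coeff j))\<^sup>2) * (Gamma (?al + 1) * c) \<le> (\<Sum>j<n. \<gamma> j * (cmod (weighted_coeff j))\<^sup>2)"
    unfolding sum_distrib_right
  proof (intro sum_mono)
    fix j
    have "Gamma (?al + 1) * (c * (real j + 1) powr ?al) \<le> \<gamma> j" unfolding \<gamma>_bin using G1 by (intro mult_left_mono c) auto
    then have "Gamma (?al + 1) * (c * (real j + 1) powr ?al) * (cmod (weighted_coeff j))\<^sup>2 \<le> \<gamma> j * (cmod (weighted_coeff j))\<^sup>2"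
      by (intro mult_right_mono) auto
    then show "(real j + 1) powr ?al * (cmod (weighted_coeff j))\<^sup>2 * (Gamma (?al + 1) * c) \<le> \<gamma> j * (cmod (weighted_coeff j))\<^sup>2"
      by (simp add: mult_ac)
  qed
  with * have "(\<Sum>j<n. (real j + 1) powr ?al * (cmod (weighted_coeff j))\<^sup>2) * (Gamma (?al + 1) * c) \<le> sq_norm lebesgue wg * ((2 * pi)\<^sup>2 * l powr (- (?al + 1)))"
    by linarith
  then have "(\<Sum>j<n. (real j + 1) powr ?al * (cmod (weighted_coeff j))\<^sup>2) \<le> sq_norm lebesgue wg * ((2 * pi)\<^sup>2 * l powr (- (?al + 1))) / (Gamma (?al + 1) * c)"
    using G1 c(1) by (simp add: pos_le_divide_eq)
  then show ?thesis by (simp add: mult_ac)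
qed

text \<open>The factor \<open>((3 - u) / 2) powr (2 * r1)\<close> is undone by expanding its
  reciprocal in powers of \<open>u\<close>; multiplication by \<open>u ^ m\<close> shifts the index
  of \<open>hardy\<close> by \<open>m\<close>.\<close>

lemma hardy_coeff_sums:
  "(\<lambda>m. of_real (ratio_coeff (- (2 * r1)) m) * weighted_coeff (k + m)) sums (LINT x|lebesgue. of_real (f x) * hardy l k x)"
proof -
  let ?M = "\<lambda>x. ((3 - cay l x) / 2) powr of_real (2 * r1)"
  let ?f = "\<lambda>m x. of_real (ratio_coeff (- (2 * r1)) m) * (of_real (f x) * (?M x * hardy l (k + m) x))"
  have fi: "integrable lebesgue (?f m)" for m
    by (intro integrable_mult_right sq_int_mult f ratio_hardy_sq_int)
  have fs: "(\<lambda>m. ?f m x) sums (of_real (f x) * hardy l k x)" for x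
  proof -
    have "(\<lambda>m. of_real (ratio_coeff (- (2 * r1)) m) * cay l x ^ m) sums (((3 - cay l x) / 2) powr of_real (- (2 * r1)))"
      by (rule ratio_sums) (simp add: l)
    then have S: "(\<lambda>m. of_real (ratio_coeff (- (2 * r1)) m) * cay l x ^ m * (of_real (f x) * (?M x * hardy l k x))) sums
        (((3 - cay l x) / 2) powr of_real (- (2 * r1)) * (of_real (f x) * (?M x * hardy l k x)))"
      by (rule sums_mult2)
    have "((3 - cay l x) / 2) powr of_real (- (2 * r1)) * ?M x = 1"
    proof -
      have "Re ((3 - cay l x) / 2) > 0" using complex_Re_le_cmod[of "cay l x"] cmod_cay[OF l, of x] by simp
      then have "(3 - cay l x) / 2 \<noteq> 0" by (metis less_irrefl zero_complex.sel(1))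
      then show ?thesis by (simp flip: powr_add)
    qed
    moreover have "A * (F * (M * H)) = (A * M) * (F * H)" for A F M H :: complex by (simp only: mult_ac)
    ultimately have "((3 - cay l x) / 2) powr of_real (- (2 * r1)) * (of_real (f x) * (?M x * hardy l k x)) = of_real (f x) * hardy l k x"
      by (simp only: mult_1_left)
    moreover have "of_real (ratio_coeff (- (2 * r1)) m) * cay l x ^ m * (of_real (f x) * (?M x * hardy l k x)) = ?f m x" for m
      by (simp add: hardy_def[OF l] power_add)
    ultimately show ?thesis using S by (simp only:)
  qed
  have nf: "norm (?f m x) = \<bar>ratio_coeff (- (2 * r1)) m\<bar> * norm (of_real (f x) * (?M x * hardy l k x))" for m x
    by (simp only: norm_mult norm_of_real cmod_hardy[OF l])
  have s1: "summable (\<lambda>m. norm (?f m x))" for x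
    unfolding nf by (intro summable_mult2 ratio_coeff_summable)
  have s2: "summable (\<lambda>m. LINT x|lebesgue. norm (?f m x))"
    unfolding nf integral_mult_right_zero by (intro summable_mult2 ratio_coeff_summable)
  have "(\<lambda>m. LINT x|lebesgue. ?f m x) sums (LINT x|lebesgue. (\<Sum>m. ?f m x))"
    by (rule sums_integral[OF fi _ s2]) (use s1 in simp)
  then show ?thesis unfolding sums_unique[OF fs, symmetric] integral_mult_right_zero weighted_coeff_def .
qed

text \<open>The preceding series is a one-sided convolution with a summable sequence and inherits
  the weighted bound. Partial sums are taken first because the convolution estimate is
  finite.\<close>

lemma hardy_coeff_bound:
  assumes K: "\<And>n. (\<Sum>j<n. (real j + 1) powr (2 * r1) * (cmod (weighted_coeff j))\<^sup>2) \<le> K"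
  shows "(\<Sum>k<n. (real k + 1) powr (2 * r1) * (cmod (LINT x|lebesgue. of_real (f x) * hardy l k x))\<^sup>2)
    \<le> (\<Sum>m. \<bar>ratio_coeff (- (2 * r1)) m\<bar>)\<^sup>2 * K"
proof -
  let ?b = "ratio_coeff (- (2 * r1))"
  define S where "S N k = (\<Sum>m<N. of_real (?b m) * weighted_coeff (k + m))" for N k
  have lim: "(\<lambda>N. S N k) \<longlonglongrightarrow> (LINT x|lebesgue. of_real (f x) * hardy l k x)" for k
    using hardy_coeff_sums[of k] unfolding S_def sums_def .
  have "(\<lambda>N. \<Sum>k<n. (real k + 1) powr (2 * r1) * (cmod (S N k))\<^sup>2) \<longlonglongrightarrow>
      (\<Sum>k<n. (real k + 1) powr (2 * r1) * (cmod (LINT x|lebesgue. of_real (f x) * hardy l k x))\<^sup>2)"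
    by (intro tendsto_intros lim)
  moreover have "(\<Sum>k<n. (real k + 1) powr (2 * r1) * (cmod (S N k))\<^sup>2) \<le> (\<Sum>m. \<bar>?b m\<bar>)\<^sup>2 * K" for N
  proof -
    have le: "cmod (S N k) \<le> (\<Sum>i\<in>{k..<n + N}. \<bar>?b (i - k)\<bar> * cmod (weighted_coeff i))" if "k < n" for k
    proof -
      have "cmod (S N k) \<le> (\<Sum>m<N. \<bar>?b m\<bar> * cmod (weighted_coeff (k + m)))"
        unfolding S_def by (rule order_trans[OF norm_sum]) (simp add: norm_mult)
      also have "\<dots> = (\<Sum>i\<in>{k..<k + N}. \<bar>?b (i - k)\<bar> * cmod (weighted_coeff i))"
        by (rule sum.reindex_bij_witness[where i="\<lambda>i. i - k" and j="\<lambda>m. k + m"]) auto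
      also have "\<dots> \<le> (\<Sum>i\<in>{k..<n + N}. \<bar>?b (i - k)\<bar> * cmod (weighted_coeff i))"
        using that by (intro sum_mono2) auto
      finally show ?thesis .
    qed
    have "(\<Sum>k<n. (real k + 1) powr (2 * r1) * (cmod (S N k))\<^sup>2) \<le>
        (\<Sum>k<n. (real k + 1) powr (2 * r1) * (\<Sum>i\<in>{k..<n + N}. \<bar>?b (i - k)\<bar> * cmod (weighted_coeff i))\<^sup>2)"
      by (intro sum_mono mult_left_mono power_mono le) auto
    also have "\<dots> \<le> (\<Sum>k<n + N. (real k + 1) powr (2 * r1) * (\<Sum>i\<in>{k..<n + N}. \<bar>?b (i - k)\<bar> * cmod (weighted_coeff i))\<^sup>2)"
      by (intro sum_mono2) auto
    also have "\<dots> \<le> (\<Sum>m. \<bar>?b m\<bar>)\<^sup>2 * (\<Sum>k<n + N. (real k + 1) powr (2 * r1) * (cmod (weighted_coeff k))\<^sup>2)"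
      by (rule convolution_bound[OF ratio_coeff_summable r1]) simp
    also have "\<dots> \<le> (\<Sum>m. \<bar>?b m\<bar>)\<^sup>2 * K" by (intro mult_left_mono K) simp
    finally show ?thesis .
  qed
  ultimately show ?thesis by (intro LIMSEQ_le_const2) auto
qed

end

text \<open>Restated outside the context so that the constant is chosen before \<open>f\<close>,
  \<open>g\<close> and \<open>n\<close>.\<close>

lemma hardy_coefficient_estimate:
  assumes l: "l > 0" and r1: "r1 \<ge> 0"
  obtains C where "C \<ge> 0" "\<forall>f g n. sq_int lebesgue (\<lambda>x. complex_of_real (f x)) \<longrightarrow>
    (\<forall>\<phi>\<in>test_functions {0<..}. (LINT x|lebesgue. kappa_minus l (2 * r1) x * of_real (f x) * fourier \<phi> x) = (LINT x:{0<..}|lebesgue. g x * \<phi> x)) \<longrightarrow>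
    sq_int lebesgue (\<lambda>x. indicator {0<..} x *\<^sub>R (of_real (x powr r1) * g x)) \<longrightarrow>
    (\<Sum>k<n. (real k + 1) powr (2 * r1) * (cmod (LINT x|lebesgue. of_real (f x) * hardy l k x))\<^sup>2)
      \<le> C * sq_norm lebesgue (\<lambda>x. indicator {0<..} x *\<^sub>R (of_real (x powr r1) * g x))"
proof -
  have "2 * r1 + 1 > 0" using r1 by simp
  from bin_asymptotic[OF this] obtain c where c: "c > 0" "\<And>m. c * (real m + 1) powr (2 * r1) \<le> bin (2 * r1 + 1) m"
    by (metis add_diff_cancel_right')
  define K where "K = (2 * pi)\<^sup>2 * l powr (- (2 * r1 + 1)) / (Gamma (2 * r1 + 1) * c)"
  have G1: "Gamma (2 * r1 + 1) > 0" using r1 by (intro Gamma_real_pos) auto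
  have K0: "K \<ge> 0" using G1 c(1) by (simp add: K_def)
  show ?thesis
  proof (rule that[of "(\<Sum>m. \<bar>ratio_coeff (- (2 * r1)) m\<bar>)\<^sup>2 * K"], goal_cases)
    case 1
    show ?case using K0 by simp
  next
    case 2
    show ?case
    proof (intro allI impI)
      fix f :: "real \<Rightarrow> real" and g :: "real \<Rightarrow> complex" and n
      assume a1: "sq_int lebesgue (\<lambda>x. complex_of_real (f x))"
        and a2: "\<forall>\<phi>\<in>test_functions {0<..}. (LINT x|lebesgue. kappa_minus l (2 * r1) x * of_real (f x) * fourier \<phi> x) = (LINT x:{0<..}|lebesgue. g x * \<phi> x)"
        and a3: "sq_int lebesgue (\<lambda>x. indicator {0<..} x *\<^sub>R (of_real (x powr r1) * g x))"
      note A = l r1 a1 a2 a3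
      have "(\<Sum>k<n. (real k + 1) powr (2 * r1) * (cmod (LINT x|lebesgue. of_real (f x) * hardy l k x))\<^sup>2)
          \<le> (\<Sum>m. \<bar>ratio_coeff (- (2 * r1)) m\<bar>)\<^sup>2 * (K * sq_norm lebesgue (wg r1 g))"
        unfolding K_def by (rule hardy_coeff_bound[OF A weighted_coeff_bessel[OF A c]])
      then show "(\<Sum>k<n. (real k + 1) powr (2 * r1) * (cmod (LINT x|lebesgue. of_real (f x) * hardy l k x))\<^sup>2)
          \<le> (\<Sum>m. \<bar>ratio_coeff (- (2 * r1)) m\<bar>)\<^sup>2 * K * sq_norm lebesgue (\<lambda>x. indicator {0<..} x *\<^sub>R (of_real (x powr r1) * g x))"
        by (simp only: wg_def[OF A, abs_def] mult.assoc)
    qed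
  qed
qed

section \<open>The spectrum of the projection error\<close>

text \<open>Local integrability gives measurability on compact subintervals, and these exhaust the
  half-line.\<close>

lemma is_function_on_measurable:
  assumes "is_function_on {0<..} T g"
  shows "(\<lambda>x. indicator {0<..} x *\<^sub>R g x) \<in> borel_measurable lebesgue"
proof -
  have m: "(\<lambda>x. indicator {1 / real (Suc n)..real (Suc n)} x *\<^sub>R g x) \<in> borel_measurable lebesgue" for n
  proof -
    have "compact {1 / real (Suc n)..real (Suc n)} \<and> {1 / real (Suc n)..real (Suc n)} \<subseteq> {0<..}"
      by (auto intro: less_le_trans[of 0 "1 / (1 + real n)"] simp: add_pos_nonneg)
    then have "set_integrable lebesgue {1 / real (Suc n)..real (Suc n)} g"
      using assms unfolding is_function_on_def by blast
    then show ?thesis unfolding set_integrable_def by (rule borel_measurable_integrable)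
  qed
  have lim: "(\<lambda>n. indicator {1 / real (Suc n)..real (Suc n)} x *\<^sub>R g x) \<longlonglongrightarrow> indicator {0<..} x *\<^sub>R g x" for x
  proof (cases "x > 0")
    case True
    obtain N where N: "max x (1 / x) < real N" using reals_Archimedean2 by blast
    have "indicator {1 / real (Suc n)..real (Suc n)} x *\<^sub>R g x = indicator {0<..} x *\<^sub>R g x" if "n \<ge> N" for n
    proof -
      have "x < real (Suc n)" "1 / x < real (Suc n)" using N that by auto
      then have "x \<in> {1 / real (Suc n)..real (Suc n)}" using True by (simp add: field_simps)
      then show ?thesis using True by simp
    qed
    then show ?thesis by (intro tendsto_eventually eventually_sequentiallyI[of N])
  next
    case False
    have "x \<notin> {1 / real (Suc n)..real (Suc n)}" for n
    proof -
      have "0 < 1 / real (Suc n)" by simp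
      then show ?thesis using False unfolding atLeastAtMost_iff by linarith
    qed
    then show ?thesis using False by simp
  qed
  show ?thesis by (rule borel_measurable_LIMSEQ_metric[OF m lim])
qed

lemma weighted_spectrum_eq:
  "weighted_spectrum l r f \<phi> = (LINT x|lebesgue. kappa_minus l r x * of_real (f x) * fourier \<phi> x)"
  by (simp add: weighted_spectrum_def fourier_dist_def regular_dist_def)

text \<open>Up to a constant, the weighted spectrum on the half-line of the sum of
  \<open>a k * cnj (hardy k)\<close> over \<open>k < M\<close>.\<close>

definition hardy_spectrum :: "real \<Rightarrow> real \<Rightarrow> (nat \<Rightarrow> complex) \<Rightarrow> nat \<Rightarrow> real \<Rightarrow> complex" where
  "hardy_spectrum l r a M x = (\<Sum>k<M. a k * (\<Sum>j\<le>k. of_real (ratio_coeff r (k - j) * lag_fun l r j x)))"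


lemma sum_triangle_transpose:
  fixes F :: "nat \<Rightarrow> nat \<Rightarrow> 'a::comm_monoid_add"
  shows "(\<Sum>k<M. \<Sum>j\<le>k. F k j) = (\<Sum>j<M. \<Sum>k\<in>{j..<M}. F k j)"
  unfolding sum.Sigma[OF finite_lessThan ballI[OF finite_atMost]]
    sum.Sigma[OF finite_lessThan ballI[OF finite_atLeastLessThan]]
  by (rule sum.reindex_bij_witness[where i="\<lambda>(j, k). (k, j)" and j="\<lambda>(k, j). (j, k)"]) auto

lemma lag_fun_connection: "lag_fun l r j x = (\<Sum>i\<le>j. bin (r - b) (j - i) * lag_fun l b i x)"
  unfolding lag_fun_def laguerre_connection[of r j _ b] by (simp add: sum_distrib_left mult_ac)

text \<open>Two triangular operators act on the coefficients: convolution with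
  \<open>ratio_coeff r\<close>, coming from the weight, and then with \<open>bin (r - b)\<close>,
  coming from the change of the Laguerre order.\<close>

lemma hardy_spectrum_expansion:
  "hardy_spectrum l r a M x = (\<Sum>i<M. (\<Sum>j\<in>{i..<M}. of_real (bin (r - b) (j - i)) *
      (\<Sum>k\<in>{j..<M}. of_real (ratio_coeff r (k - j)) * a k)) * of_real (lag_fun l b i x))"
proof -
  have "hardy_spectrum l r a M x = (\<Sum>k<M. \<Sum>j\<le>k. of_real (ratio_coeff r (k - j)) * a k * of_real (lag_fun l r j x))"
    by (simp add: hardy_spectrum_def sum_distrib_left mult_ac)
  also have "\<dots> = (\<Sum>j<M. (\<Sum>k\<in>{j..<M}. of_real (ratio_coeff r (k - j)) * a k) * of_real (lag_fun l r j x))"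
    unfolding sum_triangle_transpose by (simp add: sum_distrib_right)
  also have "\<dots> = (\<Sum>j<M. \<Sum>i\<le>j. of_real (bin (r - b) (j - i)) * (\<Sum>k\<in>{j..<M}. of_real (ratio_coeff r (k - j)) * a k) * of_real (lag_fun l b i x))"
  proof (intro sum.cong refl)
    fix j
    have "D * of_real (lag_fun l r j x) = (\<Sum>i\<le>j. of_real (bin (r - b) (j - i)) * D * of_real (lag_fun l b i x))" for D :: complex
      unfolding lag_fun_connection[of l r j x b] of_real_sum of_real_mult sum_distrib_left by (simp add: mult_ac)
    then show "(\<Sum>k\<in>{j..<M}. of_real (ratio_coeff r (k - j)) * a k) * of_real (lag_fun l r j x) =
        (\<Sum>i\<le>j. of_real (bin (r - b) (j - i)) * (\<Sum>k\<in>{j..<M}. of_real (ratio_coeff r (k - j)) * a k) * of_real (lag_fun l b i x))" .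
  qed
  also have "\<dots> = (\<Sum>i<M. (\<Sum>j\<in>{i..<M}. of_real (bin (r - b) (j - i)) *
      (\<Sum>k\<in>{j..<M}. of_real (ratio_coeff r (k - j)) * a k)) * of_real (lag_fun l b i x))"
    unfolding sum_triangle_transpose by (simp add: sum_distrib_right)
  finally show ?thesis .
qed

text \<open>\<open>e\<close> is the power of \<open>k + 1\<close> that controls the norm with parameters \<open>s\<close> and \<open>r\<close>; the two
  alternatives correspond to parts (a) and (b).\<close>

definition admissible :: "real \<Rightarrow> real \<Rightarrow> real \<Rightarrow> bool" where
  "admissible s r e \<longleftrightarrow> s > - (1 / 2) \<and> r \<ge> 0 \<and> e \<ge> 0 \<and> (e = r - s \<and> r - 2 * s > 0 \<or> e = s \<and> r - 2 * s \<le> 0)"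

text \<open>A positive order \<open>r - 2 * s\<close> means a fractional sum, which raises the
  exponent from \<open>s\<close> to \<open>(r - 2 * s) + s\<close>. Otherwise the kernel is summable
  and the exponent is kept.\<close>

lemma bin_operator_bound:
  assumes adm: "admissible s r e"
  obtains C where "C \<ge> 0" "\<forall>N x. (\<forall>k. x k \<ge> 0) \<longrightarrow>
    (\<Sum>j<N. (real j + 1) powr (2 * s) * (\<Sum>k\<in>{j..<N}. \<bar>bin (r - 2 * s) (k - j)\<bar> * x k)\<^sup>2)
    \<le> C * (\<Sum>k<N. (real k + 1) powr (2 * e) * (x k)\<^sup>2)"
proof (cases "r - 2 * s > 0")
  case True
  have s: "s > - (1 / 2)" and e: "e = r - s" using adm True by (auto simp: admissible_def)
  have b: "\<bar>bin (r - 2 * s) m\<bar> = bin (r - 2 * s) m" for m using bin_pos[OF True, of m] by simp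
  have e': "r - 2 * s + s = e" using e by simp
  show ?thesis
  proof (rule fractional_hardy[OF True s])
    fix C assume C: "C \<ge> 0" "\<And>N x. (\<Sum>j<N. (real j + 1) powr (2 * s) * (\<Sum>k\<in>{j..<N}. bin (r - 2 * s) (k - j) * x k)\<^sup>2)
      \<le> C * (\<Sum>k<N. (real k + 1) powr (2 * (r - 2 * s + s)) * (x k)\<^sup>2)"
    show ?thesis
      by (rule that[OF C(1)]) (unfold b, intro allI impI, rule C(2)[unfolded e'])
  qed
next
  case False
  have s: "s \<ge> 0" and e: "e = s" using adm False by (auto simp: admissible_def)
  have "summable (\<lambda>m. \<bar>bin (- (2 * s - r)) m\<bar>)" by (rule bin_minus_summable) (use False in simp)
  then have sm: "summable (\<lambda>m. \<bar>bin (r - 2 * s) m\<bar>)" by simp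
  show ?thesis
    by (rule that[of "(\<Sum>m. \<bar>bin (r - 2 * s) m\<bar>)\<^sup>2"]) (use convolution_bound[OF sm s] e in auto)
qed

text \<open>The order \<open>b = 2 * s\<close> is the one whose Laguerre functions are orthogonal
  for the weight \<open>x powr (2 * s)\<close> of the target norm.\<close>

lemma hardy_spectrum_norm:
  assumes l: "l > 0" and adm: "admissible s r e"
  shows "sq_int lebesgue (\<lambda>x. indicator {0<..} x *\<^sub>R (of_real (x powr s) * hardy_spectrum l r a M x))"
    and "sq_norm lebesgue (\<lambda>x. indicator {0<..} x *\<^sub>R (of_real (x powr s) * hardy_spectrum l r a M x)) =
      (\<Sum>i<M. (cmod (\<Sum>j\<in>{i..<M}. of_real (bin (r - 2 * s) (j - i)) * (\<Sum>k\<in>{j..<M}. of_real (ratio_coeff r (k - j)) * a k)))\<^sup>2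
        * (l powr (- (2 * s + 1)) * (Gamma (2 * s + 1) * bin (2 * s + 1) i)))"
proof -
  have b: "2 * s > -1" using adm by (simp add: admissible_def)
  define E where "E i = (\<Sum>j\<in>{i..<M}. complex_of_real (bin (r - 2 * s) (j - i)) * (\<Sum>k\<in>{j..<M}. of_real (ratio_coeff r (k - j)) * a k))" for i
  have e: "indicator {0<..} x *\<^sub>R (of_real (x powr s) * hardy_spectrum l r a M x) = (\<Sum>i<M. E i * of_real (lag_basis l (2 * s) i x))" for x
  proof (cases "x > 0")
    case True
    then show ?thesis unfolding hardy_spectrum_expansion[of l r a M x "2 * s"] E_def[symmetric]
      by (simp add: lag_basis_def sum_distrib_left mult_ac)
  qed (simp add: lag_basis_def)
  show "sq_int lebesgue (\<lambda>x. indicator {0<..} x *\<^sub>R (of_real (x powr s) * hardy_spectrum l r a M x))"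
    unfolding e by (intro sq_int_sum sq_int_scale lag_basis_sq_int b l)
  show "sq_norm lebesgue (\<lambda>x. indicator {0<..} x *\<^sub>R (of_real (x powr s) * hardy_spectrum l r a M x)) =
      (\<Sum>i<M. (cmod (\<Sum>j\<in>{i..<M}. of_real (bin (r - 2 * s) (j - i)) * (\<Sum>k\<in>{j..<M}. of_real (ratio_coeff r (k - j)) * a k)))\<^sup>2
        * (l powr (- (2 * s + 1)) * (Gamma (2 * s + 1) * bin (2 * s + 1) i)))"
    unfolding e E_def[symmetric]
    by (rule sq_norm_orthogonal_sum[OF lag_basis_sq_int[OF b l] lag_basis_orthogonal[OF b l]])
qed

text \<open>The squared norms of the basis are at most a multiple of
  \<open>(i + 1) powr (2 * s)\<close>, the weight expected by \<open>bin_operator_bound\<close>;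
  convolution with \<open>ratio_coeff\<close> is then bounded for the weight of exponent
  \<open>e\<close>.\<close>

lemma hardy_spectrum_estimate:
  assumes l: "l > 0" and adm: "admissible s r e"
  obtains C where "C \<ge> 0" "\<forall>M a. sq_norm lebesgue (\<lambda>x. indicator {0<..} x *\<^sub>R (of_real (x powr s) * hardy_spectrum l r a M x))
    \<le> C * (\<Sum>k<M. (real k + 1) powr (2 * e) * (cmod (a k))\<^sup>2)"
proof -
  have b: "2 * s + 1 > 0" and e0: "e \<ge> 0" using adm by (auto simp: admissible_def)
  obtain C1 where C1: "C1 > 0" "\<And>m. bin (2 * s + 1) m \<le> C1 * (real m + 1) powr (2 * s + 1 - 1)"
    by (rule bin_asymptotic[OF b]) (rule that)
  obtain C2 where C2: "C2 \<ge> 0" "\<forall>N x. (\<forall>k. x k \<ge> 0) \<longrightarrow>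
    (\<Sum>j<N. (real j + 1) powr (2 * s) * (\<Sum>k\<in>{j..<N}. \<bar>bin (r - 2 * s) (k - j)\<bar> * x k)\<^sup>2)
    \<le> C2 * (\<Sum>k<N. (real k + 1) powr (2 * e) * (x k)\<^sup>2)"
    by (rule bin_operator_bound[OF adm], rule that, assumption+)
  define B where "B = (\<Sum>m. \<bar>ratio_coeff r m\<bar>)\<^sup>2"
  have B: "B \<ge> 0" by (simp add: B_def)
  have G: "Gamma (2 * s + 1) > 0" using b by (rule Gamma_real_pos)
  define W where "W = l powr (- (2 * s + 1)) * (Gamma (2 * s + 1) * C1)"
  have W: "W \<ge> 0" using G C1(1) by (simp add: W_def)
  have main: "sq_norm lebesgue (\<lambda>x. indicator {0<..} x *\<^sub>R (of_real (x powr s) * hardy_spectrum l r a M x))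
    \<le> W * (C2 * B) * (\<Sum>k<M. (real k + 1) powr (2 * e) * (cmod (a k))\<^sup>2)" for M a
  proof -
    define D where "D j = (\<Sum>k\<in>{j..<M}. complex_of_real (ratio_coeff r (k - j)) * a k)" for j
    define E where "E i = (\<Sum>j\<in>{i..<M}. complex_of_real (bin (r - 2 * s) (j - i)) * D j)" for i
    have "sq_norm lebesgue (\<lambda>x. indicator {0<..} x *\<^sub>R (of_real (x powr s) * hardy_spectrum l r a M x)) =
        (\<Sum>i<M. (cmod (E i))\<^sup>2 * (l powr (- (2 * s + 1)) * (Gamma (2 * s + 1) * bin (2 * s + 1) i)))"
      unfolding E_def D_def by (rule hardy_spectrum_norm(2)[OF l adm])
    also have "\<dots> \<le> (\<Sum>i<M. W * ((real i + 1) powr (2 * s) * (cmod (E i))\<^sup>2))"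
    proof (intro sum_mono)
      fix i
      have "l powr (- (2 * s + 1)) * (Gamma (2 * s + 1) * bin (2 * s + 1) i) \<le> l powr (- (2 * s + 1)) * (Gamma (2 * s + 1) * (C1 * (real i + 1) powr (2 * s)))"
        using C1(2)[of i] G by (intro mult_left_mono) auto
      also have "\<dots> = W * (real i + 1) powr (2 * s)" by (simp add: W_def)
      finally have "(cmod (E i))\<^sup>2 * (l powr (- (2 * s + 1)) * (Gamma (2 * s + 1) * bin (2 * s + 1) i)) \<le> (cmod (E i))\<^sup>2 * (W * (real i + 1) powr (2 * s))"
        by (rule mult_left_mono) simp
      then show "(cmod (E i))\<^sup>2 * (l powr (- (2 * s + 1)) * (Gamma (2 * s + 1) * bin (2 * s + 1) i)) \<le> W * ((real i + 1) powr (2 * s) * (cmod (E i))\<^sup>2)"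
        by (simp only: mult_ac)
    qed
    also have "\<dots> = W * (\<Sum>i<M. (real i + 1) powr (2 * s) * (cmod (E i))\<^sup>2)" by (simp add: sum_distrib_left)
    also have "(\<Sum>i<M. (real i + 1) powr (2 * s) * (cmod (E i))\<^sup>2) \<le>
        (\<Sum>i<M. (real i + 1) powr (2 * s) * (\<Sum>j\<in>{i..<M}. \<bar>bin (r - 2 * s) (j - i)\<bar> * cmod (D j))\<^sup>2)"
    proof (intro sum_mono mult_left_mono power_mono)
      show "cmod (E i) \<le> (\<Sum>j\<in>{i..<M}. \<bar>bin (r - 2 * s) (j - i)\<bar> * cmod (D j))" for i
        unfolding E_def by (rule order_trans[OF norm_sum]) (simp add: norm_mult)
    qed auto
    also have "\<dots> \<le> C2 * (\<Sum>j<M. (real j + 1) powr (2 * e) * (cmod (D j))\<^sup>2)"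
      using C2(2) by simp
    also have "(\<Sum>j<M. (real j + 1) powr (2 * e) * (cmod (D j))\<^sup>2) \<le>
        (\<Sum>j<M. (real j + 1) powr (2 * e) * (\<Sum>k\<in>{j..<M}. \<bar>ratio_coeff r (k - j)\<bar> * cmod (a k))\<^sup>2)"
    proof (intro sum_mono mult_left_mono power_mono)
      show "cmod (D j) \<le> (\<Sum>k\<in>{j..<M}. \<bar>ratio_coeff r (k - j)\<bar> * cmod (a k))" for j
        unfolding D_def by (rule order_trans[OF norm_sum]) (simp add: norm_mult)
    qed auto
    also have "\<dots> \<le> B * (\<Sum>k<M. (real k + 1) powr (2 * e) * (cmod (a k))\<^sup>2)"
      unfolding B_def by (rule convolution_bound[OF ratio_coeff_summable e0]) simp
    finally show ?thesis using W C2(1) by (simp add: mult_left_mono mult.assoc)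
  qed
  have "W * (C2 * B) \<ge> 0" using W C2(1) B by (intro mult_nonneg_nonneg)
  then show ?thesis by (rule that) (intro allI main)
qed

lemma hardy_spectrum_truncate:
  assumes "N \<le> M"
  shows "hardy_spectrum l r a M x - hardy_spectrum l r a N x = hardy_spectrum l r (\<lambda>k. if k < N then 0 else a k) M x"
proof -
  let ?F = "\<lambda>k. (\<Sum>j\<le>k. complex_of_real (ratio_coeff r (k - j) * lag_fun l r j x))"
  have S: "(\<Sum>k<M. h k) = (\<Sum>k<N. h k) + (\<Sum>k\<in>{N..<M}. h k)" for h :: "nat \<Rightarrow> complex"
    using sum.atLeastLessThan_concat[of 0 N M h] assms by (simp add: atLeast0LessThan)
  have "(\<Sum>k<N. (if k < N then 0 else a k) * ?F k) = 0" by (intro sum.neutral) auto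
  moreover have "(\<Sum>k\<in>{N..<M}. (if k < N then 0 else a k) * ?F k) = (\<Sum>k\<in>{N..<M}. a k * ?F k)" by (intro sum.cong) auto
  ultimately show ?thesis unfolding hardy_spectrum_def S[of "\<lambda>k. a k * ?F k"] S[of "\<lambda>k. (if k < N then 0 else a k) * ?F k"] by simp
qed

section \<open>Partial sums and tails of the MTC expansion\<close>

context
  fixes l :: real
  assumes l: "l > 0"
begin

text \<open>An even number of terms keeps together the indices \<open>2 * k\<close> and
  \<open>2 * k + 1\<close> that belong to one \<open>hardy k\<close>.\<close>

definition mtc_sum :: "(nat \<Rightarrow> real) \<Rightarrow> nat \<Rightarrow> real \<Rightarrow> real" where
  "mtc_sum \<beta> M x = (\<Sum>j<2 * M. \<beta> j * mtc l j x)"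

text \<open>The coefficient of \<open>cnj (hardy k)\<close> in \<open>mtc_sum\<close>, up to a
  common constant; only this half is visible in the spectrum on the half-line.\<close>

definition pair_coeff :: "(nat \<Rightarrow> real) \<Rightarrow> nat \<Rightarrow> complex" where
  "pair_coeff \<beta> k = of_real (\<beta> (2 * k)) - \<i> * of_real (\<beta> (Suc (2 * k)))"

lemma pair_coeff_norm: "(cmod (pair_coeff \<beta> k))\<^sup>2 = (\<beta> (2 * k))\<^sup>2 + (\<beta> (Suc (2 * k)))\<^sup>2"
  by (simp add: pair_coeff_def cmod_power2)

lemma sum_pairs: "(\<Sum>j<2 * M. h j) = (\<Sum>k<M. h (2 * k) + h (Suc (2 * k)))" for h :: "nat \<Rightarrow> 'a::comm_monoid_add"
  by (induction M) (auto simp: add.assoc)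

lemma mtc_sum_hardy:
  "complex_of_real (mtc_sum \<beta> M x) = of_real (sqrt (l / pi) / 2) *
    (\<Sum>k<M. cnj (pair_coeff \<beta> k) * hardy l k x + pair_coeff \<beta> k * cnj (hardy l k x))"
proof -
  have "complex_of_real (\<beta> (2 * k) * mtc l (2 * k) x + \<beta> (Suc (2 * k)) * mtc l (Suc (2 * k)) x) =
      of_real (sqrt (l / pi) / 2) * (cnj (pair_coeff \<beta> k) * hardy l k x + pair_coeff \<beta> k * cnj (hardy l k x))" for k
    unfolding mtc_hardy[OF l] pair_coeff_def by (simp add: complex_eq_iff algebra_simps)
  then show ?thesis unfolding mtc_sum_def sum_pairs by (simp only: of_real_sum sum_distrib_left)
qed

text \<open>The terms with \<open>hardy\<close> drop out, and each conjugate contributes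
  \<open>gen_coeff\<close>, the integral of the test function against a finite Laguerre
  combination.\<close>

lemma mtc_sum_spectrum:
  assumes d: "test_chain d a b" and r: "r \<ge> 0"
  shows "(LINT x|lebesgue. of_real (mtc_sum \<beta> M x) * (kappa_minus l r x * fourier (d 0) x)) =
    of_real (sqrt (l / pi) / 2) * (\<i> powr of_real r * of_real (l powr r)) *
      (LINT x|lebesgue. hardy_spectrum l r (pair_coeff \<beta>) M x * d 0 x)"
proof -
  note D = test_chainD[OF d]
  let ?K = "\<lambda>x. kappa_minus l r x * fourier (d 0) x"
  have K: "sq_int lebesgue ?K" by (rule kappa_fourier_sq_int[OF l d r])
  have i1: "integrable lebesgue (\<lambda>x. kappa_minus l r x * hardy l k x * fourier (d 0) x)" for k
    using sq_int_mult[OF hardy_sq_int[OF l, of k] K] by (simp only: mult_ac)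
  have i2: "integrable lebesgue (\<lambda>x. kappa_minus l r x * cnj (hardy l k x) * fourier (d 0) x)" for k
    using sq_int_mult[OF sq_int_cnj[OF hardy_sq_int[OF l, of k]] K] by (simp only: mult_ac)
  have e: "of_real (mtc_sum \<beta> M x) * ?K x = of_real (sqrt (l / pi) / 2) * (\<Sum>k<M.
      cnj (pair_coeff \<beta> k) * (kappa_minus l r x * hardy l k x * fourier (d 0) x) +
      pair_coeff \<beta> k * (kappa_minus l r x * cnj (hardy l k x) * fourier (d 0) x))" for x
    unfolding mtc_sum_hardy mult.assoc sum_distrib_right by (intro arg_cong2[where f="(*)"] refl sum.cong) (simp add: algebra_simps)
  have "(LINT x|lebesgue. of_real (mtc_sum \<beta> M x) * ?K x) = of_real (sqrt (l / pi) / 2) *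
      (\<Sum>k<M. cnj (pair_coeff \<beta> k) * 0 + pair_coeff \<beta> k * (\<i> powr of_real r * of_real (l powr r) * gen_coeff l r (d 0) k))"
    unfolding e integral_mult_right_zero
    by (subst Bochner_Integration.integral_sum)
      (intro Bochner_Integration.integrable_add integrable_mult_right i1 i2,
       simp only: Bochner_Integration.integral_add[OF integrable_mult_right[OF i1] integrable_mult_right[OF i2]] integral_mult_right_zero
         kappa_hardy_fourier_integral[OF l d r])
  also have "\<dots> = of_real (sqrt (l / pi) / 2) * (\<i> powr of_real r * of_real (l powr r)) * (\<Sum>k<M. pair_coeff \<beta> k * gen_coeff l r (d 0) k)"
    by (simp add: sum_distrib_left mult_ac)
  also have "(\<Sum>k<M. pair_coeff \<beta> k * gen_coeff l r (d 0) k) = (LINT x|lebesgue. hardy_spectrum l r (pair_coeff \<beta>) M x * d 0 x)"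
  proof -
    have i: "integrable lebesgue (\<lambda>x. complex_of_real (lag_fun l r j x) * d 0 x)" for j
      by (rule compact_support_integrable(2)[where a=a and b=b]) (intro continuous_intros lag_fun_continuous D(4), simp add: D(3))
    have "hardy_spectrum l r (pair_coeff \<beta>) M x * d 0 x = (\<Sum>k<M. pair_coeff \<beta> k * (\<Sum>j\<le>k. of_real (ratio_coeff r (k - j)) * (of_real (lag_fun l r j x) * d 0 x)))" for x
      by (simp add: hardy_spectrum_def sum_distrib_left sum_distrib_right mult_ac)
    then show ?thesis
      by (simp only: gen_coeff_def[OF l] Bochner_Integration.integral_sum integrable_mult_right i Bochner_Integration.integrable_sum integral_mult_right_zero)
  qed
  finally show ?thesis .
qed

lemma mtc_sum_norm: "sq_norm lebesgue (\<lambda>x. complex_of_real (mtc_sum \<beta> M x)) = (\<Sum>k<M. (cmod (pair_coeff \<beta> k))\<^sup>2)"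
proof -
  have "sq_norm lebesgue (\<lambda>x. complex_of_real (mtc_sum \<beta> M x)) = (\<Sum>j<2 * M. (\<beta> j)\<^sup>2)"
    using mtc_sum_sq_norm[OF l, of "\<lambda>j. of_real (\<beta> j)" "{..<2 * M}"] by (simp add: mtc_sum_def)
  then show ?thesis by (simp add: sum_pairs pair_coeff_norm)
qed

lemma mtc_sum_sq_int: "sq_int lebesgue (\<lambda>x. complex_of_real (mtc_sum \<beta> M x))"
  unfolding mtc_sum_def of_real_sum of_real_mult by (intro sq_int_sum sq_int_scale mtc_sq_int[OF l])

definition tail_coeff :: "(real \<Rightarrow> real) \<Rightarrow> nat \<Rightarrow> nat \<Rightarrow> real" where
  "tail_coeff f n j = (if j \<le> n then 0 else mtc_coeff l f j)"

text \<open>\<open>mtc_proj\<close> includes its last index, so \<open>2 * M\<close> terms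
  correspond to the projection of index \<open>2 * M - 1\<close>.\<close>

lemma tail_mtc_sum:
  assumes "n < M" shows "mtc_sum (tail_coeff f n) M x = mtc_proj l (2 * M - 1) f x - mtc_proj l n f x"
proof -
  let ?h = "\<lambda>j. mtc_coeff l f j * mtc l j x"
  have "{..2 * M - 1} = {..n} \<union> {n<..<2 * M}" using assms by auto
  then have "(\<Sum>j\<le>2 * M - 1. ?h j) = (\<Sum>j\<le>n. ?h j) + (\<Sum>j\<in>{n<..<2 * M}. ?h j)"
    by (simp only:) (rule sum.union_disjoint, auto)
  moreover have "mtc_sum (tail_coeff f n) M x = (\<Sum>j\<in>{n<..<2 * M}. ?h j)"
    unfolding mtc_sum_def by (rule sum.mono_neutral_cong_right) (auto simp: tail_coeff_def)
  ultimately show ?thesis by (simp add: mtc_proj_eq[OF l])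
qed

lemma tail_mtc_sum_tendsto:
  assumes f: "sq_int lebesgue (\<lambda>x. complex_of_real (f x))"
  shows "(\<lambda>M. sq_norm lebesgue (\<lambda>x. of_real (mtc_sum (tail_coeff f n) M x) - of_real (f x - mtc_proj l n f x))) \<longlonglongrightarrow> 0"
proof -
  have "filterlim (\<lambda>M::nat. 2 * M - 1) at_top sequentially"
    by (rule filterlim_at_top_mono[OF filterlim_ident]) (auto intro!: eventually_sequentiallyI[of 1])
  from filterlim_compose[OF mtc_proj_tendsto[OF l f] this]
  have "(\<lambda>M. sq_norm lebesgue (\<lambda>x. of_real (mtc_proj l (2 * M - 1) f x) - of_real (f x))) \<longlonglongrightarrow> 0" .
  then show ?thesis
  proof (rule Lim_transform_eventually)
    show "\<forall>\<^sub>F M in sequentially. sq_norm lebesgue (\<lambda>x. of_real (mtc_proj l (2 * M - 1) f x) - of_real (f x)) =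
        sq_norm lebesgue (\<lambda>x. complex_of_real (mtc_sum (tail_coeff f n) M x) - of_real (f x - mtc_proj l n f x))"
      using eventually_gt_at_top[of n] by eventually_elim (simp add: tail_mtc_sum)
  qed
qed

text \<open>Dropping one or both coefficients of a pair only decreases its modulus. The second claim
  is the origin of the quantity \<open>n / 2\<close>: a pair that survives satisfies
  \<open>n \<le> 2 * k\<close>.\<close>

lemma tail_pair_coeff_le:
  assumes f: "sq_int lebesgue (\<lambda>x. complex_of_real (f x))"
  shows "(cmod (pair_coeff (tail_coeff f n) k))\<^sup>2 \<le> l / pi * (cmod (LINT x|lebesgue. of_real (f x) * hardy l k x))\<^sup>2"
    and "pair_coeff (tail_coeff f n) k \<noteq> 0 \<Longrightarrow> real n / 2 \<le> real k + 1"
proof -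
  let ?m = "\<lambda>j. LINT x|lebesgue. of_real (f x) * complex_of_real (mtc l j x)"
  have i: "integrable lebesgue (\<lambda>x. of_real (f x) * complex_of_real (mtc l j x))" for j
    by (intro sq_int_mult f mtc_sq_int[OF l])
  have "of_real (f x) * hardy l k x = of_real (sqrt (pi / l)) * (of_real (f x) * of_real (mtc l (2 * k) x) - \<i> * (of_real (f x) * of_real (mtc l (Suc (2 * k)) x)))" for x
    unfolding hardy_mtc[OF l] by (simp add: algebra_simps)
  then have "(LINT x|lebesgue. of_real (f x) * hardy l k x) = of_real (sqrt (pi / l)) * (?m (2 * k) - \<i> * ?m (Suc (2 * k)))"
    by (simp only: integral_mult_right_zero Bochner_Integration.integral_diff[OF i integrable_mult_right[OF i]])
  also have "\<dots> = of_real (sqrt (pi / l)) * pair_coeff (mtc_coeff l f) k"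
    by (simp only: mtc_coeff_complex[OF l f] pair_coeff_def)
  finally have "(cmod (LINT x|lebesgue. of_real (f x) * hardy l k x))\<^sup>2 = pi / l * (cmod (pair_coeff (mtc_coeff l f) k))\<^sup>2"
    using l by (simp add: norm_mult power_mult_distrib)
  then have e: "l / pi * (cmod (LINT x|lebesgue. of_real (f x) * hardy l k x))\<^sup>2 = (cmod (pair_coeff (mtc_coeff l f) k))\<^sup>2"
    using l by simp
  show "(cmod (pair_coeff (tail_coeff f n) k))\<^sup>2 \<le> l / pi * (cmod (LINT x|lebesgue. of_real (f x) * hardy l k x))\<^sup>2"
    unfolding e pair_coeff_norm by (auto simp: tail_coeff_def)
  assume "pair_coeff (tail_coeff f n) k \<noteq> 0"
  then have "\<not> Suc (2 * k) \<le> n" by (auto simp: pair_coeff_def tail_coeff_def)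
  then show "real n / 2 \<le> real k + 1" by simp
qed

lemma powr_sq_int_on_compact:
  assumes "compact K" "K \<subseteq> {0<..}"
  shows "sq_int lebesgue (\<lambda>x. indicator K x *\<^sub>R complex_of_real (x powr s))"
proof -
  have c: "continuous_on K (\<lambda>x. x powr (2 * s))" using assms(2) by (intro continuous_intros) auto
  have Kb: "K \<in> sets borel" using assms(1) by (simp add: borel_compact)
  have "(\<lambda>x. indicator K x *\<^sub>R complex_of_real (x powr s)) \<in> borel_measurable borel" using Kb by measurable
  then have m: "(\<lambda>x. indicator K x *\<^sub>R complex_of_real (x powr s)) \<in> borel_measurable lebesgue" by (rule borel_measurable_lebesgueI)
  have "integrable lborel (\<lambda>x. indicator K x *\<^sub>R (x powr (2 * s)))"
    by (rule borel_integrable_compact[OF assms(1) c])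
  then have "integrable lebesgue (\<lambda>x. indicator K x *\<^sub>R (x powr (2 * s)))"
    by (subst integrable_completion) (auto simp: borel_measurable_integrable)
  moreover have "(cmod (indicator K x *\<^sub>R complex_of_real (x powr s)))\<^sup>2 = indicator K x *\<^sub>R (x powr (2 * s))" for x
    by (cases "x \<in> K") (auto simp: powr_square)
  ultimately show ?thesis using m by (simp only: sq_int_def)
qed

text \<open>The spectrum of the projection error is obtained as the limit in the mean of the spectra
  of the partial sums of its expansion.\<close>

lemma projection_error_spectrum:
  assumes adm: "admissible s r e" and f: "sq_int lebesgue (\<lambda>x. complex_of_real (f x))"
    and C: "C \<ge> 0" "\<forall>M a. sq_norm lebesgue (\<lambda>x. indicator {0<..} x *\<^sub>R (of_real (x powr s) * hardy_spectrum l r a M x))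
      \<le> C * (\<Sum>k<M. (real k + 1) powr (2 * e) * (cmod (a k))\<^sup>2)"
    and X: "\<And>M. (\<Sum>k<M. (real k + 1) powr (2 * e) * (cmod (pair_coeff (tail_coeff f n) k))\<^sup>2) \<le> X"
  obtains g where "is_function_on {0<..} (weighted_spectrum l r (\<lambda>x. f x - mtc_proj l n f x)) g"
    "sq_int lebesgue (\<lambda>x. indicator {0<..} x *\<^sub>R (of_real (x powr s) * g x))"
    "sq_norm lebesgue (\<lambda>x. indicator {0<..} x *\<^sub>R (of_real (x powr s) * g x)) \<le> l / pi * (l powr r)\<^sup>2 * (C * X)"
proof -
  have r: "r \<ge> 0" using adm by (simp add: admissible_def)
  let ?a = "pair_coeff (tail_coeff f n)"
  let ?t = "\<lambda>k. (real k + 1) powr (2 * e) * (cmod (?a k))\<^sup>2"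
  define u where "u M x = indicator {0<..} x *\<^sub>R (of_real (x powr s) * hardy_spectrum l r ?a M x)" for M x
  have uS: "sq_int lebesgue (u M)" for M unfolding u_def[abs_def] by (rule hardy_spectrum_norm(1)[OF l adm])
  have uB: "sq_norm lebesgue (u M) \<le> C * X" for M
    unfolding u_def[abs_def] by (rule order_trans[OF C(2)[rule_format]]) (intro mult_left_mono X C(1))
  have ts: "summable ?t" by (rule summableI_nonneg_bounded[where x=X]) (auto intro: X)
  \<comment> \<open>A difference of two spectra is the spectrum for truncated coefficients, so the
    same estimate makes the sequence Cauchy.\<close>
  have diff: "sq_norm lebesgue (\<lambda>x. u M x - u N x) \<le> C * sum ?t {N..<M}" if "N \<le> M" for M N
  proof -
    have "u M x - u N x = indicator {0<..} x *\<^sub>R (of_real (x powr s) * hardy_spectrum l r (\<lambda>k. if k < N then 0 else ?a k) M x)" for x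
      unfolding hardy_spectrum_truncate[OF that, symmetric] by (simp add: u_def algebra_simps)
    then have "sq_norm lebesgue (\<lambda>x. u M x - u N x) \<le> C * (\<Sum>k<M. (real k + 1) powr (2 * e) * (cmod (if k < N then 0 else ?a k))\<^sup>2)"
      using C(2)[rule_format, of "\<lambda>k. if k < N then 0 else ?a k" M] by (simp only:)
    also have "(\<Sum>k<M. (real k + 1) powr (2 * e) * (cmod (if k < N then 0 else ?a k))\<^sup>2) = sum ?t {N..<M}"
      using that by (intro sum.mono_neutral_cong_right) auto
    finally show ?thesis .
  qed
  have comm: "sq_norm lebesgue (\<lambda>x. u M x - u N x) = sq_norm lebesgue (\<lambda>x. u N x - u M x)" for M N
    by (simp add: sq_norm_def norm_minus_commute)
  have "\<exists>N0. \<forall>M\<ge>N0. \<forall>N\<ge>N0. sq_norm lebesgue (\<lambda>x. u M x - u N x) \<le> \<epsilon>" if "\<epsilon> > 0" for \<epsilon>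
  proof -
    have "\<epsilon> / (C + 1) > 0" using that C(1) by simp
    then obtain N0 where N0: "\<And>m n. m \<ge> N0 \<Longrightarrow> norm (sum ?t {m..<n}) < \<epsilon> / (C + 1)"
      using ts unfolding summable_Cauchy by blast
    have *: "sq_norm lebesgue (\<lambda>x. u M x - u N x) \<le> \<epsilon>" if "N0 \<le> N" "N \<le> M" for M N
    proof -
      have "C * sum ?t {N..<M} \<le> C * (\<epsilon> / (C + 1))" using N0[OF that(1), of M] C(1) by (intro mult_left_mono) auto
      also have "\<dots> \<le> \<epsilon>" using C(1) \<open>\<epsilon> > 0\<close> by (simp add: field_simps)
      finally show ?thesis using diff[OF that(2)] by linarith
    qed
    have "sq_norm lebesgue (\<lambda>x. u M x - u N x) \<le> \<epsilon>" if "N0 \<le> N" "N0 \<le> M" for M N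
      using *[of N M] *[of M N] comm[of M N] that by (cases "N \<le> M") auto
    then show ?thesis by blast
  qed
  from riesz_fischer[OF uS this] obtain v where v: "sq_int lebesgue v" "(\<lambda>M. sq_norm lebesgue (\<lambda>x. u M x - v x)) \<longlonglongrightarrow> 0"
    by blast
  have vB: "sq_norm lebesgue v \<le> 2 * (C * X)" by (rule sq_norm_limit_bound[OF uS v uB])
  define c where "c = complex_of_real (sqrt (l / pi) / 2) * (\<i> powr of_real r * of_real (l powr r))"
  \<comment> \<open>\<open>v\<close> is the limit of spectra carrying the weight
    \<open>x powr s\<close>, which is divided off again; \<open>c\<close> is the constant of
    \<open>mtc_sum_spectrum\<close>.\<close>
  define g where "g x = c * (of_real (x powr (- s)) * v x)" for x
  have cc: "(cmod c)\<^sup>2 = l / pi * (l powr r)\<^sup>2 / 4"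
  proof -
    have "cmod (\<i> powr of_real r) = 1" using cmod_powr_real[of \<i> r] by simp
    then have "cmod c = sqrt (l / pi) / 2 * l powr r" using l unfolding c_def norm_mult by simp
    then have "(cmod c)\<^sup>2 = (sqrt (l / pi) / 2 * l powr r)\<^sup>2" by (simp only:)
    also have "\<dots> = l / pi * (l powr r)\<^sup>2 / 4" using l by (simp add: power_mult_distrib power_divide)
    finally show ?thesis .
  qed
  have gv: "indicator {0<..} x *\<^sub>R (of_real (x powr s) * g x) = c * (indicator {0<..} x *\<^sub>R v x)" for x
  proof (cases "x > 0")
    case True
    have "complex_of_real (x powr s) * of_real (x powr (- s)) = 1" using True by (simp flip: of_real_mult powr_add)
    moreover have "of_real (x powr s) * g x = (complex_of_real (x powr s) * of_real (x powr (- s))) * (c * v x)" by (simp add: g_def)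
    ultimately show ?thesis using True by simp
  qed simp
  have vm: "v \<in> borel_measurable lebesgue" using v(1) by (simp only: sq_int_def)
  have iv: "sq_int lebesgue (\<lambda>x. indicator {0<..} x *\<^sub>R v x)"
    by (rule sq_int_bound[OF v(1), where C=1], intro borel_measurable_scaleR borel_measurable_indicator vm) (auto simp: indicator_def)
  have ivB: "sq_norm lebesgue (\<lambda>x. indicator {0<..} x *\<^sub>R v x) \<le> sq_norm lebesgue v"
    unfolding sq_norm_def by (rule integral_mono[OF sq_int_integrable[OF iv] sq_int_integrable[OF v(1)]]) (auto simp: indicator_def)
  show ?thesis
  proof (rule that[of g])
    show "sq_int lebesgue (\<lambda>x. indicator {0<..} x *\<^sub>R (of_real (x powr s) * g x))"
      unfolding gv by (rule sq_int_scale[OF iv])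
    have "sq_norm lebesgue (\<lambda>x. indicator {0<..} x *\<^sub>R (of_real (x powr s) * g x)) \<le> l / pi * (l powr r)\<^sup>2 / 4 * (2 * (C * X))"
      unfolding gv sq_norm_scale cc using ivB vB l by (intro mult_left_mono) auto
    also have "\<dots> \<le> l / pi * (l powr r)\<^sup>2 * (C * X)"
    proof -
      have "0 \<le> C * X" using uB[of 0] sq_norm_nonneg[of lebesgue "u 0"] by linarith
      then have "0 \<le> l / pi * (l powr r)\<^sup>2 * (C * X)" using l by simp
      moreover have "k / 4 * (2 * z) \<le> k * z" if "0 \<le> k * z" for k z :: real using that by linarith
      ultimately show ?thesis by blast
    qed
    finally show "sq_norm lebesgue (\<lambda>x. indicator {0<..} x *\<^sub>R (of_real (x powr s) * g x)) \<le> l / pi * (l powr r)\<^sup>2 * (C * X)" .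
    show "is_function_on {0<..} (weighted_spectrum l r (\<lambda>x. f x - mtc_proj l n f x)) g"
      unfolding is_function_on_def
    proof (intro conjI allI impI ballI)
      fix K :: "real set" assume K: "compact K \<and> K \<subseteq> {0<..}"
      have "integrable lebesgue (\<lambda>x. c * (indicator K x *\<^sub>R complex_of_real (x powr (- s)) * v x))"
        by (intro integrable_mult_right sq_int_mult v powr_sq_int_on_compact) (use K in auto)
      then show "set_integrable lebesgue K g" by (simp add: set_integrable_def g_def)
    next
      fix \<phi> assume "\<phi> \<in> test_functions {0<..}"
      then obtain d a b where d: "d 0 = \<phi>" "test_chain d a b" by (rule test_function_test_chain)
      note D = test_chainD[OF d(2)]
      let ?K = "\<lambda>x. kappa_minus l r x * fourier (d 0) x"
      have Ks: "sq_int lebesgue ?K" by (rule kappa_fourier_sq_int[OF l d(2) r])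
      \<comment> \<open>Since the test function is supported away from zero and infinity, the factor
        \<open>x powr (- s)\<close> can be moved onto it and the product stays square
        integrable.\<close>
      let ?q = "\<lambda>x. complex_of_real (x powr (- s)) * d 0 x"
      have qs: "sq_int lebesgue ?q"
      proof -
        have "bounded (d 0 ` {a..b})" by (intro compact_imp_bounded compact_continuous_image D(4)) simp
        then obtain B where B: "\<And>x. x \<in> {a..b} \<Longrightarrow> cmod (d 0 x) \<le> B" unfolding bounded_iff by blast
        show ?thesis
        proof (rule sq_int_bound[OF powr_sq_int_on_compact[of "{a..b}" "- s"], where C=B])
          show "{a..b} \<subseteq> {0<..}" using D(1) by auto
          have "(\<lambda>x. complex_of_real (x powr (- s))) \<in> borel_measurable borel" by measurable
          then show "?q \<in> borel_measurable lebesgue" by (intro borel_measurable_times[OF borel_measurable_lebesgueI D(6)])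
          show "AE x in lebesgue. cmod (?q x) \<le> B * cmod (indicator {a..b} x *\<^sub>R complex_of_real (x powr (- s)))"
          proof (intro always_eventually allI)
            fix x
            show "cmod (?q x) \<le> B * cmod (indicator {a..b} x *\<^sub>R complex_of_real (x powr (- s)))"
              using mult_right_mono[OF B[of x], of "x powr (- s)"] D(3)[of x 0] by (cases "x \<in> {a..b}") (auto simp: norm_mult mult.commute)
          qed
        qed simp
      qed
      have hs: "sq_int lebesgue (\<lambda>x. complex_of_real (f x - mtc_proj l n f x))"
        using sq_int_diff(1)[OF f mtc_proj_sq_int[OF l, of n f]] by simp
      have L: "(\<lambda>M. LINT x|lebesgue. of_real (mtc_sum (tail_coeff f n) M x) * ?K x) \<longlonglongrightarrow> (LINT x|lebesgue. of_real (f x - mtc_proj l n f x) * ?K x)"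
        by (rule sq_norm_tendsto_integral[OF mtc_sum_sq_int hs Ks tail_mtc_sum_tendsto[OF f]])
      have R: "(\<lambda>M. c * (LINT x|lebesgue. u M x * ?q x)) \<longlonglongrightarrow> c * (LINT x|lebesgue. v x * ?q x)"
        by (intro tendsto_mult tendsto_const sq_norm_tendsto_integral[OF uS v(1) qs v(2)])
      have "(LINT x|lebesgue. of_real (mtc_sum (tail_coeff f n) M x) * ?K x) = c * (LINT x|lebesgue. u M x * ?q x)" for M
      proof -
        have "hardy_spectrum l r ?a M x * d 0 x = u M x * ?q x" for x
        proof (cases "x > 0")
          case True
          have "complex_of_real (x powr s) * of_real (x powr (- s)) = 1" using True by (simp flip: of_real_mult powr_add)
          moreover have "u M x * ?q x = (complex_of_real (x powr s) * of_real (x powr (- s))) * (hardy_spectrum l r ?a M x * d 0 x)"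
            using True by (simp add: u_def)
          ultimately show ?thesis by (simp only: mult_1)
        next
          case False
          then have "d 0 x = 0" using D(1) by (intro D(3)) auto
          then show ?thesis by simp
        qed
        then show ?thesis unfolding mtc_sum_spectrum[OF d(2) r] c_def by (simp only:)
      qed
      then have "(LINT x|lebesgue. of_real (f x - mtc_proj l n f x) * ?K x) = c * (LINT x|lebesgue. v x * ?q x)"
        using LIMSEQ_unique[OF L] R by (simp only:)
      moreover have "weighted_spectrum l r (\<lambda>x. f x - mtc_proj l n f x) \<phi> = (LINT x|lebesgue. of_real (f x - mtc_proj l n f x) * ?K x)"
        unfolding weighted_spectrum_eq d(1) by (simp only: mult_ac)
      moreover have "(LINT x:{0<..}|lebesgue. g x * \<phi> x) = c * (LINT x|lebesgue. v x * ?q x)"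
      proof -
        have "indicator {0<..} x *\<^sub>R (g x * \<phi> x) = c * (v x * ?q x)" for x
        proof (cases "x > 0")
          case False
          then have "d 0 x = 0" using D(1) by (intro D(3)) auto
          then show ?thesis using False d(1) by simp
        qed (simp add: g_def d(1)[symmetric])
        then show ?thesis by (simp only: set_lebesgue_integral_def integral_mult_right_zero)
      qed
      ultimately show "weighted_spectrum l r (\<lambda>x. f x - mtc_proj l n f x) \<phi> = (LINT x:{0<..}|lebesgue. g x * \<phi> x)"
        by (simp only:)
    qed
  qed
qed

section \<open>The error estimate in the target norm\<close>

lemma powr_tail_le:
  fixes p q y k :: real
  assumes "p \<le> q" "y > 0" "y \<le> k"
  shows "k powr (2 * p) \<le> k powr (2 * q) * y powr (2 * (p - q))"
proof -
  have "2 * p = 2 * q + 2 * (p - q)" by simp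
  then have "k powr (2 * p) = k powr (2 * q) * k powr (2 * (p - q))" by (simp only: powr_add)
  also have "\<dots> \<le> k powr (2 * q) * y powr (2 * (p - q))"
    using assms by (intro mult_left_mono powr_mono2') auto
  finally show ?thesis .
qed

lemma spectrum_fun_is_function_on:
  "\<exists>g. is_function_on {0<..} (weighted_spectrum l r f) g \<Longrightarrow> is_function_on {0<..} (weighted_spectrum l r f) (spectrum_fun l r f)"
  unfolding spectrum_fun_def by (erule someI_ex)

lemma weighted_square_eq:
  "indicator {0<..} x *\<^sub>R (x powr (2 * s) * (cmod z)\<^sup>2) = (cmod (indicator {0<..} x *\<^sub>R (of_real (x powr s) * z)))\<^sup>2"
  by (cases "x > 0") (auto simp: norm_mult power_mult_distrib powr_square)

lemma projection_error_estimate: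
  assumes adm: "admissible s r e" and r1: "r1 \<ge> 0" and e: "e \<le> r1"
  obtains c where "c > 0" "\<forall>n\<ge>1. \<forall>f\<in>Hspace l r1 (2 * r1).
    (\<lambda>x. f x - mtc_proj l n f x) \<in> Hspace l s r \<and>
    Hnorm l s r (\<lambda>x. f x - mtc_proj l n f x) \<le> c * (l * real n / 2) powr (e - r1) * Hnorm l r1 (2 * r1) f"
proof -
  have e0: "e \<ge> 0" using adm by (simp add: admissible_def)
  obtain C where C: "C \<ge> 0" "\<forall>M a. sq_norm lebesgue (\<lambda>x. indicator {0<..} x *\<^sub>R (of_real (x powr s) * hardy_spectrum l r a M x))
    \<le> C * (\<Sum>k<M. (real k + 1) powr (2 * e) * (cmod (a k))\<^sup>2)"
    by (rule hardy_spectrum_estimate[OF l adm], rule that, assumption+)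
  obtain D where D: "D \<ge> 0" "\<forall>f g n. sq_int lebesgue (\<lambda>x. complex_of_real (f x)) \<longrightarrow>
    (\<forall>\<phi>\<in>test_functions {0<..}. (LINT x|lebesgue. kappa_minus l (2 * r1) x * of_real (f x) * fourier \<phi> x) = (LINT x:{0<..}|lebesgue. g x * \<phi> x)) \<longrightarrow>
    sq_int lebesgue (\<lambda>x. indicator {0<..} x *\<^sub>R (of_real (x powr r1) * g x)) \<longrightarrow>
    (\<Sum>k<n. (real k + 1) powr (2 * r1) * (cmod (LINT x|lebesgue. of_real (f x) * hardy l k x))\<^sup>2)
      \<le> D * sq_norm lebesgue (\<lambda>x. indicator {0<..} x *\<^sub>R (of_real (x powr r1) * g x))"
    by (rule hardy_coefficient_estimate[OF l r1], rule that, assumption+)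
  define A where "A = l / pi * D"
  have A: "A \<ge> 0" using l D(1) by (simp add: A_def)
  \<comment> \<open>The first two summands come from the plain square integral and from the spectral
    part of the norm; adding 1 ensures that the final constant is positive.\<close>
  define Y where "Y = 2 powr (2 * e) * A + l / pi * (l powr r)\<^sup>2 * (C * A) + 1"
  have Y: "Y > 0" using A C(1) l by (simp add: Y_def add_nonneg_pos)
  \<comment> \<open>The rate is first obtained in \<open>n / 2\<close>; this power of
    \<open>l\<close> converts it into one in \<open>l * n / 2\<close>.\<close>
  define c where "c = sqrt Y * l powr (- (e - r1))"
  have main: "(\<lambda>x. f x - mtc_proj l n f x) \<in> Hspace l s r \<and>
    Hnorm l s r (\<lambda>x. f x - mtc_proj l n f x) \<le> c * (l * real n / 2) powr (e - r1) * Hnorm l r1 (2 * r1) f"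
    if n: "n \<ge> 1" and fH: "f \<in> Hspace l r1 (2 * r1)" for n :: nat and f
  proof -
    define S where "S = spectrum_fun l (2 * r1) f"
    have fm: "f \<in> borel_measurable lebesgue" and f2: "integrable lebesgue (\<lambda>x. (f x)\<^sup>2)"
      and fg: "\<exists>g. is_function_on {0<..} (weighted_spectrum l (2 * r1) f) g"
      and fi: "set_integrable lebesgue {0<..} (\<lambda>x. x powr (2 * r1) * (cmod (S x))\<^sup>2)"
      using fH by (auto simp: Hspace_def S_def)
    have f: "sq_int lebesgue (\<lambda>x. complex_of_real (f x))"
      unfolding sq_int_def norm_of_real power2_abs using f2 measurable_compose[OF fm borel_measurable_of_real] by (intro conjI) (simp_all only: o_def)
    have S: "is_function_on {0<..} (weighted_spectrum l (2 * r1) f) S"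
      unfolding S_def by (rule spectrum_fun_is_function_on[OF fg])
    define w where "w x = indicator {0<..} x *\<^sub>R (of_real (x powr r1) * S x)" for x
    have w: "sq_int lebesgue w"
      unfolding sq_int_def
    proof
      have e: "w x = complex_of_real (x powr r1) * (indicator {0<..} x *\<^sub>R S x)" for x by (simp add: w_def)
      have "(\<lambda>x. complex_of_real (x powr r1)) \<in> borel_measurable borel" by measurable
      then show "w \<in> borel_measurable lebesgue"
        unfolding e[abs_def] by (rule borel_measurable_times[OF borel_measurable_lebesgueI is_function_on_measurable[OF S]])
      show "integrable lebesgue (\<lambda>x. (cmod (w x))\<^sup>2)"
        using fi unfolding set_integrable_def weighted_square_eq w_def .
    qed
    define G where "G = sq_norm lebesgue w"
    have G0: "G \<ge> 0" unfolding G_def by (rule sq_norm_nonneg)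
    have GH: "sqrt G \<le> Hnorm l r1 (2 * r1) f"
    proof -
      have "(LINT x:{0<..}|lebesgue. x powr (2 * r1) * (cmod (spectrum_fun l (2 * r1) f x))\<^sup>2) = G"
        unfolding set_lebesgue_integral_def weighted_square_eq G_def sq_norm_def w_def S_def ..
      then show ?thesis unfolding Hnorm_def by (simp only: real_sqrt_le_iff) simp
    qed
    define y where "y = real n / 2"
    have y: "y > 0" using n by (simp add: y_def)
    let ?a = "pair_coeff (tail_coeff f n)"
    \<comment> \<open>On the tail \<open>k + 1 \<ge> n / 2\<close>, so lowering the exponent from
      \<open>r1\<close> to \<open>p\<close> gains a power of \<open>n / 2\<close>. It is used with
      \<open>p = e\<close> for the spectrum and with \<open>p = 0\<close> for the plain square
      integral.\<close>
    have sum_le: "(\<Sum>k<M. (real k + 1) powr (2 * p) * (cmod (?a k))\<^sup>2) \<le> y powr (2 * (p - r1)) * (A * G)" if p: "p \<le> r1" for p M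
    proof -
      have "(\<Sum>k<M. (real k + 1) powr (2 * p) * (cmod (?a k))\<^sup>2) \<le>
          (\<Sum>k<M. y powr (2 * (p - r1)) * (l / pi * ((real k + 1) powr (2 * r1) * (cmod (LINT x|lebesgue. of_real (f x) * hardy l k x))\<^sup>2)))"
      proof (intro sum_mono)
        fix k
        show "(real k + 1) powr (2 * p) * (cmod (?a k))\<^sup>2 \<le>
          y powr (2 * (p - r1)) * (l / pi * ((real k + 1) powr (2 * r1) * (cmod (LINT x|lebesgue. of_real (f x) * hardy l k x))\<^sup>2))"
        proof (cases "?a k = 0")
          case True
          then show ?thesis using l by simp
        next
          case False
          have "(real k + 1) powr (2 * p) * (cmod (?a k))\<^sup>2 \<le> ((real k + 1) powr (2 * r1) * y powr (2 * (p - r1))) *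
              (l / pi * (cmod (LINT x|lebesgue. of_real (f x) * hardy l k x))\<^sup>2)"
            using tail_pair_coeff_le(2)[OF f False] y by (intro mult_mono powr_tail_le p tail_pair_coeff_le(1)[OF f]) (auto simp: y_def)
          then show ?thesis by (simp only: mult_ac)
        qed
      qed
      also have "\<dots> = y powr (2 * (p - r1)) * (l / pi * (\<Sum>k<M. (real k + 1) powr (2 * r1) * (cmod (LINT x|lebesgue. of_real (f x) * hardy l k x))\<^sup>2))"
        by (simp only: sum_distrib_left)
      also have "\<dots> \<le> y powr (2 * (p - r1)) * (l / pi * (D * G))"
      proof (intro mult_left_mono)
        have "\<forall>\<phi>\<in>test_functions {0<..}. (LINT x|lebesgue. kappa_minus l (2 * r1) x * of_real (f x) * fourier \<phi> x) = (LINT x:{0<..}|lebesgue. S x * \<phi> x)"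
          using S unfolding is_function_on_def weighted_spectrum_eq by blast
        then show "(\<Sum>k<M. (real k + 1) powr (2 * r1) * (cmod (LINT x|lebesgue. of_real (f x) * hardy l k x))\<^sup>2) \<le> D * G"
          unfolding G_def w_def using D(2) f w[unfolded w_def[abs_def]] by blast
      qed (use l in auto)
      finally show ?thesis by (simp add: A_def mult.assoc)
    qed
    define X where "X = y powr (2 * (e - r1)) * (A * G)"
    have X: "(\<Sum>k<M. (real k + 1) powr (2 * e) * (cmod (?a k))\<^sup>2) \<le> X" for M unfolding X_def by (rule sum_le[OF e])
    obtain g where g: "is_function_on {0<..} (weighted_spectrum l r (\<lambda>x. f x - mtc_proj l n f x)) g"
      "sq_int lebesgue (\<lambda>x. indicator {0<..} x *\<^sub>R (of_real (x powr s) * g x))"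
      "sq_norm lebesgue (\<lambda>x. indicator {0<..} x *\<^sub>R (of_real (x powr s) * g x)) \<le> l / pi * (l powr r)\<^sup>2 * (C * X)"
      by (rule projection_error_spectrum[OF adm f C X])
    define h where "h x = f x - mtc_proj l n f x" for x
    define T where "T = spectrum_fun l r h"
    have T: "is_function_on {0<..} (weighted_spectrum l r h) T"
      unfolding T_def by (rule spectrum_fun_is_function_on) (use g(1) in \<open>auto simp: h_def[abs_def]\<close>)
    have g1: "is_function_on {0<..} (weighted_spectrum l r h) g" using g(1) by (simp only: h_def[abs_def])
    \<comment> \<open>The norm is computed with the selected representative \<open>T\<close>,
      whereas the bound is known for \<open>g\<close>.\<close>
    have ae: "AE x in lebesgue. (cmod (indicator {0<..} x *\<^sub>R (of_real (x powr s) * T x)))\<^sup>2 = (cmod (indicator {0<..} x *\<^sub>R (of_real (x powr s) * g x)))\<^sup>2"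
      using is_function_on_unique[OF T g1] by eventually_elim (auto simp: indicator_def)
    have Tm: "(\<lambda>x. (cmod (indicator {0<..} x *\<^sub>R (of_real (x powr s) * T x)))\<^sup>2) \<in> borel_measurable lebesgue"
    proof -
      have e: "indicator {0<..} x *\<^sub>R (of_real (x powr s) * T x) = complex_of_real (x powr s) * (indicator {0<..} x *\<^sub>R T x)" for x by simp
      have "(\<lambda>x. complex_of_real (x powr s)) \<in> borel_measurable borel" by measurable
      then have "(\<lambda>x. indicator {0<..} x *\<^sub>R (of_real (x powr s) * T x)) \<in> borel_measurable lebesgue"
        unfolding e by (rule borel_measurable_times[OF borel_measurable_lebesgueI is_function_on_measurable[OF T]])
      note [measurable] = this
      show ?thesis by measurable
    qed
    have gi: "integrable lebesgue (\<lambda>x. (cmod (indicator {0<..} x *\<^sub>R (of_real (x powr s) * g x)))\<^sup>2)"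
      by (rule sq_int_integrable[OF g(2)])
    have Ti: "integrable lebesgue (\<lambda>x. (cmod (indicator {0<..} x *\<^sub>R (of_real (x powr s) * T x)))\<^sup>2)"
      using integrable_cong_AE[OF Tm borel_measurable_integrable[OF gi] ae] gi by blast
    have TI: "(LINT x:{0<..}|lebesgue. x powr (2 * s) * (cmod (T x))\<^sup>2) \<le> l / pi * (l powr r)\<^sup>2 * (C * X)"
      unfolding set_lebesgue_integral_def weighted_square_eq
      using integral_cong_AE[OF Tm borel_measurable_integrable[OF gi] ae] g(3) by (simp only: sq_norm_def)
    have h: "sq_int lebesgue (\<lambda>x. complex_of_real (h x))"
      using sq_int_diff(1)[OF f mtc_proj_sq_int[OF l, of n f]] by (simp add: h_def)
    have hn: "sq_norm lebesgue (\<lambda>x. complex_of_real (h x)) \<le> 2 * (y powr (2 * (0 - r1)) * (A * G))"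
    proof (rule sq_norm_limit_bound[OF mtc_sum_sq_int h])
      show "(\<lambda>M. sq_norm lebesgue (\<lambda>x. of_real (mtc_sum (tail_coeff f n) M x) - of_real (h x))) \<longlonglongrightarrow> 0"
        unfolding h_def by (rule tail_mtc_sum_tendsto[OF f])
      show "sq_norm lebesgue (\<lambda>x. complex_of_real (mtc_sum (tail_coeff f n) M x)) \<le> y powr (2 * (0 - r1)) * (A * G)" for M
        unfolding mtc_sum_norm using sum_le[OF r1, of M] by simp
    qed
    have hm: "h \<in> borel_measurable lebesgue"
      using measurable_compose[OF sq_int_measurable[OF h] borel_measurable_Re] by simp
    have h2: "integrable lebesgue (\<lambda>x. (h x)\<^sup>2)" using sq_int_integrable[OF h] by simp
    have hS: "h \<in> Hspace l s r"
      unfolding Hspace_def using hm h2 g1 Ti[folded weighted_square_eq] by (auto simp: set_integrable_def T_def)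
    \<comment> \<open>The plain square integral decays at the faster rate \<open>- r1\<close>; the
      factor \<open>2 powr (2 * e)\<close> is there because \<open>n \<ge> 1\<close> only gives
      \<open>2 * y \<ge> 1\<close>.\<close>
    have y0: "y powr (2 * (0 - r1)) \<le> 2 powr (2 * e) * y powr (2 * (e - r1))"
    proof -
      have "1 \<le> 2 * y" using n by (simp add: y_def)
      then have "1 \<le> (2 * y) powr (2 * e)" using e0 by (intro ge_one_powr_ge_zero) auto
      then have "y powr (2 * (0 - r1)) * 1 \<le> y powr (2 * (0 - r1)) * (2 * y) powr (2 * e)" by (intro mult_left_mono) auto
      also have "(2 * y) powr (2 * e) = 2 powr (2 * e) * y powr (2 * e)" using y by (simp add: powr_mult)
      also have "y powr (2 * (0 - r1)) * (2 powr (2 * e) * y powr (2 * e)) = 2 powr (2 * e) * y powr (2 * (e - r1))"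
        by (simp add: mult.left_commute flip: powr_add)
      finally show ?thesis by simp
    qed
    have "Hnorm l s r h \<le> sqrt (Y * (y powr (e - r1))\<^sup>2 * G)"
      unfolding Hnorm_def T_def[symmetric]
    proof (rule real_sqrt_le_mono)
      have "1 / 2 * (LINT x|lebesgue. (h x)\<^sup>2) = 1 / 2 * sq_norm lebesgue (\<lambda>x. complex_of_real (h x))" by (simp add: sq_norm_def)
      also have "\<dots> \<le> y powr (2 * (0 - r1)) * (A * G)" using hn by simp
      also have "\<dots> \<le> (2 powr (2 * e) * y powr (2 * (e - r1))) * (A * G)" using y0 A G0 by (intro mult_right_mono) auto
      finally have "1 / 2 * (LINT x|lebesgue. (h x)\<^sup>2) + (LINT x:{0<..}|lebesgue. x powr (2 * s) * (cmod (T x))\<^sup>2) \<le>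
          (2 powr (2 * e) * y powr (2 * (e - r1))) * (A * G) + l / pi * (l powr r)\<^sup>2 * (C * X)"
        using TI by linarith
      also have "\<dots> = (Y - 1) * y powr (2 * (e - r1)) * G" unfolding X_def Y_def by (simp add: algebra_simps)
      also have "\<dots> \<le> Y * y powr (2 * (e - r1)) * G" using G0 by (intro mult_right_mono) auto
      finally show "1 / 2 * (LINT x|lebesgue. (h x)\<^sup>2) + (LINT x:{0<..}|lebesgue. x powr (2 * s) * (cmod (T x))\<^sup>2) \<le> Y * (y powr (e - r1))\<^sup>2 * G"
        by (simp only: powr_square)
    qed
    also have "\<dots> = sqrt Y * y powr (e - r1) * sqrt G" by (simp add: real_sqrt_mult)
    also have "\<dots> \<le> sqrt Y * y powr (e - r1) * Hnorm l r1 (2 * r1) f" using GH Y by (intro mult_left_mono) auto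
    also have "sqrt Y * y powr (e - r1) = c * (l * real n / 2) powr (e - r1)"
    proof -
      have "(l * real n / 2) powr (e - r1) = l powr (e - r1) * y powr (e - r1)"
        using l y by (simp add: y_def flip: powr_mult)
      moreover have "l powr (- (e - r1)) * l powr (e - r1) = 1" using l by (simp flip: powr_add)
      ultimately show ?thesis unfolding c_def by (metis (no_types, lifting) mult.assoc mult_1)
    qed
    finally show ?thesis using hS by (simp only: h_def[abs_def])
  qed
  show ?thesis
  proof (rule that[of c])
    show "c > 0" using Y l by (simp add: c_def)
    show "\<forall>n\<ge>1. \<forall>f\<in>Hspace l r1 (2 * r1). (\<lambda>x. f x - mtc_proj l n f x) \<in> Hspace l s r \<and>
      Hnorm l s r (\<lambda>x. f x - mtc_proj l n f x) \<le> c * (l * real n / 2) powr (e - r1) * Hnorm l r1 (2 * r1) f"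
      using main by blast
  qed
qed

end

theorem lemma3p1:
  fixes l s r0 r1 :: real
  assumes "l > 0" and "s > -1" and "r0 \<ge> 0" and "r1 \<ge> 0"
  shows "\<exists>c>0. \<forall>n::nat. n \<ge> 1 \<longrightarrow> (\<forall>f \<in> Hspace l r1 (2 * r1).
      (- (1 / 2) < s \<and> s \<le> r0 / 2 \<and> r0 / 2 \<le> (s + r1) / 2 \<longrightarrow>
         (\<lambda>x. f x - mtc_proj l n f x) \<in> Hspace l s r0 \<and>
         Hnorm l s r0 (\<lambda>x. f x - mtc_proj l n f x)
           \<le> c * (l * real n / 2) powr (r0 - r1 - s) * Hnorm l r1 (2 * r1) f) \<and>
      (0 \<le> r0 / 2 \<and> r0 / 2 \<le> s \<and> s \<le> r1 \<longrightarrow>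
         (\<lambda>x. f x - mtc_proj l n f x) \<in> Hspace l s r0 \<and>
         Hnorm l s r0 (\<lambda>x. f x - mtc_proj l n f x)
           \<le> c * (l * real n / 2) powr (s - r1) * Hnorm l r1 (2 * r1) f))"
proof -
  \<comment> \<open>The borderline \<open>s = r0 / 2\<close> is put into the second case, where both
    rates coincide; the first case is then strict and makes the second claim vacuous.\<close>
  consider (a) "- (1 / 2) < s" "s < r0 / 2" "r0 / 2 \<le> (s + r1) / 2"
    | (b) "r0 / 2 \<le> s" "s \<le> r1"
    | (c) "\<not> (- (1 / 2) < s \<and> s \<le> r0 / 2 \<and> r0 / 2 \<le> (s + r1) / 2)" "\<not> (0 \<le> r0 / 2 \<and> r0 / 2 \<le> s \<and> s \<le> r1)"
    using assms(3) by fastforce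
  then show ?thesis
  proof cases
    case a
    have adm: "admissible s r0 (r0 - s)" using a assms by (simp add: admissible_def)
    have le: "r0 - s \<le> r1" using a by simp
    obtain c where c: "c > 0" "\<forall>n\<ge>1. \<forall>f\<in>Hspace l r1 (2 * r1). (\<lambda>x. f x - mtc_proj l n f x) \<in> Hspace l s r0 \<and>
      Hnorm l s r0 (\<lambda>x. f x - mtc_proj l n f x) \<le> c * (l * real n / 2) powr (r0 - s - r1) * Hnorm l r1 (2 * r1) f"
      by (rule projection_error_estimate[OF assms(1) adm assms(4) le], rule that, assumption+)
    have e: "r0 - s - r1 = r0 - r1 - s" by simp
    show ?thesis using c(1) c(2)[unfolded e] a(2) by (intro exI[of _ c]) auto
  next
    case b
    have adm: "admissible s r0 s" using b assms by (simp add: admissible_def)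
    obtain c where c: "c > 0" "\<forall>n\<ge>1. \<forall>f\<in>Hspace l r1 (2 * r1). (\<lambda>x. f x - mtc_proj l n f x) \<in> Hspace l s r0 \<and>
      Hnorm l s r0 (\<lambda>x. f x - mtc_proj l n f x) \<le> c * (l * real n / 2) powr (s - r1) * Hnorm l r1 (2 * r1) f"
      by (rule projection_error_estimate[OF assms(1) adm assms(4) b(2)], rule that, assumption+)
    have e: "r0 - r1 - s = s - r1" if "s \<le> r0 / 2" using that b(1) by simp
    show ?thesis using c e by (intro exI[of _ c]) auto
  next
    case c
    then show ?thesis by (intro exI[of _ 1]) auto
  qed
qed

end
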